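(* In the differential setting described in the context, assume that $\mathfrak{a}$ satisfies Condition (L) or Condition (B). Let $X,Y,Z,Q$ be as in the context, and set $W:=Q(I+iQZQ)^{-1}Q$ and $P:=I-Q$ (pointwise). Then for all $u,v\in D(\mathfrak{a})$, \[ \begin{aligned} \mathfrak{a}_{\mathrm{reg}}(u,v)&=\big\langle (I+iZ+ZWZ)PA^{1/2}\nabla u,\;PA^{1/2}\nabla v\big\rangle\\ &\quad+\big\langle X^*(I-iWZ)PA^{1/2}\nabla u,\;v\big\rangle+\big\langle u,\;Y^*(I+iW^*Z)PA^{1/2}\nabla v\big\rangle\\ &\quad-\big\langle (X^*WY)u,\;v\big\rangle+\langle c_0u,v\rangle . \end{aligned} \] In particular $\mathfrak{a}_{\mathrm{reg}}$ is again a differential sectorial form.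
   Context: Notation: $\langle f,g\rangle=\int_\Omega f\overline g$ on $L^2(\Omega)$ and $\langle w_1,w_2\rangle=\int_\Omega\sum_k w_{1,k}\overline{w_{2,k}}$ on $(L^2(\Omega))^d$; for $\zeta,\eta\in\mathbb{C}^d$, $\zeta\cdot\eta=\sum_k\zeta_k\overline{\eta_k}$; for a $\mathbb{C}^d$-valued function $X$, $X^*\zeta:=\sum_k\overline{X_k}\zeta_k$ (pointwise); $\Sigma_\theta=\{z\in\mathbb{C}: z=0\text{ or }|\arg z|\le\theta\}$. Forms: a sesquilinear form $\mathfrak{b}$ with domain $D(\mathfrak{b})$ in a Hilbert space $H$ is sectorial with vertex $\gamma\in\mathbb{R}$ if $\mathfrak{b}(u,u)-\gamma\|u\|_H^2\in\Sigma_\theta$ for all $u$ and some $\theta\in[0,\pi/2)$. $(\Re\mathfrak b)(u,v)=\frac12(\mathfrak b(u,v)+\overline{\mathfrak b(v,u)})$, $(\Im\mathfrak b)(u,v)=\frac1{2i}(\mathfrak b(u,v)-\overline{\mathfrak b(v,u)})$. For sectorial $\mathfrak b$ with vertex $\gamma$, $\|u\|_{\mathfrak b}^2=\Re\mathfrak b(u,u)+(1-\gamma)\|u\|_H^2$; $\mathfrak b$ is closed if $(D(\mathfrak b),\|\cdot\|_{\mathfrak b})$ is complete, and closable if it has a closed sectorial extension. For a densely defined sectorial form $\mathfrak b$, the associated operator $B$ is defined by: $x\in D(B)$ and $Bx=f$ iff there is a sequence $(u_n)$ in $D(\mathfrak b)$ with $u_n\to x$ in $H$, $\sup_n\Re\mathfrak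 b(u_n,u_n)<\infty$ and $\mathfrak b(u_n,v)\to\langle f,v\rangle_H$ for all $v\in D(\mathfrak b)$; $B$ is m-sectorial. The regular part $\mathfrak b_{\mathrm{reg}}$ of $\mathfrak b$ is the unique closable sectorial form with $D(\mathfrak b_{\mathrm{reg}})=D(\mathfrak b)$ whose associated operator is $B$; the singular part is $\mathfrak b_{\mathrm s}=\mathfrak b-\mathfrak b_{\mathrm{reg}}$. Differential setting: $\Omega\subset\mathbb{R}^d$ open, $H=L^2(\Omega)$. $D(\mathfrak{a})$ is a linear subspace of $L^2(\Omega)$ containing $C_c^\infty(\Omega)$ with $\partial_k u\in L^1_{\mathrm{loc}}(\Omega)$ for all $u\in D(\mathfrak a)$. The functions $c_{kl},b_k,d_k,c_0\colon\Omega\to\mathbb{C}$ are measurable, $c_0\in L^\infty(\Omega)$; $C=(c_{kl})$, $b=(b_k)$, $d=(d_k)$. Assume $C\nabla u\cdot\nabla u\in L^1(\Omega)$ for $u\in D(\mathfrak a)$ and $C(x)\xi\cdot\xi\in\Sigma_\theta$ for all $\xi\in\mathbb{C}^d$, $x\in\Omega$, for some $\theta\in[0,\pi/2)$. $A=\frac12(C+C^* )$, $A^{1/2}$ its pointwise positive semi-definite square root. Assume there is $K>0$ with $|\overline{b(x)}\cdot\xi|\le K\|A^{1/2}(x)\xi\|$ and $|d(x)\cdot\xi|\le K\|A^{1/2}(x)\xi\|$ for all $\xi,x$. $\mathfrak a(u,v)=\int_\Omega\sum_{k,l}c_{kl}\partial_ku\,\overline{\partial_lv}+\int_\Omega\sum_kb_k\partial_ku\,\overline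 v+\int_\Omega\sum_kd_ku\,\overline{\partial_kv}+\int_\Omega c_0u\overline v$ on $D(\mathfrak a)$ (a densely defined sectorial form). Let $X,Y\colon\Omega\to\mathbb{C}^d$ be bounded measurable with $A^{1/2}X=\overline b$, $A^{1/2}Y=d$ pointwise, and $Z\colon\Omega\to\mathbb{C}^{d\times d}$ bounded measurable with $Z(x)$ Hermitian and $A^{1/2}(x)(I+iZ(x))A^{1/2}(x)=C(x)$ for all $x$ (such maps exist). Condition (L): (i) $D(\mathfrak a)\cap L^\infty(\Omega)$ is invariant under multiplication by $C_c^\infty(\Omega)$ functions; (ii) there is $\psi\in C^1_b(\mathbb{R})$ with $\psi(0)=0$, $\psi'(0)=1$ and $\psi\circ(\Re u)+i\,\psi\circ(\Im u)\in D(\mathfrak a)$ for all $u\in D(\mathfrak a)$; (iii) $c_{kl}+\overline{c_{lk}}$ is real valued for all $k,l$. Condition (B): (i) $D(\mathfrak a)$ is invariant under multiplication by $C_c^\infty(\Omega)$ functions; (ii) $c_{kl}\in L^\infty_{\mathrm{loc}}(\Omega)$ for all $k,l$. Let $V$ be the closure in $L^2(\Omega)\times(L^2(\Omega))^d$ of $\{(u,A^{1/2}\nabla u):u\in D(\mathfrak a)\}$ and $V_{\mathrm s}=\{w\in(L^2(\Omega))^d:(0,w)\in V\}$, a closed subspace. It is known that under (L) or (B) there is a measurable $Q\colon\Omega\to\mathbb{C}^{d\times d}$ with each $Q(x)$ an orthogonal projection matrix such that $w\mapsto Qw$ (pointwise multiplication) is the orthogonal projection of $(L^2(\Omega))^d$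 onto $V_{\mathrm s}$; $Q$ denotes such a map. Note $QZQ$ is pointwise Hermitian, so $I+iQZQ$ is invertible.
   Formalization: The principal part of the form is taken as ∫ C∇u·∇v, i.e. Σ c_{lk} ∂_k u conj(∂_l v); the index order Σ c_{kl} ∂_k u conj(∂_l v) displayed in the setting is inconsistent with A^{1/2}(I+iZ)A^{1/2}=C and makes the formula false for non-symmetric C. *)

theory Defs
  imports "HOL-Analysis.Analysis"
begin

definition cdot :: "complex^'n \<Rightarrow> complex^'n \<Rightarrow> complex" where
  "cdot \<zeta> \<eta> = (\<Sum>k\<in>UNIV. \<zeta>$k * cnj (\<eta>$k))"

definition cstar :: "complex^'n \<Rightarrow> complex^'n \<Rightarrow> complex" where
  "cstar X \<zeta> = (\<Sum>k\<in>UNIV. cnj (X$k) * \<zeta>$k)"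

definition vconj :: "complex^'n \<Rightarrow> complex^'n" where
  "vconj \<zeta> = (\<chi> k. cnj (\<zeta>$k))"

definition cscale :: "complex \<Rightarrow> complex^'n^'m \<Rightarrow> complex^'n^'m" where
  "cscale c M = (\<chi> i j. c * M$i$j)"

definition adj :: "complex^'n^'m \<Rightarrow> complex^'m^'n" where
  "adj M = (\<chi> i j. cnj (M$j$i))"

definition hermitian :: "complex^'n^'n \<Rightarrow> bool" where
  "hermitian M \<longleftrightarrow> adj M = M"

definition psd :: "complex^'n^'n \<Rightarrow> bool" where
  "psd M \<longleftrightarrow> hermitian M \<and> (\<forall>\<xi>. 0 \<le> Re (cdot (M *v \<xi>) \<xi>))"

definition msqrt :: "complex^'n^'n \<Rightarrow> complex^'n^'n" where
  "msqrt M = (THE S. psd S \<and> S ** S = M)"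

definition herm_part :: "complex^'n^'n \<Rightarrow> complex^'n^'n" where
  "herm_part M = (\<chi> i j. (M$i$j + cnj (M$j$i)) / 2)"

definition sqrtA :: "('x \<Rightarrow> complex^'n^'n) \<Rightarrow> 'x \<Rightarrow> complex^'n^'n" where
  "sqrtA C x = msqrt (herm_part (C x))"

definition sector :: "real \<Rightarrow> complex set" where
  "sector \<theta> = {z. z = 0 \<or> \<bar>Arg z\<bar> \<le> \<theta>}"

definition L2 :: "(real^'n) set \<Rightarrow> (real^'n \<Rightarrow> complex) \<Rightarrow> bool" where
  "L2 \<Omega> f \<longleftrightarrow> f \<in> borel_measurable (lebesgue_on \<Omega>) \<and>
     integrable (lebesgue_on \<Omega>) (\<lambda>x. (cmod (f x))\<^sup>2)"

definition L2v :: "(real^'n) set \<Rightarrow> (real^'n \<Rightarrow> complex^'n) \<Rightarrow> bool" where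
  "L2v \<Omega> w \<longleftrightarrow> w \<in> borel_measurable (lebesgue_on \<Omega>) \<and>
     integrable (lebesgue_on \<Omega>) (\<lambda>x. (norm (w x))\<^sup>2)"

definition linner :: "(real^'n) set \<Rightarrow> (real^'n \<Rightarrow> complex) \<Rightarrow> (real^'n \<Rightarrow> complex) \<Rightarrow> complex" where
  "linner \<Omega> f g = (LINT x|lebesgue_on \<Omega>. f x * cnj (g x))"

definition vinner :: "(real^'n) set \<Rightarrow> (real^'n \<Rightarrow> complex^'n) \<Rightarrow> (real^'n \<Rightarrow> complex^'n) \<Rightarrow> complex" where
  "vinner \<Omega> w1 w2 = (LINT x|lebesgue_on \<Omega>. cdot (w1 x) (w2 x))"

definition l2norm :: "(real^'n) set \<Rightarrow> (real^'n \<Rightarrow> complex) \<Rightarrow> real" where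
  "l2norm \<Omega> f = sqrt (LINT x|lebesgue_on \<Omega>. (cmod (f x))\<^sup>2)"

definition l2vnorm :: "(real^'n) set \<Rightarrow> (real^'n \<Rightarrow> complex^'n) \<Rightarrow> real" where
  "l2vnorm \<Omega> w = sqrt (LINT x|lebesgue_on \<Omega>. (norm (w x))\<^sup>2)"

definition ess_bounded :: "(real^'n) set \<Rightarrow> (real^'n \<Rightarrow> complex) \<Rightarrow> bool" where
  "ess_bounded \<Omega> f \<longleftrightarrow> (\<exists>M. AE x in lebesgue_on \<Omega>. cmod (f x) \<le> M)"

definition L1loc :: "(real^'n) set \<Rightarrow> (real^'n \<Rightarrow> complex) \<Rightarrow> bool" where
  "L1loc \<Omega> f \<longleftrightarrow> f \<in> borel_measurable (lebesgue_on \<Omega>) \<and>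
     (\<forall>K. compact K \<and> K \<subseteq> \<Omega> \<longrightarrow> integrable (lebesgue_on K) f)"

definition Linfloc :: "(real^'n) set \<Rightarrow> (real^'n \<Rightarrow> complex) \<Rightarrow> bool" where
  "Linfloc \<Omega> f \<longleftrightarrow> f \<in> borel_measurable (lebesgue_on \<Omega>) \<and>
     (\<forall>K. compact K \<and> K \<subseteq> \<Omega> \<longrightarrow> ess_bounded K f)"

definition partial :: "'n \<Rightarrow> (real^'n \<Rightarrow> complex) \<Rightarrow> real^'n \<Rightarrow> complex" where
  "partial k f = (\<lambda>x. frechet_derivative f (at x) (axis k 1))"

primrec iter_partial :: "'n list \<Rightarrow> (real^'n \<Rightarrow> complex) \<Rightarrow> real^'n \<Rightarrow> complex" where
  "iter_partial [] f = f"
| "iter_partial (k # ks) f = partial k (iter_partial ks f)"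

definition smooth :: "(real^'n \<Rightarrow> complex) \<Rightarrow> bool" where
  "smooth f \<longleftrightarrow> (\<forall>ks x. iter_partial ks f differentiable (at x))"

definition tsupp :: "(real^'n \<Rightarrow> complex) \<Rightarrow> (real^'n) set" where
  "tsupp f = closure {x. f x \<noteq> 0}"

definition test_fn :: "(real^'n) set \<Rightarrow> (real^'n \<Rightarrow> complex) \<Rightarrow> bool" where
  "test_fn \<Omega> \<phi> \<longleftrightarrow> smooth \<phi> \<and> compact (tsupp \<phi>) \<and> tsupp \<phi> \<subseteq> \<Omega>"

definition weak_grad :: "(real^'n) set \<Rightarrow> (real^'n \<Rightarrow> complex) \<Rightarrow> (real^'n \<Rightarrow> complex^'n) \<Rightarrow> bool" where
  "weak_grad \<Omega> u G \<longleftrightarrow> (\<forall>k. L1loc \<Omega> (\<lambda>x. G x $ k) \<and>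
     (\<forall>\<phi>. test_fn \<Omega> \<phi> \<longrightarrow>
        (LINT x|lebesgue_on \<Omega>. u x * partial k \<phi> x) = - (LINT x|lebesgue_on \<Omega>. G x $ k * \<phi> x)))"

text \<open>Elements of H are represented by functions; a form must not distinguish functions
  that agree a.e. (null condition).\<close>
definition sesq_form :: "(real^'n) set \<Rightarrow> ((real^'n \<Rightarrow> complex) \<Rightarrow> (real^'n \<Rightarrow> complex) \<Rightarrow> complex)
    \<Rightarrow> (real^'n \<Rightarrow> complex) set \<Rightarrow> bool" where
  "sesq_form \<Omega> b Db \<longleftrightarrow>
     (\<forall>u\<in>Db. L2 \<Omega> u) \<and> (\<lambda>x. 0) \<in> Db \<and>
     (\<forall>u\<in>Db. \<forall>v\<in>Db. (\<lambda>x. u x + v x) \<in> Db) \<and>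
     (\<forall>u\<in>Db. \<forall>c. (\<lambda>x. c * u x) \<in> Db) \<and>
     (\<forall>u\<in>Db. \<forall>v\<in>Db. \<forall>w\<in>Db. \<forall>c.
        b (\<lambda>x. u x + v x) w = b u w + b v w \<and> b (\<lambda>x. c * u x) w = c * b u w \<and>
        b w (\<lambda>x. u x + v x) = b w u + b w v \<and> b w (\<lambda>x. c * u x) = cnj c * b w u) \<and>
     (\<forall>u\<in>Db. l2norm \<Omega> u = 0 \<longrightarrow> (\<forall>v\<in>Db. b u v = 0 \<and> b v u = 0))"

definition sectorial_vertex :: "(real^'n) set \<Rightarrow> ((real^'n \<Rightarrow> complex) \<Rightarrow> (real^'n \<Rightarrow> complex) \<Rightarrow> complex)
    \<Rightarrow> (real^'n \<Rightarrow> complex) set \<Rightarrow> real \<Rightarrow> bool" where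
  "sectorial_vertex \<Omega> b Db \<gamma> \<longleftrightarrow> sesq_form \<Omega> b Db \<and>
     (\<exists>\<theta>. 0 \<le> \<theta> \<and> \<theta> < pi/2 \<and>
        (\<forall>u\<in>Db. b u u - complex_of_real (\<gamma> * (l2norm \<Omega> u)\<^sup>2) \<in> sector \<theta>))"

definition sectorial :: "(real^'n) set \<Rightarrow> ((real^'n \<Rightarrow> complex) \<Rightarrow> (real^'n \<Rightarrow> complex) \<Rightarrow> complex)
    \<Rightarrow> (real^'n \<Rightarrow> complex) set \<Rightarrow> bool" where
  "sectorial \<Omega> b Db \<longleftrightarrow> (\<exists>\<gamma>. sectorial_vertex \<Omega> b Db \<gamma>)"

definition form_norm :: "(real^'n) set \<Rightarrow> ((real^'n \<Rightarrow> complex) \<Rightarrow> (real^'n \<Rightarrow> complex) \<Rightarrow> complex)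
    \<Rightarrow> real \<Rightarrow> (real^'n \<Rightarrow> complex) \<Rightarrow> real" where
  "form_norm \<Omega> b \<gamma> u = sqrt (Re (b u u) + (1 - \<gamma>) * (l2norm \<Omega> u)\<^sup>2)"

definition closed_form :: "(real^'n) set \<Rightarrow> ((real^'n \<Rightarrow> complex) \<Rightarrow> (real^'n \<Rightarrow> complex) \<Rightarrow> complex)
    \<Rightarrow> (real^'n \<Rightarrow> complex) set \<Rightarrow> bool" where
  "closed_form \<Omega> b Db \<longleftrightarrow> (\<exists>\<gamma>. sectorial_vertex \<Omega> b Db \<gamma> \<and>
     (\<forall>s. (\<forall>n. s n \<in> Db) \<and>
          (\<forall>e>0. \<exists>N. \<forall>m\<ge>N. \<forall>n\<ge>N. form_norm \<Omega> b \<gamma> (\<lambda>x. s m x - s n x) < e)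
        \<longrightarrow> (\<exists>u\<in>Db. (\<lambda>n. form_norm \<Omega> b \<gamma> (\<lambda>x. s n x - u x)) \<longlonglongrightarrow> 0)))"

definition closable :: "(real^'n) set \<Rightarrow> ((real^'n \<Rightarrow> complex) \<Rightarrow> (real^'n \<Rightarrow> complex) \<Rightarrow> complex)
    \<Rightarrow> (real^'n \<Rightarrow> complex) set \<Rightarrow> bool" where
  "closable \<Omega> b Db \<longleftrightarrow> (\<exists>b' Db'. Db \<subseteq> Db' \<and> (\<forall>u\<in>Db. \<forall>v\<in>Db. b' u v = b u v) \<and>
     closed_form \<Omega> b' Db')"

definition assoc_op :: "(real^'n) set \<Rightarrow> ((real^'n \<Rightarrow> complex) \<Rightarrow> (real^'n \<Rightarrow> complex) \<Rightarrow> complex)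
    \<Rightarrow> (real^'n \<Rightarrow> complex) set \<Rightarrow> ((real^'n \<Rightarrow> complex) \<times> (real^'n \<Rightarrow> complex)) set" where
  "assoc_op \<Omega> b Db = {(x, f). L2 \<Omega> x \<and> L2 \<Omega> f \<and>
     (\<exists>s. (\<forall>n. s n \<in> Db) \<and> (\<lambda>n. l2norm \<Omega> (\<lambda>y. s n y - x y)) \<longlonglongrightarrow> 0 \<and>
          (\<exists>M. \<forall>n. Re (b (s n) (s n)) \<le> M) \<and>
          (\<forall>v\<in>Db. (\<lambda>n. b (s n) v) \<longlonglongrightarrow> linner \<Omega> f v))}"

text \<open>Regular part: the unique closable sectorial form on the same domain with the same
  associated operator (normalised to 0 outside the domain).\<close>
definition reg_part :: "(real^'n) set \<Rightarrow> ((real^'n \<Rightarrow> complex) \<Rightarrow> (real^'n \<Rightarrow> complex) \<Rightarrow> complex)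
    \<Rightarrow> (real^'n \<Rightarrow> complex) set \<Rightarrow> ((real^'n \<Rightarrow> complex) \<Rightarrow> (real^'n \<Rightarrow> complex) \<Rightarrow> complex)" where
  "reg_part \<Omega> b Db = (THE r. sectorial \<Omega> r Db \<and> closable \<Omega> r Db \<and>
      assoc_op \<Omega> r Db = assoc_op \<Omega> b Db \<and> (\<forall>u v. \<not> (u \<in> Db \<and> v \<in> Db) \<longrightarrow> r u v = 0))"

definition diff_form :: "(real^'n) set \<Rightarrow> ((real^'n \<Rightarrow> complex) \<Rightarrow> real^'n \<Rightarrow> complex^'n)
    \<Rightarrow> (real^'n \<Rightarrow> complex^'n^'n) \<Rightarrow> (real^'n \<Rightarrow> complex^'n) \<Rightarrow> (real^'n \<Rightarrow> complex^'n)
    \<Rightarrow> (real^'n \<Rightarrow> complex) \<Rightarrow> (real^'n \<Rightarrow> complex) \<Rightarrow> (real^'n \<Rightarrow> complex) \<Rightarrow> complex" where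
  "diff_form \<Omega> grad C b d c0 u v =
     (LINT x|lebesgue_on \<Omega>. cdot (C x *v grad u x) (grad v x))
   + (LINT x|lebesgue_on \<Omega>. (\<Sum>k\<in>UNIV. b x $ k * grad u x $ k) * cnj (v x))
   + (LINT x|lebesgue_on \<Omega>. (\<Sum>k\<in>UNIV. d x $ k * u x * cnj (grad v x $ k)))
   + (LINT x|lebesgue_on \<Omega>. c0 x * u x * cnj (v x))"

definition diff_setting :: "(real^'n) set \<Rightarrow> (real^'n \<Rightarrow> complex) set \<Rightarrow> ((real^'n \<Rightarrow> complex) \<Rightarrow> real^'n \<Rightarrow> complex^'n)
    \<Rightarrow> (real^'n \<Rightarrow> complex^'n^'n) \<Rightarrow> (real^'n \<Rightarrow> complex^'n) \<Rightarrow> (real^'n \<Rightarrow> complex^'n)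
    \<Rightarrow> (real^'n \<Rightarrow> complex) \<Rightarrow> bool" where
  "diff_setting \<Omega> D grad C b d c0 \<longleftrightarrow>
     open \<Omega> \<and>
     (\<forall>u\<in>D. L2 \<Omega> u) \<and>
     (\<forall>u\<in>D. \<forall>v\<in>D. (\<lambda>x. u x + v x) \<in> D) \<and>
     (\<forall>u\<in>D. \<forall>c. (\<lambda>x. c * u x) \<in> D) \<and>
     (\<forall>\<phi>. test_fn \<Omega> \<phi> \<longrightarrow> \<phi> \<in> D) \<and>
     (\<forall>u\<in>D. weak_grad \<Omega> u (grad u)) \<and>
     C \<in> borel_measurable (lebesgue_on \<Omega>) \<and>
     b \<in> borel_measurable (lebesgue_on \<Omega>) \<and>
     d \<in> borel_measurable (lebesgue_on \<Omega>) \<and>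
     c0 \<in> borel_measurable (lebesgue_on \<Omega>) \<and> ess_bounded \<Omega> c0 \<and>
     (\<forall>u\<in>D. integrable (lebesgue_on \<Omega>) (\<lambda>x. cdot (C x *v grad u x) (grad u x))) \<and>
     (\<exists>\<theta>. 0 \<le> \<theta> \<and> \<theta> < pi/2 \<and> (\<forall>x\<in>\<Omega>. \<forall>\<xi>. cdot (C x *v \<xi>) \<xi> \<in> sector \<theta>)) \<and>
     (\<exists>K>0. \<forall>x\<in>\<Omega>. \<forall>\<xi>.
        cmod (cdot (vconj (b x)) \<xi>) \<le> K * norm (sqrtA C x *v \<xi>) \<and>
        cmod (cdot (d x) \<xi>) \<le> K * norm (sqrtA C x *v \<xi>))"

definition condL :: "(real^'n) set \<Rightarrow> (real^'n \<Rightarrow> complex) set \<Rightarrow> (real^'n \<Rightarrow> complex^'n^'n) \<Rightarrow> bool" where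
  "condL \<Omega> D C \<longleftrightarrow>
     (\<forall>u\<in>D. ess_bounded \<Omega> u \<longrightarrow> (\<forall>\<phi>. test_fn \<Omega> \<phi> \<longrightarrow> (\<lambda>x. \<phi> x * u x) \<in> D)) \<and>
     (\<exists>\<psi> \<psi>' :: real \<Rightarrow> real.
        (\<forall>t. (\<psi> has_real_derivative \<psi>' t) (at t)) \<and> continuous_on UNIV \<psi>' \<and>
        bounded (range \<psi>) \<and> bounded (range \<psi>') \<and> \<psi> 0 = 0 \<and> \<psi>' 0 = 1 \<and>
        (\<forall>u\<in>D. (\<lambda>x. complex_of_real (\<psi> (Re (u x))) + \<i> * complex_of_real (\<psi> (Im (u x)))) \<in> D)) \<and>
     (\<forall>x\<in>\<Omega>. \<forall>k l. Im (C x $ k $ l + cnj (C x $ l $ k)) = 0)"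

definition condB :: "(real^'n) set \<Rightarrow> (real^'n \<Rightarrow> complex) set \<Rightarrow> (real^'n \<Rightarrow> complex^'n^'n) \<Rightarrow> bool" where
  "condB \<Omega> D C \<longleftrightarrow>
     (\<forall>u\<in>D. \<forall>\<phi>. test_fn \<Omega> \<phi> \<longrightarrow> (\<lambda>x. \<phi> x * u x) \<in> D) \<and>
     (\<forall>k l. Linfloc \<Omega> (\<lambda>x. C x $ k $ l))"

text \<open>V_s = {w in (L^2)^d : (0,w) in closure of {(u, A^(1/2) grad u) : u in D}}.\<close>
definition Vs :: "(real^'n) set \<Rightarrow> (real^'n \<Rightarrow> complex) set \<Rightarrow> ((real^'n \<Rightarrow> complex) \<Rightarrow> real^'n \<Rightarrow> complex^'n)
    \<Rightarrow> (real^'n \<Rightarrow> complex^'n^'n) \<Rightarrow> (real^'n \<Rightarrow> complex^'n) set" where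
  "Vs \<Omega> D grad C = {w. L2v \<Omega> w \<and>
     (\<exists>s. (\<forall>n. s n \<in> D) \<and> (\<lambda>n. l2norm \<Omega> (s n)) \<longlonglongrightarrow> 0 \<and>
          (\<lambda>n. l2vnorm \<Omega> (\<lambda>x. sqrtA C x *v grad (s n) x - w x)) \<longlonglongrightarrow> 0)}"

end

theory Submission
  imports Defs "HOL-Library.Function_Algebras"
begin

text \<open>
  Let $V$ be the closure of the graph of $u \mapsto (u, A^{1/2}\nabla u)$. Read on $V$ with the
  integrand $((1 + iZ)w + aY) \cdot w' + (X^*w + c_0 a)\overline{a'}$, the form is bounded and
  coercive up to a multiple of the $L^2$-norm of the first component. The fibre of $V$ over a
  function is a coset of $V_s = \operatorname{ran} Q$, and replacing $w$ by
  $Pw - W(iZPw + aY)$ selects the only element of the coset at which the form annihilates $V_s$.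
  The resulting form depends only on first components, is closed on the first projection
  of $V$, and restricts on $D(a)$ to the asserted formula.

  Its associated operator is that of the original form. For bounded graph sequences, testing
  extends from $D(a)$ to $V$ by density; the difference of the two forms at $(u_n, v)$ is the
  original form tested with a fixed element of $V_s$, and hence tends to $0$. Conversely, each
  selected element is approximated by graph elements, which gives the required sequence for the
  original form. Finally the regular part is unique, because for a
  closed sectorial form the operator domain is a form core (Lax--Milgram), so that two closable
  forms with the same domain and the same operator agree. Linearity of the weak gradient almost
  everywhere comes from the du Bois-Reymond lemma.
\<close>

section \<open>Hermitian matrices and square roots\<close>

text \<open>Two sequences in \<open>D\<close> with the same L2 limit can have fields A^(1/2) grad
  with different limits, which differ by elements of V_s. The limiting form can thus see more than
  the first component, and regularising means removing this ambiguity. Since the form is not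
  symmetric, the representative is fixed by an equation on ran Q instead of a minimum. Its operator
  is the compression of 1 + iZ, whose real part is the identity on ran Q; it is therefore
  invertible, and W is its inverse extended by zero.

  Tests against V_s tend to 0 because a singular element has first component 0, so that the limit is
  the product of f with 0.

  Functions that agree almost everywhere are not identified, and \<open>grad\<close> is merely some
  choice of weak gradients. Hence the spaces carry seminorms, the graph map is linear only almost
  everywhere, and forms must be shown to ignore null functions. For this reason Riesz and
  Lax--Milgram are proved for semi-inner products on a carrier set, where limits and representatives
  exist without being unique.\<close>

lemma cdot_add_left: "cdot (x + y) z = cdot x z + cdot y z"
  by (simp add: cdot_def sum.distrib algebra_simps)

lemma cdot_add_right: "cdot x (y + z) = cdot x y + cdot x z"
  by (simp add: cdot_def sum.distrib algebra_simps)

lemma cdot_diff_left: "cdot (x - y) z = cdot x z - cdot y z"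
  by (simp add: cdot_def sum_subtractf algebra_simps)

lemma cdot_diff_right: "cdot x (y - z) = cdot x y - cdot x z"
  by (simp add: cdot_def sum_subtractf algebra_simps)

lemma cdot_zero [simp]: "cdot 0 x = 0" "cdot x 0 = 0"
  by (simp_all add: cdot_def)

lemma cdot_smult_left: "cdot (c *s x) y = c * cdot x y"
  by (simp add: cdot_def sum_distrib_left mult.assoc)

lemma cdot_smult_right: "cdot x (c *s y) = cnj c * cdot x y"
  by (simp add: cdot_def sum_distrib_left algebra_simps)

lemma cdot_sum_left: "cdot (\<Sum>i\<in>I. f i) y = (\<Sum>i\<in>I. cdot (f i) y)"
  by (induction I rule: infinite_finite_induct) (auto simp: cdot_add_left)

lemma cnj_cdot: "cnj (cdot x y) = cdot y x"
  by (simp add: cdot_def mult.commute)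

lemma Re_cdot: "Re (cdot x y) = x \<bullet> y"
  by (simp add: cdot_def inner_vec_def inner_complex_def)

lemma cdot_self: "cdot x x = of_real ((norm x)\<^sup>2)"
proof (rule complex_eqI)
  show "Re (cdot x x) = Re (of_real ((norm x)\<^sup>2))"
    by (simp add: Re_cdot power2_norm_eq_inner)
  have "cnj (cdot x x) = cdot x x" by (rule cnj_cdot)
  then have "Im (cdot x x) = 0" by (metis complex_cnj_cancel_iff cnj.simps(2) neg_equal_zero)
  then show "Im (cdot x x) = Im (of_real ((norm x)\<^sup>2))" by simp
qed

lemma norm_smult_vec: "norm (c *s (x :: complex^'n)) = cmod c * norm x"
proof -
  have "complex_of_real ((norm (c *s x))\<^sup>2) = of_real ((cmod c * norm x)\<^sup>2)"
    by (simp only: cdot_self [symmetric] cdot_smult_left cdot_smult_right)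
       (simp add: cdot_self power_mult_distrib complex_norm_square mult.assoc del: of_real_power)
  then have "(norm (c *s x))\<^sup>2 = (cmod c * norm x)\<^sup>2" by (simp only: of_real_eq_iff)
  then show ?thesis by (simp add: power2_eq_iff_nonneg)
qed

text \<open>The real Cauchy--Schwarz inequality is applied to \<open>x\<close> and
  \<open>?c *s y\<close>: multiplying by the value \<open>?c\<close> itself rotates the complex
  product onto the nonnegative real axis.\<close>

lemma norm_cdot_le: "cmod (cdot x y) \<le> norm x * norm y"
proof -
  let ?c = "cdot x y"
  have "(cmod ?c)\<^sup>2 = Re (cdot x (?c *s y))"
    using cmod_power2[of ?c] by (simp add: cdot_smult_right power2_eq_square)
  also have "\<dots> \<le> norm x * norm (?c *s y)"
    by (simp add: Re_cdot norm_cauchy_schwarz)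
  also have "\<dots> = cmod ?c * (norm x * norm y)" by (simp add: norm_smult_vec)
  finally show ?thesis
    by (cases "cmod ?c = 0") (auto simp: power2_eq_square)
qed

lemma cstar_eq_cdot: "cstar X \<zeta> = cdot \<zeta> X"
  by (simp add: cstar_def cdot_def mult.commute)

lemma cdot_adj: "cdot (M *v x) y = cdot x (adj M *v y)"
proof -
  have "cdot (M *v x) y = (\<Sum>i\<in>UNIV. \<Sum>j\<in>UNIV. M$i$j * x$j * cnj (y$i))"
    by (simp add: cdot_def matrix_vector_mult_def sum_distrib_right)
  also have "\<dots> = (\<Sum>j\<in>UNIV. \<Sum>i\<in>UNIV. M$i$j * x$j * cnj (y$i))" by (rule sum.swap)
  also have "\<dots> = cdot x (adj M *v y)"
    by (simp add: cdot_def matrix_vector_mult_def adj_def sum_distrib_left algebra_simps)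
  finally show ?thesis .
qed

lemma adj_adj [simp]: "adj (adj M) = M"
  by (simp add: adj_def vec_eq_iff)

lemma adj_mult: "adj (M ** N) = adj N ** adj M"
  by (simp add: adj_def matrix_matrix_mult_def vec_eq_iff mult.commute)

lemma adj_add: "adj (M + N) = adj M + adj N"
  by (simp add: adj_def vec_eq_iff)

lemma adj_diff: "adj (M - N) = adj M - adj N"
  by (simp add: adj_def vec_eq_iff)

lemma adj_cscale: "adj (cscale c M) = cscale (cnj c) (adj M)"
  by (simp add: adj_def cscale_def vec_eq_iff)

lemma adj_mat1 [simp]: "adj (mat 1) = mat 1"
  by (auto simp: adj_def mat_def vec_eq_iff)

lemma cdot_hermitian: "hermitian M \<Longrightarrow> cdot (M *v x) y = cdot x (M *v y)"
  by (simp add: cdot_adj hermitian_def)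

lemma cscale_mult_vec: "cscale c M *v x = c *s (M *v x)"
  by (simp add: cscale_def matrix_vector_mult_def vec_eq_iff sum_distrib_left mult.assoc)

lemma mult_vec_smult: "(M :: complex^'n^'m) *v (c *s x) = c *s (M *v x)"
  by (simp add: matrix_vector_mult_def vec_eq_iff sum_distrib_left algebra_simps)

lemma scaleR_eq_smult: "r *\<^sub>R (x :: complex^'n) = complex_of_real r *s x"
  by (simp add: vec_eq_iff scaleR_conv_of_real[where 'a=complex])

lemma mult_vec_scaleR: "(M :: complex^'n^'m) *v (r *\<^sub>R x) = r *\<^sub>R (M *v x)"
  by (simp add: scaleR_eq_smult mult_vec_smult)

lemma mult_vec_axis: "((M :: complex^'n^'m) *v axis j 1) $ i = M $ i $ j"
proof -
  have "(M *v axis j 1) $ i = (\<Sum>k\<in>UNIV. if k = j then M $ i $ k else 0)"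
    unfolding matrix_vector_mult_def vec_lambda_beta by (rule sum.cong) (auto simp: axis_def)
  then show ?thesis by simp
qed

lemma matrix_mult_diff_left: "((A :: complex^'n^'m) - B) ** C = A ** C - B ** C"
  by (simp add: matrix_matrix_mult_def vec_eq_iff sum_subtractf algebra_simps)

lemma matrix_mult_diff_right: "(A :: complex^'n^'m) ** (B - C) = A ** B - A ** C"
  by (simp add: matrix_matrix_mult_def vec_eq_iff sum_subtractf algebra_simps)

text \<open>The norm of a matrix in this type is the Euclidean norm of its row norms, so
  Cauchy--Schwarz row by row suffices. \<open>vconj\<close> appears because \<open>cdot\<close>
  conjugates its second argument.\<close>

lemma norm_mult_vec_le: "norm ((M :: complex^'n^'m) *v x) \<le> norm M * norm x"
proof -
  have "norm ((M *v x) $ i) \<le> norm (M $ i) * norm x" for i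
  proof -
    have "(M *v x) $ i = cdot (M $ i) (vconj x)"
      by (simp add: matrix_vector_mult_def cdot_def vconj_def)
    moreover have "norm (vconj x) = norm x"
      by (simp add: norm_vec_def vconj_def)
    ultimately show ?thesis using norm_cdot_le[of "M $ i" "vconj x"] by simp
  qed
  then have "norm (M *v x) \<le> L2_set (\<lambda>i. norm (M $ i) * norm x) UNIV"
    by (auto simp: norm_vec_def intro: L2_set_mono)
  also have "\<dots> = norm M * norm x"
    by (simp add: norm_vec_def L2_set_left_distrib)
  finally show ?thesis .
qed

section \<open>Semidefinite matrices, eigenvectors and square roots\<close>

lemma hermitian_Im_0: "hermitian M \<Longrightarrow> Im (cdot (M *v x) x) = 0"
  by (metis cdot_hermitian cnj_cdot cnj.simps(2) neg_equal_zero)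

text \<open>A nonzero \<open>w = G v\<close> would be a direction of descent: moving from
  \<open>v\<close> by \<open>-t w\<close> changes the quadratic form by \<open>-2t |w|^2\<close> to
  first order. Nonnegativity is asked only along this line, so that the lemma serves for
  semidefinite matrices as well as inside an invariant subspace.\<close>

lemma hermitian_semidefinite_kernel:
  assumes "hermitian G" and S: "\<And>t. 0 \<le> Re (cdot (G *v (v - t *\<^sub>R (G *v v))) (v - t *\<^sub>R (G *v v)))"
    and "Re (cdot (G *v v) v) = 0"
  shows "G *v v = 0"
proof (rule ccontr)
  assume nz: "G *v v \<noteq> 0"
  define w where "w = G *v v"
  \<comment> \<open>The summand 1 keeps \<open>K\<close> positive, and \<open>t\<close> is chosen
    such that the quadratic term is at most half of the linear gain.\<close>
  define K where "K = \<bar>Re (cdot (G *v w) w)\<bar> + 1"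
  define t where "t = (norm w)\<^sup>2 / K"
  have K: "K > 0" by (simp add: K_def)
  have t: "t > 0" using nz K by (simp add: t_def w_def)
  have 1: "(G *v v) \<bullet> w = (norm w)\<^sup>2" by (simp add: w_def power2_norm_eq_inner)
  have 2: "(G *v w) \<bullet> v = (norm w)\<^sup>2"
    using cdot_hermitian[OF assms(1), of w v] by (metis Re_cdot w_def power2_norm_eq_inner)
  have 3: "(G *v v) \<bullet> v = 0" using assms(3) by (simp add: Re_cdot)
  have "0 \<le> Re (cdot (G *v (v - t *\<^sub>R w)) (v - t *\<^sub>R w))"
    using S[of t] by (simp add: w_def)
  also have "\<dots> = (G *v v) \<bullet> v - t * ((G *v w) \<bullet> v) - t * ((G *v v) \<bullet> w) + t\<^sup>2 * ((G *v w) \<bullet> w)"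
    by (simp add: Re_cdot matrix_vector_mult_diff_distrib mult_vec_scaleR inner_diff_left
        inner_diff_right power2_eq_square algebra_simps)
  also have "\<dots> = - 2 * t * (norm w)\<^sup>2 + t\<^sup>2 * ((G *v w) \<bullet> w)"
    by (simp add: 1 2 3)
  also have "\<dots> \<le> - 2 * t * (norm w)\<^sup>2 + t\<^sup>2 * K"
    by (intro add_left_mono mult_left_mono) (auto simp: K_def Re_cdot)
  also have "t\<^sup>2 * K = t * (norm w)\<^sup>2" using K by (simp add: t_def power2_eq_square)
  also have "- 2 * t * (norm w)\<^sup>2 + t * (norm w)\<^sup>2 = - (t * (norm w)\<^sup>2)" by simp
  finally show False using t nz by (simp add: w_def mult_le_0_iff)
qed

lemma psd_kernel: "psd S \<Longrightarrow> Re (cdot (S *v v) v) = 0 \<Longrightarrow> S *v v = 0"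
  by (rule hermitian_semidefinite_kernel) (auto simp: psd_def)

lemma hermitian_square_eq_0:
  assumes "hermitian M" "M ** M = 0" shows "M = 0"
proof -
  have "M *v x = 0" for x
  proof -
    have "cdot (M *v x) (M *v x) = cdot x (M *v (M *v x))" by (rule cdot_hermitian[OF assms(1)])
    then have "cdot (M *v x) (M *v x) = 0" by (simp add: matrix_vector_mul_assoc assms(2))
    then show ?thesis by (simp add: cdot_self)
  qed
  then show ?thesis by (metis matrix_eq matrix_vector_mult_0)
qed

lemma cdot_axis_right: "cdot x (axis i 1) = x $ i"
proof -
  have "cdot x (axis i 1) = (\<Sum>k\<in>UNIV. if k = i then x $ k else 0)"
    unfolding cdot_def by (rule sum.cong) (auto simp: axis_def)
  then show ?thesis by simp
qed

lemma sum_cdot_axis: "(\<Sum>i\<in>UNIV. cdot (M *v axis i 1) (axis i 1)) = trace M"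
  by (simp add: cdot_axis_right trace_def mult_vec_axis)

text \<open>With $D = S - T$ one has $SD + DT = 0$, so the trace of $DSD + DTD$ vanishes.\<close>

lemma psd_sqrt_unique:
  fixes S T :: "complex^'n^'n"
  assumes S: "psd S" and T: "psd T" and eq: "S ** S = T ** T"
  shows "S = T"
proof -
  define D where "D = S - T"
  have hS: "hermitian S" and hT: "hermitian T" using S T by (auto simp: psd_def)
  have hD: "hermitian D" using hS hT by (simp add: D_def hermitian_def adj_diff)
  have "S ** D + D ** T = 0"
    by (simp add: D_def matrix_mult_diff_left matrix_mult_diff_right eq)
  then have SD: "S ** D = - (D ** T)" by (simp add: eq_neg_iff_add_eq_0)
  have "trace (D ** S ** D) = - trace (D ** T ** D)"
  proof -
    have "trace (D ** S ** D) = trace (D ** (S ** D))" by (simp add: matrix_mul_assoc)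
    also have "\<dots> = - trace (D ** (D ** T))"
      by (simp only: SD) (simp add: trace_def sum_negf matrix_matrix_mult_def)
    also have "trace (D ** (D ** T)) = trace ((D ** T) ** D)" by (rule trace_mul_sym)
    finally show ?thesis by simp
  qed
  then have "(\<Sum>i\<in>UNIV. cdot ((D ** S ** D) *v axis i 1) (axis i 1))
      + (\<Sum>i\<in>UNIV. cdot ((D ** T ** D) *v axis i 1) (axis i 1)) = 0"
    by (simp add: sum_cdot_axis)
  moreover have conj: "cdot ((D ** M ** D) *v x) x = cdot (M *v (D *v x)) (D *v x)" for M x
    by (simp add: matrix_vector_mul_assoc[symmetric] cdot_hermitian[OF hD])
  ultimately have "(\<Sum>i\<in>UNIV. Re (cdot (S *v (D *v axis i 1)) (D *v axis i 1))
     + Re (cdot (T *v (D *v axis i 1)) (D *v axis i 1))) = 0"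
    by (simp add: sum.distrib) (metis Re_sum plus_complex.simps(1) zero_complex.simps(1))
  moreover have ge: "0 \<le> Re (cdot (S *v x) x)" "0 \<le> Re (cdot (T *v x) x)" for x
    using S T by (auto simp: psd_def)
  ultimately have "Re (cdot (S *v (D *v axis i 1)) (D *v axis i 1))
     + Re (cdot (T *v (D *v axis i 1)) (D *v axis i 1)) = 0" for i
    by (subst (asm) sum_nonneg_eq_0_iff) auto
  then have "Re (cdot (S *v (D *v axis i 1)) (D *v axis i 1)) = 0"
     "Re (cdot (T *v (D *v axis i 1)) (D *v axis i 1)) = 0" for i
    using ge by (smt (verit))+
  \<comment> \<open>Both \<open>S\<close> and \<open>T\<close> annihilate the range of
    \<open>D\<close>, hence so does their difference \<open>D\<close>.\<close>
  then have "S *v (D *v axis i 1) = 0" "T *v (D *v axis i 1) = 0" for i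
    using psd_kernel S T by blast+
  then have "(D ** D) *v axis i 1 = 0" for i
    by (simp add: matrix_vector_mul_assoc[symmetric])
       (simp add: D_def matrix_vector_mult_diff_rdistrib)
  then have "D ** D = 0"
    by (simp add: mult_vec_axis vec_eq_iff)
  then show ?thesis using hermitian_square_eq_0[OF hD] by (simp add: D_def)
qed

text \<open>Induction on the real dimension of a subspace that is closed under complex scalars and
  invariant under \<open>H\<close>. The maximiser \<open>v\<close> of the Rayleigh quotient on the
  unit sphere of \<open>S\<close> is an eigenvector, because \<open>m - H\<close> is nonnegative on
  \<open>S\<close> and its quadratic form vanishes at \<open>v\<close>; the induction continues in
  the orthogonal complement of \<open>v\<close> in \<open>S\<close>. The conclusion is an
  orthonormal expansion, the form in which the construction of square roots uses it.\<close>

lemma hermitian_eigenbasis: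
  fixes H :: "complex^'n^'n"
  assumes H: "hermitian H"
  shows "subspace S \<Longrightarrow> (\<forall>c. \<forall>x\<in>S. c *s x \<in> S) \<Longrightarrow> (\<forall>x\<in>S. H *v x \<in> S) \<Longrightarrow>
     \<exists>B l. finite B \<and> B \<subseteq> S \<and> (\<forall>e\<in>B. norm e = 1 \<and> H *v e = complex_of_real (l e) *s e) \<and>
       (\<forall>e\<in>B. \<forall>f\<in>B. e \<noteq> f \<longrightarrow> cdot e f = 0) \<and> (\<forall>x\<in>S. x = (\<Sum>e\<in>B. cdot x e *s e))"
proof (induction "dim S" arbitrary: S rule: less_induct)
  case less
  show ?case
  proof (cases "S = {0}")
    case True
    then show ?thesis by (intro exI[of _ "{}"]) auto
  next
    case False
    have S: "subspace S" and cS: "\<And>c x. x \<in> S \<Longrightarrow> c *s x \<in> S" and HS: "\<And>x. x \<in> S \<Longrightarrow> H *v x \<in> S"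
      using less.prems by auto
    obtain x0 where x0: "x0 \<in> S" "x0 \<noteq> 0" using False S subspace_0 by blast
    let ?K = "S \<inter> sphere 0 1"
    have "compact ?K" using closed_subspace[OF S] by (simp add: closed_Int_compact)
    moreover have "?K \<noteq> {}"
      using x0 S subspace_scale[OF S, of x0 "1 / norm x0"] by (auto intro!: exI[of _ "(1 / norm x0) *\<^sub>R x0"])
    moreover have lin: "linear (\<lambda>x. H *v x)"
      by (rule linearI) (simp_all add: matrix_vector_right_distrib mult_vec_scaleR)
    then have "continuous_on ?K (\<lambda>x. (H *v x) \<bullet> x)"
      by (intro continuous_intros linear_continuous_on linear_conv_bounded_linear[THEN iffD1])
    ultimately have "\<exists>v\<in>?K. \<forall>x\<in>?K. (H *v x) \<bullet> x \<le> (H *v v) \<bullet> v"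
      by (intro continuous_attains_sup)
    then obtain v where v: "v \<in> ?K" and vmax: "\<And>x. x \<in> ?K \<Longrightarrow> (H *v x) \<bullet> x \<le> (H *v v) \<bullet> v"
      by blast
    have vS: "v \<in> S" and v1: "norm v = 1" using v by auto
    define m where "m = (H *v v) \<bullet> v"
    define G where "G = cscale (of_real m) (mat 1) - H"
    have Gv: "G *v x = m *\<^sub>R x - H *v x" for x
      by (simp add: G_def matrix_vector_mult_diff_rdistrib cscale_mult_vec vec_eq_iff)
        (simp add: scaleR_conv_of_real[where 'a=complex])
    have hG: "hermitian G" using H by (simp add: G_def hermitian_def adj_diff adj_cscale)
    have pos: "0 \<le> Re (cdot (G *v x) x)" if "x \<in> S" for x
    proof (cases "x = 0")
      case False
      define y where "y = (1 / norm x) *\<^sub>R x"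
      have "y \<in> ?K" using that False subspace_scale[OF S] by (simp add: y_def)
      then have "(H *v y) \<bullet> y \<le> m" using vmax by (simp add: m_def)
      then have "(H *v x) \<bullet> x \<le> m * (norm x)\<^sup>2" using False
        by (simp add: y_def mult_vec_scaleR field_simps power2_eq_square)
      then show ?thesis by (simp add: Re_cdot Gv inner_diff_left power2_norm_eq_inner)
    qed auto
    have GS: "G *v v \<in> S" unfolding Gv
      by (intro subspace_diff[OF S] subspace_scale[OF S] vS HS)
    have "G *v v = 0"
    proof (rule hermitian_semidefinite_kernel[OF hG])
      show "0 \<le> Re (cdot (G *v (v - t *\<^sub>R (G *v v))) (v - t *\<^sub>R (G *v v)))" for t
        by (intro pos subspace_diff[OF S] subspace_scale[OF S] vS GS)
      show "Re (cdot (G *v v) v) = 0"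
        using v1 by (simp add: Re_cdot Gv m_def inner_diff_left power2_norm_eq_inner[symmetric])
    qed
    then have Hv: "H *v v = complex_of_real m *s v" unfolding Gv
      by (simp add: vec_eq_iff scaleR_conv_of_real[where 'a=complex])
    define S' where "S' = {x \<in> S. cdot x v = 0}"
    have S': "subspace S'"
      using S by (auto simp: S'_def subspace_def cdot_add_left scaleR_eq_smult cdot_smult_left)
    have "v \<notin> S'" using v1 by (simp add: S'_def cdot_self)
    then have "S' \<subset> S" using vS by (auto simp: S'_def)
    then have "dim S' < dim S"
      using S S' by (metis dim_subset subspace_dim_equal less_imp_le order_le_less psubsetE)
    moreover have "\<forall>c. \<forall>x\<in>S'. c *s x \<in> S'" using cS by (auto simp: S'_def cdot_smult_left)
    moreover have "\<forall>x\<in>S'. H *v x \<in> S'"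
      using HS by (auto simp: S'_def cdot_hermitian[OF H] Hv cdot_smult_right)
    ultimately obtain B l where B: "finite B" "B \<subseteq> S'"
      "\<forall>e\<in>B. norm e = 1 \<and> H *v e = complex_of_real (l e) *s e"
      "\<forall>e\<in>B. \<forall>f\<in>B. e \<noteq> f \<longrightarrow> cdot e f = 0" "\<forall>x\<in>S'. x = (\<Sum>e\<in>B. cdot x e *s e)"
      using less.hyps[of S'] S' by blast
    have vB: "v \<notin> B" using B(2) \<open>v \<notin> S'\<close> by auto
    have Bv: "cdot e v = 0" if "e \<in> B" for e
      using B(2) that by (auto simp: S'_def)
    have Bv': "cdot v e = 0" if "e \<in> B" for e
      using Bv[OF that] by (metis cnj_cdot complex_cnj_zero)
    have ex: "x = (\<Sum>e\<in>insert v B. cdot x e *s e)" if "x \<in> S" for x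
    proof -
      define y where "y = x - cdot x v *s v"
      have "y \<in> S'" using that cS vS v1
        by (auto simp: S'_def y_def subspace_diff[OF S] cdot_diff_left cdot_smult_left cdot_self)
      then have "y = (\<Sum>e\<in>B. cdot y e *s e)" using B(5) by blast
      also have "\<dots> = (\<Sum>e\<in>B. cdot x e *s e)"
        by (rule sum.cong) (auto simp: y_def cdot_diff_left cdot_smult_left Bv')
      finally show ?thesis using B(1) vB by (simp add: y_def algebra_simps)
    qed
    show ?thesis
    proof (intro exI[of _ "insert v B"] exI[of _ "l(v := m)"] conjI)
      show "\<forall>e\<in>insert v B. norm e = 1 \<and> H *v e = complex_of_real ((l(v := m)) e) *s e"
        using B(3) vB v1 Hv by auto
      show "\<forall>e\<in>insert v B. \<forall>f\<in>insert v B. e \<noteq> f \<longrightarrow> cdot e f = 0"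
        using B(4) Bv Bv' by auto
    qed (use B vS ex in \<open>auto simp: S'_def\<close>)
  qed
qed

text \<open>Spectral calculus: \<open>S\<close> is the sum of the rank-one projections onto the
  eigenvectors, weighted by the square roots of the eigenvalues, so that its square has to be
  compared with \<open>M\<close> on eigenvectors only.\<close>

lemma psd_sqrt_exists:
  fixes M :: "complex^'n^'n"
  assumes M: "psd M"
  shows "\<exists>S. psd S \<and> S ** S = M"
proof -
  have hM: "hermitian M" using M by (simp add: psd_def)
  obtain B l where B: "finite B" 
      "\<forall>e\<in>B. norm e = 1 \<and> M *v e = complex_of_real (l e) *s e"
      "\<forall>e\<in>B. \<forall>f\<in>B. e \<noteq> f \<longrightarrow> cdot e f = 0" "\<And>x. x = (\<Sum>e\<in>B. cdot x e *s e)"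
    using hermitian_eigenbasis[OF hM, of UNIV] by auto
  have l: "0 \<le> l e" if "e \<in> B" for e
  proof -
    have "0 \<le> Re (cdot (M *v e) e)" using M by (simp add: psd_def)
    then show ?thesis using B(2) that by (simp add: cdot_smult_left cdot_self)
  qed
  define S :: "complex^'n^'n" where
    "S = (\<Sum>e\<in>B. cscale (of_real (sqrt (l e))) (\<chi> i j. e$i * cnj (e$j)))"
  have rank1: "(\<chi> i j. e$i * cnj (e$j)) *v x = cdot x e *s e" for e x :: "complex^'n"
    by (simp add: matrix_vector_mult_def vec_eq_iff cdot_def sum_distrib_left sum_distrib_right algebra_simps)
  have summv: "(\<Sum>e\<in>I. F e) *v x = (\<Sum>e\<in>I. F e *v x)" for I and F :: "complex^'n \<Rightarrow> complex^'n^'n" and x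
    by (induction I rule: infinite_finite_induct) (auto simp: matrix_vector_mult_add_rdistrib)
  have Sx: "S *v x = (\<Sum>e\<in>B. (of_real (sqrt (l e)) * cdot x e) *s e)" for x
    by (simp add: S_def summv cscale_mult_vec rank1 vector_smult_assoc)
  have Se: "S *v e = of_real (sqrt (l e)) *s e" if "e \<in> B" for e
  proof -
    have "S *v e = (\<Sum>f\<in>B. if f = e then of_real (sqrt (l e)) *s e else 0)"
      unfolding Sx
      by (rule sum.cong) (use B(2,3) that in \<open>auto simp: cdot_self\<close>)
    then show ?thesis using B(1) that by simp
  qed
  have "(S ** S) *v x = M *v x" for x
  proof -
    have lin: "linear (\<lambda>x. A *v x)" for A :: "complex^'n^'n"
      by (rule linearI) (simp_all add: matrix_vector_right_distrib mult_vec_scaleR)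
    have "(S ** S) *v e = M *v e" if "e \<in> B" for e
      using that B(2) l[OF that]
      by (simp add: matrix_vector_mul_assoc[symmetric] Se mult_vec_smult vector_smult_assoc
          flip: of_real_mult)
    then have "(S ** S) *v (\<Sum>e\<in>B. cdot x e *s e) = M *v (\<Sum>e\<in>B. cdot x e *s e)"
      by (simp add: linear_sum[OF lin] mult_vec_smult)
    then show ?thesis using B(4)[of x] by simp
  qed
  then have "S ** S = M" by (simp add: matrix_eq)
  moreover have "psd S" unfolding psd_def
  proof
    show "hermitian S"
      unfolding hermitian_def
    proof -
      have "adj (\<Sum>e\<in>I. F e) = (\<Sum>e\<in>I. adj (F e))" for I and F :: "complex^'n \<Rightarrow> complex^'n^'n"
        by (induction I rule: infinite_finite_induct) (auto simp: adj_add, auto simp: adj_def vec_eq_iff)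
      then show "adj S = S"
        by (simp add: S_def adj_cscale) (simp add: adj_def mult.commute)
    qed
    show "\<forall>\<xi>. 0 \<le> Re (cdot (S *v \<xi>) \<xi>)"
    proof
      fix \<xi>
      have "cdot (S *v \<xi>) \<xi> = (\<Sum>e\<in>B. of_real (sqrt (l e)) * (cdot \<xi> e * cnj (cdot \<xi> e)))"
        by (simp add: Sx cdot_sum_left cdot_smult_left cnj_cdot mult.assoc)
      then have "Re (cdot (S *v \<xi>) \<xi>) = (\<Sum>e\<in>B. sqrt (l e) * (cmod (cdot \<xi> e))\<^sup>2)"
        by (simp add: complex_mult_cnj cmod_power2)
      also have "\<dots> \<ge> 0" using l by (auto intro!: sum_nonneg)
      finally show "0 \<le> Re (cdot (S *v \<xi>) \<xi>)" .
    qed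
  qed
  ultimately show ?thesis by blast
qed

lemma msqrt_unique: "psd S \<Longrightarrow> S ** S = M \<Longrightarrow> msqrt M = S"
  unfolding msqrt_def by (rule the_equality) (auto intro: psd_sqrt_unique)

lemma msqrt:
  assumes "psd M" shows "psd (msqrt M)" "msqrt M ** msqrt M = M"
  using psd_sqrt_exists[OF assms] msqrt_unique by metis+

section \<open>Measurability of the matrix square root\<close>

lemma continuous_on_matrix_mult:
  fixes f :: "'a::topological_space \<Rightarrow> complex^'k^'m" and g :: "'a \<Rightarrow> complex^'n^'k"
  assumes "continuous_on S f" "continuous_on S g"
  shows "continuous_on S (\<lambda>x. f x ** g x)"
  unfolding matrix_matrix_mult_def using assms
  by (intro continuous_intros)

lemma continuous_on_mult_vec:
  fixes f :: "'a::topological_space \<Rightarrow> complex^'n^'m" and g :: "'a \<Rightarrow> complex^'n"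
  assumes "continuous_on S f" "continuous_on S g"
  shows "continuous_on S (\<lambda>x. f x *v g x)"
  unfolding matrix_vector_mult_def using assms
  by (intro continuous_intros)

lemma continuous_on_cdot:
  assumes "continuous_on S f" "continuous_on S g"
  shows "continuous_on S (\<lambda>x. cdot (f x) (g x))"
  unfolding cdot_def using assms by (intro continuous_intros)

lemma closed_psd: "closed {M :: complex^'n^'n. psd M}"
proof -
  have "continuous_on UNIV (\<lambda>M :: complex^'n^'n. adj M)"
    unfolding adj_def by (intro continuous_intros)
  then have "closed {M :: complex^'n^'n. adj M = M}"
    by (intro closed_Collect_eq continuous_intros)
  moreover have "closed {M :: complex^'n^'n. 0 \<le> Re (cdot (M *v \<xi>) \<xi>)}" for \<xi>
    by (intro closed_Collect_le continuous_intros continuous_on_cdot continuous_on_mult_vec)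
  ultimately have "closed ({M :: complex^'n^'n. adj M = M} \<inter> (\<Inter>\<xi>. {M. 0 \<le> Re (cdot (M *v \<xi>) \<xi>)}))"
    by (intro closed_Int closed_INT) auto
  moreover have "{M :: complex^'n^'n. psd M} = {M. adj M = M} \<inter> (\<Inter>\<xi>. {M. 0 \<le> Re (cdot (M *v \<xi>) \<xi>)})"
    by (auto simp: psd_def hermitian_def)
  ultimately show ?thesis by simp
qed

text \<open>\<open>msqrt\<close> inverts the continuous squaring map, so its own continuity can be
  avoided. The semidefinite matrices in a closed set \<open>K\<close> form a countable union of
  compact pieces, the squares of each piece are compact, and by uniqueness of the root the preimage
  of \<open>K\<close> under \<open>msqrt\<close> composed with \<open>F\<close> is the preimage of
  these squares under \<open>F\<close>.\<close>

lemma borel_measurable_msqrt: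
  fixes F :: "'a \<Rightarrow> complex^'n^'n"
  assumes F: "F \<in> borel_measurable M" and psd: "\<And>x. x \<in> space M \<Longrightarrow> psd (F x)"
  shows "(\<lambda>x. msqrt (F x)) \<in> borel_measurable M"
  unfolding borel_eq_closed
proof (rule measurable_measure_of)
  fix K :: "(complex^'n^'n) set" assume "K \<in> Collect closed"
  then have K: "closed K" by simp
  let ?P = "\<lambda>n. K \<inter> {S. psd S} \<inter> cball 0 (real n)"
  let ?sq = "\<lambda>S :: complex^'n^'n. S ** S"
  have "compact (?sq ` ?P n)" for n
    by (intro compact_continuous_image continuous_on_matrix_mult continuous_on_id
        closed_Int_compact closed_Int K closed_psd compact_cball)
  then have "(\<Union>n. ?sq ` ?P n) \<in> sets borel"
    by (intro sets.countable_UN) (auto intro: borel_compact)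
  then have "F -` (\<Union>n. ?sq ` ?P n) \<inter> space M \<in> sets M" by (rule measurable_sets[OF F])
  moreover have "(\<lambda>x. msqrt (F x)) -` K \<inter> space M = F -` (\<Union>n. ?sq ` ?P n) \<inter> space M"
  proof (intro set_eqI iffI)
    fix x assume x: "x \<in> (\<lambda>x. msqrt (F x)) -` K \<inter> space M"
    then have p: "psd (F x)" using psd by auto
    obtain n where "norm (msqrt (F x)) \<le> real n" using real_arch_simple by blast
    then show "x \<in> F -` (\<Union>n. ?sq ` ?P n) \<inter> space M"
      using x msqrt[OF p] by (auto intro!: image_eqI[of _ _ "msqrt (F x)"])
  next
    fix x assume "x \<in> F -` (\<Union>n. ?sq ` ?P n) \<inter> space M"
    then obtain S where "S \<in> K" "psd S" "F x = S ** S" "x \<in> space M" by auto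
    then show "x \<in> (\<lambda>x. msqrt (F x)) -` K \<inter> space M" using msqrt_unique[of S "F x"] by auto
  qed
  ultimately show "(\<lambda>x. msqrt (F x)) -` K \<inter> space M \<in> sets M" by simp
qed auto

section \<open>Square-integrable functions\<close>

text \<open>One notion for all value types: scalar functions, vector fields and pairs of both share
  the same estimates.\<close>

definition sqi :: "'a measure \<Rightarrow> ('a \<Rightarrow> 'b::{banach, second_countable_topology}) \<Rightarrow> bool" where
  "sqi M f \<longleftrightarrow> f \<in> borel_measurable M \<and> integrable M (\<lambda>x. (norm (f x))\<^sup>2)"

definition sqn :: "'a measure \<Rightarrow> ('a \<Rightarrow> 'b::{banach, second_countable_topology}) \<Rightarrow> real" where
  "sqn M f = sqrt (LINT x|M. (norm (f x))\<^sup>2)"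

lemma sqi_measurable: "sqi M f \<Longrightarrow> f \<in> borel_measurable M"
  and sqi_integrable: "sqi M f \<Longrightarrow> integrable M (\<lambda>x. (norm (f x))\<^sup>2)"
  by (auto simp: sqi_def)

lemma sqn_nonneg [simp]: "0 \<le> sqn M f"
  by (simp add: sqn_def)

lemma sqn_power2: "(sqn M f)\<^sup>2 = (LINT x|M. (norm (f x))\<^sup>2)"
  by (simp add: sqn_def)

lemma sqi_dominated:
  assumes f: "sqi M f" and g: "g \<in> borel_measurable M" and c: "0 \<le> c"
    and le: "AE x in M. norm (g x) \<le> c * norm (f x)"
  shows "sqi M g" "sqn M g \<le> c * sqn M f"
proof -
  have sq: "AE x in M. (norm (g x))\<^sup>2 \<le> c\<^sup>2 * (norm (f x))\<^sup>2"
    using le by eventually_elim (metis norm_ge_zero power_mono power_mult_distrib)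
  have i: "integrable M (\<lambda>x. c\<^sup>2 * (norm (f x))\<^sup>2)" using f by (simp add: sqi_def)
  show 1: "sqi M g" unfolding sqi_def
    using g sq by (auto intro!: Bochner_Integration.integrable_bound[OF i])
  have "(LINT x|M. (norm (g x))\<^sup>2) \<le> (LINT x|M. c\<^sup>2 * (norm (f x))\<^sup>2)"
    using 1 sq by (intro integral_mono_AE i) (auto simp: sqi_def)
  then have "(sqn M g)\<^sup>2 \<le> (c * sqn M f)\<^sup>2"
    by (simp add: sqn_power2 power_mult_distrib)
  then show "sqn M g \<le> c * sqn M f" by (rule power2_le_imp_le) (simp add: c)
qed

text \<open>Cauchy--Schwarz by the discriminant: the integral of \<open>(t |f| - |g|)^2\<close> is a
  quadratic polynomial in \<open>t\<close> without negative values.\<close>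

lemma sqi_norm_product:
  assumes f: "sqi M f" and g: "sqi M g"
  shows "integrable M (\<lambda>x. norm (f x) * norm (g x))"
    "(LINT x|M. norm (f x) * norm (g x)) \<le> sqn M f * sqn M g"
proof -
  have mf: "f \<in> borel_measurable M" and mg: "g \<in> borel_measurable M"
    and if2: "integrable M (\<lambda>x. (norm (f x))\<^sup>2)" and ig: "integrable M (\<lambda>x. (norm (g x))\<^sup>2)"
    using f g by (auto simp: sqi_def)
  have pt: "norm (f x) * norm (g x) \<le> (norm (f x))\<^sup>2 + (norm (g x))\<^sup>2" for x
  proof -
    have "2 * (norm (f x) * norm (g x)) \<le> (norm (f x))\<^sup>2 + (norm (g x))\<^sup>2"
      using sum_squares_bound[of "norm (f x)" "norm (g x)"] by (simp add: mult.assoc)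
    moreover have "0 \<le> norm (f x) * norm (g x)" by simp
    ultimately show ?thesis by linarith
  qed
  show int: "integrable M (\<lambda>x. norm (f x) * norm (g x))"
    by (rule Bochner_Integration.integrable_bound[OF Bochner_Integration.integrable_add[OF if2 ig]])
       (use mf mg pt in auto)
  define a where "a = (LINT x|M. (norm (f x))\<^sup>2)"
  define b where "b = (LINT x|M. (norm (g x))\<^sup>2)"
  define c where "c = (LINT x|M. norm (f x) * norm (g x))"
  have a: "0 \<le> a" and b: "0 \<le> b" and c: "0 \<le> c"
    by (auto simp: a_def b_def c_def intro!: Bochner_Integration.integral_nonneg)
  have q: "0 \<le> t\<^sup>2 * a - 2 * t * c + b" for t
  proof -
    have "0 \<le> (LINT x|M. (t * norm (f x) - norm (g x))\<^sup>2)" by simp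
    also have "(\<lambda>x. (t * norm (f x) - norm (g x))\<^sup>2)
        = (\<lambda>x. t\<^sup>2 * (norm (f x))\<^sup>2 - 2 * t * (norm (f x) * norm (g x)) + (norm (g x))\<^sup>2)"
      by (auto simp: power2_eq_square algebra_simps)
    also have "(LINT x|M. \<dots> x) = t\<^sup>2 * a - 2 * t * c + b"
      unfolding a_def b_def c_def using if2 ig int by simp
    finally show ?thesis .
  qed
  have "c\<^sup>2 \<le> a * b"
  proof (cases "a = 0")
    case True
    have "c = 0"
    proof (rule ccontr)
      assume "c \<noteq> 0"
      \<comment> \<open>For \<open>a = 0\<close> the polynomial is affine in \<open>t\<close>, and
        at this \<open>t\<close> its value would be \<open>-1\<close>.\<close>
      then have "2 * ((b + 1) / (2 * c)) * c = b + 1" by simp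
      then show False using q[of "(b + 1) / (2 * c)"] True by simp
    qed
    then show ?thesis using True by simp
  next
    case False
    then have "0 < a" using a by simp
    have "0 \<le> (c / a)\<^sup>2 * a - 2 * (c / a) * c + b" by (rule q)
    also have "\<dots> = b - c\<^sup>2 / a" using False by (simp add: power2_eq_square field_simps)
    finally show ?thesis using \<open>0 < a\<close> by (simp add: field_simps)
  qed
  then have "sqrt (c\<^sup>2) \<le> sqrt (a * b)" by (rule real_sqrt_le_mono)
  then show "(LINT x|M. norm (f x) * norm (g x)) \<le> sqn M f * sqn M g"
    using c by (simp add: sqn_def real_sqrt_mult a_def b_def c_def)
qed

text \<open>The common source of integrability and boundedness for the forms below, whose integrands
  are dominated pointwise by a product of two square-integrable norms.\<close>

lemma sqi_bilinear:
  fixes h :: "'a \<Rightarrow> 'c::{banach, second_countable_topology}"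
  assumes f: "sqi M f" and g: "sqi M g" and h: "h \<in> borel_measurable M" and c: "0 \<le> c"
    and le: "AE x in M. norm (h x) \<le> c * (norm (f x) * norm (g x))"
  shows "integrable M h" "norm (LINT x|M. h x) \<le> c * (sqn M f * sqn M g)"
proof -
  have i: "integrable M (\<lambda>x. c * (norm (f x) * norm (g x)))"
    using sqi_norm_product[OF f g] by simp
  show ih: "integrable M h"
    by (rule Bochner_Integration.integrable_bound[OF i h]) (use le c in auto)
  have "norm (LINT x|M. h x) \<le> (LINT x|M. norm (h x))" by (rule integral_norm_bound)
  also have "\<dots> \<le> (LINT x|M. c * (norm (f x) * norm (g x)))"
    using le by (intro integral_mono_AE i) (auto simp: ih)
  also have "\<dots> \<le> c * (sqn M f * sqn M g)"
    using sqi_norm_product[OF f g] c by (simp add: mult_left_mono)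
  finally show "norm (LINT x|M. h x) \<le> c * (sqn M f * sqn M g)" .
qed

lemma sqi_add:
  assumes f: "sqi M f" and g: "sqi M g"
  shows "sqi M (\<lambda>x. f x + g x)" "sqn M (\<lambda>x. f x + g x) \<le> sqn M f + sqn M g"
proof -
  have mf: "f \<in> borel_measurable M" and mg: "g \<in> borel_measurable M"
    and if2: "integrable M (\<lambda>x. (norm (f x))\<^sup>2)" and ig: "integrable M (\<lambda>x. (norm (g x))\<^sup>2)"
    using f g by (auto simp: sqi_def)
  have i: "integrable M (\<lambda>x. (norm (f x))\<^sup>2 + 2 * (norm (f x) * norm (g x)) + (norm (g x))\<^sup>2)"
    using if2 ig sqi_norm_product[OF f g] by simp
  have le: "(norm (f x + g x))\<^sup>2 \<le> (norm (f x))\<^sup>2 + 2 * (norm (f x) * norm (g x)) + (norm (g x))\<^sup>2" for x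
  proof -
    have "(norm (f x + g x))\<^sup>2 \<le> (norm (f x) + norm (g x))\<^sup>2"
      by (intro power_mono norm_triangle_ineq norm_ge_zero)
    then show ?thesis by (simp add: power2_eq_square algebra_simps)
  qed
  show 1: "sqi M (\<lambda>x. f x + g x)"
    unfolding sqi_def
    by (intro conjI Bochner_Integration.integrable_bound[OF i]) (use mf mg le in \<open>auto intro!: AE_I2\<close>)
  have "(sqn M (\<lambda>x. f x + g x))\<^sup>2 \<le> (LINT x|M. (norm (f x))\<^sup>2 + 2 * (norm (f x) * norm (g x)) + (norm (g x))\<^sup>2)"
    unfolding sqn_power2 by (intro integral_mono i le) (use 1 in \<open>auto simp: sqi_def\<close>)
  also have "\<dots> = (sqn M f)\<^sup>2 + 2 * (LINT x|M. norm (f x) * norm (g x)) + (sqn M g)\<^sup>2"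
    using if2 ig sqi_norm_product[OF f g] by (simp add: sqn_power2)
  also have "\<dots> \<le> (sqn M f)\<^sup>2 + 2 * (sqn M f * sqn M g) + (sqn M g)\<^sup>2"
    using sqi_norm_product[OF f g] by simp
  also have "\<dots> = (sqn M f + sqn M g)\<^sup>2" by (simp add: power2_eq_square algebra_simps)
  finally show "sqn M (\<lambda>x. f x + g x) \<le> sqn M f + sqn M g" by (rule power2_le_imp_le) simp
qed

lemma sqi_uminus: "sqi M f \<Longrightarrow> sqi M (\<lambda>x. - f x)"
  by (simp add: sqi_def)

lemma sqn_uminus: "sqn M (\<lambda>x. - f x) = sqn M f"
  by (simp add: sqn_def)

lemma sqi_diff:
  assumes "sqi M f" "sqi M g"
  shows "sqi M (\<lambda>x. f x - g x)" "sqn M (\<lambda>x. f x - g x) \<le> sqn M f + sqn M g"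
  using sqi_add[OF assms(1) sqi_uminus[OF assms(2)]] by (simp_all add: sqn_uminus)

lemma sqn_triangle_diff:
  assumes "sqi M f" "sqi M g" "sqi M h"
  shows "sqn M (\<lambda>x. f x - h x) \<le> sqn M (\<lambda>x. f x - g x) + sqn M (\<lambda>x. g x - h x)"
  using sqi_add(2)[OF sqi_diff(1)[OF assms(1,2)] sqi_diff(1)[OF assms(2,3)]] by simp

lemma sqn_cong_AE:
  assumes "f \<in> borel_measurable M" "g \<in> borel_measurable M" "AE x in M. f x = g x"
  shows "sqn M f = sqn M g"
  unfolding sqn_def using assms by (intro arg_cong[of _ _ sqrt] integral_cong_AE) auto

lemma sqn_cong: "(\<And>x. x \<in> space M \<Longrightarrow> f x = g x) \<Longrightarrow> sqn M f = sqn M g"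
  unfolding sqn_def by (intro arg_cong[of _ _ sqrt] Bochner_Integration.integral_cong) auto

lemma sqn_eq_0_iff: "sqi M f \<Longrightarrow> sqn M f = 0 \<longleftrightarrow> (AE x in M. f x = 0)"
  using integral_nonneg_eq_0_iff_AE[of M "\<lambda>x. (norm (f x))\<^sup>2"] by (simp add: sqn_def sqi_def)

lemma sqi_zero [simp]: "sqi M (\<lambda>x. 0)" "sqn M (\<lambda>x. 0) = 0"
  by (simp_all add: sqi_def sqn_def)

lemma nn_integral_sqn:
  "sqi M f \<Longrightarrow> (\<integral>\<^sup>+x. ennreal ((norm (f x))\<^sup>2) \<partial>M) = ennreal ((sqn M f)\<^sup>2)"
  by (simp add: sqn_power2 sqi_def nn_integral_eq_integral)

text \<open>Riesz--Fischer: a rapid selection of indices converges almost everywhere, and Fatou's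
  lemma carries the Cauchy estimate over to the limit.\<close>

lemma square_integrable_complete:
  fixes f :: "nat \<Rightarrow> 'a \<Rightarrow> 'b::{banach, second_countable_topology}"
  assumes f: "\<And>n. sqi M (f n)"
    and C: "\<And>e. e > 0 \<Longrightarrow> \<exists>N. \<forall>m\<ge>N. \<forall>n\<ge>N. sqn M (\<lambda>x. f m x - f n x) < e"
  shows "\<exists>g. sqi M g \<and> (\<lambda>n. sqn M (\<lambda>x. f n x - g x)) \<longlonglongrightarrow> 0"
proof -
  have "\<exists>N. \<forall>m\<ge>N. \<forall>n\<ge>N. sqn M (\<lambda>x. f m x - f n x) < (1/4) ^ k" for k :: nat
    by (rule C) simp
  then obtain N where N: "\<And>k m n. m \<ge> N k \<Longrightarrow> n \<ge> N k \<Longrightarrow> sqn M (\<lambda>x. f m x - f n x) < (1/4) ^ k"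
    by metis
  \<comment> \<open>The maximum puts \<open>r k\<close> above all thresholds up to \<open>k\<close>,
    so both \<open>r k\<close> and \<open>r (Suc k)\<close> are at least \<open>N k\<close>. The
    summand \<open>k\<close> lets \<open>r\<close> reach every index bound that occurs in the Fatou
    step.\<close>
  define r where "r k = Max (N ` {..k}) + k" for k
  have rN: "r k \<ge> N j" if "j \<le> k" for j k
    using that by (auto simp: r_def intro!: trans_le_add1 Max_ge)
  define g where "g k = f (r k)" for k
  have sg: "sqi M (g k)" for k by (simp add: g_def f)
  define h where "h k x = g (Suc k) x - g k x" for k x
  have sh: "sqi M (h k)" for k unfolding h_def by (intro sqi_diff sg)
  \<comment> \<open>This decay leaves room for the weight \<open>4 ^ k\<close> in the sum of squares
    below. Finiteness of the weighted sum then forces the increments to decay like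
    \<open>(1/2) ^ k\<close> at almost every point.\<close>
  have hk: "sqn M (h k) \<le> (1/4) ^ k" for k
    unfolding h_def g_def using N[OF rN rN, of k "Suc k" k] by simp
  have [measurable]: "h k \<in> borel_measurable M" "g k \<in> borel_measurable M" "f k \<in> borel_measurable M" for k
    by (rule sqi_measurable[OF sh] sqi_measurable[OF sg] sqi_measurable[OF f])+
  have "(\<integral>\<^sup>+x. (\<Sum>k. ennreal (4 ^ k * (norm (h k x))\<^sup>2)) \<partial>M)
      = (\<Sum>k. \<integral>\<^sup>+x. ennreal (4 ^ k * (norm (h k x))\<^sup>2) \<partial>M)"
    by (rule nn_integral_suminf) auto
  also have "\<dots> = (\<Sum>k. ennreal (4 ^ k * (sqn M (h k))\<^sup>2))"
    using sh by (subst ennreal_mult', simp, subst nn_integral_cmult)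
      (auto simp: nn_integral_sqn ennreal_mult')
  also have "\<dots> \<le> (\<Sum>k. ennreal ((1/4) ^ k))"
  proof (intro suminf_le ennreal_leI)
    fix k :: nat
    have "(sqn M (h k))\<^sup>2 \<le> ((1/4) ^ k)\<^sup>2" by (intro power_mono hk) simp
    then have "4 ^ k * (sqn M (h k))\<^sup>2 \<le> 4 ^ k * ((1/4) ^ k)\<^sup>2" by simp
    also have "\<dots> = (1/4) ^ k"
      by (simp add: power2_eq_square power_one_over)
    finally show "4 ^ k * (sqn M (h k))\<^sup>2 \<le> (1/4) ^ k" .
  qed auto
  also have "\<dots> = ennreal (\<Sum>k. (1/4) ^ k)"
    by (intro suminf_ennreal2) (auto intro: summable_geometric)
  finally have "(\<integral>\<^sup>+x. (\<Sum>k. ennreal (4 ^ k * (norm (h k x))\<^sup>2)) \<partial>M) \<noteq> \<infinity>"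
    by (auto simp: top_unique)
  then have "AE x in M. (\<Sum>k. ennreal (4 ^ k * (norm (h k x))\<^sup>2)) \<noteq> \<infinity>"
    by (intro nn_integral_noteq_infinite) auto
  then have conv: "AE x in M. convergent (\<lambda>k. g k x)"
  proof eventually_elim
    fix x assume fin: "(\<Sum>k. ennreal (4 ^ k * (norm (h k x))\<^sup>2)) \<noteq> \<infinity>"
    define T where "T = enn2real (\<Sum>k. ennreal (4 ^ k * (norm (h k x))\<^sup>2))"
    have T: "T \<ge> 0" "(\<Sum>k. ennreal (4 ^ k * (norm (h k x))\<^sup>2)) = ennreal T"
      unfolding T_def using fin by (simp_all add: less_top)
    have "norm (h k x) \<le> sqrt T * (1/2) ^ k" for k
    proof -
      have "ennreal (4 ^ k * (norm (h k x))\<^sup>2) \<le> ennreal T"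
        using sum_le_suminf[of "\<lambda>k. ennreal (4 ^ k * (norm (h k x))\<^sup>2)" "{k}"] by (simp add: T(2))
      then have "4 ^ k * (norm (h k x))\<^sup>2 \<le> T" using T(1) by (simp add: ennreal_le_iff)
      moreover have four: "(4::real) ^ k = 2 ^ k * 2 ^ k" by (simp flip: power_mult_distrib)
      ultimately have "sqrt ((2 ^ k * norm (h k x))\<^sup>2) \<le> sqrt T"
        using four by (intro real_sqrt_le_mono) (simp add: power_mult_distrib power2_eq_square mult.assoc mult.left_commute)
      then have "2 ^ k * norm (h k x) \<le> sqrt T" by simp
      then show ?thesis by (simp add: field_simps)
    qed
    then have "summable (\<lambda>k. h k x)"
      by (intro summable_comparison_test'[OF summable_mult[OF summable_geometric[of "1/2"]], of 0]) auto
    then have "convergent (\<lambda>n. \<Sum>k<n. h k x)" by (simp add: summable_iff_convergent)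
    then have "convergent (\<lambda>n. g 0 x + (\<Sum>k<n. h k x))"
      by (intro convergent_add convergent_const)
    moreover have "(\<lambda>n. g 0 x + (\<Sum>k<n. h k x)) = (\<lambda>n. g n x)"
      using sum_lessThan_telescope[of "\<lambda>k. g k x"] by (simp add: h_def)
    ultimately show "convergent (\<lambda>k. g k x)" by simp
  qed
  define G where "G x = lim (\<lambda>k. g k x)" for x
  have mG [measurable]: "G \<in> borel_measurable M" unfolding G_def by measurable
  have lim: "AE x in M. (\<lambda>k. g k x) \<longlonglongrightarrow> G x"
    using conv by eventually_elim (simp add: G_def convergent_LIMSEQ_iff)
  \<comment> \<open>Fatou along the selection \<open>g\<close>: closeness of \<open>f n\<close> to
    all later members passes to \<open>G\<close>. Square integrability of \<open>f n - G\<close>,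
    and with it that of \<open>G\<close>, comes out as well.\<close>
  have key: "sqi M (\<lambda>x. f n x - G x) \<and> sqn M (\<lambda>x. f n x - G x) \<le> e"
    if e: "e > 0" and ne: "\<And>m. m \<ge> K \<Longrightarrow> sqn M (\<lambda>x. f n x - f m x) < e" for n e K
  proof -
    have "(\<integral>\<^sup>+x. ennreal ((norm (f n x - G x))\<^sup>2) \<partial>M)
        = (\<integral>\<^sup>+x. liminf (\<lambda>k. ennreal ((norm (f n x - g k x))\<^sup>2)) \<partial>M)"
    proof (rule nn_integral_cong_AE)
      show "AE x in M. ennreal ((norm (f n x - G x))\<^sup>2) = liminf (\<lambda>k. ennreal ((norm (f n x - g k x))\<^sup>2))"
        using lim
      proof eventually_elim
        fix x assume "(\<lambda>k. g k x) \<longlonglongrightarrow> G x"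
        then have "(\<lambda>k. ennreal ((norm (f n x - g k x))\<^sup>2)) \<longlonglongrightarrow> ennreal ((norm (f n x - G x))\<^sup>2)"
          by (intro tendsto_intros)
        then show "ennreal ((norm (f n x - G x))\<^sup>2) = liminf (\<lambda>k. ennreal ((norm (f n x - g k x))\<^sup>2))"
          using lim_imp_Liminf by (metis sequentially_bot)
      qed
    qed
    also have "\<dots> \<le> liminf (\<lambda>k. \<integral>\<^sup>+x. ennreal ((norm (f n x - g k x))\<^sup>2) \<partial>M)"
      by (rule nn_integral_liminf) auto
    also have "\<dots> \<le> ennreal (e\<^sup>2)"
    proof (rule Liminf_le)
      have "(\<integral>\<^sup>+x. ennreal ((norm (f n x - g k x))\<^sup>2) \<partial>M) \<le> ennreal (e\<^sup>2)" if "k \<ge> K" for k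
      proof -
        have "r k \<ge> K" using that by (simp add: r_def)
        then have "sqn M (\<lambda>x. f n x - g k x) < e" unfolding g_def by (rule ne)
        then show ?thesis
          using nn_integral_sqn[OF sqi_diff(1)[OF f sg]] 
          by (auto intro!: ennreal_leI power_mono)
      qed
      then show "\<forall>\<^sub>F k in sequentially. (\<integral>\<^sup>+x. ennreal ((norm (f n x - g k x))\<^sup>2) \<partial>M) \<le> ennreal (e\<^sup>2)"
        using eventually_sequentially by blast
    qed auto
    finally have le: "(\<integral>\<^sup>+x. ennreal ((norm (f n x - G x))\<^sup>2) \<partial>M) \<le> ennreal (e\<^sup>2)" .
    then have "integrable M (\<lambda>x. (norm (f n x - G x))\<^sup>2)"
      by (intro integrableI_bounded) (auto simp: le_less_trans[OF _ ennreal_less_top])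
    then have s: "sqi M (\<lambda>x. f n x - G x)" by (simp add: sqi_def)
    then have "ennreal ((sqn M (\<lambda>x. f n x - G x))\<^sup>2) \<le> ennreal (e\<^sup>2)" using le by (simp add: nn_integral_sqn)
    then have "(sqn M (\<lambda>x. f n x - G x))\<^sup>2 \<le> e\<^sup>2" by (simp add: ennreal_le_iff)
    then have "sqn M (\<lambda>x. f n x - G x) \<le> e" by (rule power2_le_imp_le) (use e in simp)
    then show ?thesis using s by simp
  qed
  obtain K where K: "\<And>m n. m \<ge> K \<Longrightarrow> n \<ge> K \<Longrightarrow> sqn M (\<lambda>x. f m x - f n x) < 1"
    using C[of 1] by auto
  have "sqi M (\<lambda>x. f K x - G x)" using key[of 1 K K] K by simp
  then have "sqi M (\<lambda>x. f K x - (f K x - G x))" by (rule sqi_diff(1)[OF f])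
  then have sG: "sqi M G" by simp
  moreover have "(\<lambda>n. sqn M (\<lambda>x. f n x - G x)) \<longlonglongrightarrow> 0"
  proof (rule LIMSEQ_I)
    fix e :: real assume e: "0 < e"
    then have "e / 2 > 0" by simp
    from C[OF this] obtain L where "\<forall>m\<ge>L. \<forall>n\<ge>L. sqn M (\<lambda>x. f m x - f n x) < e / 2" ..
    then have "norm (sqn M (\<lambda>x. f n x - G x) - 0) < e" if "n \<ge> L" for n
      using key[of "e/2" L n] e that by simp
    then show "\<exists>no. \<forall>n\<ge>no. norm (sqn M (\<lambda>x. f n x - G x) - 0) < e" by blast
  qed
  ultimately show ?thesis by blast
qed

section \<open>Measurability of vector- and matrix-valued functions\<close>

lemma borel_measurable_vec_iff:
  fixes f :: "'a \<Rightarrow> 'b::euclidean_space^'n"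
  shows "f \<in> borel_measurable M \<longleftrightarrow> (\<forall>i. (\<lambda>x. f x $ i) \<in> borel_measurable M)"
proof
  assume f: "f \<in> borel_measurable M"
  have "continuous_on UNIV (\<lambda>y :: 'b^'n. y $ i)" for i by (intro continuous_intros)
  then show "\<forall>i. (\<lambda>x. f x $ i) \<in> borel_measurable M"
    using borel_measurable_continuous_on[OF _ f] by blast
next
  assume f: "\<forall>i. (\<lambda>x. f x $ i) \<in> borel_measurable M"
  show "f \<in> borel_measurable M"
  proof (rule borel_measurable_euclidean_space[THEN iffD2], rule)
    fix b :: "'b^'n" assume "b \<in> Basis"
    then obtain i u where "b = axis i u" unfolding Basis_vec_def by blast
    then have "(\<lambda>x. f x \<bullet> b) = (\<lambda>x. f x $ i \<bullet> u)" by (simp add: inner_axis)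
    then show "(\<lambda>x. f x \<bullet> b) \<in> borel_measurable M" using f by (simp add: borel_measurable_inner)
  qed
qed

lemma borel_measurable_matrix_mult:
  fixes f :: "'a \<Rightarrow> complex^'k^'m" and g :: "'a \<Rightarrow> complex^'n^'k"
  assumes "f \<in> borel_measurable M" "g \<in> borel_measurable M"
  shows "(\<lambda>x. f x ** g x) \<in> borel_measurable M"
  by (rule borel_measurable_continuous_Pair[OF assms]) 
     (intro continuous_on_matrix_mult continuous_intros)

lemma borel_measurable_mult_vec:
  fixes f :: "'a \<Rightarrow> complex^'n^'m" and g :: "'a \<Rightarrow> complex^'n"
  assumes "f \<in> borel_measurable M" "g \<in> borel_measurable M"
  shows "(\<lambda>x. f x *v g x) \<in> borel_measurable M"
  by (rule borel_measurable_continuous_Pair[OF assms]) 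
     (intro continuous_on_mult_vec continuous_intros)

lemma borel_measurable_cdot:
  assumes "f \<in> borel_measurable M" "g \<in> borel_measurable M"
  shows "(\<lambda>x. cdot (f x) (g x)) \<in> borel_measurable M"
  by (rule borel_measurable_continuous_Pair[OF assms]) 
     (intro continuous_on_cdot continuous_intros)

lemma borel_measurable_smult:
  fixes g :: "'a \<Rightarrow> complex^'n"
  assumes "f \<in> borel_measurable M" "g \<in> borel_measurable M"
  shows "(\<lambda>x. f x *s g x) \<in> borel_measurable M"
  using assms unfolding borel_measurable_vec_iff by (auto intro!: borel_measurable_times)

lemma borel_measurable_adj:
  fixes f :: "'a \<Rightarrow> complex^'n^'m"
  assumes "f \<in> borel_measurable M"
  shows "(\<lambda>x. adj (f x)) \<in> borel_measurable M"
  by (rule borel_measurable_continuous_on[OF _ assms]) (unfold adj_def, intro continuous_intros)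

lemma borel_measurable_vconj:
  assumes "f \<in> borel_measurable M"
  shows "(\<lambda>x. vconj (f x)) \<in> borel_measurable M"
  by (rule borel_measurable_continuous_on[OF _ assms]) (unfold vconj_def, intro continuous_intros)

lemma borel_measurable_cscale:
  fixes f :: "'a \<Rightarrow> complex^'n^'m"
  assumes "f \<in> borel_measurable M"
  shows "(\<lambda>x. cscale c (f x)) \<in> borel_measurable M"
  by (rule borel_measurable_continuous_on[OF _ assms]) (unfold cscale_def, intro continuous_intros)

lemma borel_measurable_herm_part:
  fixes f :: "'a \<Rightarrow> complex^'n^'n"
  assumes "f \<in> borel_measurable M"
  shows "(\<lambda>x. herm_part (f x)) \<in> borel_measurable M"
  by (rule borel_measurable_continuous_on[OF _ assms]) (unfold herm_part_def, intro continuous_intros, simp)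

text \<open>By Cramer's rule the entries of the inverse are quotients of determinants, and these are
  polynomials in the entries. In \<open>?N i j\<close> column \<open>i\<close> is replaced by the
  \<open>j\<close>-th unit vector.\<close>

lemma borel_measurable_matrix_inv:
  fixes f :: "'a \<Rightarrow> complex^'n^'n"
  assumes f: "f \<in> borel_measurable M" and inv: "\<And>x. x \<in> space M \<Longrightarrow> invertible (f x)"
  shows "(\<lambda>x. matrix_inv (f x)) \<in> borel_measurable M"
proof -
  let ?N = "\<lambda>i j x. \<chi> k l. if l = i then axis j 1 $ k else f x $ k $ l"
  have det: "(\<lambda>x. det (g x)) \<in> borel_measurable M" if g: "g \<in> borel_measurable M" for g :: "'a \<Rightarrow> complex^'n^'n"
  proof -
    have "(\<lambda>x. g x $ k $ l) \<in> borel_measurable M" for k l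
      using g by (simp add: borel_measurable_vec_iff)
    then show ?thesis unfolding det_def
      by (intro borel_measurable_sum borel_measurable_times borel_measurable_prod borel_measurable_const)
  qed
  have "(\<lambda>x. matrix_inv (f x) $ i $ j) \<in> borel_measurable M" for i j
  proof -
    have "(\<lambda>x. f x $ k $ l) \<in> borel_measurable M" for k l
      using f by (simp add: borel_measurable_vec_iff)
    then have "?N i j \<in> borel_measurable M"
      by (auto simp: borel_measurable_vec_iff)
    then have "(\<lambda>x. det (?N i j x) / det (f x)) \<in> borel_measurable M"
      using f by (intro borel_measurable_divide det)
    moreover have "matrix_inv (f x) $ i $ j = det (?N i j x) / det (f x)" if "x \<in> space M" for x
    proof -
      have "f x ** matrix_inv (f x) = mat 1"
        using someI_ex[OF inv[OF that, unfolded invertible_def]] by (simp add: matrix_inv_def)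
      then have "f x *v (matrix_inv (f x) *v axis j 1) = axis j 1"
        by (simp add: matrix_vector_mul_assoc)
      moreover have "det (f x) \<noteq> 0" using inv[OF that] by (simp add: invertible_det_nz)
      ultimately have "matrix_inv (f x) *v axis j 1
          = (\<chi> i. det (\<chi> k l. if l = i then axis j 1 $ k else f x $ k $ l) / det (f x))"
        by (simp add: cramer)
      then show ?thesis using mult_vec_axis[of "matrix_inv (f x)" j i] by simp
    qed
    ultimately show ?thesis
      by (subst measurable_cong[of M _ "\<lambda>x. det (?N i j x) / det (f x)"])
  qed
  then show ?thesis by (intro borel_measurable_vec_iff[THEN iffD2] allI)
qed

section \<open>Test functions and weak gradients\<close>

text \<open>For \<open>k = 0\<close> this is the standard smooth function that is flat at 0. The
  power of \<open>inverse t\<close> makes the family closed under differentiation up to linear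
  combinations.\<close>

definition bump :: "nat \<Rightarrow> real \<Rightarrow> real" where
  "bump k t = (if 0 < t then exp (- inverse t) * inverse t ^ k else 0)"

lemma bump_tendsto_0: "((\<lambda>t. bump k t) \<longlongrightarrow> 0) (at 0)"
proof (rule filterlim_split_at)
  have "((\<lambda>t. inverse t ^ k / exp (inverse t)) \<longlongrightarrow> (0::real)) (at_right 0)"
    by (rule filterlim_compose[OF tendsto_power_div_exp_0 filterlim_inverse_at_top_right])
  moreover have "\<forall>\<^sub>F t in at_right 0. inverse t ^ k / exp (inverse t) = bump k t"
    by (auto simp: eventually_at_filter bump_def exp_minus field_simps)
  ultimately show "((\<lambda>t. bump k t) \<longlongrightarrow> 0) (at_right 0)" by (rule Lim_transform_eventually)
  have "\<forall>\<^sub>F t in at_left 0. 0 = bump k t"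
    by (auto simp: eventually_at_filter bump_def)
  then show "((\<lambda>t. bump k t) \<longlongrightarrow> 0) (at_left 0)"
    by (rule Lim_transform_eventually[OF tendsto_const])
qed

lemma bump_has_derivative:
  "(bump k has_real_derivative bump (k + 2) t - real k * bump (k + 1) t) (at t)"
proof -
  consider "t > 0" | "t < 0" | "t = 0" by linarith
  then show ?thesis
  proof cases
    case 1
    have pw: "inverse t ^ (k + 2) = inverse t ^ k * (inverse t)\<^sup>2" "inverse t ^ (k + 1) = inverse t ^ k * inverse t"
      by (simp_all add: power_add power2_eq_square)
    have kk: "real k * inverse t ^ (k - Suc 0) * (inverse t)\<^sup>2 = real k * (inverse t ^ k * inverse t)"
      by (cases k) (auto simp: power2_eq_square)
    have "((\<lambda>t. exp (- inverse t) * inverse t ^ k) has_real_derivative bump (k + 2) t - real k * bump (k + 1) t) (at t)"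
      using 1 kk by (auto intro!: derivative_eq_intros simp: bump_def pw power2_eq_square algebra_simps)
    then show ?thesis
    proof (rule DERIV_cong_ev[THEN iffD1, rotated 3])
      show "\<forall>\<^sub>F x in nhds t. exp (- inverse x) * inverse x ^ k = bump k x"
        using eventually_nhds_in_open[of "{0<..}" t] 1 by (auto simp: bump_def elim!: eventually_mono)
    qed auto
  next
    case 2
    have "((\<lambda>t. 0) has_real_derivative bump (k + 2) t - real k * bump (k + 1) t) (at t)"
      using 2 by (simp add: bump_def)
    then show ?thesis
    proof (rule DERIV_cong_ev[THEN iffD1, rotated 3])
      show "\<forall>\<^sub>F x in nhds t. 0 = bump k x"
        using eventually_nhds_in_open[of "{..<0}" t] 2 by (auto simp: bump_def elim!: eventually_mono)
    qed auto
  next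
    case 3
    \<comment> \<open>Dividing by \<open>y\<close> raises the exponent by one, so the difference
      quotient at 0 is again a member of the family and tends to 0.\<close>
    have "(\<lambda>y. (bump k y - bump k 0) / (y - 0)) = bump (Suc k)"
      by (auto simp: bump_def fun_eq_iff field_simps)
    moreover have "bump j 0 = 0" for j by (simp add: bump_def)
    ultimately show ?thesis using bump_tendsto_0[of "Suc k"] 3
      by (simp add: has_field_derivative_iff)
  qed
qed

text \<open>The algebra generated by bumps in single coordinates. It consists of differentiable
  functions and is stable under partial derivatives, so membership alone gives smoothness of all
  orders.\<close>

inductive_set bump_algebra :: "(real^'n \<Rightarrow> complex) set" where
  const: "(\<lambda>x. c) \<in> bump_algebra"
| base: "(\<lambda>x. complex_of_real (bump k (\<alpha> * x $ i + \<beta>))) \<in> bump_algebra"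
| add: "f \<in> bump_algebra \<Longrightarrow> g \<in> bump_algebra \<Longrightarrow> (\<lambda>x. f x + g x) \<in> bump_algebra"
| mult: "f \<in> bump_algebra \<Longrightarrow> g \<in> bump_algebra \<Longrightarrow> (\<lambda>x. f x * g x) \<in> bump_algebra"

lemma partial_eq:
  assumes "\<And>x. (f has_derivative f' x) (at x)"
  shows "partial k f = (\<lambda>x. f' x (axis k 1))"
  using frechet_derivative_at[OF assms] by (simp add: partial_def fun_eq_iff)

lemma bump_algebra_partial:
  "f \<in> (bump_algebra :: (real^'n \<Rightarrow> complex) set) \<Longrightarrow> (\<forall>x. f differentiable (at x)) \<and> (\<forall>k. partial k f \<in> bump_algebra)"
proof (induction rule: bump_algebra.induct)
  case (const c)
  have "((\<lambda>x. c) has_derivative (\<lambda>h. 0)) (at x)" for x :: "real^'n" by simp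
  from partial_eq[OF this] show ?case
    by (auto intro: bump_algebra.const)
next
  case (base k \<alpha> i \<beta>)
  have d: "((\<lambda>x. complex_of_real (bump k (\<alpha> * x $ i + \<beta>))) has_derivative
     (\<lambda>h. of_real ((\<alpha> * h $ i) * (bump (k + 2) (\<alpha> * x $ i + \<beta>) - real k * bump (k + 1) (\<alpha> * x $ i + \<beta>))))) (at x)" 
    for x :: "real^'n"
  proof -
    have "((\<lambda>x::real^'n. x $ i) has_derivative (\<lambda>h. h $ i)) (at x)"
      by (intro bounded_linear_imp_has_derivative bounded_linear_vec_nth)
    then have "((\<lambda>x::real^'n. \<alpha> * x $ i + \<beta>) has_derivative (\<lambda>h. \<alpha> * h $ i)) (at x)"
      by (auto intro!: derivative_eq_intros)
    from has_derivative_compose[OF this bump_has_derivative[of k "\<alpha> * x $ i + \<beta>", unfolded has_field_derivative_def]]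
    have "((\<lambda>x. bump k (\<alpha> * x $ i + \<beta>)) has_derivative
       (\<lambda>h. (\<alpha> * h $ i) * (bump (k + 2) (\<alpha> * x $ i + \<beta>) - real k * bump (k + 1) (\<alpha> * x $ i + \<beta>)))) (at x)"
      by (simp add: mult.commute)
    then show ?thesis by (rule has_derivative_of_real)
  qed
  have "partial j (\<lambda>x. complex_of_real (bump k (\<alpha> * x $ i + \<beta>)))
      = (\<lambda>x. complex_of_real (\<alpha> * axis j 1 $ i) * (of_real (bump (k + 2) (\<alpha> * x $ i + \<beta>))
           + of_real (- real k) * of_real (bump (k + 1) (\<alpha> * x $ i + \<beta>))))" for j
    unfolding partial_eq[OF d] by (simp add: fun_eq_iff)
  moreover have "\<dots> j \<in> bump_algebra" for j
    by (intro bump_algebra.intros)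
  ultimately show ?case using d by (auto simp: differentiable_def)
next
  case (add f g)
  then have d: "(f has_derivative frechet_derivative f (at x)) (at x)"
      "(g has_derivative frechet_derivative g (at x)) (at x)" for x
    by (auto simp: frechet_derivative_works)
  have "partial k (\<lambda>x. f x + g x) = (\<lambda>x. partial k f x + partial k g x)" for k
    unfolding partial_eq[OF has_derivative_add[OF d]] by (simp add: partial_def)
  then show ?case using add by (auto intro: bump_algebra.intros)
next
  case (mult f g)
  then have d: "(f has_derivative frechet_derivative f (at x)) (at x)"
      "(g has_derivative frechet_derivative g (at x)) (at x)" for x
    by (auto simp: frechet_derivative_works)
  have "partial k (\<lambda>x. f x * g x) = (\<lambda>x. f x * partial k g x + partial k f x * g x)" for k
    unfolding partial_eq[OF has_derivative_mult[OF d]] by (simp add: partial_def)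
  moreover have "(\<lambda>x. f x * partial k g x + partial k f x * g x) \<in> bump_algebra" for k
    using mult by (intro bump_algebra.add bump_algebra.mult) auto
  ultimately show ?case using mult by auto
qed

lemma bump_algebra_smooth: "f \<in> bump_algebra \<Longrightarrow> smooth f"
proof -
  assume f: "f \<in> bump_algebra"
  have "iter_partial ks f \<in> bump_algebra" for ks
    by (induction ks) (auto simp: f bump_algebra_partial)
  then show ?thesis unfolding smooth_def using bump_algebra_partial by blast
qed

text \<open>Products over the coordinates of the flat function of the distances to the two faces,
  with the argument stretched by \<open>Suc m\<close>. For growing \<open>m\<close> each factor
  tends to 1 inside the box while the support stays in the closed box; the uniform bound is meant
  for dominated convergence.\<close>

lemma box_cutoff_exists:
  fixes a b :: "real^'n"
  assumes ab: "cbox a b \<subseteq> \<Omega>"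
  shows "\<exists>\<phi>. (\<forall>m::nat. test_fn \<Omega> (\<phi> m) \<and> (\<forall>x. cmod (\<phi> m x) \<le> 1) \<and> (\<forall>x. x \<notin> box a b \<longrightarrow> \<phi> m x = 0)) \<and>
     (\<forall>x. (\<lambda>m. \<phi> m x) \<longlonglongrightarrow> indicator (box a b) x)"
proof -
  define \<beta> where "\<beta> m s = bump 0 (real (Suc m) * s)" for m s
  have \<beta>0: "\<beta> m s = 0" if "s \<le> 0" for m s using that by (simp add: \<beta>_def bump_def mult_le_0_iff not_less)
  have \<beta>1: "0 \<le> \<beta> m s" "\<beta> m s \<le> 1" for m s
    unfolding \<beta>_def by (auto simp: bump_def simp del: inverse_mult_distrib of_nat_Suc)
  have \<beta>lim: "(\<lambda>m. \<beta> m s) \<longlonglongrightarrow> 1" if "s > 0" for s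
  proof -
    have "(\<lambda>m. exp (- (inverse (real (Suc m)) * inverse s))) \<longlonglongrightarrow> exp (- (0 * inverse s))"
      by (intro tendsto_intros LIMSEQ_inverse_real_of_nat)
    moreover have "\<beta> m s = exp (- (inverse (real (Suc m)) * inverse s))" for m
      using that by (simp add: \<beta>_def bump_def inverse_mult_distrib del: of_nat_Suc)
    ultimately show ?thesis by simp
  qed
  define \<phi> where "\<phi> m x = (\<Prod>i\<in>UNIV. complex_of_real (\<beta> m (x $ i - a $ i)) * complex_of_real (\<beta> m (b $ i - x $ i)))"
    for m and x :: "real^'n"
  have out: "\<phi> m x = 0" if "x \<notin> box a b" for m x
  proof -
    have "\<exists>i. \<not> (a $ i < x $ i \<and> x $ i < b $ i)" using that by (simp add: mem_box_cart)
    then obtain i where "x $ i \<le> a $ i \<or> b $ i \<le> x $ i" using not_less by blast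
    then have "complex_of_real (\<beta> m (x $ i - a $ i)) * complex_of_real (\<beta> m (b $ i - x $ i)) = 0"
      by (auto simp: \<beta>0)
    then show ?thesis unfolding \<phi>_def by (meson UNIV_I finite prod_zero)
  qed
  have "(\<lambda>x. \<Prod>i\<in>I. complex_of_real (\<beta> m (x $ i - a $ i)) * complex_of_real (\<beta> m (b $ i - x $ i)))
      \<in> bump_algebra" if "finite I" for m I
    using that
  proof (induction I rule: finite_induct)
    case empty
    then show ?case by (simp add: bump_algebra.const)
  next
    case (insert i I)
    have 1: "(\<lambda>x. complex_of_real (\<beta> m (x $ i - a $ i))) \<in> bump_algebra"
      using bump_algebra.base[of 0 "real (Suc m)" i "- real (Suc m) * a $ i"]
      by (simp add: \<beta>_def algebra_simps)
    have 2: "(\<lambda>x. complex_of_real (\<beta> m (b $ i - x $ i))) \<in> bump_algebra"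
      using bump_algebra.base[of 0 "- real (Suc m)" i "real (Suc m) * b $ i"]
      by (simp add: \<beta>_def algebra_simps)
    show ?case using insert bump_algebra.mult[OF bump_algebra.mult[OF 1 2] insert.IH] by simp
  qed
  then have "smooth (\<phi> m)" for m
    unfolding \<phi>_def by (intro bump_algebra_smooth) simp
  moreover have "{x. \<phi> m x \<noteq> 0} \<subseteq> cbox a b" for m using out box_subset_cbox by blast
  then have ts: "tsupp (\<phi> m) \<subseteq> cbox a b" for m
    unfolding tsupp_def by (intro closure_minimal) auto
  moreover have "compact (tsupp (\<phi> m))" for m
    using ts compact_cbox by (metis bounded_subset bounded_cbox closed_closure compact_eq_bounded_closed tsupp_def)
  ultimately have "test_fn \<Omega> (\<phi> m)" for m
    unfolding test_fn_def using ab by (meson order_trans)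
  moreover have "cmod (\<phi> m x) \<le> 1" for m x
    unfolding \<phi>_def norm_mult prod_norm[symmetric]
    by (intro prod_le_1) (auto simp: \<beta>1 mult_le_one)
  moreover have "(\<lambda>m. \<phi> m x) \<longlonglongrightarrow> indicator (box a b) x" for x
  proof (cases "x \<in> box a b")
    case True
    then have "x $ i - a $ i > 0" "b $ i - x $ i > 0" for i by (auto simp: mem_box_cart)
    then have "(\<lambda>m. \<phi> m x) \<longlonglongrightarrow> (\<Prod>i\<in>(UNIV :: 'n set). complex_of_real 1 * complex_of_real 1)"
      unfolding \<phi>_def by (intro tendsto_intros \<beta>lim)
    then show ?thesis using True by simp
  qed (simp add: out)
  ultimately show ?thesis using out by (intro exI[of _ \<phi>]) blast
qed

section \<open>The du Bois-Reymond lemma and weak gradients\<close>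

text \<open>Dynkin's argument: open boxes are stable under intersection and generate the Borel sets.
  The vanishing total integral is what handles complements.\<close>

lemma integral_boxes_zero_imp_AE_zero:
  fixes g :: "'a::euclidean_space \<Rightarrow> real"
  assumes g: "integrable lebesgue g" and tot: "(LINT x|lebesgue. g x) = 0"
    and box: "\<And>c d. (LINT x|lebesgue. indicator (box c d) x * g x) = 0"
  shows "AE x in lebesgue. g x = 0"
proof -
  have mg: "g \<in> borel_measurable lebesgue" using g by simp
  let ?G = "range (\<lambda> (a, b). box a b :: 'a set)"
  have sb: "sets (borel :: 'a measure) = sigma_sets UNIV ?G"
    by (subst borel_eq_box) simp
  have intA: "integrable lebesgue (\<lambda>x. indicator A x * g x)" if "A \<in> sets lebesgue" for A
    using integrable_mult_indicator[OF that g] by simp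
  have z: "(LINT x|lebesgue. indicator A x * g x) = 0" if "A \<in> sets borel" for A
  proof -
    have "Int_stable ?G"
      by (auto simp: Int_stable_def box_Int_box)
    then show ?thesis
      using subset_UNIV[of ?G, folded Pow_UNIV] that[unfolded sb]
    proof (induction rule: sigma_sets_induct_disjoint)
      case (basic A)
      then show ?case using box by auto
    next
      case empty
      then show ?case by simp
    next
      case (compl A)
      have A: "A \<in> sets lebesgue" using compl(1) unfolding sb[symmetric] by simp
      have "(LINT x|lebesgue. indicator (UNIV - A) x * g x) = (LINT x|lebesgue. g x - indicator A x * g x)"
        by (rule Bochner_Integration.integral_cong) (auto simp: indicator_def)
      also have "\<dots> = 0" using intA[OF A] g compl tot by simp
      finally show ?case .
    next
      case (union A)
      have A: "A i \<in> sets lebesgue" for i using union(2) unfolding sb[symmetric] by auto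
      have "(LINT x:(\<Union>i. A i)|lebesgue. g x) = (\<Sum>i. LINT x:A i|lebesgue. g x)"
        using A union(1) intA[of "\<Union>i. A i"]
        by (intro lebesgue_integral_countable_add) (auto simp: disjoint_family_on_def set_integrable_def)
      then show ?case using union(3) by (simp add: set_lebesgue_integral_def)
    qed
  qed
  \<comment> \<open>Integrals vanish over Borel sets, while \<open>g\<close> is only Lebesgue
    measurable; its sign sets are therefore taken from a Borel version.\<close>
  obtain g' where g': "g' \<in> borel_measurable lborel" and ae: "AE x in lborel. g x = g' x"
    using completion_ex_borel_measurable_real[OF mg] by blast
  have ae': "AE x in lebesgue. g x = g' x" using ae by (rule AE_completion)
  have half: "AE x in lebesgue. max 0 (s * g x) = 0" if s: "s = 1 \<or> s = -1" for s :: real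
  proof -
    let ?A = "{x. s * g' x > 0}"
    have A: "?A \<in> sets borel" using g' by simp
    then have AL: "?A \<in> sets lebesgue" by simp
    have "(LINT x|lebesgue. max 0 (s * g x)) = (LINT x|lebesgue. s * (indicator ?A x * g x))"
      using mg intA[OF AL] ae'
      by (intro integral_cong_AE) (auto elim!: eventually_mono simp: indicator_def max_def)
    also have "\<dots> = 0" using z[OF A] by simp
    finally have "(LINT x|lebesgue. max 0 (s * g x)) = 0" .
    moreover have "integrable lebesgue (\<lambda>x. max 0 (s * g x))"
      using g by (intro Bochner_Integration.integrable_max) auto
    ultimately show ?thesis by (subst (asm) integral_nonneg_eq_0_iff_AE) auto
  qed
  have "AE x in lebesgue. max 0 (1 * g x) = 0" "AE x in lebesgue. max 0 ((-1) * g x) = 0"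
    using half[of 1] half[of "-1"] by auto
  then show ?thesis by eventually_elim (auto simp: max_def split: if_splits)
qed

text \<open>Local integrability speaks of compact sets. The bounded factor vanishes off one of them,
  which extends integrability to all of \<Omega>.\<close>

lemma L1loc_mult_integrable:
  fixes \<Omega> K :: "(real^'n) set"
  assumes \<Omega>: "open \<Omega>" and g: "L1loc \<Omega> g" and K: "compact K" "K \<subseteq> \<Omega>"
    and \<psi>: "\<psi> \<in> borel_measurable borel" "\<And>x. cmod (\<psi> x) \<le> c" and out: "\<And>x. x \<notin> K \<Longrightarrow> \<psi> x = 0"
  shows "integrable (lebesgue_on \<Omega>) (\<lambda>x. g x * \<psi> x)"
proof -
  have gK: "integrable (lebesgue_on K) g" using g K by (simp add: L1loc_def)
  have "\<psi> \<in> borel_measurable (lebesgue_on K)"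
    using \<psi>(1) by (simp add: measurable_restrict_space1 measurable_completion)
  moreover have "c \<ge> 0" using \<psi>(2)[of undefined] norm_ge_zero order_trans by blast
  then have "norm (g x * \<psi> x) \<le> norm (norm (g x) * c)" for x
    using \<psi>(2)[of x] by (simp add: norm_mult mult_left_mono)
  moreover have "integrable (lebesgue_on K) (\<lambda>x. norm (g x) * c)" using gK by simp
  moreover have "g \<in> borel_measurable (lebesgue_on K)" using gK by simp
  ultimately have "integrable (lebesgue_on K) (\<lambda>x. g x * \<psi> x)"
    by (blast intro: Bochner_Integration.integrable_bound[OF _ borel_measurable_times AE_I2])
  moreover have "K \<in> sets lebesgue" using K(1) by (simp add: compact_imp_closed)
  moreover have "(\<lambda>x. indicator \<Omega> x *\<^sub>R (g x * \<psi> x)) = (\<lambda>x. indicator K x *\<^sub>R (g x * \<psi> x))"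
    using K(2) out by (auto simp: indicator_def fun_eq_iff)
  ultimately show ?thesis using \<Omega> by (simp add: integrable_restrict_space borel_open)
qed

lemma test_fn_borel: "test_fn \<Omega> \<phi> \<Longrightarrow> \<phi> \<in> borel_measurable borel" "test_fn \<Omega> \<phi> \<Longrightarrow> continuous_on UNIV \<phi>"
proof -
  assume "test_fn \<Omega> \<phi>"
  then have "iter_partial [] \<phi> differentiable (at x)" for x by (simp only: test_fn_def smooth_def)
  then show c: "continuous_on UNIV \<phi>"
    by (auto intro!: continuous_at_imp_continuous_on differentiable_imp_continuous_within)
  then show "\<phi> \<in> borel_measurable borel" by (rule borel_measurable_continuous_onI)
qed

text \<open>Cutoffs turn the hypothesis into vanishing integrals over all boxes whose closed box
  lies in \<Omega>. This settles the question on each such box, where \<open>f\<close> is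
  integrable, and countably many of them cover \<Omega>.\<close>

lemma du_Bois_Reymond:
  fixes \<Omega> :: "(real^'n) set"
  assumes \<Omega>: "open \<Omega>" and f: "L1loc \<Omega> f"
    and z: "\<And>\<phi>. test_fn \<Omega> \<phi> \<Longrightarrow> (LINT x|lebesgue_on \<Omega>. f x * \<phi> x) = 0"
  shows "AE x in lebesgue_on \<Omega>. f x = 0"
proof -
  have \<Omega>L: "\<Omega> \<in> sets lebesgue" using \<Omega> by (simp add: borel_open)
  have bx: "(LINT x|lebesgue. indicator (box a b) x *\<^sub>R f x) = 0" if ab: "cbox a b \<subseteq> \<Omega>" for a b
  proof -
    obtain \<phi> where \<phi>: "\<And>m. test_fn \<Omega> (\<phi> m)" "\<And>m x. cmod (\<phi> m x) \<le> 1"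
      "\<And>m x. x \<notin> box a b \<Longrightarrow> \<phi> m x = 0" "\<And>x. (\<lambda>m::nat. \<phi> m x) \<longlonglongrightarrow> indicator (box a b) x"
      using box_cutoff_exists[OF ab] by blast
    have out: "\<phi> m x = 0" if "x \<notin> cbox a b" for m x using \<phi>(3) that box_subset_cbox by blast
    have ind: "(indicator (box a b) :: real^'n \<Rightarrow> complex) \<in> borel_measurable borel"
      by simp
    have i1: "integrable (lebesgue_on \<Omega>) (\<lambda>x. f x * indicator (box a b) x)"
      by (rule L1loc_mult_integrable[OF \<Omega> f compact_cbox ab ind, of 1])
         (use box_subset_cbox in \<open>auto simp: indicator_def\<close>)
    have i2: "integrable (lebesgue_on \<Omega>) (\<lambda>x. f x * \<phi> m x)" for m
      by (rule L1loc_mult_integrable[OF \<Omega> f compact_cbox ab test_fn_borel(1)[OF \<phi>(1)] \<phi>(2) out])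
    have "(\<lambda>m. LINT x|lebesgue_on \<Omega>. f x * \<phi> m x) \<longlonglongrightarrow> (LINT x|lebesgue_on \<Omega>. f x * indicator (box a b) x)"
    proof (rule integral_dominated_convergence[where w = "\<lambda>x. norm (f x * indicator (box a b) x)"])
      show "AE x in lebesgue_on \<Omega>. (\<lambda>m. f x * \<phi> m x) \<longlonglongrightarrow> f x * indicator (box a b) x"
        using \<phi>(4) by (intro AE_I2 tendsto_intros)
      show "AE x in lebesgue_on \<Omega>. norm (f x * \<phi> m x) \<le> norm (f x * indicator (box a b) x)" for m
        using \<phi>(2,3) by (intro AE_I2) (auto simp: norm_mult indicator_def mult_left_le)
    qed (use i1 i2 in auto)
    then have "(LINT x|lebesgue_on \<Omega>. f x * indicator (box a b) x) = 0"
      using z[OF \<phi>(1)] by (simp add: LIMSEQ_const_iff)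
    also have "(LINT x|lebesgue_on \<Omega>. f x * indicator (box a b) x)
        = (LINT x|lebesgue. indicator \<Omega> x *\<^sub>R (f x * indicator (box a b) x))"
      using \<Omega>L by (subst integral_restrict_space) auto
    also have "(\<lambda>x. indicator \<Omega> x *\<^sub>R (f x * indicator (box a b) x)) = (\<lambda>x. indicator (box a b) x *\<^sub>R f x)"
      using ab box_subset_cbox[of a b] by (auto simp: indicator_def fun_eq_iff)
    finally show ?thesis .
  qed
  have loc: "AE x in lebesgue. x \<in> box a b \<longrightarrow> f x = 0" if ab: "cbox a b \<subseteq> \<Omega>" for a b
  proof -
    have "integrable (lebesgue_on (cbox a b)) f" using f ab by (simp add: L1loc_def)
    then have "integrable lebesgue (\<lambda>x. indicator (cbox a b) x *\<^sub>R f x)"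
      by (simp add: integrable_restrict_space)
    then have "integrable lebesgue (\<lambda>x. indicator (box a b) x *\<^sub>R (indicator (cbox a b) x *\<^sub>R f x))"
      by (rule integrable_mult_indicator[rotated]) simp
    moreover have "(\<lambda>x. indicator (box a b) x *\<^sub>R (indicator (cbox a b) x *\<^sub>R f x)) = (\<lambda>x. indicator (box a b) x *\<^sub>R f x)"
      using box_subset_cbox[of a b] by (auto simp: indicator_def fun_eq_iff)
    ultimately have i: "integrable lebesgue (\<lambda>x. indicator (box a b) x *\<^sub>R f x)" by simp
    \<comment> \<open>An intersection of boxes is a box \<open>box p q\<close>. If it is nonempty,
      \<open>cbox p q\<close> is its closure and stays in \<open>cbox a b\<close>; an empty open box
      says nothing about \<open>cbox p q\<close> and is treated separately.\<close>
    have sub: "(LINT x|lebesgue. indicator (box c d) x *\<^sub>R (indicator (box a b) x *\<^sub>R f x)) = 0" for c d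
    proof -
      obtain p q where pq: "box c d \<inter> box a b = box p q" by (rule that[OF box_Int_box])
      have e: "(\<lambda>x. indicator (box c d) x *\<^sub>R (indicator (box a b) x *\<^sub>R f x)) = (\<lambda>x. indicator (box p q) x *\<^sub>R f x)"
        by (auto simp: pq[symmetric] indicator_def fun_eq_iff)
      show ?thesis
      proof (cases "box p q = {}")
        case False
        then have "cbox p q = closure (box c d \<inter> box a b)" using pq by simp
        also have "\<dots> \<subseteq> cbox a b"
          by (intro closure_minimal) (use box_subset_cbox[of a b] in auto)
        finally show ?thesis unfolding e using bx ab by blast
      next
        case True
        then show ?thesis unfolding e by simp
      qed
    qed
    have part: "AE x in lebesgue. L (indicator (box a b) x *\<^sub>R f x) = 0" if L: "bounded_linear L" for L :: "complex \<Rightarrow> real"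
    proof (rule integral_boxes_zero_imp_AE_zero)
      show "integrable lebesgue (\<lambda>x. L (indicator (box a b) x *\<^sub>R f x))"
        by (rule integrable_bounded_linear[OF L i])
      show "(LINT x|lebesgue. L (indicator (box a b) x *\<^sub>R f x)) = 0"
        using integral_bounded_linear[OF L i] bx[OF ab] by (simp add: linear_0[OF bounded_linear.linear[OF L]])
      fix c d
      have ic: "integrable lebesgue (\<lambda>x. indicator (box c d) x *\<^sub>R (indicator (box a b) x *\<^sub>R f x))"
        by (rule integrable_mult_indicator[OF _ i]) simp
      have "(LINT x|lebesgue. indicator (box c d) x * L (indicator (box a b) x *\<^sub>R f x))
          = (LINT x|lebesgue. L (indicator (box c d) x *\<^sub>R (indicator (box a b) x *\<^sub>R f x)))"
        by (rule Bochner_Integration.integral_cong)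
           (simp_all only: linear_scale[OF bounded_linear.linear[OF L]] real_scaleR_def)
      also have "\<dots> = 0"
        by (simp only: integral_bounded_linear[OF L ic] sub linear_0[OF bounded_linear.linear[OF L]])
      finally show "(LINT x|lebesgue. indicator (box c d) x * L (indicator (box a b) x *\<^sub>R f x)) = 0" .
    qed
    show ?thesis
      using part[OF bounded_linear_Re] part[OF bounded_linear_Im]
      by eventually_elim (simp add: complex_eq_iff indicator_def)
  qed
  define F where "F = {S. \<exists>a b. S = box a b \<and> cbox a b \<subseteq> \<Omega>}"
  obtain F' where F': "F' \<subseteq> F" "countable F'" "\<Union>F' = \<Union>F"
  proof (rule Lindelof)
    show "open S" if "S \<in> F" for S using that open_box by (auto simp: F_def)
  qed
  have "\<Omega> \<subseteq> \<Union>F"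
  proof
    fix x assume "x \<in> \<Omega>"
    then obtain a b where "cbox a b \<subseteq> \<Omega>" "x \<in> box a b"
      using open_contains_cbox[OF \<Omega>] by metis
    then show "x \<in> \<Union>F" by (auto simp: F_def)
  qed
  then have cov: "\<Omega> \<subseteq> \<Union>F'" using F'(3) by simp
  have "AE x in lebesgue. \<forall>S\<in>F'. x \<in> S \<longrightarrow> f x = 0"
  proof (subst AE_ball_countable[OF F'(2)], rule)
    fix S assume "S \<in> F'"
    then obtain a b where "S = box a b" "cbox a b \<subseteq> \<Omega>" using F'(1) by (auto simp: F_def)
    then show "AE x in lebesgue. x \<in> S \<longrightarrow> f x = 0" using loc by simp
  qed
  then have "AE x in lebesgue. x \<in> \<Omega> \<longrightarrow> f x = 0"
  proof eventually_elim
    case (elim x)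
    then show ?case using cov by blast
  qed
  then show ?thesis using \<Omega>L by (simp add: AE_restrict_space_iff)
qed

text \<open>On a compact set the constant 1 is integrable, and \<open>|u|\<close> is at most
  \<open>1 + |u|^2\<close>.\<close>

lemma L2_L1loc:
  fixes \<Omega> :: "(real^'n) set"
  assumes \<Omega>: "open \<Omega>" and u: "L2 \<Omega> u"
  shows "L1loc \<Omega> u"
  unfolding L1loc_def
proof (intro conjI allI impI)
  show "u \<in> borel_measurable (lebesgue_on \<Omega>)" using u by (simp add: L2_def)
  fix K assume K: "compact K \<and> K \<subseteq> \<Omega>"
  have KL: "K \<in> sets lebesgue" using K by (simp add: compact_imp_closed)
  have \<Omega>L: "\<Omega> \<in> sets lebesgue" using \<Omega> by (simp add: borel_open)
  have mu: "u \<in> borel_measurable (lebesgue_on K)"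
    using u K by (auto simp: L2_def intro: measurable_restrict_mono)
  have "integrable lebesgue (\<lambda>x. indicator \<Omega> x *\<^sub>R (cmod (u x))\<^sup>2)"
    using u \<Omega>L by (simp add: L2_def integrable_restrict_space)
  then have "integrable lebesgue (\<lambda>x. indicator K x *\<^sub>R (indicator \<Omega> x *\<^sub>R (cmod (u x))\<^sup>2))"
    by (rule integrable_mult_indicator[OF KL])
  moreover have "(\<lambda>x. indicator K x *\<^sub>R (indicator \<Omega> x *\<^sub>R (cmod (u x))\<^sup>2)) = (\<lambda>x. indicator K x *\<^sub>R (cmod (u x))\<^sup>2)"
    using K by (auto simp: indicator_def fun_eq_iff)
  ultimately have i: "integrable (lebesgue_on K) (\<lambda>x. (cmod (u x))\<^sup>2)"
    using KL by (simp add: integrable_restrict_space)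
  have "integrable (lebesgue_on K) (\<lambda>x. 1 :: real)"
    using K KL fmeasurableD2[OF lmeasurable_compact[of K]]
    by (simp add: integrable_restrict_space integrable_real_indicator less_top)
  then have "integrable (lebesgue_on K) (\<lambda>x. 1 + (cmod (u x))\<^sup>2)" using i by simp
  moreover have "cmod (u x) \<le> 1 + (cmod (u x))\<^sup>2" for x
  proof -
    have "2 * cmod (u x) \<le> 1 + (cmod (u x))\<^sup>2" using sum_squares_bound[of 1 "cmod (u x)"] by simp
    moreover have "0 \<le> cmod (u x)" by simp
    ultimately show ?thesis by linarith
  qed
  then have "norm (u x) \<le> norm (1 + (cmod (u x))\<^sup>2)" for x
    using abs_ge_self order_trans by (metis real_norm_def)
  ultimately show "integrable (lebesgue_on K) u"
    using mu by (blast intro: Bochner_Integration.integrable_bound[OF _ _ AE_I2])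
qed

lemma test_fn_partial:
  assumes "test_fn \<Omega> \<phi>"
  shows "continuous_on UNIV (partial k \<phi>)" "\<And>x. x \<notin> tsupp \<phi> \<Longrightarrow> partial k \<phi> x = 0"
proof -
  have "iter_partial [k] \<phi> differentiable (at x)" for x using assms unfolding test_fn_def smooth_def by blast
  then show "continuous_on UNIV (partial k \<phi>)"
    by (auto intro!: continuous_at_imp_continuous_on differentiable_imp_continuous_within)
  fix x assume x: "x \<notin> tsupp \<phi>"
  have "open (- tsupp \<phi>)" by (simp add: tsupp_def open_Compl)
  then have "(\<phi> has_derivative (\<lambda>h. 0)) (at x)"
  proof (rule has_derivative_transform_within_open[of "\<lambda>x. 0", rotated])
    show "\<And>y. y \<in> - tsupp \<phi> \<Longrightarrow> 0 = \<phi> y" using closure_subset by (force simp: tsupp_def)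
  qed (use x in auto)
  then show "partial k \<phi> x = 0" by (simp add: partial_def frechet_derivative_at[symmetric])
qed

lemma compact_support_bounded:
  fixes \<psi> :: "'a::metric_space \<Rightarrow> complex"
  assumes "continuous_on UNIV \<psi>" "compact K" "\<And>x. x \<notin> K \<Longrightarrow> \<psi> x = 0"
  shows "\<exists>c. \<forall>x. cmod (\<psi> x) \<le> c"
proof -
  have "bounded (\<psi> ` K)"
    using assms by (intro compact_imp_bounded compact_continuous_image) (auto intro: continuous_on_subset)
  then obtain c where c: "\<And>x. x \<in> K \<Longrightarrow> cmod (\<psi> x) \<le> c" by (auto simp: bounded_iff)
  have "cmod (\<psi> x) \<le> max c 0" for x
    using c[of x] assms(3)[of x] by (cases "x \<in> K") auto
  then show ?thesis by blast
qed

text \<open>A weak gradient is determined only up to null sets, and \<open>K\<close> is given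
  independently of \<open>G\<close> and \<open>H\<close>. Each component of the difference
  integrates to zero against all test functions.\<close>

lemma weak_grad_linear:
  fixes \<Omega> :: "(real^'n) set"
  assumes \<Omega>: "open \<Omega>" and u: "L2 \<Omega> u" and v: "L2 \<Omega> v"
    and G: "weak_grad \<Omega> u G" and H: "weak_grad \<Omega> v H"
    and K: "weak_grad \<Omega> (\<lambda>x. u x + c * v x) K"
  shows "AE x in lebesgue_on \<Omega>. K x = G x + c *s H x"
proof -
  have comp: "AE x in lebesgue_on \<Omega>. K x $ k - (G x $ k + c * H x $ k) = 0" for k
  proof (rule du_Bois_Reymond[OF \<Omega>])
    have gk: "L1loc \<Omega> (\<lambda>x. G x $ k)" and hk: "L1loc \<Omega> (\<lambda>x. H x $ k)" and kk: "L1loc \<Omega> (\<lambda>x. K x $ k)"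
      using G H K by (auto simp: weak_grad_def)
    then show "L1loc \<Omega> (\<lambda>x. K x $ k - (G x $ k + c * H x $ k))"
      by (auto simp: L1loc_def)
    fix \<phi> assume \<phi>: "test_fn \<Omega> \<phi>"
    have cs: "compact (tsupp \<phi>)" "tsupp \<phi> \<subseteq> \<Omega>" using \<phi> by (auto simp: test_fn_def)
    have out: "\<phi> x = 0" if "x \<notin> tsupp \<phi>" for x
      using that closure_subset by (force simp: tsupp_def)
    obtain m where m: "\<And>x. cmod (\<phi> x) \<le> m"
      using compact_support_bounded[OF test_fn_borel(2)[OF \<phi>] cs(1) out] by blast
    obtain m' where m': "\<And>x. cmod (partial k \<phi> x) \<le> m'"
      using compact_support_bounded[OF test_fn_partial(1)[OF \<phi>] cs(1) test_fn_partial(2)[OF \<phi>]] by blast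
    have int: "integrable (lebesgue_on \<Omega>) (\<lambda>x. g x * \<phi> x)" if "L1loc \<Omega> g" for g
      by (rule L1loc_mult_integrable[OF \<Omega> that cs test_fn_borel(1)[OF \<phi>] m out])
    have int': "integrable (lebesgue_on \<Omega>) (\<lambda>x. g x * partial k \<phi> x)" if "L2 \<Omega> g" for g
      by (rule L1loc_mult_integrable[OF \<Omega> L2_L1loc[OF \<Omega> that] cs
            borel_measurable_continuous_onI[OF test_fn_partial(1)[OF \<phi>]] m' test_fn_partial(2)[OF \<phi>]])
    have "(LINT x|lebesgue_on \<Omega>. (K x $ k - (G x $ k + c * H x $ k)) * \<phi> x)
       = (LINT x|lebesgue_on \<Omega>. K x $ k * \<phi> x - (G x $ k * \<phi> x + c * (H x $ k * \<phi> x)))"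
      by (rule Bochner_Integration.integral_cong) (auto simp: algebra_simps)
    also have "\<dots> = (LINT x|lebesgue_on \<Omega>. K x $ k * \<phi> x) - ((LINT x|lebesgue_on \<Omega>. G x $ k * \<phi> x)
        + c * (LINT x|lebesgue_on \<Omega>. H x $ k * \<phi> x))"
      using int[OF gk] int[OF hk] int[OF kk] by simp
    also have "\<dots> = - (LINT x|lebesgue_on \<Omega>. (u x + c * v x) * partial k \<phi> x)
       + ((LINT x|lebesgue_on \<Omega>. u x * partial k \<phi> x) + c * (LINT x|lebesgue_on \<Omega>. v x * partial k \<phi> x))"
      using G H K \<phi> by (simp add: weak_grad_def)
    also have "(LINT x|lebesgue_on \<Omega>. (u x + c * v x) * partial k \<phi> x)
       = (LINT x|lebesgue_on \<Omega>. u x * partial k \<phi> x + c * (v x * partial k \<phi> x))"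
      by (rule Bochner_Integration.integral_cong) (auto simp: algebra_simps)
    also have "\<dots> = (LINT x|lebesgue_on \<Omega>. u x * partial k \<phi> x) + c * (LINT x|lebesgue_on \<Omega>. v x * partial k \<phi> x)"
      using int'[OF u] int'[OF v] by simp
    finally show "(LINT x|lebesgue_on \<Omega>. (K x $ k - (G x $ k + c * H x $ k)) * \<phi> x) = 0" by simp
  qed
  have "AE x in lebesgue_on \<Omega>. \<forall>k. K x $ k - (G x $ k + c * H x $ k) = 0"
    using comp by (subst AE_all_countable) auto
  then show ?thesis by eventually_elim (simp add: vec_eq_iff)
qed

section \<open>Closed sectorial forms\<close>

text \<open>Pointwise real scaling makes sets of functions eligible as a \<open>subspace\<close>,
  the setting in which the abstract Hilbert space arguments are run.\<close>

instantiation "fun" :: (type, real_vector) real_vector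
begin

definition scaleR_fun :: "real \<Rightarrow> ('a \<Rightarrow> 'b) \<Rightarrow> 'a \<Rightarrow> 'b" where
  "scaleR_fun r f = (\<lambda>x. r *\<^sub>R f x)"

instance
  by standard (simp_all add: scaleR_fun_def fun_eq_iff algebra_simps)

end

text \<open>The product may vanish on nonzero vectors, because functions that agree almost
  everywhere stay distinct. It is real-valued; complex forms enter through their real parts.\<close>

locale semi_inner =
  fixes S :: "'a::real_vector set" and g :: "'a \<Rightarrow> 'a \<Rightarrow> real"
  assumes S: "subspace S"
    and g_add: "\<And>x y z. x \<in> S \<Longrightarrow> y \<in> S \<Longrightarrow> z \<in> S \<Longrightarrow> g (x + y) z = g x z + g y z"
    and g_scale: "\<And>r x y. x \<in> S \<Longrightarrow> y \<in> S \<Longrightarrow> g (r *\<^sub>R x) y = r * g x y"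
    and g_sym: "\<And>x y. x \<in> S \<Longrightarrow> y \<in> S \<Longrightarrow> g x y = g y x"
    and g_nonneg: "\<And>x. x \<in> S \<Longrightarrow> 0 \<le> g x x"
begin

definition nrm :: "'a \<Rightarrow> real" where "nrm x = sqrt (g x x)"

lemmas S_add = subspace_add[OF S] and S_scale = subspace_scale[OF S]
  and S_diff = subspace_diff[OF S] and S_0 = subspace_0[OF S]

lemma nrm_nonneg [simp]: "x \<in> S \<Longrightarrow> 0 \<le> nrm x" by (simp add: nrm_def g_nonneg)

lemma nrm_power2: "x \<in> S \<Longrightarrow> (nrm x)\<^sup>2 = g x x" by (simp add: nrm_def g_nonneg)

lemma g_add_right: "x \<in> S \<Longrightarrow> y \<in> S \<Longrightarrow> z \<in> S \<Longrightarrow> g x (y + z) = g x y + g x z"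
  by (metis g_add g_sym S_add)

lemma g_scale_right: "x \<in> S \<Longrightarrow> y \<in> S \<Longrightarrow> g x (r *\<^sub>R y) = r * g x y"
  by (metis g_scale g_sym S_scale)

lemma g_diff: "x \<in> S \<Longrightarrow> y \<in> S \<Longrightarrow> z \<in> S \<Longrightarrow> g (x - y) z = g x z - g y z"
  using g_add[of x "(-1) *\<^sub>R y" z] g_scale[of y z "-1"] S_scale[of y "-1"] by simp

lemma g_diff_right: "x \<in> S \<Longrightarrow> y \<in> S \<Longrightarrow> z \<in> S \<Longrightarrow> g x (y - z) = g x y - g x z"
  by (metis g_diff g_sym S_diff)

lemma quadratic: "x \<in> S \<Longrightarrow> y \<in> S \<Longrightarrow> g (x + t *\<^sub>R y) (x + t *\<^sub>R y) = g x x + 2 * t * g x y + t\<^sup>2 * g y y"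
  using S_scale[of y t] S_add[of x "t *\<^sub>R y"] g_sym[of y x]
  by (simp add: g_add g_add_right g_scale g_scale_right power2_eq_square algebra_simps)

lemma cauchy_schwarz:
  assumes x: "x \<in> S" and y: "y \<in> S"
  shows "\<bar>g x y\<bar> \<le> nrm x * nrm y"
proof -
  have q: "0 \<le> g x x + 2 * t * g x y + t\<^sup>2 * g y y" for t
    using g_nonneg[OF S_add[OF x S_scale[OF y, of t]]] by (simp add: quadratic[OF x y])
  have "(g x y)\<^sup>2 \<le> g x x * g y y"
  proof (cases "g y y = 0")
    case True
    have "g x y = 0"
    proof (rule ccontr)
      assume nz: "g x y \<noteq> 0"
      \<comment> \<open>For \<open>g y y = 0\<close> the quadratic polynomial is affine in
        \<open>t\<close>, and this \<open>t\<close> gives it the value \<open>-1\<close>.\<close>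
      show False using q[of "- (g x x + 1) / (2 * g x y)"] True nz by (simp add: field_simps)
    qed
    then show ?thesis using True by simp
  next
    case False
    then have pos: "g y y > 0" using g_nonneg[OF y] by simp
    have "0 \<le> g x x + 2 * (- g x y / g y y) * g x y + (- g x y / g y y)\<^sup>2 * g y y" by (rule q)
    also have "\<dots> = g x x - (g x y)\<^sup>2 / g y y" using False by (simp add: power2_eq_square field_simps)
    finally show ?thesis using pos by (simp add: field_simps)
  qed
  then have "sqrt ((g x y)\<^sup>2) \<le> sqrt (g x x * g y y)" by (rule real_sqrt_le_mono)
  then show ?thesis by (simp add: nrm_def real_sqrt_mult)
qed

lemma nrm_triangle:
  assumes x: "x \<in> S" and y: "y \<in> S"
  shows "nrm (x + y) \<le> nrm x + nrm y"
proof (rule power2_le_imp_le)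
  have "(nrm (x + y))\<^sup>2 = g x x + 2 * g x y + g y y"
    using quadratic[OF x y, of 1] by (simp add: nrm_power2 S_add x y)
  also have "\<dots> \<le> g x x + 2 * (nrm x * nrm y) + g y y"
    using cauchy_schwarz[OF x y] by linarith
  also have "\<dots> = (nrm x + nrm y)\<^sup>2" using x y by (simp add: power2_sum nrm_power2[symmetric])
  finally show "(nrm (x + y))\<^sup>2 \<le> (nrm x + nrm y)\<^sup>2" .
qed (simp add: x y)

lemma nrm_minus_commute: "x \<in> S \<Longrightarrow> y \<in> S \<Longrightarrow> nrm (x - y) = nrm (y - x)"
  by (simp add: nrm_def g_diff g_diff_right S_diff)

lemma nrm_triangle_diff: "x \<in> S \<Longrightarrow> y \<in> S \<Longrightarrow> z \<in> S \<Longrightarrow> nrm (x - z) \<le> nrm (x - y) + nrm (y - z)"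
  using nrm_triangle[of "x - y" "y - z"] S_diff by simp

lemma nrm_le_diff_add: "x \<in> S \<Longrightarrow> y \<in> S \<Longrightarrow> nrm x \<le> nrm (x - y) + nrm y"
  using nrm_triangle[of "x - y" y] S_diff by simp

end

locale semi_hilbert = semi_inner +
  assumes complete: "\<And>s. (\<And>n::nat. s n \<in> S) \<Longrightarrow>
    (\<And>e. e > 0 \<Longrightarrow> \<exists>N. \<forall>m\<ge>N. \<forall>n\<ge>N. nrm (s m - s n) < e) \<Longrightarrow> \<exists>x\<in>S. (\<lambda>n. nrm (s n - x)) \<longlonglongrightarrow> 0"
begin

text \<open>Minimisation of \<open>g v v - 2 F v\<close>: the functional is bounded below, the
  parallelogram law makes minimising sequences Cauchy, and a limit satisfies the variational
  equation. Orthogonal complements are avoided, so null vectors of \<open>g\<close> do no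
  harm.\<close>

lemma riesz:
  assumes F_add: "\<And>x y. x \<in> S \<Longrightarrow> y \<in> S \<Longrightarrow> F (x + y) = F x + F y"
    and F_scale: "\<And>r x. x \<in> S \<Longrightarrow> F (r *\<^sub>R x) = r * F x"
    and F_bd: "\<And>x. x \<in> S \<Longrightarrow> \<bar>F x\<bar> \<le> K * nrm x"
  shows "\<exists>z\<in>S. \<forall>y\<in>S. g z y = F y"
proof -
  define J where "J v = g v v - 2 * F v" for v
  have J_ge: "- K\<^sup>2 \<le> J v" if v: "v \<in> S" for v
  proof -
    have "F v \<le> K * nrm v" using F_bd[OF v] by linarith
    moreover have "0 \<le> (nrm v - K)\<^sup>2" by simp
    ultimately show ?thesis using nrm_power2[OF v] by (simp add: J_def power2_eq_square algebra_simps)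
  qed
  define m where "m = Inf (J ` S)"
  have bdd: "bdd_below (J ` S)" using J_ge by (intro bdd_belowI[of _ "- K\<^sup>2"]) auto
  have m_le: "m \<le> J v" if "v \<in> S" for v unfolding m_def using that bdd by (intro cInf_lower) auto
  have "\<exists>v\<in>S. J v < m + inverse (real (Suc n))" for n
  proof -
    have "Inf (J ` S) < m + inverse (real (Suc n))" by (simp add: m_def)
    then show ?thesis using S_0 bdd by (subst (asm) cInf_less_iff) auto
  qed
  then obtain v where vS: "\<And>n. v n \<in> S" and vJ: "\<And>n. J (v n) < m + inverse (real (Suc n))" by metis
  have par: "(nrm (x - y))\<^sup>2 \<le> 2 * (J x - m) + 2 * (J y - m)" if x: "x \<in> S" and y: "y \<in> S" for x y
  proof -
    have h: "(1/2) *\<^sub>R (x + y) \<in> S" by (intro S_scale S_add x y)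
    have J2: "J ((1/2) *\<^sub>R (x + y)) = (g x x + 2 * g x y + g y y) / 4 - (F x + F y)"
      using S_add[OF x y] x y g_sym[OF y x]
      by (simp add: J_def g_scale g_scale_right F_scale F_add S_scale g_add g_add_right
          del: scaleR_add_right) (simp add: field_simps)
    have "(nrm (x - y))\<^sup>2 = g x x - 2 * g x y + g y y"
      using x y S_diff[OF x y] g_sym[OF y x] by (simp add: nrm_power2 g_diff g_diff_right)
    also have "\<dots> = 2 * J x + 2 * J y - 4 * J ((1/2) *\<^sub>R (x + y))"
      unfolding J2 by (simp add: J_def field_simps)
    also have "\<dots> \<le> 2 * (J x - m) + 2 * (J y - m)" using m_le[OF h] by simp
    finally show ?thesis .
  qed
  have "\<exists>z\<in>S. (\<lambda>n. nrm (v n - z)) \<longlonglongrightarrow> 0"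
  proof (rule complete[OF vS])
    fix e :: real assume e: "e > 0"
    obtain N where N: "inverse (real (Suc N)) < e\<^sup>2 / 4" using reals_Archimedean[of "e\<^sup>2 / 4"] e by auto
    have "nrm (v k - v n) < e" if "k \<ge> N" "n \<ge> N" for k n
    proof (rule power2_less_imp_less)
      have "inverse (real (Suc k)) \<le> inverse (real (Suc N))" "inverse (real (Suc n)) \<le> inverse (real (Suc N))"
        using that by (auto intro!: le_imp_inverse_le)
      then show "(nrm (v k - v n))\<^sup>2 < e\<^sup>2"
        using par[OF vS vS, of k n] vJ[of k] vJ[of n] N by argo
    qed (use e in simp)
    then show "\<exists>N. \<forall>m\<ge>N. \<forall>n\<ge>N. nrm (v m - v n) < e" by blast
  qed
  then obtain z where z: "z \<in> S" and lim: "(\<lambda>n. nrm (v n - z)) \<longlonglongrightarrow> 0" by blast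
  have "g z y = F y" if y: "y \<in> S" for y
  proof -
    have gl: "(\<lambda>n. g (v n) y) \<longlonglongrightarrow> g z y"
    proof (rule LIM_zero_cancel, rule Lim_null_comparison)
      show "\<forall>\<^sub>F n in sequentially. norm (g (v n) y - g z y) \<le> nrm (v n - z) * nrm y"
        using cauchy_schwarz[OF S_diff[OF vS z] y] by (simp add: g_diff vS z y)
      show "(\<lambda>n. nrm (v n - z) * nrm y) \<longlonglongrightarrow> 0" using tendsto_mult_left_zero[OF lim] .
    qed
    have q: "0 \<le> 2 * t * (g z y - F y) + t\<^sup>2 * g y y" for t
    proof (rule LIMSEQ_le_const)
      show "(\<lambda>n. inverse (real (Suc n)) + (2 * t * (g (v n) y - F y) + t\<^sup>2 * g y y))
          \<longlonglongrightarrow> 2 * t * (g z y - F y) + t\<^sup>2 * g y y"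
        using tendsto_add[OF LIMSEQ_inverse_real_of_nat tendsto_add[OF tendsto_mult_left[OF tendsto_diff[OF gl tendsto_const]] tendsto_const]]
        by simp
      have "0 \<le> inverse (real (Suc n)) + (2 * t * (g (v n) y - F y) + t\<^sup>2 * g y y)" for n
      proof -
        have "m \<le> J (v n + t *\<^sub>R y)" by (intro m_le S_add S_scale vS y)
        also have "\<dots> = J (v n) + (2 * t * (g (v n) y - F y) + t\<^sup>2 * g y y)"
          using quadratic[OF vS y, of n t] S_scale[OF y, of t]
          by (simp add: J_def F_add F_scale vS y algebra_simps)
        finally show ?thesis using vJ[of n] by linarith
      qed
      then show "\<exists>N. \<forall>n\<ge>N. 0 \<le> inverse (real (Suc n)) + (2 * t * (g (v n) y - F y) + t\<^sup>2 * g y y)" by blast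
    qed
    define a where "a = g z y - F y"
    \<comment> \<open>The summand 1 allows a division where \<open>g y y\<close> itself may be
      zero.\<close>
    define p where "p = g y y + 1"
    have p: "p > 0" "g y y \<le> p" using g_nonneg[OF y] by (auto simp: p_def)
    have "0 \<le> 2 * (- a / p) * a + (- a / p)\<^sup>2 * g y y" using q[of "- a / p"] by (simp add: a_def)
    also have "\<dots> \<le> 2 * (- a / p) * a + (- a / p)\<^sup>2 * p" using p by (intro add_left_mono mult_left_mono) auto
    also have "\<dots> = - (a\<^sup>2 / p)" using p by (simp add: power2_eq_square field_simps)
    finally have "a\<^sup>2 / p \<le> 0" by simp
    then have "a = 0" using p by (simp add: divide_le_0_iff power2_less_0 not_less)
    then show ?thesis by (simp add: a_def)
  qed
  then show ?thesis using z by blast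
qed

text \<open>Serves twice: for the closure of a form domain inside a larger closed form, and for the
  closure of the operator domain in the proof that it is a core.\<close>

lemma closure_subspace:
  assumes T: "subspace T" "T \<subseteq> S"
  shows "semi_hilbert {x \<in> S. \<forall>e>0. \<exists>y\<in>T. nrm (y - x) < e} g" (is "semi_hilbert ?Tc g")
proof -
  have add: "x + x' \<in> ?Tc" if x: "x \<in> ?Tc" and x': "x' \<in> ?Tc" for x x'
  proof -
    have "\<exists>y\<in>T. nrm (y - (x + x')) < e" if e: "e > 0" for e
    proof -
      have "e / 2 > 0" using e by simp
      then have "\<exists>y\<in>T. nrm (y - x) < e / 2" "\<exists>y\<in>T. nrm (y - x') < e / 2"
        using x x' by blast+
      then obtain y y' where y: "y \<in> T" "nrm (y - x) < e / 2" and y': "y' \<in> T" "nrm (y' - x') < e / 2"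
        by blast
      have "nrm ((y - x) + (y' - x')) \<le> nrm (y - x) + nrm (y' - x')"
        using x x' y y' T by (intro nrm_triangle S_diff) auto
      moreover have "(y - x) + (y' - x') = (y + y') - (x + x')" by simp
      ultimately have "nrm ((y + y') - (x + x')) < e" using y y' by simp
      then show ?thesis using subspace_add[OF T(1) y(1) y'(1)] by blast
    qed
    then show ?thesis using x x' S_add by auto
  qed
  have scale: "r *\<^sub>R x \<in> ?Tc" if x: "x \<in> ?Tc" for r x
  proof -
    have "\<exists>y\<in>T. nrm (y - r *\<^sub>R x) < e" if e: "e > 0" for e
    proof -
      have "e / (\<bar>r\<bar> + 1) > 0" using e by simp
      then obtain y where y: "y \<in> T" "nrm (y - x) < e / (\<bar>r\<bar> + 1)" using x by auto
      have yx: "y - x \<in> S" using x y T by (auto intro: S_diff)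
      have "nrm (r *\<^sub>R y - r *\<^sub>R x) = \<bar>r\<bar> * nrm (y - x)"
        using yx S_scale[OF yx, of r]
        by (simp add: nrm_def g_scale g_scale_right real_sqrt_mult real_sqrt_mult_self scaleR_diff_right[symmetric]
            mult.assoc[symmetric] del: scaleR_diff_right)
      also have "\<dots> \<le> (\<bar>r\<bar> + 1) * nrm (y - x)" using yx by (intro mult_right_mono) auto
      also have "\<dots> < e" using y(2) by (simp add: field_simps)
      finally show ?thesis using subspace_scale[OF T(1) y(1)] by blast
    qed
    then show ?thesis using x S_scale by auto
  qed
  have zero: "0 \<in> ?Tc" using S_0 subspace_0[OF T(1)] by (auto intro!: bexI[of _ 0] simp: nrm_def g_scale[OF S_0 S_0, of 0, simplified])
  have sub: "subspace ?Tc" unfolding subspace_def using add scale zero by blast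
  interpret Tc: semi_inner ?Tc g
    by unfold_locales (use sub in \<open>auto simp: g_add g_scale g_nonneg intro: g_sym\<close>)
  show ?thesis
  proof unfold_locales
    fix s :: "nat \<Rightarrow> 'a"
    assume s: "\<And>n. s n \<in> ?Tc" and C: "\<And>e. e > 0 \<Longrightarrow> \<exists>N. \<forall>m\<ge>N. \<forall>n\<ge>N. nrm (s m - s n) < e"
    have sS: "s n \<in> S" for n using s by auto
    obtain x where x: "x \<in> S" "(\<lambda>n. nrm (s n - x)) \<longlonglongrightarrow> 0" using complete[OF sS C] by blast
    have "\<exists>y\<in>T. nrm (y - x) < e" if e: "e > 0" for e
    proof -
      have e2: "e / 2 > 0" using e by simp
      then obtain n where n: "nrm (s n - x) < e / 2"
        using order_tendstoD(2)[OF x(2) e2] eventually_sequentially by auto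
      have "\<exists>y\<in>T. nrm (y - s n) < e / 2" using s[of n] e2 by blast
      then obtain y where y: "y \<in> T" "nrm (y - s n) < e / 2" by blast
      have "nrm (y - x) \<le> nrm (y - s n) + nrm (s n - x)"
        using y T x s by (intro nrm_triangle_diff) auto
      then show ?thesis using n y by (intro bexI[of _ y]) auto
    qed
    then show "\<exists>x\<in>?Tc. (\<lambda>n. nrm (s n - x)) \<longlonglongrightarrow> 0" using x by blast
  qed
qed

text \<open>Damped iteration on residuals: the residual of \<open>x\<close> is represented by some
  \<open>z\<close> through \<open>riesz\<close>, and \<open>x\<close> is corrected to
  \<open>x + t z\<close>. Estimating residuals, instead of contracting with an operator, copes with
  representatives that are not unique.\<close>

lemma lax_milgram:
  assumes B_add: "\<And>x y z. x \<in> S \<Longrightarrow> y \<in> S \<Longrightarrow> z \<in> S \<Longrightarrow> B (x + y) z = B x z + B y z"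
    and B_scale: "\<And>r x y. x \<in> S \<Longrightarrow> y \<in> S \<Longrightarrow> B (r *\<^sub>R x) y = r * B x y"
    and B_add_right: "\<And>x y z. x \<in> S \<Longrightarrow> y \<in> S \<Longrightarrow> z \<in> S \<Longrightarrow> B x (y + z) = B x y + B x z"
    and B_scale_right: "\<And>r x y. x \<in> S \<Longrightarrow> y \<in> S \<Longrightarrow> B x (r *\<^sub>R y) = r * B x y"
    and B_bd: "\<And>x y. x \<in> S \<Longrightarrow> y \<in> S \<Longrightarrow> \<bar>B x y\<bar> \<le> M * (nrm x * nrm y)"
    and B_coercive: "\<And>x. x \<in> S \<Longrightarrow> g x x \<le> B x x"
    and F_add: "\<And>x y. x \<in> S \<Longrightarrow> y \<in> S \<Longrightarrow> F (x + y) = F x + F y"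
    and F_scale: "\<And>r x. x \<in> S \<Longrightarrow> F (r *\<^sub>R x) = r * F x"
    and F_bd: "\<And>x. x \<in> S \<Longrightarrow> \<bar>F x\<bar> \<le> K * nrm x"
  shows "\<exists>x\<in>S. \<forall>y\<in>S. B x y = F y"
proof -
  define L where "L = max 1 M"
  have L: "L \<ge> 1" by (simp add: L_def)
  have B_bdL: "\<bar>B x y\<bar> \<le> L * (nrm x * nrm y)" if "x \<in> S" "y \<in> S" for x y
    using B_bd[OF that] mult_right_mono[of M L "nrm x * nrm y"] that by (simp add: L_def)
  have B_diff: "B (x - y) z = B x z - B y z" if "x \<in> S" "y \<in> S" "z \<in> S" for x y z
    using B_add[of x "(-1) *\<^sub>R y" z] B_scale[of y z "-1"] S_scale[of y "-1"] that by simp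
  \<comment> \<open>By boundedness and coercivity of \<open>B\<close> one correction multiplies the
    squared residual bound by at most \<open>1 - 2t + t^2 L^2\<close>. The minimiser
    \<open>t = 1 / L^2\<close> turns this factor into \<open>1 - t\<close>, and
    \<open>\<theta>\<close> is its square root.\<close>
  define t where "t = 1 / L\<^sup>2"
  define \<theta> where "\<theta> = sqrt (1 - t)"
  have t: "0 < t" "t \<le> 1" using L by (auto simp: t_def)
  have \<theta>: "0 \<le> \<theta>" "\<theta> < 1" using t by (auto simp: \<theta>_def)
  have step: "\<exists>x'\<in>S. \<forall>y\<in>S. \<bar>F y - B x' y\<bar> \<le> (\<theta> * c) * nrm y"
    if x: "x \<in> S" and res: "\<And>y. y \<in> S \<Longrightarrow> \<bar>F y - B x y\<bar> \<le> c * nrm y" and c: "0 \<le> c" for x c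
  proof -
    have "\<exists>z\<in>S. \<forall>y\<in>S. g z y = F y - B x y"
      by (rule riesz[OF _ _ res]) (auto simp: F_add F_scale B_add_right B_scale_right x algebra_simps)
    then obtain z where z: "z \<in> S" and gz: "\<And>y. y \<in> S \<Longrightarrow> g z y = F y - B x y" by blast
    have "\<exists>z'\<in>S. \<forall>y\<in>S. g z' y = B z y"
      by (rule riesz[where K = "L * nrm z"]) (use B_bdL[OF z] in \<open>auto simp: B_add_right B_scale_right z mult.assoc\<close>)
    then obtain z' where z': "z' \<in> S" and gz': "\<And>y. y \<in> S \<Longrightarrow> g z' y = B z y" by blast
    have nz: "nrm z \<le> c"
    proof -
      have "nrm z * nrm z \<le> c * nrm z"
        using gz[OF z] res[OF z] nrm_power2[OF z] by (simp add: power2_eq_square)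
      then show ?thesis using c nrm_nonneg[OF z] by (cases "nrm z = 0") auto
    qed
    have nz': "nrm z' \<le> L * nrm z"
    proof -
      have "nrm z' * nrm z' \<le> L * nrm z * nrm z'"
        using gz'[OF z'] B_bdL[OF z z'] nrm_power2[OF z'] by (simp add: power2_eq_square)
      then show ?thesis using L nrm_nonneg[OF z] nrm_nonneg[OF z'] by (cases "nrm z' = 0") auto
    qed
    have tz': "t *\<^sub>R z' \<in> S" by (rule S_scale[OF z'])
    have d: "z - t *\<^sub>R z' \<in> S" by (rule S_diff[OF z tz'])
    have "(nrm (z - t *\<^sub>R z'))\<^sup>2 = g z z - 2 * t * g z' z + t\<^sup>2 * (nrm z')\<^sup>2"
      using quadratic[OF z z', of "- t"] d g_sym[OF z z'] by (simp add: nrm_power2 z z')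
    also have "\<dots> \<le> g z z - 2 * t * g z z + t\<^sup>2 * (L * nrm z)\<^sup>2"
      using B_coercive[OF z] gz'[OF z] t nz' nrm_nonneg[OF z']
      by (intro add_mono diff_mono mult_left_mono power_mono) auto
    also have "t\<^sup>2 * (L * nrm z)\<^sup>2 = t * g z z"
      using L nrm_power2[OF z] by (simp add: t_def power2_eq_square field_simps)
    also have "g z z - 2 * t * g z z + t * g z z = (1 - t) * (nrm z)\<^sup>2"
      using nrm_power2[OF z] by (simp add: algebra_simps)
    also have "\<dots> \<le> (1 - t) * c\<^sup>2" using t nz nrm_nonneg[OF z] by (intro mult_left_mono power_mono) auto
    also have "\<dots> = (\<theta> * c)\<^sup>2" using t by (simp add: \<theta>_def power_mult_distrib)
    finally have nd: "nrm (z - t *\<^sub>R z') \<le> \<theta> * c" by (rule power2_le_imp_le) (use \<theta> c in simp)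
    have "\<bar>F y - B (x + t *\<^sub>R z) y\<bar> \<le> (\<theta> * c) * nrm y" if y: "y \<in> S" for y
    proof -
      have "F y - B (x + t *\<^sub>R z) y = g (z - t *\<^sub>R z') y"
        using S_scale[OF z, of t] by (simp add: B_add B_scale x z y g_diff z' tz' g_scale gz[OF y] gz'[OF y])
      also have "\<bar>\<dots>\<bar> \<le> nrm (z - t *\<^sub>R z') * nrm y" by (rule cauchy_schwarz[OF d y])
      also have "\<dots> \<le> (\<theta> * c) * nrm y" using nd y by (intro mult_right_mono) auto
      finally show ?thesis .
    qed
    then show ?thesis using S_add[OF x S_scale[OF z, of t]] by blast
  qed
  define K' where "K' = max K 0"
  have "\<exists>x\<in>S. \<forall>y\<in>S. \<bar>F y - B x y\<bar> \<le> (\<theta> ^ n * K') * nrm y" for n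
  proof (induction n)
    case 0
    have "B 0 y = 0" if "y \<in> S" for y using B_scale[OF S_0 that, of 0] by simp
    moreover have "\<bar>F y\<bar> \<le> K' * nrm y" if "y \<in> S" for y
      using F_bd[OF that] mult_right_mono[of K K' "nrm y"] that by (simp add: K'_def)
    ultimately show ?case using S_0 by (intro bexI[of _ 0]) auto
  next
    case (Suc n)
    then obtain x where x: "x \<in> S" "\<And>y. y \<in> S \<Longrightarrow> \<bar>F y - B x y\<bar> \<le> (\<theta> ^ n * K') * nrm y" by blast
    have "0 \<le> \<theta> ^ n * K'" using \<theta> by (simp add: K'_def)
    from step[OF x this] show ?case by (simp add: mult.assoc)
  qed
  then obtain x where xS: "\<And>n. x n \<in> S" and res: "\<And>n y. y \<in> S \<Longrightarrow> \<bar>F y - B (x n) y\<bar> \<le> (\<theta> ^ n * K') * nrm y"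
    by metis
  \<comment> \<open>Coercivity bounds the distance of two iterates by the sum of their residual
    bounds.\<close>
  have cau: "nrm (x m - x n) \<le> \<theta> ^ n * K' + \<theta> ^ m * K'" for m n
  proof -
    define e where "e = x m - x n"
    have e: "e \<in> S" unfolding e_def by (rule S_diff[OF xS xS])
    have "nrm e * nrm e \<le> B e e" using B_coercive[OF e] nrm_power2[OF e] by (simp add: power2_eq_square)
    also have "B e e = (F e - B (x n) e) - (F e - B (x m) e)"
      using B_diff[OF xS xS e, of m n] by (simp add: e_def)
    also have "\<dots> \<le> (\<theta> ^ n * K') * nrm e + (\<theta> ^ m * K') * nrm e"
      using res[OF e, of n] res[OF e, of m] by linarith
    finally have "nrm e * nrm e \<le> (\<theta> ^ n * K' + \<theta> ^ m * K') * nrm e" by (simp add: algebra_simps)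
    moreover have "0 \<le> \<theta> ^ n * K' + \<theta> ^ m * K'" using \<theta> by (simp add: K'_def)
    ultimately have "nrm e \<le> \<theta> ^ n * K' + \<theta> ^ m * K'"
      using nrm_nonneg[OF e] by (cases "nrm e = 0") auto
    then show ?thesis by (simp add: e_def)
  qed
  have lim\<theta>: "(\<lambda>n. \<theta> ^ n * K') \<longlonglongrightarrow> 0"
    using \<theta> by (intro tendsto_mult_left_zero LIMSEQ_power_zero) simp
  have "\<exists>x0\<in>S. (\<lambda>n. nrm (x n - x0)) \<longlonglongrightarrow> 0"
  proof (rule complete[OF xS])
    fix e :: real assume "e > 0"
    then have "\<forall>\<^sub>F n in sequentially. \<theta> ^ n * K' < e / 2" by (intro order_tendstoD(2)[OF lim\<theta>]) simp
    then obtain N where N: "\<And>n. n \<ge> N \<Longrightarrow> \<theta> ^ n * K' < e / 2" by (auto simp: eventually_sequentially)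
    have "nrm (x m - x n) < e" if "m \<ge> N" "n \<ge> N" for m n
      using cau[of m n] N[OF that(1)] N[OF that(2)] by linarith
    then show "\<exists>N. \<forall>m\<ge>N. \<forall>n\<ge>N. nrm (x m - x n) < e" by blast
  qed
  then obtain x0 where x0: "x0 \<in> S" "(\<lambda>n. nrm (x n - x0)) \<longlonglongrightarrow> 0" by blast
  have "B x0 y = F y" if y: "y \<in> S" for y
  proof -
    have "\<bar>F y - B x0 y\<bar> \<le> (\<theta> ^ n * K') * nrm y + L * (nrm (x n - x0) * nrm y)" for n
      using res[OF y, of n] B_bdL[OF S_diff[OF xS x0(1)] y, of n] B_diff[OF xS x0(1) y, of n] by linarith
    moreover have "(\<lambda>n. (\<theta> ^ n * K') * nrm y + L * (nrm (x n - x0) * nrm y)) \<longlonglongrightarrow> 0 * nrm y + L * (0 * nrm y)"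
      by (intro tendsto_intros lim\<theta> x0(2))
    ultimately have "\<bar>F y - B x0 y\<bar> \<le> 0 * nrm y + L * (0 * nrm y)"
      by (intro LIMSEQ_le_const) auto
    then show ?thesis by simp
  qed
  then show ?thesis using x0(1) by blast
qed

end


section \<open>The inner product of L2\<close>

lemma L2_iff_sqi: "L2 \<Omega> u \<longleftrightarrow> sqi (lebesgue_on \<Omega>) u" and L2v_iff_sqi: "L2v \<Omega> w \<longleftrightarrow> sqi (lebesgue_on \<Omega>) w"
  and l2norm_eq_sqn: "l2norm \<Omega> u = sqn (lebesgue_on \<Omega>) u" and l2vnorm_eq_sqn: "l2vnorm \<Omega> w = sqn (lebesgue_on \<Omega>) w"
  by (simp_all add: L2_def L2v_def sqi_def l2norm_def l2vnorm_def sqn_def)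

lemma l2norm_nonneg [simp]: "0 \<le> l2norm \<Omega> u" by (simp add: l2norm_eq_sqn)

lemma L2_add: "L2 \<Omega> u \<Longrightarrow> L2 \<Omega> v \<Longrightarrow> L2 \<Omega> (u + v)"
  by (simp add: L2_iff_sqi plus_fun_def sqi_add)

lemma L2_cmult:
  assumes u: "L2 \<Omega> u"
  shows "L2 \<Omega> (\<lambda>x. c * u x)" "l2norm \<Omega> (\<lambda>x. c * u x) = cmod c * l2norm \<Omega> u"
proof -
  show "L2 \<Omega> (\<lambda>x. c * u x)" using u
    by (auto simp: L2_def norm_mult power_mult_distrib intro: borel_measurable_times borel_measurable_const)
  show "l2norm \<Omega> (\<lambda>x. c * u x) = cmod c * l2norm \<Omega> u"
    by (simp add: l2norm_def norm_mult power_mult_distrib real_sqrt_mult)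
qed

lemma L2_diff: "L2 \<Omega> u \<Longrightarrow> L2 \<Omega> v \<Longrightarrow> L2 \<Omega> (u - v)"
  by (simp add: L2_iff_sqi fun_diff_def sqi_diff)

lemma l2norm_triangle: "L2 \<Omega> u \<Longrightarrow> L2 \<Omega> v \<Longrightarrow> l2norm \<Omega> (u + v) \<le> l2norm \<Omega> u + l2norm \<Omega> v"
  by (simp add: L2_iff_sqi l2norm_eq_sqn plus_fun_def sqi_add)

lemma l2norm_minus_commute: "l2norm \<Omega> (u - v) = l2norm \<Omega> (v - u)"
  by (simp add: l2norm_def fun_diff_def norm_minus_commute)

lemma linner_integrable:
  assumes "L2 \<Omega> u" "L2 \<Omega> v"
  shows "integrable (lebesgue_on \<Omega>) (\<lambda>x. u x * cnj (v x))" "cmod (linner \<Omega> u v) \<le> l2norm \<Omega> u * l2norm \<Omega> v"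
proof -
  have "u \<in> borel_measurable (lebesgue_on \<Omega>)" "v \<in> borel_measurable (lebesgue_on \<Omega>)" using assms by (auto simp: L2_def)
  then have m: "(\<lambda>x. u x * cnj (v x)) \<in> borel_measurable (lebesgue_on \<Omega>)"
    by (intro borel_measurable_times borel_measurable_continuous_on[of cnj]) (auto intro: continuous_on_cnj continuous_on_id)
  show "integrable (lebesgue_on \<Omega>) (\<lambda>x. u x * cnj (v x))" "cmod (linner \<Omega> u v) \<le> l2norm \<Omega> u * l2norm \<Omega> v"
    using sqi_bilinear[OF assms[unfolded L2_iff_sqi] m, of 1] by (auto simp: norm_mult linner_def l2norm_eq_sqn)
qed

lemma linner_add_left: "L2 \<Omega> u \<Longrightarrow> L2 \<Omega> v \<Longrightarrow> L2 \<Omega> w \<Longrightarrow> linner \<Omega> (u + v) w = linner \<Omega> u w + linner \<Omega> v w"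
  using linner_integrable(1)[of \<Omega> u w] linner_integrable(1)[of \<Omega> v w]
  by (simp add: linner_def distrib_right)

lemma linner_cmult_left: "linner \<Omega> (\<lambda>x. c * u x) w = c * linner \<Omega> u w"
  by (simp add: linner_def mult.assoc)

lemma cnj_linner: "cnj (linner \<Omega> u v) = linner \<Omega> v u"
proof -
  have "cnj (LINT x|lebesgue_on \<Omega>. u x * cnj (v x)) = (LINT x|lebesgue_on \<Omega>. cnj (u x * cnj (v x)))"
    by (rule integral_bounded_linear'[OF bounded_linear_cnj bounded_linear_cnj, symmetric]) simp
  then show ?thesis by (simp add: linner_def mult.commute)
qed

lemma linner_add_right: "L2 \<Omega> u \<Longrightarrow> L2 \<Omega> v \<Longrightarrow> L2 \<Omega> w \<Longrightarrow> linner \<Omega> w (u + v) = linner \<Omega> w u + linner \<Omega> w v"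
  by (metis cnj_linner complex_cnj_add linner_add_left)

lemma linner_cmult_right: "linner \<Omega> w (\<lambda>x. c * u x) = cnj c * linner \<Omega> w u"
  by (metis cnj_linner complex_cnj_mult linner_cmult_left)

lemma linner_self: "linner \<Omega> u u = of_real ((l2norm \<Omega> u)\<^sup>2)"
  by (simp add: linner_def l2norm_def complex_norm_square[symmetric] del: of_real_power)

lemma diff_eq_add_cmult: "u - v = u + (\<lambda>x. (-1) * (v x :: complex))"
  by (simp add: fun_eq_iff)

lemma linner_diff_left: "L2 \<Omega> u \<Longrightarrow> L2 \<Omega> v \<Longrightarrow> L2 \<Omega> w \<Longrightarrow> linner \<Omega> (u - v) w = linner \<Omega> u w - linner \<Omega> v w"
  using linner_add_left[of \<Omega> u "\<lambda>x. (-1) * v x" w] L2_cmult(1)[of \<Omega> v "-1"] linner_cmult_left[of \<Omega> "-1" v w]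
  unfolding diff_eq_add_cmult[of u v] by simp

lemma linner_diff_right: "L2 \<Omega> u \<Longrightarrow> L2 \<Omega> v \<Longrightarrow> L2 \<Omega> w \<Longrightarrow> linner \<Omega> w (u - v) = linner \<Omega> w u - linner \<Omega> w v"
  by (metis cnj_linner complex_cnj_diff linner_diff_left)

lemma linner_tendsto:
  assumes "\<And>n. L2 \<Omega> (s n)" "L2 \<Omega> x" "L2 \<Omega> v" "(\<lambda>n. l2norm \<Omega> (s n - x)) \<longlonglongrightarrow> 0"
  shows "(\<lambda>n. linner \<Omega> (s n) v) \<longlonglongrightarrow> linner \<Omega> x v"
proof (rule LIM_zero_cancel, rule Lim_null_comparison)
  show "\<forall>\<^sub>F n in sequentially. norm (linner \<Omega> (s n) v - linner \<Omega> x v) \<le> l2norm \<Omega> (s n - x) * l2norm \<Omega> v"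
    using linner_integrable(2)[OF L2_diff[OF assms(1,2)] assms(3)] by (simp add: linner_diff_left assms)
  show "(\<lambda>n. l2norm \<Omega> (s n - x) * l2norm \<Omega> v) \<longlonglongrightarrow> 0" using tendsto_mult_left_zero[OF assms(4)] .
qed

lemma linner_null:
  assumes "L2 \<Omega> u" "L2 \<Omega> v" "l2norm \<Omega> u = 0"
  shows "linner \<Omega> u v = 0" "linner \<Omega> v u = 0"
  using linner_integrable(2)[OF assms(1,2)] linner_integrable(2)[OF assms(2,1)] assms(3) by auto

section \<open>Sectors and sectorial forms\<close>

text \<open>Sectoriality is used only as a bound of the imaginary part by a multiple of the real
  part; this lemma and its converse \<open>sectorI\<close> translate between angles and such
  bounds.\<close>

lemma sectorD:
  assumes z: "z \<in> sector \<theta>" and \<theta>: "0 \<le> \<theta>" "\<theta> < pi / 2"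
  shows "0 \<le> Re z" "\<bar>Im z\<bar> \<le> tan \<theta> * Re z"
proof -
  have "0 \<le> Re z \<and> \<bar>Im z\<bar> \<le> tan \<theta> * Re z"
  proof (cases "z = 0")
    case False
    define \<alpha> where "\<alpha> = Arg z"
    have \<alpha>: "\<bar>\<alpha>\<bar> \<le> \<theta>" using z False by (simp add: sector_def \<alpha>_def)
    have zc: "Re z = cmod z * cos \<alpha>" "Im z = cmod z * sin \<alpha>"
      using Arg_eq[OF False] by (metis \<alpha>_def rcis_cmod_Arg Re_rcis, metis \<alpha>_def rcis_cmod_Arg Im_rcis)
    have c: "0 < cos \<alpha>" using \<alpha> \<theta> by (intro cos_gt_zero_pi) auto
    have "\<bar>sin \<alpha>\<bar> = sin \<bar>\<alpha>\<bar>"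
      using \<alpha> \<theta> sin_ge_zero[of "\<bar>\<alpha>\<bar>"] by (cases "\<alpha> \<ge> 0") auto
    then have "\<bar>sin \<alpha>\<bar> / cos \<alpha> = tan \<bar>\<alpha>\<bar>" by (simp add: tan_def)
    also have "\<dots> \<le> tan \<theta>" using \<alpha> \<theta> by (intro tan_mono_le) auto
    finally have "\<bar>sin \<alpha>\<bar> \<le> tan \<theta> * cos \<alpha>" using c by (simp add: field_simps)
    then have "cmod z * \<bar>sin \<alpha>\<bar> \<le> cmod z * (tan \<theta> * cos \<alpha>)" by (rule mult_left_mono) simp
    then show ?thesis using c by (simp add: zc abs_mult mult.left_commute)
  qed simp
  then show "0 \<le> Re z" "\<bar>Im z\<bar> \<le> tan \<theta> * Re z" by auto
qed

lemma sectorI: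
  assumes re: "0 \<le> Re z" and z: "\<bar>Im z\<bar> \<le> c * Re z"
  shows "z \<in> sector (arctan c)"
proof (cases "Re z = 0")
  case True
  then have "z = 0" using z by (simp add: complex_eq_iff)
  then show ?thesis by (simp add: sector_def)
next
  case False
  then have pos: "Re z > 0" using re by simp
  then have "\<bar>Im z / Re z\<bar> \<le> c" using z by (simp add: field_simps)
  then have "arctan \<bar>Im z / Re z\<bar> \<le> arctan c" by (rule arctan_monotone')
  moreover have "\<bar>arctan t\<bar> = arctan \<bar>t\<bar>" for t by (cases "t \<ge> 0") (auto simp: arctan_minus abs_if)
  moreover have "Arg z = arctan (Im z / Re z)" using pos by (simp add: arg_conv_arctan)
  ultimately show ?thesis by (simp add: sector_def)
qed

text \<open>The best choice is \<open>t = R / P\<close>, where the bracket equals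
  \<open>2 P R\<close>. Adding a small \<open>d\<close> to numerator and denominator keeps both
  positive when one of the norms is zero.\<close>

lemma scaled_bound:
  fixes a c P R :: real
  assumes c: "0 \<le> c" and P: "0 \<le> P" and R: "0 \<le> R"
    and bd: "\<And>t. 0 < t \<Longrightarrow> a \<le> c * (t * P\<^sup>2 + R\<^sup>2 / t)"
  shows "a \<le> 2 * c * (P * R)"
proof (rule field_le_epsilon)
  fix e :: real assume e: "e > 0"
  define d where "d = e / (c * (P + R) + 1)"
  have den: "c * (P + R) + 1 > 0" using c P R by (intro add_nonneg_pos mult_nonneg_nonneg) auto
  have d: "d > 0" using e den by (simp add: d_def)
  have "a \<le> c * ((R + d) / (P + d) * P\<^sup>2 + R\<^sup>2 / ((R + d) / (P + d)))"
    using d P R by (intro bd) simp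
  also have "\<dots> \<le> c * ((R + d) * P + R * (P + d))"
  proof (intro mult_left_mono add_mono c)
    have "P\<^sup>2 / (P + d) \<le> P" using d P by (simp add: field_simps power2_eq_square)
    then have "(R + d) * (P\<^sup>2 / (P + d)) \<le> (R + d) * P" using d R by (intro mult_left_mono) auto
    then show "(R + d) / (P + d) * P\<^sup>2 \<le> (R + d) * P" by simp
    have "R\<^sup>2 / (R + d) \<le> R" using d R by (simp add: field_simps power2_eq_square)
    then have "(R\<^sup>2 / (R + d)) * (P + d) \<le> R * (P + d)" using d P by (intro mult_right_mono) auto
    then show "R\<^sup>2 / ((R + d) / (P + d)) \<le> R * (P + d)" by simp
  qed
  also have "\<dots> = 2 * c * (P * R) + d * (c * (P + R))" by (simp add: algebra_simps)
  also have "d * (c * (P + R)) \<le> d * (c * (P + R) + 1)" using d by (intro mult_left_mono) auto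
  also have "d * (c * (P + R) + 1) = e" using den by (simp add: d_def)
  finally show "a \<le> 2 * c * (P * R) + e" by simp
qed

locale sectorial_form =
  fixes \<Omega> :: "(real^'n) set" and b :: "(real^'n \<Rightarrow> complex) \<Rightarrow> (real^'n \<Rightarrow> complex) \<Rightarrow> complex"
    and V :: "(real^'n \<Rightarrow> complex) set" and \<gamma> :: real
  assumes sv: "sectorial_vertex \<Omega> b V \<gamma>"
begin

text \<open>The shift by \<open>1 - \<gamma>\<close> makes the real part dominate the squared L2
  norm, so that \<open>B\<close> is coercive for the form norm \<open>q\<close>.\<close>

definition B :: "(real^'n \<Rightarrow> complex) \<Rightarrow> (real^'n \<Rightarrow> complex) \<Rightarrow> complex" where
  "B u v = b u v + of_real (1 - \<gamma>) * linner \<Omega> u v"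

text \<open>The symmetrised real part of \<open>B\<close>: the real semi-inner product whose
  seminorm is the form norm.\<close>

definition g :: "(real^'n \<Rightarrow> complex) \<Rightarrow> (real^'n \<Rightarrow> complex) \<Rightarrow> real" where
  "g u v = (Re (B u v) + Re (B v u)) / 2"

abbreviation q :: "(real^'n \<Rightarrow> complex) \<Rightarrow> real" where "q \<equiv> form_norm \<Omega> b \<gamma>"

lemma sesq: "sesq_form \<Omega> b V" using sv by (simp add: sectorial_vertex_def)

lemma V_L2: "u \<in> V \<Longrightarrow> L2 \<Omega> u" using sesq unfolding sesq_form_def by blast

lemma V_0: "0 \<in> V" using sesq unfolding sesq_form_def zero_fun_def by blast

lemma V_add: "u \<in> V \<Longrightarrow> v \<in> V \<Longrightarrow> u + v \<in> V" using sesq unfolding sesq_form_def plus_fun_def by blast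

lemma V_cmult: "u \<in> V \<Longrightarrow> (\<lambda>x. c * u x) \<in> V" using sesq unfolding sesq_form_def by blast

lemma V_diff: "u \<in> V \<Longrightarrow> v \<in> V \<Longrightarrow> u - v \<in> V"
  unfolding diff_eq_add_cmult by (intro V_add V_cmult)

lemma scaleR_eq_cmult: "r *\<^sub>R u = (\<lambda>x. complex_of_real r * u x)"
  by (simp add: scaleR_fun_def scaleR_conv_of_real[where 'a=complex])

lemma subspace_V: "subspace V"
  unfolding subspace_def scaleR_eq_cmult using V_0 V_add V_cmult by blast

lemma b_lin:
  assumes "u \<in> V" "v \<in> V" "w \<in> V"
  shows "b (u + v) w = b u w + b v w" "b (\<lambda>x. c * u x) w = c * b u w"
    "b w (u + v) = b w u + b w v" "b w (\<lambda>x. c * u x) = cnj c * b w u"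
  using sesq assms unfolding sesq_form_def plus_fun_def by blast+

lemma b_diff: 
  assumes "u \<in> V" "v \<in> V" "w \<in> V"
  shows "b (u - v) w = b u w - b v w" "b w (u - v) = b w u - b w v"
proof -
  have v: "(\<lambda>x. (-1) * v x) \<in> V" by (rule V_cmult[OF assms(2)])
  show "b (u - v) w = b u w - b v w"
    unfolding diff_eq_add_cmult b_lin(1)[OF assms(1) v assms(3)] b_lin(2)[OF assms(2,2,3)] by simp
  show "b w (u - v) = b w u - b w v"
    unfolding diff_eq_add_cmult b_lin(3)[OF assms(1) v assms(3)] b_lin(4)[OF assms(2,2,3)] by simp
qed

lemma B_lin:
  assumes "u \<in> V" "v \<in> V" "w \<in> V"
  shows "B (u + v) w = B u w + B v w" "B (\<lambda>x. c * u x) w = c * B u w"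
    "B w (u + v) = B w u + B w v" "B w (\<lambda>x. c * u x) = cnj c * B w u"
  by (simp_all add: B_def b_lin(1,3)[OF assms] b_lin(2,4)[OF assms(1,2,3)] linner_add_left linner_add_right V_L2 assms
      linner_cmult_left linner_cmult_right algebra_simps)

lemma B_diff: 
  assumes "u \<in> V" "v \<in> V" "w \<in> V"
  shows "B (u - v) w = B u w - B v w" "B w (u - v) = B w u - B w v"
  by (simp_all add: B_def b_diff[OF assms] linner_diff_left linner_diff_right V_L2 assms algebra_simps)

lemma b_null: "u \<in> V \<Longrightarrow> v \<in> V \<Longrightarrow> l2norm \<Omega> u = 0 \<Longrightarrow> b u v = 0"
    "u \<in> V \<Longrightarrow> v \<in> V \<Longrightarrow> l2norm \<Omega> u = 0 \<Longrightarrow> b v u = 0"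
  using sesq unfolding sesq_form_def by blast+

lemma q_0: "q 0 = 0"
  using b_null(1)[OF V_0 V_0] by (simp add: form_norm_def l2norm_def)

lemma Re_b_ge: "u \<in> V \<Longrightarrow> \<gamma> * (l2norm \<Omega> u)\<^sup>2 \<le> Re (b u u)"
proof -
  assume u: "u \<in> V"
  obtain \<theta> where "0 \<le> \<theta>" "\<theta> < pi/2" "b u u - complex_of_real (\<gamma> * (l2norm \<Omega> u)\<^sup>2) \<in> sector \<theta>"
    using sv u unfolding sectorial_vertex_def by blast
  from sectorD(1)[OF this(3,1,2)] show ?thesis by simp
qed

lemma Re_B: "Re (B u u) = Re (b u u) + (1 - \<gamma>) * (l2norm \<Omega> u)\<^sup>2"
  by (simp add: B_def linner_self del: of_real_power)

lemma q_power2: "u \<in> V \<Longrightarrow> (q u)\<^sup>2 = Re (B u u)" and q_nonneg: "u \<in> V \<Longrightarrow> 0 \<le> q u"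
  and l2norm_le_q: "u \<in> V \<Longrightarrow> l2norm \<Omega> u \<le> q u"
proof -
  assume u: "u \<in> V"
  have ge: "(l2norm \<Omega> u)\<^sup>2 \<le> Re (b u u) + (1 - \<gamma>) * (l2norm \<Omega> u)\<^sup>2"
    using Re_b_ge[OF u] by (simp add: algebra_simps)
  have "0 \<le> (l2norm \<Omega> u)\<^sup>2" by simp
  with ge have p: "0 \<le> Re (b u u) + (1 - \<gamma>) * (l2norm \<Omega> u)\<^sup>2" by linarith
  show "(q u)\<^sup>2 = Re (B u u)" "0 \<le> q u" using p by (simp_all add: form_norm_def Re_B)
  then show "l2norm \<Omega> u \<le> q u" using ge unfolding Re_B[symmetric]
    by (metis power2_le_imp_le)
qed

sublocale semi_inner V g
proof
  show "subspace V" by (rule subspace_V)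
  show "g (r *\<^sub>R x) y = r * g x y" if "x \<in> V" "y \<in> V" for r x y
    unfolding g_def scaleR_eq_cmult B_lin(2,4)[OF that(1,1,2)] by (simp add: algebra_simps add_divide_distrib)
qed (auto simp: g_def B_lin(1,3) q_power2[symmetric] add_divide_distrib)

lemma nrm_eq_q: "nrm u = q u"
  by (simp add: nrm_def g_def form_norm_def Re_B)

text \<open>On the diagonal the sector controls the imaginary part. Polarisation extends this to a
  bound by \<open>g u u + g v v\<close>, and rescaling \<open>u\<close> and \<open>v\<close> in
  opposite ways turns the sum into a product.\<close>

lemma B_bounded: "\<exists>M\<ge>0. \<forall>u\<in>V. \<forall>v\<in>V. cmod (B u v) \<le> M * (q u * q v)"
proof -
  obtain \<theta> where \<theta>: "0 \<le> \<theta>" "\<theta> < pi/2"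
    "\<And>u. u \<in> V \<Longrightarrow> b u u - complex_of_real (\<gamma> * (l2norm \<Omega> u)\<^sup>2) \<in> sector \<theta>"
    using sv unfolding sectorial_vertex_def by blast
  have tan: "0 \<le> tan \<theta>" using \<theta>(1,2) tan_gt_zero[of \<theta>] by (cases "\<theta> = 0") auto
  define c where "c = 1 + tan \<theta>"
  have c: "c \<ge> 0" using tan by (simp add: c_def)
  have diag: "cmod (B u u) \<le> c * g u u" if u: "u \<in> V" for u
  proof -
    have im: "\<bar>Im (b u u)\<bar> \<le> tan \<theta> * (Re (b u u) - \<gamma> * (l2norm \<Omega> u)\<^sup>2)"
      using sectorD(2)[OF \<theta>(3)[OF u] \<theta>(1,2)] by simp
    have "Im (B u u) = Im (b u u)" by (simp add: B_def linner_self del: of_real_power)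
    moreover have "tan \<theta> * (Re (b u u) - \<gamma> * (l2norm \<Omega> u)\<^sup>2) \<le> tan \<theta> * Re (B u u)"
      using tan by (intro mult_left_mono) (auto simp: Re_B algebra_simps)
    ultimately have "\<bar>Im (B u u)\<bar> \<le> tan \<theta> * Re (B u u)" using im by linarith
    moreover have "0 \<le> Re (B u u)" using q_power2[OF u] by (metis zero_le_power2)
    ultimately show ?thesis using cmod_le[of "B u u"] by (simp add: c_def g_def algebra_simps)
  qed
  have pol: "cmod (B u v) \<le> c * (g u u + g v v)" if u: "u \<in> V" and v: "v \<in> V" for u v
  proof -
    define iv where "iv = (\<lambda>x. \<i> * v x)"
    have iv: "iv \<in> V" unfolding iv_def by (rule V_cmult[OF v])
    have giv: "g iv iv = g v v" unfolding iv_def by (simp add: g_def B_lin[OF v v V_cmult[OF v]] B_lin[OF v v v])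
    \<comment> \<open>Polarisation for a form that is conjugate linear in its second
      argument.\<close>
    have e: "4 * B u v = B (u + v) (u + v) - B (u - v) (u - v) + \<i> * B (u + iv) (u + iv) - \<i> * B (u - iv) (u - iv)"
      using u v iv
      by (simp add: B_lin(1,3) B_diff V_add V_diff)
         (simp add: iv_def B_lin(2,4)[OF v v u] B_lin(2,4)[OF v v V_cmult[OF v]] B_lin(2,4)[OF v v v] algebra_simps)
    have "cmod (4 * B u v) \<le> cmod (B (u + v) (u + v)) + cmod (B (u - v) (u - v))
       + cmod (\<i> * B (u + iv) (u + iv)) + cmod (\<i> * B (u - iv) (u - iv))"
      unfolding e by (meson norm_triangle_le norm_triangle_le_diff add_mono order_refl)
    also have "\<dots> \<le> c * g (u + v) (u + v) + c * g (u - v) (u - v) + c * g (u + iv) (u + iv) + c * g (u - iv) (u - iv)"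
      using diag[OF V_add[OF u v]] diag[OF V_diff[OF u v]] diag[OF V_add[OF u iv]] diag[OF V_diff[OF u iv]]
      by (simp add: norm_mult)
    also have "\<dots> = c * (4 * (g u u + g v v))"
      using u v iv by (simp add: g_add g_add_right g_diff g_diff_right V_add V_diff giv algebra_simps)
    finally show ?thesis by (simp add: norm_mult algebra_simps)
  qed
  have "cmod (B u v) \<le> 2 * c * (q u * q v)" if u: "u \<in> V" and v: "v \<in> V" for u v
  proof (rule scaled_bound[OF c q_nonneg[OF u] q_nonneg[OF v]])
    fix t :: real assume t: "0 < t"
    define r where "r = sqrt t"
    have r: "r > 0" "r * r = t" using t by (auto simp: r_def)
    have ru: "r *\<^sub>R u \<in> V" and rv: "(1 / r) *\<^sub>R v \<in> V" by (auto intro!: S_scale u v)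
    have "B (r *\<^sub>R u) ((1 / r) *\<^sub>R v) = B u v"
      unfolding scaleR_eq_cmult B_lin(2)[OF u u V_cmult[OF v]] B_lin(4)[OF v v u] using r by simp
    then have "cmod (B u v) \<le> c * (g (r *\<^sub>R u) (r *\<^sub>R u) + g ((1 / r) *\<^sub>R v) ((1 / r) *\<^sub>R v))"
      using pol[OF ru rv] by simp
    also have "g (r *\<^sub>R u) (r *\<^sub>R u) = t * (q u)\<^sup>2"
      using nrm_power2[OF u] u ru r by (simp add: g_scale g_scale_right nrm_eq_q mult.assoc[symmetric])
    also have "g ((1 / r) *\<^sub>R v) ((1 / r) *\<^sub>R v) = (q v)\<^sup>2 / t"
      using nrm_power2[OF v] v rv r by (simp add: g_scale g_scale_right nrm_eq_q field_simps)
    finally show "cmod (B u v) \<le> c * (t * (q u)\<^sup>2 + (q v)\<^sup>2 / t)" .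
  qed
  then show ?thesis using c by (intro exI[of _ "2 * c"]) auto
qed

end


locale closed_sectorial_form = sectorial_form +
  assumes cpl: "\<And>s. (\<And>n::nat. s n \<in> V) \<Longrightarrow>
    (\<And>e. e > 0 \<Longrightarrow> \<exists>N. \<forall>m\<ge>N. \<forall>n\<ge>N. q (s m - s n) < e) \<Longrightarrow> \<exists>u\<in>V. (\<lambda>n. q (s n - u)) \<longlonglongrightarrow> 0"
begin

sublocale semi_hilbert V g
  by unfold_locales (unfold nrm_eq_q, rule cpl)

lemma q_triangle: "x \<in> V \<Longrightarrow> y \<in> V \<Longrightarrow> z \<in> V \<Longrightarrow> q (x - z) \<le> q (x - y) + q (y - z)"
  using nrm_triangle_diff unfolding nrm_eq_q by blast

lemma l2norm_tendsto:
  assumes "\<And>n. s n \<in> V" "x \<in> V" "(\<lambda>n. q (s n - x)) \<longlonglongrightarrow> 0"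
  shows "(\<lambda>n. l2norm \<Omega> (s n - x)) \<longlonglongrightarrow> 0"
  by (rule Lim_null_comparison[OF _ assms(3)]) (simp add: l2norm_le_q V_diff assms)

lemma B_tendsto:
  assumes s: "\<And>n. s n \<in> V" and x: "x \<in> V" and v: "v \<in> V" and lim: "(\<lambda>n. q (s n - x)) \<longlonglongrightarrow> 0"
  shows "(\<lambda>n. B (s n) v) \<longlonglongrightarrow> B x v"
proof -
  obtain M where M: "M \<ge> 0" "\<And>u v. u \<in> V \<Longrightarrow> v \<in> V \<Longrightarrow> cmod (B u v) \<le> M * (q u * q v)" using B_bounded by blast
  show ?thesis
  proof (rule LIM_zero_cancel, rule Lim_null_comparison)
    show "\<forall>\<^sub>F n in sequentially. norm (B (s n) v - B x v) \<le> M * (q (s n - x) * q v)"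
      using M(2)[OF V_diff[OF s x] v] by (simp add: B_diff s x v)
    show "(\<lambda>n. M * (q (s n - x) * q v)) \<longlonglongrightarrow> 0"
      using tendsto_mult_right_zero[OF tendsto_mult_left_zero[OF lim]] .
  qed
qed

lemma b_tendsto:
  assumes s: "\<And>n. s n \<in> V" and x: "x \<in> V" and v: "v \<in> V" and lim: "(\<lambda>n. q (s n - x)) \<longlonglongrightarrow> 0"
  shows "(\<lambda>n. b (s n) v) \<longlonglongrightarrow> b x v"
proof -
  have e: "b u v = B u v - of_real (1 - \<gamma>) * linner \<Omega> u v" for u by (simp add: B_def)
  have "(\<lambda>n. linner \<Omega> (s n) v) \<longlonglongrightarrow> linner \<Omega> x v"
    by (rule linner_tendsto) (auto simp: V_L2 s x v intro: l2norm_tendsto[OF s x lim])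
  then show ?thesis unfolding e by (intro tendsto_intros B_tendsto[OF s x v lim])
qed

text \<open>Lax--Milgram is real and yields equality of real parts; testing with
  \<open>\<i> v\<close> recovers the imaginary parts. The second solution belongs to the adjoint
  problem and becomes the test element in \<open>assoc_opD\<close>.\<close>

lemma linner_solvable:
  assumes h: "L2 \<Omega> h"
  shows "\<exists>x\<in>V. \<forall>v\<in>V. B x v = linner \<Omega> h v" "\<exists>w\<in>V. \<forall>v\<in>V. B v w = linner \<Omega> v h"
proof -
  obtain M where M: "M \<ge> 0" "\<And>u v. u \<in> V \<Longrightarrow> v \<in> V \<Longrightarrow> cmod (B u v) \<le> M * (q u * q v)" using B_bounded by blast
  have bd: "\<bar>Re (B x y)\<bar> \<le> M * (nrm x * nrm y)" if "x \<in> V" "y \<in> V" for x y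
    using M(2)[OF that] abs_Re_le_cmod[of "B x y"] by (simp add: nrm_eq_q)
  have hbd: "\<bar>Re (linner \<Omega> h y)\<bar> \<le> l2norm \<Omega> h * nrm y" if y: "y \<in> V" for y
  proof -
    have "\<bar>Re (linner \<Omega> h y)\<bar> \<le> l2norm \<Omega> h * l2norm \<Omega> y"
      using linner_integrable(2)[OF h V_L2[OF y]] abs_Re_le_cmod order_trans by blast
    also have "\<dots> \<le> l2norm \<Omega> h * q y" by (intro mult_left_mono l2norm_le_q y) auto
    finally show ?thesis by (simp add: nrm_eq_q)
  qed
  have sc: "Re (B (r *\<^sub>R x) y) = r * Re (B x y)" "Re (B y (r *\<^sub>R x)) = r * Re (B y x)" if "x \<in> V" "y \<in> V" for r x y
    unfolding scaleR_eq_cmult B_lin(2,4)[OF that(1,1,2)] by simp_all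
  have co: "g x x \<le> Re (B x x)" if "x \<in> V" for x by (simp add: g_def)
  have Fs: "Re (linner \<Omega> h (r *\<^sub>R x)) = r * Re (linner \<Omega> h x)" for r x
    unfolding scaleR_eq_cmult linner_cmult_right by simp
  have "\<exists>x\<in>V. \<forall>y\<in>V. Re (B x y) = Re (linner \<Omega> h y)"
  proof (rule lax_milgram[where B = "\<lambda>x y. Re (B x y)" and F = "\<lambda>y. Re (linner \<Omega> h y)", OF _ _ _ _ bd co _ Fs hbd])
    show "Re (linner \<Omega> h (x + y)) = Re (linner \<Omega> h x) + Re (linner \<Omega> h y)" if "x \<in> V" "y \<in> V" for x y
      using that by (simp add: linner_add_right V_L2 h)
  qed (simp_all add: B_lin(1,3) sc)
  then obtain x where x: "x \<in> V" "\<And>y. y \<in> V \<Longrightarrow> Re (B x y) = Re (linner \<Omega> h y)" by blast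
  have "B x v = linner \<Omega> h v" if v: "v \<in> V" for v
    using x(2)[OF v] x(2)[OF V_cmult[OF v, of \<i>]]
    by (simp add: complex_eq_iff B_lin(4)[OF v v x(1)] linner_cmult_right)
  then show "\<exists>x\<in>V. \<forall>v\<in>V. B x v = linner \<Omega> h v" using x(1) by blast
  have "\<exists>w\<in>V. \<forall>y\<in>V. Re (B y w) = Re (linner \<Omega> h y)"
  proof (rule lax_milgram[where B = "\<lambda>x y. Re (B y x)" and F = "\<lambda>y. Re (linner \<Omega> h y)", OF _ _ _ _ _ co _ Fs hbd])
    show "Re (linner \<Omega> h (x + y)) = Re (linner \<Omega> h x) + Re (linner \<Omega> h y)" if "x \<in> V" "y \<in> V" for x y
      using that by (simp add: linner_add_right V_L2 h)
    show "\<bar>Re (B y x)\<bar> \<le> M * (nrm x * nrm y)" if "x \<in> V" "y \<in> V" for x y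
      using bd[OF that(2,1)] by (simp add: mult.commute)
  qed (simp_all add: B_lin(1,3) sc)
  then obtain w where w: "w \<in> V" "\<And>y. y \<in> V \<Longrightarrow> Re (B y w) = Re (linner \<Omega> h y)" by blast
  have "B v w = linner \<Omega> v h" if v: "v \<in> V" for v
  proof -
    have "B v w = cnj (linner \<Omega> h v)"
      using w(2)[OF v] w(2)[OF V_cmult[OF v, of \<i>]]
      by (simp add: complex_eq_iff B_lin(2)[OF v v w(1)] linner_cmult_right)
    then show ?thesis by (simp add: cnj_linner)
  qed
  then show "\<exists>w\<in>V. \<forall>v\<in>V. B v w = linner \<Omega> v h" using w(1) by blast
qed

text \<open>The domain of the operator that belongs to the closed form.\<close>

definition N where "N = {x \<in> V. \<exists>f. L2 \<Omega> f \<and> (\<forall>v\<in>V. b x v = linner \<Omega> f v)}"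

text \<open>Duality: Lax--Milgram on the closure of \<open>N\<close>, with the arguments of
  \<open>B\<close> exchanged, gives \<open>w\<close> in that closure such that
  \<open>B y (w - u)\<close> has real part 0 for all \<open>y\<close> there. With
  \<open>d = w - u\<close>, the solution \<open>x\<close> of
  \<open>B x v = linner \<Omega> d v\<close> lies in \<open>N\<close>, and testing with it makes the
  L2 norm of \<open>d\<close> vanish. So \<open>u\<close> is approximated because \<open>w\<close>
  is.\<close>

lemma N_dense:
  assumes u: "u \<in> V" and e: "e > 0"
  shows "\<exists>x\<in>N. q (x - u) < e"
proof -
  have NV: "N \<subseteq> V" by (auto simp: N_def)
  have subN: "subspace N"
    unfolding subspace_def
  proof (intro conjI ballI allI)
    have "b 0 v = linner \<Omega> 0 v" if "v \<in> V" for v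
      using b_lin(2)[OF V_0 V_0 that, of 0] linner_cmult_left[of \<Omega> 0 0 v] by (simp add: zero_fun_def)
    moreover have "L2 \<Omega> 0" using V_0 V_L2 by blast
    ultimately show "0 \<in> N" using V_0 by (auto simp: N_def)
  next
    fix x y assume "x \<in> N" "y \<in> N"
    then obtain f f' where "x \<in> V" "y \<in> V" and f: "L2 \<Omega> f" "\<forall>v\<in>V. b x v = linner \<Omega> f v"
      and f': "L2 \<Omega> f'" "\<forall>v\<in>V. b y v = linner \<Omega> f' v" by (auto simp: N_def)
    moreover from this have "\<forall>v\<in>V. b (x + y) v = linner \<Omega> (f + f') v"
      by (simp add: b_lin(1) linner_add_left V_L2)
    moreover have "L2 \<Omega> (f + f')" by (rule L2_add[OF f(1) f'(1)])
    ultimately show "x + y \<in> N" using V_add by (auto simp: N_def)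
  next
    fix x and c :: real assume "x \<in> N"
    then obtain f where x: "x \<in> V" and f: "L2 \<Omega> f" "\<forall>v\<in>V. b x v = linner \<Omega> f v" by (auto simp: N_def)
    then have "\<forall>v\<in>V. b (c *\<^sub>R x) v = linner \<Omega> (\<lambda>y. of_real c * f y) v"
      by (simp add: scaleR_eq_cmult b_lin(2)[OF x x] linner_cmult_left)
    then show "c *\<^sub>R x \<in> N"
      using x L2_cmult(1)[OF f(1)] S_scale by (auto simp: N_def)
  qed
  define Nc where "Nc = {x \<in> V. \<forall>e>0. \<exists>y\<in>N. nrm (y - x) < e}"
  interpret Nc: semi_hilbert Nc g
    unfolding Nc_def by (rule closure_subspace[OF subN NV])
  have NcV: "x \<in> Nc \<Longrightarrow> x \<in> V" for x by (simp add: Nc_def)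
  have NNc: "x \<in> N \<Longrightarrow> x \<in> Nc" for x
    using NV by (auto simp: Nc_def nrm_eq_q q_0 intro!: bexI[of _ x])
  obtain M where M: "M \<ge> 0" "\<And>u v. u \<in> V \<Longrightarrow> v \<in> V \<Longrightarrow> cmod (B u v) \<le> M * (q u * q v)" using B_bounded by blast
  have bd: "\<bar>Re (B x y)\<bar> \<le> M * (nrm x * nrm y)" if "x \<in> V" "y \<in> V" for x y
    using M(2)[OF that] abs_Re_le_cmod[of "B x y"] by (simp add: nrm_eq_q)
  have sc: "Re (B (r *\<^sub>R x) y) = r * Re (B x y)" "Re (B y (r *\<^sub>R x)) = r * Re (B y x)" if "x \<in> V" "y \<in> V" for r x y
    unfolding scaleR_eq_cmult B_lin(2,4)[OF that(1,1,2)] by simp_all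
  have "\<exists>w\<in>Nc. \<forall>y\<in>Nc. Re (B y w) = Re (B y u)"
  proof (rule Nc.lax_milgram[where B = "\<lambda>x y. Re (B y x)" and M = M and K = "M * nrm u"])
    show "\<bar>Re (B y x)\<bar> \<le> M * (nrm x * nrm y)" if "x \<in> Nc" "y \<in> Nc" for x y
      using bd[OF NcV[OF that(2)] NcV[OF that(1)]] by (simp add: mult.commute)
    show "\<bar>Re (B x u)\<bar> \<le> M * nrm u * nrm x" if "x \<in> Nc" for x
      using bd[OF NcV[OF that] u] by (simp add: mult_ac)
  qed (auto simp: NcV B_lin(1,3) sc u g_def)
  then obtain w where w: "w \<in> Nc" "\<And>y. y \<in> Nc \<Longrightarrow> Re (B y w) = Re (B y u)" by blast
  have wV: "w \<in> V" by (rule NcV[OF w(1)])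
  define d where "d = w - u"
  have dV: "d \<in> V" unfolding d_def by (rule V_diff[OF wV u])
  have dL: "L2 \<Omega> d" by (rule V_L2[OF dV])
  obtain x where x: "x \<in> V" "\<And>v. v \<in> V \<Longrightarrow> B x v = linner \<Omega> d v" using linner_solvable(1)[OF dL] by blast
  have "b x v = linner \<Omega> (d - (\<lambda>y. of_real (1 - \<gamma>) * x y)) v" if v: "v \<in> V" for v
    unfolding linner_diff_left[OF dL L2_cmult(1)[OF V_L2[OF x(1)]] V_L2[OF v]] linner_cmult_left
    using x(2)[OF v] by (simp add: B_def algebra_simps)
  moreover have "L2 \<Omega> (d - (\<lambda>y. of_real (1 - \<gamma>) * x y))"
    by (intro L2_diff dL L2_cmult V_L2 x)
  ultimately have "x \<in> N" using x(1) unfolding N_def by blast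
  then have "Re (B x w) = Re (B x u)" by (intro w(2) NNc)
  then have "Re (B x d) = 0" by (simp add: d_def B_diff wV u x(1))
  then have nd: "l2norm \<Omega> d = 0" using x(2)[OF dV] by (simp add: linner_self)
  then have qd: "q d = 0" using b_null(1)[OF dV dV nd] by (simp add: form_norm_def)
  obtain y where y: "y \<in> N" "q (y - w) < e" using w(1) e by (auto simp: Nc_def nrm_eq_q)
  have "q (y - u) \<le> q (y - w) + q (w - u)" using y(1) NV wV u by (intro q_triangle) auto
  then show ?thesis using y qd by (auto simp: d_def intro!: bexI[of _ y])
qed

end

section \<open>Closable forms and the associated operator\<close>

text \<open>The closure of a closable form \<open>r\<close>: a closed form on a set of L2 functions
  that extends \<open>r\<close> and in which \<open>D\<close> is dense.\<close>

locale form_closure = closed_sectorial_form \<Omega> b V \<gamma>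
  for \<Omega> :: "(real^'n) set" and b V \<gamma> +
  fixes D :: "(real^'n \<Rightarrow> complex) set" and r :: "(real^'n \<Rightarrow> complex) \<Rightarrow> (real^'n \<Rightarrow> complex) \<Rightarrow> complex"
  assumes D_subset: "D \<subseteq> V"
    and extends: "\<And>u v. u \<in> D \<Longrightarrow> v \<in> D \<Longrightarrow> b u v = r u v"
    and dense: "\<And>x e. x \<in> V \<Longrightarrow> e > 0 \<Longrightarrow> \<exists>y\<in>D. q (y - x) < e"
begin

lemma approximating_sequence:
  assumes "x \<in> V" shows "\<exists>s. (\<forall>n. s n \<in> D) \<and> (\<forall>n. q (s n - x) < inverse (real (Suc n))) \<and> (\<lambda>n. q (s n - x)) \<longlonglongrightarrow> 0"
proof -
  have "\<forall>n. \<exists>y\<in>D. q (y - x) < inverse (real (Suc n))" using dense[OF assms] by simp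
  then obtain s where s: "\<And>n. s n \<in> D" "\<And>n. q (s n - x) < inverse (real (Suc n))" by metis
  have "0 \<le> q (s n - x)" for n using s(1) D_subset assms by (intro q_nonneg V_diff) auto
  then have "(\<lambda>n. q (s n - x)) \<longlonglongrightarrow> 0"
    using s(2) by (intro Lim_null_comparison[OF _ LIMSEQ_inverse_real_of_nat]) (auto simp: less_imp_le)
  then show ?thesis using s by blast
qed

text \<open>An approximating sequence from \<open>D\<close> with distances below
  \<open>1 / (n + 1)\<close> has form norms at most \<open>1 + q x\<close>, which supplies the bound
  on real parts.\<close>

lemma assoc_opI:
  assumes x: "x \<in> V" and f: "L2 \<Omega> f" and eq: "\<And>v. v \<in> V \<Longrightarrow> b x v = linner \<Omega> f v"
  shows "(x, f) \<in> assoc_op \<Omega> r D"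
proof -
  obtain s where s: "\<And>n. s n \<in> D" "\<And>n. q (s n - x) < inverse (real (Suc n))" "(\<lambda>n. q (s n - x)) \<longlonglongrightarrow> 0"
    using approximating_sequence[OF x] by blast
  have sV: "s n \<in> V" for n using s(1) D_subset by blast
  have "(\<lambda>n. l2norm \<Omega> (\<lambda>y. s n y - x y)) \<longlonglongrightarrow> 0"
    using l2norm_tendsto[OF sV x s(3)] by (simp add: fun_diff_def)
  moreover have "Re (r (s n) (s n)) \<le> (1 + \<bar>1 - \<gamma>\<bar>) * (1 + q x)\<^sup>2" for n
  proof -
    have "q (s n) \<le> q (s n - x) + q x" using nrm_le_diff_add[OF sV x] by (simp add: nrm_eq_q)
    moreover have "inverse (real (Suc n)) \<le> 1" by (simp add: field_simps)
    ultimately have qs: "q (s n) \<le> 1 + q x" using s(2)[of n] by linarith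
    have "Re (r (s n) (s n)) = Re (B (s n) (s n)) - (1 - \<gamma>) * (l2norm \<Omega> (s n))\<^sup>2"
      by (simp add: Re_B extends[OF s(1) s(1), symmetric])
    also have "\<dots> \<le> (q (s n))\<^sup>2 + \<bar>1 - \<gamma>\<bar> * (l2norm \<Omega> (s n))\<^sup>2"
      using mult_right_mono[OF abs_ge_minus_self[of "1 - \<gamma>"], of "(l2norm \<Omega> (s n))\<^sup>2"] by (simp add: q_power2[OF sV] algebra_simps)
    also have "\<dots> \<le> (q (s n))\<^sup>2 + \<bar>1 - \<gamma>\<bar> * (q (s n))\<^sup>2"
      by (intro add_left_mono mult_left_mono power_mono l2norm_le_q sV) auto
    also have "\<dots> = (1 + \<bar>1 - \<gamma>\<bar>) * (q (s n))\<^sup>2" by (simp add: algebra_simps)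
    also have "\<dots> \<le> (1 + \<bar>1 - \<gamma>\<bar>) * (1 + q x)\<^sup>2"
      by (intro mult_left_mono power_mono qs q_nonneg sV) auto
    finally show ?thesis .
  qed
  moreover have "(\<lambda>n. r (s n) v) \<longlonglongrightarrow> linner \<Omega> f v" if v: "v \<in> D" for v
  proof -
    have vV: "v \<in> V" using v D_subset by blast
    have "(\<lambda>n. b (s n) v) \<longlonglongrightarrow> b x v" by (rule b_tendsto[OF sV x vV s(3)])
    then show ?thesis by (simp add: extends[OF s(1) v] eq[OF vV])
  qed
  ultimately show ?thesis using f V_L2[OF x] s(1) unfolding assoc_op_def by blast
qed

text \<open>Lax--Milgram provides a candidate \<open>x'\<close> for the data \<open>f\<close> and
  \<open>x\<close>. The differences \<open>t n = s n - x'\<close> are bounded in form norm, and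
  \<open>B (t n) v\<close> tends to 0 for \<open>v\<close> in \<open>D\<close>, hence by density for
  all \<open>v\<close> in \<open>V\<close>. Testing with the adjoint solution \<open>w\<close> for
  \<open>y = x - x'\<close> gives \<open>|y|^2 = 0\<close>. The equality of \<open>x\<close> and
  \<open>x'\<close> is one in L2 only, because membership in \<open>V\<close> is not transported
  along null sets.\<close>

lemma assoc_opD:
  assumes xf: "(x, f) \<in> assoc_op \<Omega> r D"
  shows "\<exists>x'\<in>V. l2norm \<Omega> (x' - x) = 0 \<and> (\<forall>v\<in>V. b x' v = linner \<Omega> f v)"
proof -
  obtain s C where xL: "L2 \<Omega> x" and fL: "L2 \<Omega> f" and sD: "\<And>n. s n \<in> D"
    and sx: "(\<lambda>n. l2norm \<Omega> (\<lambda>y. s n y - x y)) \<longlonglongrightarrow> 0"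
    and C: "\<And>n. Re (r (s n) (s n)) \<le> C" and lim: "\<And>v. v \<in> D \<Longrightarrow> (\<lambda>n. r (s n) v) \<longlonglongrightarrow> linner \<Omega> f v"
    using xf unfolding assoc_op_def by blast
  have sx: "(\<lambda>n. l2norm \<Omega> (s n - x)) \<longlonglongrightarrow> 0" using sx by (simp add: fun_diff_def)
  have sV: "s n \<in> V" for n using sD D_subset by blast
  define h where "h = f + (\<lambda>y. of_real (1 - \<gamma>) * x y)"
  have hL: "L2 \<Omega> h" unfolding h_def by (intro L2_add fL L2_cmult xL)
  have hv: "linner \<Omega> h v = linner \<Omega> f v + of_real (1 - \<gamma>) * linner \<Omega> x v" if "L2 \<Omega> v" for v
    unfolding h_def linner_add_left[OF fL L2_cmult(1)[OF xL] that] linner_cmult_left by simp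
  obtain x' where x': "x' \<in> V" "\<And>v. v \<in> V \<Longrightarrow> B x' v = linner \<Omega> h v" using linner_solvable(1)[OF hL] by blast
  have x'L: "L2 \<Omega> x'" by (rule V_L2[OF x'(1)])
  define y where "y = x - x'"
  have yL: "L2 \<Omega> y" unfolding y_def by (rule L2_diff[OF xL x'L])
  obtain w where w: "w \<in> V" "\<And>v. v \<in> V \<Longrightarrow> B v w = linner \<Omega> v y" using linner_solvable(2)[OF yL] by blast
  define t where "t n = s n - x'" for n
  have tV: "t n \<in> V" for n unfolding t_def by (rule V_diff[OF sV x'(1)])
  obtain M where M: "M \<ge> 0" "\<And>u v. u \<in> V \<Longrightarrow> v \<in> V \<Longrightarrow> cmod (B u v) \<le> M * (q u * q v)" using B_bounded by blast
  have "Bseq (\<lambda>n. l2norm \<Omega> (s n - x))" using sx by (simp add: convergent_imp_Bseq convergentI)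
  then obtain R where R: "\<And>n. l2norm \<Omega> (s n - x) \<le> R" by (auto simp: Bseq_def)
  have "\<exists>K\<ge>0. \<forall>n. q (t n) \<le> K"
  proof -
    define C' where "C' = \<bar>C\<bar> + \<bar>1 - \<gamma>\<bar> * (R + l2norm \<Omega> x)\<^sup>2"
    have "q (t n) \<le> sqrt C' + q x'" for n
    proof -
      have ls: "l2norm \<Omega> (s n) \<le> R + l2norm \<Omega> x"
        using l2norm_triangle[OF L2_diff[OF V_L2[OF sV] xL] xL, of n] R[of n] by simp
      have "(q (s n))\<^sup>2 = Re (r (s n) (s n)) + (1 - \<gamma>) * (l2norm \<Omega> (s n))\<^sup>2"
        by (simp add: q_power2[OF sV] Re_B extends[OF sD sD])
      also have "\<dots> \<le> \<bar>C\<bar> + \<bar>1 - \<gamma>\<bar> * (l2norm \<Omega> (s n))\<^sup>2"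
        using C[of n] by (intro add_mono mult_right_mono) auto
      also have "\<dots> \<le> C'" unfolding C'_def
        by (intro add_left_mono mult_left_mono power_mono ls) auto
      finally have "q (s n) \<le> sqrt C'" using q_nonneg[OF sV] by (simp add: real_le_rsqrt)
      moreover have "q (s n - x') \<le> q (s n) + q x'"
        using q_triangle[OF sV V_0 x'(1), of n] nrm_minus_commute[OF V_0 x'(1)] by (simp add: nrm_eq_q)
      ultimately show ?thesis by (simp add: t_def)
    qed
    moreover have "0 \<le> C'" by (auto simp: C'_def)
    ultimately show ?thesis using q_nonneg[OF x'(1)] by (intro exI[of _ "sqrt C' + q x'"]) auto
  qed
  then obtain K where K: "K \<ge> 0" "\<And>n. q (t n) \<le> K" by blast
  have tv: "(\<lambda>n. B (t n) v) \<longlonglongrightarrow> 0" if v: "v \<in> D" for v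
  proof -
    have vV: "v \<in> V" using v D_subset by blast
    have "(\<lambda>n. r (s n) v + of_real (1 - \<gamma>) * linner \<Omega> (s n) v) \<longlonglongrightarrow> linner \<Omega> f v + of_real (1 - \<gamma>) * linner \<Omega> x v"
      by (intro tendsto_intros lim v linner_tendsto V_L2 sV xL vV sx)
    then have "(\<lambda>n. B (s n) v) \<longlonglongrightarrow> B x' v"
      by (simp add: B_def[of "s _"] extends[OF sD v] x'(2)[OF vV] hv[OF V_L2[OF vV]])
    then have "(\<lambda>n. B (s n) v - B x' v) \<longlonglongrightarrow> B x' v - B x' v" by (intro tendsto_intros)
    then show ?thesis by (simp add: t_def B_diff sV x' vV)
  qed
  have "(\<lambda>n. linner \<Omega> (t n) y) \<longlonglongrightarrow> linner \<Omega> y y"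
  proof (rule linner_tendsto[OF V_L2[OF tV] yL yL])
    show "(\<lambda>n. l2norm \<Omega> (t n - y)) \<longlonglongrightarrow> 0" using sx by (simp add: t_def y_def)
  qed
  then have tw: "(\<lambda>n. cmod (B (t n) w)) \<longlonglongrightarrow> cmod (linner \<Omega> y y)"
    by (simp add: w(2)[OF tV] tendsto_norm)
  have "cmod (linner \<Omega> y y) \<le> 0 + e" if e: "e > 0" for e
  proof -
    define d where "d = e / (M * K + 1)"
    have MK: "M * K + 1 > 0" using M K by (intro add_nonneg_pos mult_nonneg_nonneg) auto
    have "d > 0" using e MK by (simp add: d_def)
    then obtain v where v: "v \<in> D" "q (v - w) < d" using dense[OF w(1)] by blast
    have vV: "v \<in> V" using v D_subset by blast
    have "cmod (B (t n) w) \<le> cmod (B (t n) v) + M * (K * d)" for n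
    proof -
      have "B (t n) w = B (t n) v - B (t n) (v - w)" by (simp add: B_diff tV w vV)
      then have "cmod (B (t n) w) \<le> cmod (B (t n) v) + cmod (B (t n) (v - w))"
        by (simp add: norm_triangle_ineq4)
      also have "cmod (B (t n) (v - w)) \<le> M * (q (t n) * q (v - w))"
        by (rule M(2)[OF tV V_diff[OF vV w(1)]])
      also have "\<dots> \<le> M * (K * d)"
        using v(2) K M q_nonneg[OF tV] q_nonneg[OF V_diff[OF vV w(1)]] by (intro mult_left_mono mult_mono) auto
      finally show ?thesis by simp
    qed
    moreover have "(\<lambda>n. cmod (B (t n) v) + M * (K * d)) \<longlonglongrightarrow> cmod 0 + M * (K * d)"
      by (intro tendsto_intros tv v(1))
    ultimately have "cmod (linner \<Omega> y y) \<le> cmod 0 + M * (K * d)"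
      using tw by (intro LIMSEQ_le) auto
    also have "\<dots> \<le> (M * K + 1) * d" using \<open>d > 0\<close> by (simp add: algebra_simps)
    also have "\<dots> = e" using MK by (simp add: d_def)
    finally show ?thesis by simp
  qed
  then have "cmod (linner \<Omega> y y) \<le> 0" by (rule field_le_epsilon)
  then have y0: "l2norm \<Omega> y = 0" by (simp add: linner_self)
  have "b x' v = linner \<Omega> f v" if v: "v \<in> V" for v
  proof -
    have "linner \<Omega> x v - linner \<Omega> x' v = 0"
      using linner_null(1)[OF yL V_L2[OF v] y0] linner_diff_left[OF xL x'L V_L2[OF v]] by (simp add: y_def)
    then show ?thesis using x'(2)[OF v] hv[OF V_L2[OF v]] by (simp add: B_def)
  qed
  moreover have "l2norm \<Omega> (x' - x) = 0" using y0 by (simp add: y_def l2norm_minus_commute)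
  ultimately show ?thesis using x'(1) by blast
qed

end


section \<open>Uniqueness of the closable form with a given operator\<close>

lemma sesq_form_mono:
  assumes "sesq_form \<Omega> b V" "D \<subseteq> V" "0 \<in> D" "\<And>u v. u \<in> D \<Longrightarrow> v \<in> D \<Longrightarrow> u + v \<in> D"
    "\<And>c u. u \<in> D \<Longrightarrow> (\<lambda>x. c * u x) \<in> D"
  shows "sesq_form \<Omega> b D"
proof -
  have lin: "b (\<lambda>x. u x + v x) w = b u w + b v w \<and> b (\<lambda>x. c * u x) w = c * b u w \<and>
      b w (\<lambda>x. u x + v x) = b w u + b w v \<and> b w (\<lambda>x. c * u x) = cnj c * b w u"
    if "u \<in> D" "v \<in> D" "w \<in> D" for u v w c
  proof -
    have "u \<in> V" "v \<in> V" "w \<in> V" using that assms(2) by auto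
    then show ?thesis using assms(1) unfolding sesq_form_def by blast
  qed
  have "L2 \<Omega> u" "l2norm \<Omega> u = 0 \<Longrightarrow> v \<in> D \<Longrightarrow> b u v = 0 \<and> b v u = 0" if "u \<in> D" for u v
    using that assms(1,2) unfolding sesq_form_def by blast+
  then show ?thesis
    unfolding sesq_form_def using lin assms(3-5) by (auto simp: zero_fun_def plus_fun_def)
qed

lemma sectorial_vertex_mono:
  assumes "sectorial_vertex \<Omega> b V \<gamma>" "D \<subseteq> V" "0 \<in> D" "\<And>u v. u \<in> D \<Longrightarrow> v \<in> D \<Longrightarrow> u + v \<in> D"
    "\<And>c u. u \<in> D \<Longrightarrow> (\<lambda>x. c * u x) \<in> D"
  shows "sectorial_vertex \<Omega> b D \<gamma>"
  using assms(1,2) sesq_form_mono[OF _ assms(2-5)] unfolding sectorial_vertex_def by blast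

text \<open>The closed extension supplied by closability may be too large; the closure of
  \<open>D\<close> inside it is still complete and has \<open>D\<close> as a dense subset.\<close>

lemma closable_form_closure:
  assumes sec: "sesq_form \<Omega> r D" and cl: "closable \<Omega> r D"
  shows "\<exists>b V \<gamma>. form_closure \<Omega> b V \<gamma> D r"
proof -
  obtain b Db \<gamma> where DDb: "D \<subseteq> Db" and agree: "\<And>u v. u \<in> D \<Longrightarrow> v \<in> D \<Longrightarrow> b u v = r u v"
    and sv: "sectorial_vertex \<Omega> b Db \<gamma>"
    and cpl: "\<And>s. (\<forall>n. s n \<in> Db) \<Longrightarrow>
       (\<forall>e>0. \<exists>N. \<forall>m\<ge>N. \<forall>n\<ge>N. form_norm \<Omega> b \<gamma> (\<lambda>x. s m x - s n x) < e) \<Longrightarrow>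
       (\<exists>u\<in>Db. (\<lambda>n. form_norm \<Omega> b \<gamma> (\<lambda>x. s n x - u x)) \<longlonglongrightarrow> 0)"
    using cl unfolding closable_def closed_form_def by blast
  interpret F: closed_sectorial_form \<Omega> b Db \<gamma>
    by unfold_locales (use sv cpl in \<open>auto simp: fun_diff_def\<close>)
  have D0: "0 \<in> D" and Dadd: "\<And>u v. u \<in> D \<Longrightarrow> v \<in> D \<Longrightarrow> u + v \<in> D" and Dc: "\<And>u c. u \<in> D \<Longrightarrow> (\<lambda>x. c * u x) \<in> D"
    using sec unfolding sesq_form_def zero_fun_def plus_fun_def by blast+
  have subD: "subspace D" unfolding subspace_def F.scaleR_eq_cmult using D0 Dadd Dc by blast
  define V where "V = {x \<in> Db. \<forall>e>0. \<exists>y\<in>D. F.nrm (y - x) < e}"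
  interpret V: semi_hilbert V F.g
    unfolding V_def by (rule F.closure_subspace[OF subD DDb])
  have VDb: "V \<subseteq> Db" by (auto simp: V_def)
  \<comment> \<open>The closure is known as a real subspace; complex scalars need the homogeneity of
    the form norm.\<close>
  have Vc: "(\<lambda>x. c * u x) \<in> V" if u: "u \<in> V" for c u
  proof -
    have uD: "u \<in> Db" using u VDb by blast
    have "\<exists>y\<in>D. F.nrm (y - (\<lambda>x. c * u x)) < e" if e: "e > 0" for e
    proof -
      have "e / (cmod c + 1) > 0" using e by (simp add: add_nonneg_pos)
      then have "\<exists>y\<in>D. F.nrm (y - u) < e / (cmod c + 1)" using u unfolding V_def by blast
      then obtain y where y: "y \<in> D" "F.nrm (y - u) < e / (cmod c + 1)" by blast
      have yu: "y - u \<in> Db" using y DDb uD by (intro F.V_diff) auto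
      define z where "z = y - u"
      have zD: "z \<in> Db" using yu by (simp add: z_def)
      have eq: "(\<lambda>x. c * y x) - (\<lambda>x. c * u x) = (\<lambda>x. c * z x)" by (simp add: z_def fun_eq_iff algebra_simps)
      have "F.B (\<lambda>x. c * z x) (\<lambda>x. c * z x) = c * cnj c * F.B z z"
        using F.B_lin(2)[OF zD zD F.V_cmult[OF zD]] F.B_lin(4)[OF zD zD zD] by simp
      also have "c * cnj c = of_real ((cmod c)\<^sup>2)" by (rule complex_norm_square[symmetric])
      finally have "F.g (\<lambda>x. c * z x) (\<lambda>x. c * z x) = (cmod c)\<^sup>2 * F.g z z"
        by (simp add: F.g_def del: of_real_power)
      then have "F.nrm ((\<lambda>x. c * y x) - (\<lambda>x. c * u x)) = cmod c * F.nrm (y - u)"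
        unfolding eq F.nrm_def z_def[symmetric] by (simp add: real_sqrt_mult)
      also have "\<dots> \<le> (cmod c + 1) * F.nrm (y - u)" using yu by (intro mult_right_mono) auto
      also have "\<dots> < e"
        using y(2) pos_less_divide_eq[of "cmod c + 1"] by (simp add: add_nonneg_pos mult.commute)
      finally show ?thesis using Dc[OF y(1)] by blast
    qed
    then show ?thesis using F.V_cmult[OF uD] unfolding V_def by blast
  qed
  have "D \<subseteq> V"
  proof
    fix x assume x: "x \<in> D"
    have "F.nrm (x - x) = 0" by (simp add: F.nrm_eq_q F.q_0)
    then have "\<exists>y\<in>D. F.nrm (y - x) < e" if "e > 0" for e using x that by (intro bexI[of _ x]) simp_all
    then show "x \<in> V" using x DDb unfolding V_def by blast
  qed
  moreover have "\<exists>u\<in>V. (\<lambda>n. form_norm \<Omega> b \<gamma> (s n - u)) \<longlonglongrightarrow> 0"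
    if "\<And>n::nat. s n \<in> V" "\<And>e. e > 0 \<Longrightarrow> \<exists>N. \<forall>m\<ge>N. \<forall>n\<ge>N. form_norm \<Omega> b \<gamma> (s m - s n) < e" for s
    by (rule V.complete[unfolded F.nrm_eq_q, OF that])
  moreover have "sectorial_vertex \<Omega> b V \<gamma>"
    by (rule sectorial_vertex_mono[OF sv VDb V.S_0 V.S_add Vc])
  moreover have "\<exists>y\<in>D. form_norm \<Omega> b \<gamma> (y - x) < e" if "x \<in> V" "e > 0" for x e
    using that unfolding V_def F.nrm_eq_q by blast
  ultimately have "form_closure \<Omega> b V \<gamma> D r"
    using agree by unfold_locales auto
  then show ?thesis by blast
qed

text \<open>The vector \<open>u\<close> is approximated from the operator domain of the first form.
  The common operator carries the approximants to \<open>V'\<close>, where they converge too, to a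
  vector that agrees with \<open>u\<close> almost everywhere; both forms have the same values along
  the way.\<close>

lemma closable_form_unique:
  assumes r: "sesq_form \<Omega> r D" "closable \<Omega> r D" and r': "sesq_form \<Omega> r' D" "closable \<Omega> r' D"
    and eq: "assoc_op \<Omega> r D = assoc_op \<Omega> r' D" and u: "u \<in> D" and v: "v \<in> D"
  shows "r u v = r' u v"
proof -
  obtain b V \<gamma> where "form_closure \<Omega> b V \<gamma> D r" using closable_form_closure[OF r] by blast
  then interpret F: form_closure \<Omega> b V \<gamma> D r .
  obtain b' V' \<gamma>' where "form_closure \<Omega> b' V' \<gamma>' D r'" using closable_form_closure[OF r'] by blast
  then interpret F': form_closure \<Omega> b' V' \<gamma>' D r' .
  have uV: "u \<in> V" "u \<in> V'" and vV: "v \<in> V" "v \<in> V'" using u v F.D_subset F'.D_subset by auto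
  have "\<forall>n. \<exists>x\<in>F.N. F.q (x - u) < inverse (real (Suc n))" using F.N_dense[OF uV(1)] by simp
  then obtain x where xN: "\<And>n. x n \<in> F.N" and xq: "\<And>n. F.q (x n - u) < inverse (real (Suc n))" by metis
  have xV: "x n \<in> V" for n using xN by (auto simp: F.N_def)
  have "\<forall>n. \<exists>f. L2 \<Omega> f \<and> (\<forall>v\<in>V. b (x n) v = linner \<Omega> f v)" using xN by (auto simp: F.N_def)
  then obtain f where fL: "\<And>n. L2 \<Omega> (f n)" and f: "\<And>n v. v \<in> V \<Longrightarrow> b (x n) v = linner \<Omega> (f n) v" by metis
  have "\<exists>x'\<in>V'. l2norm \<Omega> (x' - x n) = 0 \<and> (\<forall>v\<in>V'. b' x' v = linner \<Omega> (f n) v)" for n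
    using F'.assoc_opD F.assoc_opI[OF xV fL f] eq by blast
  then obtain x' where x'V: "\<And>n. x' n \<in> V'" and x'x: "\<And>n. l2norm \<Omega> (x' n - x n) = 0"
    and f': "\<And>n v. v \<in> V' \<Longrightarrow> b' (x' n) v = linner \<Omega> (f n) v" by metis
  have xL: "L2 \<Omega> (x n)" and x'L: "L2 \<Omega> (x' n)" for n using F.V_L2[OF xV] F'.V_L2[OF x'V] by auto
  have xlim: "(\<lambda>n. F.q (x n - u)) \<longlonglongrightarrow> 0"
    using xq F.q_nonneg[OF F.V_diff[OF xV uV(1)]]
    by (intro Lim_null_comparison[OF _ LIMSEQ_inverse_real_of_nat]) (auto simp: less_imp_le)
  \<comment> \<open>The two closures may have different vertices; \<open>c\<close> absorbs the
    resulting L2 term.\<close>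
  define c where "c = 1 + \<bar>\<gamma> - \<gamma>'\<bar>"
  have key: "F'.q (x' m - x' n) \<le> c * F.q (x m - x n)" for m n
  proof -
    define d where "d = x m - x n"
    define d' where "d' = x' m - x' n"
    have d: "d \<in> V" "L2 \<Omega> d" and d': "d' \<in> V'" "L2 \<Omega> d'"
      using F.V_diff[OF xV xV] F'.V_diff[OF x'V x'V] F.V_L2 F'.V_L2 by (auto simp: d_def d'_def)
    have "d' - d = (x' m - x m) - (x' n - x n)" by (simp add: d_def d'_def)
    then have "l2norm \<Omega> (d' - d) \<le> l2norm \<Omega> (x' m - x m) + l2norm \<Omega> (x' n - x n)"
      using sqi_diff(2)[of "lebesgue_on \<Omega>" "x' m - x m" "x' n - x n"] L2_diff[OF x'L xL]
      by (simp add: l2norm_eq_sqn L2_iff_sqi fun_diff_def)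
    then have null: "l2norm \<Omega> (d' - d) = 0" using x'x l2norm_nonneg[of \<Omega> "d' - d"] by simp
    have inn: "linner \<Omega> h d' = linner \<Omega> h d" if "L2 \<Omega> h" for h
      using linner_null(2)[OF L2_diff[OF d'(2) d(2)] that null] linner_diff_right[OF d'(2) d(2) that] by simp
    \<comment> \<open>Both forms act on these differences through the same right-hand sides
      \<open>f m\<close> and \<open>f n\<close>, so their values on the diagonal coincide.\<close>
    have "b' d' d' = b' (x' m) d' - b' (x' n) d'"
      unfolding d'_def[symmetric] using F'.b_diff(1)[OF x'V x'V d'(1), of m n] by (simp add: d'_def)
    also have "\<dots> = linner \<Omega> (f m) d - linner \<Omega> (f n) d" by (simp add: f' d' inn fL)
    also have "\<dots> = b d d"
      using F.b_diff(1)[OF xV xV d(1), of m n] by (simp add: d_def[symmetric] f d)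
    finally have bb: "b' d' d' = b d d" .
    have "linner \<Omega> d' d' = linner \<Omega> d d"
      using inn[OF d'(2)] inn[OF d(2)] by (metis cnj_linner)
    then have ll: "(l2norm \<Omega> d')\<^sup>2 = (l2norm \<Omega> d)\<^sup>2" by (simp only: linner_self of_real_eq_iff)
    have "(F'.q d')\<^sup>2 = (F.q d)\<^sup>2 + (\<gamma> - \<gamma>') * (l2norm \<Omega> d)\<^sup>2"
      unfolding F'.q_power2[OF d'(1)] F.q_power2[OF d(1)] F'.Re_B F.Re_B bb ll by (simp add: algebra_simps)
    also have "\<dots> \<le> (F.q d)\<^sup>2 + \<bar>\<gamma> - \<gamma>'\<bar> * (F.q d)\<^sup>2"
      by (intro add_left_mono mult_mono power_mono F.l2norm_le_q d) auto
    also have "\<dots> = c * (F.q d)\<^sup>2" by (simp add: c_def algebra_simps)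
    also have "\<dots> \<le> c\<^sup>2 * (F.q d)\<^sup>2"
      using mult_left_mono[of 1 c c] by (intro mult_right_mono) (auto simp: c_def power2_eq_square)
    finally have "(F'.q d')\<^sup>2 \<le> (c * F.q d)\<^sup>2" by (simp add: power_mult_distrib)
    then have "F'.q d' \<le> c * F.q d"
      by (rule power2_le_imp_le) (use F.q_nonneg[OF d(1)] in \<open>simp add: c_def\<close>)
    then show ?thesis by (simp add: d_def d'_def)
  qed
  have "\<exists>w\<in>V'. (\<lambda>n. F'.q (x' n - w)) \<longlonglongrightarrow> 0"
  proof (rule F'.cpl[OF x'V])
    fix e :: real assume e: "e > 0"
    have c: "c > 0" by (simp add: c_def)
    then have "e / (2 * c) > 0" using e by simp
    then obtain N where N: "\<And>n. n \<ge> N \<Longrightarrow> F.q (x n - u) < e / (2 * c)"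
      using order_tendstoD(2)[OF xlim] unfolding eventually_sequentially by metis
    have "F'.q (x' m - x' n) < e" if mn: "m \<ge> N" "n \<ge> N" for m n
    proof -
      have "F.q (x m - x n) \<le> F.q (x m - u) + F.q (u - x n)" by (rule F.q_triangle[OF xV uV(1) xV])
      also have "F.q (u - x n) = F.q (x n - u)" using F.nrm_minus_commute[OF uV(1) xV] by (simp add: F.nrm_eq_q)
      finally have "F.q (x m - x n) < e / (2 * c) + e / (2 * c)" using N[OF mn(1)] N[OF mn(2)] by linarith
      then have "c * F.q (x m - x n) < c * (e / c)" using c by (intro mult_strict_left_mono) (simp_all add: field_simps)
      then show ?thesis using key[of m n] c by simp
    qed
    then show "\<exists>N. \<forall>m\<ge>N. \<forall>n\<ge>N. F'.q (x' m - x' n) < e" by blast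
  qed
  then obtain w where w: "w \<in> V'" "(\<lambda>n. F'.q (x' n - w)) \<longlonglongrightarrow> 0" by blast
  have wL: "L2 \<Omega> w" and uL: "L2 \<Omega> u" using F'.V_L2 w(1) uV(2) by auto
  \<comment> \<open>The limit in \<open>V'\<close> is compared with \<open>u\<close> in L2 only; by
    the null condition this is enough for the form.\<close>
  have "l2norm \<Omega> (w - u) \<le> l2norm \<Omega> (x' n - w) + l2norm \<Omega> (x n - u)" for n
  proof -
    have "w - u = (w - x' n) + ((x' n - x n) + (x n - u))" by simp
    then have "l2norm \<Omega> (w - u) \<le> l2norm \<Omega> (w - x' n) + l2norm \<Omega> ((x' n - x n) + (x n - u))"
      by (metis l2norm_triangle L2_add L2_diff wL uL xL x'L)
    also have "l2norm \<Omega> ((x' n - x n) + (x n - u)) \<le> l2norm \<Omega> (x' n - x n) + l2norm \<Omega> (x n - u)"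
      by (intro l2norm_triangle L2_diff uL xL x'L)
    finally show ?thesis using x'x[of n] l2norm_minus_commute[of \<Omega> w "x' n"] by linarith
  qed
  moreover have "(\<lambda>n. l2norm \<Omega> (x' n - w) + l2norm \<Omega> (x n - u)) \<longlonglongrightarrow> 0 + 0"
    by (intro tendsto_add F'.l2norm_tendsto[OF x'V w] F.l2norm_tendsto[OF xV uV(1) xlim])
  ultimately have "l2norm \<Omega> (w - u) \<le> 0 + 0" by (intro LIMSEQ_le_const) auto
  then have null: "l2norm \<Omega> (w - u) = 0" using l2norm_nonneg[of \<Omega> "w - u"] by simp
  have "b' (w - u) v = 0" by (rule F'.b_null(1)[OF F'.V_diff[OF w(1) uV(2)] vV(2) null])
  then have "b' w v = b' u v" by (simp add: F'.b_diff w(1) uV vV)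
  moreover have "(\<lambda>n. b' (x' n) v) \<longlonglongrightarrow> b' w v" by (rule F'.b_tendsto[OF x'V w(1) vV(2) w(2)])
  moreover have "(\<lambda>n. b (x n) v) \<longlonglongrightarrow> b u v" by (rule F.b_tendsto[OF xV uV(1) vV(1) xlim])
  moreover have "b' (x' n) v = b (x n) v" for n by (simp add: f f' vV)
  ultimately have "b' u v = b u v" using LIMSEQ_unique by simp
  then show ?thesis using F.extends[OF u v] F'.extends[OF u v] by simp
qed

section \<open>The pointwise projection onto the singular directions\<close>

text \<open>For hermitian \<open>Z\<close> and an orthogonal projection \<open>Q\<close> this is the
  inverse of the compression of \<open>1 + iZ\<close> to the range of \<open>Q\<close>, extended by
  zero.\<close>

definition Wmat :: "complex^'n^'n \<Rightarrow> complex^'n^'n \<Rightarrow> complex^'n^'n" where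
  "Wmat Z Q = Q ** matrix_inv (mat 1 + cscale \<i> (Q ** Z ** Q)) ** Q"

text \<open>The product of \<open>H x\<close> with \<open>x\<close> is real, so the term with the
  factor \<open>\<i>\<close> is purely imaginary.\<close>

lemma Re_cdot_one_plus_i_hermitian:
  assumes "hermitian H"
  shows "Re (cdot (x + \<i> *s (H *v x)) x) = (norm x)\<^sup>2" "Re (cdot x (x + \<i> *s (H *v x))) = (norm x)\<^sup>2"
proof -
  show *: "Re (cdot (x + \<i> *s (H *v x)) x) = (norm x)\<^sup>2"
    using hermitian_Im_0[OF assms, of x] by (simp add: cdot_add_left cdot_smult_left cdot_self del: of_real_power)
  show "Re (cdot x (x + \<i> *s (H *v x))) = (norm x)\<^sup>2"
    using * by (metis cnj_cdot cnj.simps(1))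
qed

lemma invertible_one_plus_i_hermitian:
  fixes H :: "complex^'n^'n"
  assumes H: "hermitian H"
  shows "invertible (mat 1 + cscale \<i> H)"
proof -
  have mv: "(mat 1 + cscale \<i> H) *v x = x + \<i> *s (H *v x)" for x
    by (simp add: matrix_vector_mult_add_rdistrib cscale_mult_vec)
  have "x = y" if "(mat 1 + cscale \<i> H) *v x = (mat 1 + cscale \<i> H) *v y" for x y
  proof -
    have "(mat 1 + cscale \<i> H) *v (x - y) = 0" using that by (simp add: matrix_vector_mult_diff_distrib)
    then have "(norm (x - y))\<^sup>2 = 0"
      using Re_cdot_one_plus_i_hermitian(1)[OF H, of "x - y"] by (simp add: mv)
    then show ?thesis by simp
  qed
  then have "inj ((*v) (mat 1 + cscale \<i> H))" by (auto simp: inj_def)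
  then obtain B where "B ** (mat 1 + cscale \<i> H) = mat 1"
    using matrix_left_invertible_injective by blast
  then show ?thesis using invertible_left_inverse by blast
qed

locale projection_data =
  fixes Z Q :: "complex^'n^'n"
  assumes hZ: "hermitian Z" and hQ: "hermitian Q" and QQ: "Q ** Q = Q"
begin

abbreviation "W \<equiv> Wmat Z Q"
abbreviation "P \<equiv> mat 1 - Q"
abbreviation "R \<equiv> matrix_inv (mat 1 + cscale \<i> (Q ** Z ** Q))"

lemma hH: "hermitian (Q ** Z ** Q)"
  using hZ hQ by (simp add: hermitian_def adj_mult matrix_mul_assoc)

lemma R_inv: "(mat 1 + cscale \<i> (Q ** Z ** Q)) ** R = mat 1" "R ** (mat 1 + cscale \<i> (Q ** Z ** Q)) = mat 1"
  using someI_ex[OF invertible_one_plus_i_hermitian[OF hH, unfolded invertible_def]] by (simp_all add: matrix_inv_def)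

lemma QQv: "Q *v (Q *v x) = Q *v x" by (simp add: matrix_vector_mul_assoc QQ)

lemma Pv: "P *v x = x - Q *v x" by (simp add: matrix_vector_mult_diff_rdistrib)

lemma QPv: "Q *v (P *v x) = 0" by (simp add: Pv matrix_vector_mult_diff_distrib QQv)

lemma PQv: "P *v (Q *v x) = 0" by (simp add: Pv QQv)

lemma PPv: "P *v (P *v x) = P *v x" by (simp only: Pv[of "P *v x"] QPv diff_zero)

lemma Wv: "W *v x = Q *v (R *v (Q *v x))"
  by (simp add: Wmat_def matrix_vector_mul_assoc[symmetric])

lemma QWv: "Q *v (W *v x) = W *v x" by (simp add: Wv QQv)

lemma PWv: "P *v (W *v x) = 0" by (metis PQv QWv)

text \<open>Right inverse property for the compression, the one that solves the equation behind
  \<open>hat\<close>. Its mirror image \<open>W_left\<close> describes the difference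
  \<open>p - hat p\<close>.\<close>

lemma W_right: "W *v x + \<i> *s (Q *v (Z *v (W *v x))) = Q *v x"
proof -
  define y where "y = R *v (Q *v x)"
  have "y + \<i> *s (Q *v (Z *v (Q *v y))) = ((mat 1 + cscale \<i> (Q ** Z ** Q)) ** R) *v (Q *v x)"
    by (simp add: y_def matrix_vector_mul_assoc[symmetric] matrix_vector_mult_add_rdistrib cscale_mult_vec)
  then have "y + \<i> *s (Q *v (Z *v (Q *v y))) = Q *v x" by (simp add: R_inv)
  then have "Q *v (y + \<i> *s (Q *v (Z *v (Q *v y)))) = Q *v (Q *v x)" by simp
  then show ?thesis by (simp add: matrix_vector_right_distrib mult_vec_smult QQv Wv y_def)
qed

lemma W_left: "W *v x + \<i> *s (W *v (Z *v (Q *v x))) = Q *v x"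
proof -
  have "(R ** (mat 1 + cscale \<i> (Q ** Z ** Q))) *v (Q *v x) = Q *v x" by (simp add: R_inv)
  then have "R *v (Q *v x) + \<i> *s (R *v (Q *v (Z *v (Q *v x)))) = Q *v x"
    by (simp add: matrix_vector_mul_assoc[symmetric] matrix_vector_mult_add_rdistrib cscale_mult_vec
        matrix_vector_right_distrib mult_vec_smult QQv)
  then have "Q *v (R *v (Q *v x) + \<i> *s (R *v (Q *v (Z *v (Q *v x))))) = Q *v (Q *v x)" by simp
  then show ?thesis by (simp add: matrix_vector_right_distrib mult_vec_smult QQv Wv)
qed

lemma norm_Q_le: "norm (Q *v x) \<le> norm x"
proof -
  have "(norm (Q *v x))\<^sup>2 = Re (cdot (Q *v x) x)"
    using cdot_self[of "Q *v x"] by (metis cdot_hermitian[OF hQ] QQv Re_complex_of_real)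
  also have "\<dots> \<le> norm (Q *v x) * norm x" by (simp add: Re_cdot norm_cauchy_schwarz)
  finally show ?thesis by (cases "norm (Q *v x) = 0") (auto simp: power2_eq_square)
qed

lemma hP: "hermitian P" using hQ by (simp add: hermitian_def adj_diff)

lemma cdot_P: "cdot (P *v x) x = of_real ((norm (P *v x))\<^sup>2)"
  using cdot_self[of "P *v x"] by (metis cdot_hermitian[OF hP] PPv)

lemma norm_P_le: "norm (P *v x) \<le> norm x"
proof -
  have "(norm (P *v x))\<^sup>2 = Re (cdot (P *v x) x)" by (simp add: cdot_P del: of_real_power)
  also have "\<dots> \<le> norm (P *v x) * norm x" by (simp add: Re_cdot norm_cauchy_schwarz)
  finally show ?thesis by (cases "norm (P *v x) = 0") (auto simp: power2_eq_square)
qed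

text \<open>With \<open>y = R Q x\<close> and the hermitian matrix \<open>H = QZQ\<close> one has
  \<open>Q x = (1 + iH) y\<close>, so pairing \<open>y\<close> with \<open>Q x\<close> has real part
  \<open>|y|^2\<close>. Both accretivity and contractivity of \<open>W\<close> follow.\<close>

lemma W_resolvent:
  "Re (cdot (W *v x) x) = (norm (R *v (Q *v x)))\<^sup>2" "norm (R *v (Q *v x)) \<le> norm x"
proof -
  define y where "y = R *v (Q *v x)"
  have "((mat 1 + cscale \<i> (Q ** Z ** Q)) ** R) *v (Q *v x) = Q *v x" by (simp add: R_inv)
  then have Qx: "y + \<i> *s ((Q ** Z ** Q) *v y) = Q *v x"
    by (simp add: y_def matrix_vector_mul_assoc[symmetric] matrix_vector_mult_add_rdistrib cscale_mult_vec)
  have "cdot (W *v x) x = cdot y (Q *v x)" by (simp add: Wv y_def cdot_hermitian[OF hQ])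
  then show 1: "Re (cdot (W *v x) x) = (norm (R *v (Q *v x)))\<^sup>2"
    unfolding y_def[symmetric] using Re_cdot_one_plus_i_hermitian(2)[OF hH, of y] Qx by simp
  have "(norm y)\<^sup>2 = Re (cdot y (Q *v x))"
    using Re_cdot_one_plus_i_hermitian(2)[OF hH, of y] Qx by simp
  also have "\<dots> \<le> norm y * norm (Q *v x)" by (simp add: Re_cdot norm_cauchy_schwarz)
  also have "\<dots> \<le> norm y * norm x" by (intro mult_left_mono norm_Q_le) simp
  finally show "norm (R *v (Q *v x)) \<le> norm x"
    unfolding y_def[symmetric] by (cases "norm y = 0") (auto simp: power2_eq_square)
qed

lemma Re_cdot_W_nonneg: "0 \<le> Re (cdot (W *v x) x)" by (simp add: W_resolvent)

lemma norm_W_le: "norm (W *v x) \<le> norm x"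
  using order_trans[OF norm_Q_le W_resolvent(2), of x] by (simp add: Wv)

lemma adj_W_Q: "Q *v (adj W *v x) = adj W *v x"
proof -
  have "adj W = Q ** adj R ** Q" using hQ by (simp add: Wmat_def adj_mult hermitian_def matrix_mul_assoc)
  then show ?thesis by (simp add: matrix_vector_mul_assoc[symmetric] QQv)
qed

lemma norm_adj_W_le: "norm (adj W *v x) \<le> norm x"
proof -
  have "(norm (adj W *v x))\<^sup>2 = Re (cdot (W *v (adj W *v x)) x)"
    using cdot_self[of "adj W *v x"] cdot_adj[of W "adj W *v x" x] by simp
  also have "\<dots> \<le> norm (W *v (adj W *v x)) * norm x" by (simp add: Re_cdot norm_cauchy_schwarz)
  also have "\<dots> \<le> norm (adj W *v x) * norm x" by (intro mult_right_mono norm_W_le) simp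
  finally show ?thesis by (cases "norm (adj W *v x) = 0") (auto simp: power2_eq_square)
qed

end

text \<open>On the fibre $w + \operatorname{ran} Q$ the point \<open>hat\<close> is characterised by
  $Q((1 + iZ)w + aY) = 0$, that is, by the form vanishing in the singular test directions.\<close>

definition hat :: "complex^'n^'n \<Rightarrow> complex^'n^'n \<Rightarrow> complex^'n \<Rightarrow> complex \<times> (complex^'n) \<Rightarrow> complex \<times> (complex^'n)" where
  "hat Z Q Y p = (fst p, (mat 1 - Q) *v snd p - Wmat Z Q *v (\<i> *s (Z *v ((mat 1 - Q) *v snd p)) + fst p *s Y))"

text \<open>The part of a pair that its first component determines along the closure of the graph;
  see \<open>VV_fst_unique\<close>.\<close>

definition pr :: "complex^'n^'n \<Rightarrow> complex \<times> (complex^'n) \<Rightarrow> complex \<times> (complex^'n)" where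
  "pr Q p = (fst p, (mat 1 - Q) *v snd p)"

text \<open>In these variables the coefficients are bounded; the possibly unbounded and degenerate
  matrix is hidden inside the pairs.\<close>

definition form_integrand :: "complex^'n^'n \<Rightarrow> complex^'n \<Rightarrow> complex^'n \<Rightarrow> complex
    \<Rightarrow> complex \<times> (complex^'n) \<Rightarrow> complex \<times> (complex^'n) \<Rightarrow> complex" where
  "form_integrand Z X Y c p p' = cdot (snd p + \<i> *s (Z *v snd p)) (snd p') + cdot (snd p) X * cnj (fst p')
     + fst p * cdot Y (snd p') + c * fst p * cnj (fst p')"

definition psm :: "complex \<Rightarrow> complex \<times> (complex^'n) \<Rightarrow> complex \<times> (complex^'n)" where
  "psm c p = (c * fst p, c *s snd p)"

lemma norm_psm: "norm (psm c p) = cmod c * norm p"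
proof -
  have "norm (psm c p) = sqrt ((cmod c)\<^sup>2 * ((norm (fst p))\<^sup>2 + (norm (snd p))\<^sup>2))"
    by (simp add: psm_def norm_prod_def norm_mult norm_smult_vec power_mult_distrib algebra_simps)
  then show ?thesis by (simp add: real_sqrt_mult norm_prod_def)
qed

lemma form_integrand_add:
  "form_integrand Z X Y c (p + q) r = form_integrand Z X Y c p r + form_integrand Z X Y c q r"
  "form_integrand Z X Y c r (p + q) = form_integrand Z X Y c r p + form_integrand Z X Y c r q"
  by (simp_all add: form_integrand_def cdot_add_left cdot_add_right cdot_smult_left matrix_vector_right_distrib algebra_simps
      vector_add_ldistrib)

lemma form_integrand_diff:
  "form_integrand Z X Y c (p - q) r = form_integrand Z X Y c p r - form_integrand Z X Y c q r"
  "form_integrand Z X Y c r (p - q) = form_integrand Z X Y c r p - form_integrand Z X Y c r q"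
  using form_integrand_add(1)[of Z X Y c "p - q" q r] form_integrand_add(2)[of Z X Y c r "p - q" q] by simp_all

lemma form_integrand_psm:
  "form_integrand Z X Y c (psm a p) r = a * form_integrand Z X Y c p r"
  "form_integrand Z X Y c r (psm a p) = cnj a * form_integrand Z X Y c r p"
  by (simp_all add: form_integrand_def psm_def cdot_add_left cdot_smult_left cdot_smult_right mult_vec_smult algebra_simps)

lemma norm_fst_snd_le: "norm (fst p) \<le> norm p" "norm (snd p) \<le> norm p"
  by (metis norm_fst_le prod.collapse) (metis norm_snd_le prod.collapse)

lemma form_integrand_bound:
  assumes Z: "norm Z \<le> \<kappa>" and X: "norm X \<le> \<kappa>" and Y: "norm Y \<le> \<kappa>" and c: "cmod c \<le> \<kappa>"
  shows "cmod (form_integrand Z X Y c p p') \<le> (1 + 4 * \<kappa>) * (norm p * norm p')"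
proof -
  define m where "m = norm p * norm p'"
  have m0: "0 \<le> m" by (simp add: m_def)
  have k0: "0 \<le> \<kappa>" using Z norm_ge_zero order_trans by blast
  note b = norm_fst_snd_le[of p] norm_fst_snd_le[of p']
  have "cmod (cdot (snd p + \<i> *s (Z *v snd p)) (snd p')) \<le> norm (snd p + \<i> *s (Z *v snd p)) * norm (snd p')"
    by (rule norm_cdot_le)
  also have "\<dots> \<le> ((1 + \<kappa>) * norm p) * norm p'"
  proof (intro mult_mono b)
    have "norm (snd p + \<i> *s (Z *v snd p)) \<le> norm (snd p) + norm (Z *v snd p)"
      using norm_triangle_ineq[of "snd p" "\<i> *s (Z *v snd p)"] by (simp add: norm_smult_vec)
    also have "\<dots> \<le> norm (snd p) + \<kappa> * norm (snd p)"
      using norm_mult_vec_le[of Z "snd p"] mult_right_mono[OF Z norm_ge_zero, of "snd p"] by linarith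
    also have "\<dots> = (1 + \<kappa>) * norm (snd p)" by (simp add: algebra_simps)
    also have "\<dots> \<le> (1 + \<kappa>) * norm p" using k0 by (intro mult_left_mono b) simp
    finally show "norm (snd p + \<i> *s (Z *v snd p)) \<le> (1 + \<kappa>) * norm p" .
  qed (use k0 in auto)
  finally have 1: "cmod (cdot (snd p + \<i> *s (Z *v snd p)) (snd p')) \<le> (1 + \<kappa>) * m" by (simp add: m_def)
  have "cmod (cdot (snd p) X) \<le> norm p * \<kappa>"
    using norm_cdot_le[of "snd p" X] mult_mono[OF b(2) X] by simp
  then have 2: "cmod (cdot (snd p) X * cnj (fst p')) \<le> \<kappa> * m"
    using mult_mono[OF _ b(3), of "cmod (cdot (snd p) X)" "norm p * \<kappa>"] k0 by (simp add: norm_mult m_def mult_ac)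
  have "cmod (cdot Y (snd p')) \<le> \<kappa> * norm p'"
    using norm_cdot_le[of Y "snd p'"] mult_mono[OF Y b(4)] k0 by simp
  then have 3: "cmod (fst p * cdot Y (snd p')) \<le> \<kappa> * m"
    using mult_mono[OF b(1), of "cmod (cdot Y (snd p'))" "\<kappa> * norm p'"] by (simp add: norm_mult m_def mult_ac)
  have 4: "cmod (c * fst p * cnj (fst p')) \<le> \<kappa> * m"
    using mult_mono[OF mult_mono[OF c b(1)] b(3)] k0 by (simp add: norm_mult m_def mult_ac)
  have "cmod (form_integrand Z X Y c p p') \<le> (1 + \<kappa>) * m + \<kappa> * m + \<kappa> * m + \<kappa> * m"
    unfolding form_integrand_def
    by (intro norm_triangle_le add_mono 1 2 3 4)
  then show ?thesis by (simp add: m_def algebra_simps)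
qed

text \<open>The term with \<open>\<i> Z\<close> does not contribute to the real part. The two
  first-order terms are absorbed by Young's inequality, the square in the proof, at the price of
  \<open>2 \<kappa>^2\<close>; the zero-order term adds \<open>\<kappa>\<close>.\<close>

lemma form_integrand_coercive:
  assumes hZ: "hermitian Z" and X: "norm X \<le> \<kappa>" and Y: "norm Y \<le> \<kappa>" and c: "cmod c \<le> \<kappa>"
  shows "(norm (snd p))\<^sup>2 / 2 - (2 * \<kappa>\<^sup>2 + \<kappa>) * (norm (fst p))\<^sup>2 \<le> Re (form_integrand Z X Y c p p)"
proof -
  define s where "s = norm (snd p)"
  define t where "t = norm (fst p)"
  have st: "0 \<le> s" "0 \<le> t" by (simp_all add: s_def t_def)
  have k0: "0 \<le> \<kappa>" using X norm_ge_zero order_trans by blast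
  have "cmod (cdot (snd p) X * cnj (fst p)) \<le> (s * \<kappa>) * t"
    using norm_cdot_le[of "snd p" X] mult_left_mono[OF X, of s] st
    by (simp add: norm_mult s_def t_def mult_right_mono order_trans)
  then have 2: "- (\<kappa> * s * t) \<le> Re (cdot (snd p) X * cnj (fst p))"
    using abs_Re_le_cmod[of "cdot (snd p) X * cnj (fst p)"] by (simp add: mult_ac)
  have "cmod (fst p * cdot Y (snd p)) \<le> t * (\<kappa> * s)"
    using norm_cdot_le[of Y "snd p"] mult_right_mono[OF Y, of s] st
    by (simp add: norm_mult s_def t_def mult_left_mono order_trans)
  then have 3: "- (\<kappa> * s * t) \<le> Re (fst p * cdot Y (snd p))"
    using abs_Re_le_cmod[of "fst p * cdot Y (snd p)"] by (simp add: mult_ac)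
  have "cmod (c * fst p * cnj (fst p)) \<le> \<kappa> * t\<^sup>2"
    using mult_right_mono[OF c, of "t * t"] st by (simp add: norm_mult t_def power2_eq_square mult.assoc)
  then have 4: "- (\<kappa> * t\<^sup>2) \<le> Re (c * fst p * cnj (fst p))"
    using abs_Re_le_cmod[of "c * fst p * cnj (fst p)"] by linarith
  have "0 \<le> (s - 2 * \<kappa> * t)\<^sup>2" by simp
  then have "2 * (\<kappa> * s * t) \<le> s\<^sup>2 / 2 + 2 * \<kappa>\<^sup>2 * t\<^sup>2" by (simp add: power2_eq_square algebra_simps)
  moreover have "Re (cdot (snd p + \<i> *s (Z *v snd p)) (snd p)) = s\<^sup>2"
    unfolding s_def by (rule Re_cdot_one_plus_i_hermitian(1)[OF hZ])
  ultimately show ?thesis using 2 3 4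
    unfolding form_integrand_def s_def[symmetric] t_def[symmetric] by (simp add: algebra_simps)
qed

lemma hat_add: "hat Z Q Y (p + q) = hat Z Q Y p + hat Z Q Y q"
  by (simp add: hat_def prod_eq_iff matrix_vector_right_distrib matrix_vector_mult_diff_distrib mult_vec_smult
      vector_add_ldistrib vector_sadd_rdistrib algebra_simps)

lemma hat_psm: "hat Z Q Y (psm a p) = psm a (hat Z Q Y p)"
  by (simp add: hat_def psm_def prod_eq_iff matrix_vector_right_distrib matrix_vector_mult_diff_distrib mult_vec_smult
      vector_ssub_ldistrib vector_add_ldistrib vector_smult_assoc mult.commute)

context projection_data
begin

text \<open>\<open>W_right\<close>, applied to the inhomogeneity \<open>e\<close>, cancels what
  \<open>P\<close> leaves over in the range of \<open>Q\<close>.\<close>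

lemma hat_snd_Q:
  "Q *v (snd (hat Z Q Y p) + \<i> *s (Z *v snd (hat Z Q Y p))) + fst p *s (Q *v Y) = 0"
proof -
  define w where "w = P *v snd p"
  define e where "e = \<i> *s (Z *v w) + fst p *s Y"
  have h: "snd (hat Z Q Y p) = w - W *v e" by (simp add: hat_def w_def e_def)
  have Qw: "Q *v w = 0" by (simp add: w_def QPv)
  have "Q *v (snd (hat Z Q Y p) + \<i> *s (Z *v snd (hat Z Q Y p))) + fst p *s (Q *v Y)
     = - (W *v e + \<i> *s (Q *v (Z *v (W *v e)))) + (\<i> *s (Q *v (Z *v w)) + fst p *s (Q *v Y))"
    unfolding h by (simp add: matrix_vector_right_distrib matrix_vector_mult_diff_distrib mult_vec_smult QWv Qw
        vector_add_ldistrib vector_ssub_ldistrib algebra_simps)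
  also have "\<i> *s (Q *v (Z *v w)) + fst p *s (Q *v Y) = Q *v e"
    by (simp add: e_def matrix_vector_right_distrib mult_vec_smult)
  finally show ?thesis unfolding W_right by simp
qed

lemma form_integrand_hat_Q: "form_integrand Z X Y c (hat Z Q Y p) (0, Q *v z) = 0"
proof -
  have "form_integrand Z X Y c (hat Z Q Y p) (0, Q *v z)
    = cdot (Q *v (snd (hat Z Q Y p) + \<i> *s (Z *v snd (hat Z Q Y p))) + fst p *s (Q *v Y)) z"
    by (simp add: form_integrand_def cdot_add_left cdot_smult_left cdot_hermitian[OF hQ] hat_def)
  then show ?thesis by (simp add: hat_snd_Q)
qed

text \<open>Since singular directions are annihilated, the second argument counts only through its
  nonsingular part. This is what frees the regularised form from the choice of second components in
  its second argument.\<close>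

lemma form_integrand_hat_pr: "form_integrand Z X Y c (hat Z Q Y p) p' = form_integrand Z X Y c (hat Z Q Y p) (pr Q p')"
proof -
  have "p' = pr Q p' + (0, Q *v snd p')" by (simp add: pr_def Pv prod_eq_iff)
  then show ?thesis using form_integrand_add(2)[of Z X Y c "hat Z Q Y p" "pr Q p'" "(0, Q *v snd p')"]
    by (simp add: form_integrand_hat_Q)
qed

lemma pr_hat: "pr Q (hat Z Q Y p) = pr Q p"
  by (simp add: pr_def hat_def matrix_vector_mult_diff_distrib PPv PWv)

lemma hat_pr: "hat Z Q Y (pr Q p) = hat Z Q Y p"
  by (simp add: pr_def hat_def PPv)

lemma norm_pr_le: "norm (pr Q p) \<le> norm p"
  unfolding norm_prod_def pr_def by (auto intro!: real_sqrt_le_mono add_mono power_mono norm_P_le)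

lemma hat_defect_Q: "p - hat Z Q Y p = (0, Q *v snd (p - hat Z Q Y p))"
  by (simp add: hat_def prod_eq_iff Pv matrix_vector_mult_diff_distrib matrix_vector_right_distrib QQv QWv algebra_simps)

text \<open>By \<open>W_left\<close> the defect is \<open>W\<close> applied to the same vector
  against which \<open>form_integrand\<close> pairs singular directions. Moving \<open>W\<close> to
  the other side yields a singular test element that depends on \<open>p'\<close> only, so that a
  whole sequence of \<open>p\<close> can be tested against one element.\<close>

lemma form_integrand_defect:
  "form_integrand Z X Y c (p - hat Z Q Y p) p'
    = form_integrand Z X Y c p (0, Q *v (adj W *v (snd p' - \<i> *s (Z *v snd p') + fst p' *s X)))"
proof -
  define w where "w = P *v snd p"
  define e where "e = \<i> *s (Z *v w) + fst p *s Y"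
  define F where "F = snd p' - \<i> *s (Z *v snd p') + fst p' *s X"
  have s: "snd (p - hat Z Q Y p) = Q *v snd p + W *v e" by (simp add: hat_def w_def e_def Pv)
  have sp: "snd p = w + Q *v snd p" by (simp add: w_def Pv)
  have "W *v (snd p + \<i> *s (Z *v snd p)) + fst p *s (W *v Y) = Q *v snd p + W *v e"
  proof -
    have "W *v (snd p + \<i> *s (Z *v snd p)) + fst p *s (W *v Y)
       = W *v snd p + \<i> *s (W *v (Z *v (w + Q *v snd p))) + fst p *s (W *v Y)"
      by (subst (2) sp) (simp add: matrix_vector_right_distrib mult_vec_smult)
    also have "\<dots> = (W *v snd p + \<i> *s (W *v (Z *v (Q *v snd p)))) + W *v e"
      by (simp add: e_def matrix_vector_right_distrib mult_vec_smult vector_add_ldistrib)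
    finally show ?thesis by (simp add: W_left)
  qed
  then have s': "snd (p - hat Z Q Y p) = W *v (snd p + \<i> *s (Z *v snd p) + fst p *s Y)"
    unfolding s by (simp add: matrix_vector_right_distrib mult_vec_smult)
  define q where "q = p - hat Z Q Y p"
  have "fst q = 0" by (simp add: q_def hat_def)
  then have "form_integrand Z X Y c q p' = cdot (snd q) F"
    by (simp add: form_integrand_def F_def cdot_add_left cdot_add_right cdot_diff_right cdot_smult_left cdot_smult_right
        cdot_hermitian[OF hZ])
  then have "form_integrand Z X Y c (p - hat Z Q Y p) p' = cdot (snd (p - hat Z Q Y p)) F" by (simp only: q_def)
  also have "\<dots> = cdot (snd p + \<i> *s (Z *v snd p) + fst p *s Y) (adj W *v F)"
    unfolding s' by (rule cdot_adj)
  also have "\<dots> = form_integrand Z X Y c p (0, Q *v (adj W *v F))"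
    by (simp add: form_integrand_def adj_W_Q cdot_add_left cdot_smult_left)
  finally show ?thesis by (simp add: F_def)
qed

text \<open>The constant collects 1 each for the first component and for \<open>P w\<close>, and
  \<open>2 \<kappa>\<close> for the correction, on which \<open>W\<close> acts as a
  contraction.\<close>

lemma norm_hat_le:
  assumes Z: "norm Z \<le> \<kappa>" and Y: "norm Y \<le> \<kappa>"
  shows "norm (hat Z Q Y p) \<le> (2 + 2 * \<kappa>) * norm (pr Q p)"
proof -
  define w where "w = P *v snd p"
  have k0: "0 \<le> \<kappa>" using Z norm_ge_zero order_trans by blast
  have fw: "norm (fst p) \<le> norm (pr Q p)" "norm w \<le> norm (pr Q p)"
    using norm_fst_snd_le[of "pr Q p"] by (simp_all add: pr_def w_def)
  have "norm (\<i> *s (Z *v w) + fst p *s Y) \<le> norm (Z *v w) + norm (fst p) * norm Y"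
    using norm_triangle_ineq[of "\<i> *s (Z *v w)" "fst p *s Y"] by (simp add: norm_smult_vec)
  also have "\<dots> \<le> \<kappa> * norm (pr Q p) + norm (pr Q p) * \<kappa>"
    using order_trans[OF norm_mult_vec_le mult_mono[OF Z fw(2) k0 norm_ge_zero]] mult_mono[OF fw(1) Y]
    by (intro add_mono) auto
  finally have 1: "norm (W *v (\<i> *s (Z *v w) + fst p *s Y)) \<le> 2 * \<kappa> * norm (pr Q p)"
    using norm_W_le[of "\<i> *s (Z *v w) + fst p *s Y"] by (simp add: algebra_simps)
  have "norm (hat Z Q Y p) \<le> norm (fst p) + norm (w - W *v (\<i> *s (Z *v w) + fst p *s Y))"
    unfolding hat_def w_def[symmetric] norm_prod_def fst_conv snd_conv
    by (rule sqrt_sum_squares_le_sum) auto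
  also have "\<dots> \<le> norm (fst p) + (norm w + norm (W *v (\<i> *s (Z *v w) + fst p *s Y)))"
    by (intro add_left_mono norm_triangle_ineq4)
  finally show ?thesis using fw 1 by (simp add: algebra_simps)
qed

end


section \<open>Square roots of real parts, and square-integrable pairs\<close>

lemma cdot_herm_part: "cdot (herm_part M *v \<xi>) \<xi> = of_real (Re (cdot (M *v \<xi>) \<xi>))"
proof -
  have "herm_part M = cscale (1/2) (M + adj M)"
    by (simp add: herm_part_def cscale_def adj_def vec_eq_iff)
  then have "cdot (herm_part M *v \<xi>) \<xi> = (cdot (M *v \<xi>) \<xi> + cdot (adj M *v \<xi>) \<xi>) / 2"
    by (simp add: cscale_mult_vec cdot_smult_left matrix_vector_mult_add_rdistrib cdot_add_left)
  also have "cdot (adj M *v \<xi>) \<xi> = cnj (cdot (M *v \<xi>) \<xi>)"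
    by (simp add: cdot_adj cnj_cdot)
  finally show ?thesis by (simp add: complex_add_cnj)
qed

text \<open>The norm identity is how integrability of the leading term of the form becomes square
  integrability of A^(1/2) grad u.\<close>

lemma msqrt_herm_part:
  assumes "\<And>\<xi>. 0 \<le> Re (cdot (M *v \<xi>) \<xi>)"
  shows "psd (herm_part M)" "hermitian (msqrt (herm_part M))"
    "(norm (msqrt (herm_part M) *v \<xi>))\<^sup>2 = Re (cdot (M *v \<xi>) \<xi>)"
proof -
  have "adj (herm_part M) = herm_part M" by (simp add: adj_def herm_part_def vec_eq_iff add.commute)
  then show p: "psd (herm_part M)" using assms by (simp add: psd_def hermitian_def cdot_herm_part)
  show h: "hermitian (msqrt (herm_part M))" using msqrt(1)[OF p] by (simp add: psd_def)
  have "complex_of_real ((norm (msqrt (herm_part M) *v \<xi>))\<^sup>2)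
      = cdot (msqrt (herm_part M) *v (msqrt (herm_part M) *v \<xi>)) \<xi>"
    by (simp only: cdot_self[symmetric] cdot_hermitian[OF h])
  also have "\<dots> = of_real (Re (cdot (M *v \<xi>) \<xi>))"
    by (simp only: matrix_vector_mul_assoc msqrt(2)[OF p] cdot_herm_part)
  finally show "(norm (msqrt (herm_part M) *v \<xi>))\<^sup>2 = Re (cdot (M *v \<xi>) \<xi>)" by (simp only: of_real_eq_iff)
qed

lemma sqi_fst_snd:
  assumes U: "sqi M U"
  shows "sqi M (\<lambda>x. fst (U x))" "sqn M (\<lambda>x. fst (U x)) \<le> sqn M U"
    "sqi M (\<lambda>x. snd (U x))" "sqn M (\<lambda>x. snd (U x)) \<le> sqn M U"
proof -
  have m: "(\<lambda>x. fst (U x)) \<in> borel_measurable M" "(\<lambda>x. snd (U x)) \<in> borel_measurable M"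
    by (rule borel_measurable_continuous_on[OF _ sqi_measurable[OF U]], intro continuous_intros)+
  show "sqi M (\<lambda>x. fst (U x))" "sqn M (\<lambda>x. fst (U x)) \<le> sqn M U"
    using sqi_dominated[OF U m(1), of 1] by (auto simp: norm_fst_snd_le norm_fst_le)
  show "sqi M (\<lambda>x. snd (U x))" "sqn M (\<lambda>x. snd (U x)) \<le> sqn M U"
    using sqi_dominated[OF U m(2), of 1] by (auto simp: norm_fst_snd_le norm_snd_le)
qed

lemma sqi_Pair:
  assumes u: "sqi M u" and w: "sqi M w"
  shows "sqi M (\<lambda>x. (u x, w x))" "(sqn M (\<lambda>x. (u x, w x)))\<^sup>2 = (sqn M u)\<^sup>2 + (sqn M w)\<^sup>2"
proof -
  have n: "(norm (u x, w x))\<^sup>2 = (norm (u x))\<^sup>2 + (norm (w x))\<^sup>2" for x by (simp add: norm_Pair)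
  show "sqi M (\<lambda>x. (u x, w x))"
    using u w unfolding sqi_def n by (auto intro: borel_measurable_Pair)
  show "(sqn M (\<lambda>x. (u x, w x)))\<^sup>2 = (sqn M u)\<^sup>2 + (sqn M w)\<^sup>2"
    using u w unfolding sqn_power2 n sqi_def by simp
qed

lemma sqi_psm:
  assumes U: "sqi M U"
  shows "sqi M (\<lambda>x. psm c (U x))" "sqn M (\<lambda>x. psm c (U x)) = cmod c * sqn M U"
proof -
  have "(\<lambda>x. psm c (U x)) \<in> borel_measurable M"
    unfolding psm_def using sqi_measurable[OF sqi_fst_snd(1)[OF U]] sqi_measurable[OF sqi_fst_snd(3)[OF U]]
    by (intro borel_measurable_Pair borel_measurable_times borel_measurable_smult borel_measurable_const)
  then show "sqi M (\<lambda>x. psm c (U x))" using U by (simp add: sqi_def norm_psm power_mult_distrib)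
  show "sqn M (\<lambda>x. psm c (U x)) = cmod c * sqn M U"
    by (simp add: sqn_def norm_psm power_mult_distrib real_sqrt_mult)
qed

section \<open>The regular part of a differential form\<close>

locale differential_form =
  fixes \<Omega> :: "(real^'n) set"
    and D :: "(real^'n \<Rightarrow> complex) set"
    and grad :: "(real^'n \<Rightarrow> complex) \<Rightarrow> real^'n \<Rightarrow> complex^'n"
    and C :: "real^'n \<Rightarrow> complex^'n^'n"
    and b d :: "real^'n \<Rightarrow> complex^'n"
    and c0 :: "real^'n \<Rightarrow> complex"
    and X Y :: "real^'n \<Rightarrow> complex^'n"
    and Z Q :: "real^'n \<Rightarrow> complex^'n^'n"
  assumes setting: "diff_setting \<Omega> D grad C b d c0"
    and X: "X \<in> borel_measurable (lebesgue_on \<Omega>)" "bounded (X ` \<Omega>)"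
           "\<forall>x\<in>\<Omega>. sqrtA C x *v X x = vconj (b x)"
    and Y: "Y \<in> borel_measurable (lebesgue_on \<Omega>)" "bounded (Y ` \<Omega>)"
           "\<forall>x\<in>\<Omega>. sqrtA C x *v Y x = d x"
    and Z: "Z \<in> borel_measurable (lebesgue_on \<Omega>)" "bounded (Z ` \<Omega>)"
           "\<forall>x\<in>\<Omega>. hermitian (Z x)"
           "\<forall>x\<in>\<Omega>. sqrtA C x ** (mat 1 + cscale \<i> (Z x)) ** sqrtA C x = C x"
    and Q: "Q \<in> borel_measurable (lebesgue_on \<Omega>)"
           "\<forall>x\<in>\<Omega>. Q x ** Q x = Q x \<and> hermitian (Q x)"
           "\<forall>w. L2v \<Omega> w \<longrightarrow> (\<lambda>x. Q x *v w x) \<in> Vs \<Omega> D grad C \<and>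
                (\<forall>z\<in>Vs \<Omega> D grad C. vinner \<Omega> (\<lambda>x. w x - Q x *v w x) z = 0)"
begin

abbreviation "M \<equiv> lebesgue_on \<Omega>"
abbreviation "A \<equiv> sqrtA C"
definition "G u x = (u x, A x *v grad u x)"
definition "hatf U x = hat (Z x) (Q x) (Y x) (U x)"
definition "prf U x = pr (Q x) (U x)"
definition "aform U V = (LINT x|M. form_integrand (Z x) (X x) (Y x) (c0 x) (U x) (V x))"
text \<open>Closure for the L2 seminorm, described by approximation; as a set of functions it is
  stable under changes on null sets.\<close>

definition "VV = {U. sqi M U \<and> (\<forall>e>0. \<exists>s\<in>D. sqn M (\<lambda>x. G s x - U x) < e)}"

lemma \<Omega>: "open \<Omega>" using setting by (simp add: diff_setting_def)

lemma space_M: "space M = \<Omega>" by (simp add: space_restrict_space)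

lemma projection: "x \<in> \<Omega> \<Longrightarrow> projection_data (Z x) (Q x)"
  using Q(2) Z(3) by unfold_locales auto

lemma D_L2: "u \<in> D \<Longrightarrow> L2 \<Omega> u" and D_add: "u \<in> D \<Longrightarrow> v \<in> D \<Longrightarrow> (\<lambda>x. u x + v x) \<in> D"
  and D_cmult: "u \<in> D \<Longrightarrow> (\<lambda>x. c * u x) \<in> D" and D_grad: "u \<in> D \<Longrightarrow> weak_grad \<Omega> u (grad u)"
  and D_test: "test_fn \<Omega> \<phi> \<Longrightarrow> \<phi> \<in> D"
  using setting unfolding diff_setting_def by blast+

lemma C_accretive: "x \<in> \<Omega> \<Longrightarrow> 0 \<le> Re (cdot (C x *v \<xi>) \<xi>)"
  using setting sectorD(1) unfolding diff_setting_def by meson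

lemma A_hermitian: "x \<in> \<Omega> \<Longrightarrow> hermitian (A x)"
  and norm_A: "x \<in> \<Omega> \<Longrightarrow> (norm (A x *v \<xi>))\<^sup>2 = Re (cdot (C x *v \<xi>) \<xi>)"
  unfolding sqrtA_def using msqrt_herm_part[OF C_accretive] by blast+

lemma measurable_coeffs:
  "A \<in> borel_measurable M" "c0 \<in> borel_measurable M" "u \<in> D \<Longrightarrow> grad u \<in> borel_measurable M"
  "(\<lambda>x. mat 1 - Q x) \<in> borel_measurable M" "(\<lambda>x. Wmat (Z x) (Q x)) \<in> borel_measurable M"
proof -
  have C: "C \<in> borel_measurable M" and "c0 \<in> borel_measurable M" using setting by (auto simp: diff_setting_def)
  then show "c0 \<in> borel_measurable M" by simp
  show "A \<in> borel_measurable M" unfolding sqrtA_def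
    by (rule borel_measurable_msqrt[OF borel_measurable_herm_part[OF C]])
       (use msqrt_herm_part(1)[OF C_accretive] in \<open>auto simp: space_M\<close>)
  show "grad u \<in> borel_measurable M" if "u \<in> D"
    using D_grad[OF that] by (auto simp: weak_grad_def L1loc_def borel_measurable_vec_iff)
  show "(\<lambda>x. mat 1 - Q x) \<in> borel_measurable M"
    by (intro borel_measurable_diff borel_measurable_const Q(1))
  show "(\<lambda>x. Wmat (Z x) (Q x)) \<in> borel_measurable M"
    unfolding Wmat_def
    by (intro borel_measurable_matrix_mult borel_measurable_matrix_inv borel_measurable_add borel_measurable_const
        borel_measurable_cscale Q(1) Z(1))
       (use invertible_one_plus_i_hermitian projection_data.hH[OF projection] space_M in blast)
qed

text \<open>One constant for all coefficient bounds; the bound on \<open>c0\<close> holds only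
  almost everywhere.\<close>

definition "\<kappa> = (SOME k. (\<forall>x\<in>\<Omega>. norm (Z x) \<le> k \<and> norm (X x) \<le> k \<and> norm (Y x) \<le> k) \<and>
    (AE x in M. cmod (c0 x) \<le> k) \<and> 0 \<le> k)"

lemma \<kappa>: "x \<in> \<Omega> \<Longrightarrow> norm (Z x) \<le> \<kappa>" "x \<in> \<Omega> \<Longrightarrow> norm (X x) \<le> \<kappa>" "x \<in> \<Omega> \<Longrightarrow> norm (Y x) \<le> \<kappa>"
  "AE x in M. cmod (c0 x) \<le> \<kappa>" "0 \<le> \<kappa>"
proof -
  obtain k1 where k1: "\<forall>x\<in>\<Omega>. norm (Z x) \<le> k1" using Z(2) by (auto simp: bounded_iff)
  obtain k2 where k2: "\<forall>x\<in>\<Omega>. norm (X x) \<le> k2" using X(2) by (auto simp: bounded_iff)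
  obtain k3 where k3: "\<forall>x\<in>\<Omega>. norm (Y x) \<le> k3" using Y(2) by (auto simp: bounded_iff)
  obtain k4 where k4: "AE x in M. cmod (c0 x) \<le> k4" using setting by (auto simp: diff_setting_def ess_bounded_def)
  define k where "k = max 0 (max (max k1 k2) (max k3 k4))"
  have le: "k1 \<le> k" "k2 \<le> k" "k3 \<le> k" "k4 \<le> k" "0 \<le> k" by (auto simp: k_def)
  have "AE x in M. cmod (c0 x) \<le> k" using k4 by eventually_elim (use le in simp)
  moreover have "norm (Z x) \<le> k \<and> norm (X x) \<le> k \<and> norm (Y x) \<le> k" if "x \<in> \<Omega>" for x
    using k1 k2 k3 le that by (meson order_trans)
  ultimately have "\<exists>k. (\<forall>x\<in>\<Omega>. norm (Z x) \<le> k \<and> norm (X x) \<le> k \<and> norm (Y x) \<le> k) \<and>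
    (AE x in M. cmod (c0 x) \<le> k) \<and> 0 \<le> k" using le(5) by blast
  from someI_ex[OF this] show "x \<in> \<Omega> \<Longrightarrow> norm (Z x) \<le> \<kappa>" "x \<in> \<Omega> \<Longrightarrow> norm (X x) \<le> \<kappa>" "x \<in> \<Omega> \<Longrightarrow> norm (Y x) \<le> \<kappa>"
    "AE x in M. cmod (c0 x) \<le> \<kappa>" "0 \<le> \<kappa>"
    unfolding \<kappa>_def[symmetric] by auto
qed

lemma sqi_G: "u \<in> D \<Longrightarrow> sqi M (G u)"
proof -
  assume u: "u \<in> D"
  have "sqi M (\<lambda>x. A x *v grad u x)"
    unfolding sqi_def
  proof
    show "(\<lambda>x. A x *v grad u x) \<in> borel_measurable M"
      by (intro borel_measurable_mult_vec measurable_coeffs u)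
    have "integrable M (\<lambda>x. Re (cdot (C x *v grad u x) (grad u x)))"
      using setting u by (intro integrable_Re) (auto simp: diff_setting_def)
    then show "integrable M (\<lambda>x. (norm (A x *v grad u x))\<^sup>2)"
      by (subst Bochner_Integration.integrable_cong[OF refl norm_A]) (auto simp: space_M)
  qed
  then show ?thesis unfolding G_def by (intro sqi_Pair) (use D_L2[OF u] in \<open>auto simp: L2_iff_sqi\<close>)
qed

lemma measurable_hatf: "U \<in> borel_measurable M \<Longrightarrow> hatf U \<in> borel_measurable M"
  and measurable_prf: "U \<in> borel_measurable M \<Longrightarrow> prf U \<in> borel_measurable M"
  and measurable_form: "U \<in> borel_measurable M \<Longrightarrow> V \<in> borel_measurable M \<Longrightarrow>
    (\<lambda>x. form_integrand (Z x) (X x) (Y x) (c0 x) (U x) (V x)) \<in> borel_measurable M"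
proof -
  have fs: "(\<lambda>x. fst (U x)) \<in> borel_measurable M" "(\<lambda>x. snd (U x)) \<in> borel_measurable M"
    if "U \<in> borel_measurable M" for U :: "real^'n \<Rightarrow> complex \<times> (complex^'n)"
    by (rule borel_measurable_continuous_on[OF _ that], intro continuous_intros)+
  show "hatf U \<in> borel_measurable M" if "U \<in> borel_measurable M"
    unfolding hatf_def hat_def
    by (intro borel_measurable_Pair borel_measurable_diff borel_measurable_add borel_measurable_mult_vec
        borel_measurable_smult borel_measurable_const measurable_coeffs fs that Z(1) Y(1))
  show "prf U \<in> borel_measurable M" if "U \<in> borel_measurable M"
    unfolding prf_def pr_def
    by (intro borel_measurable_Pair borel_measurable_mult_vec measurable_coeffs fs that)
  show "(\<lambda>x. form_integrand (Z x) (X x) (Y x) (c0 x) (U x) (V x)) \<in> borel_measurable M"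
    if "U \<in> borel_measurable M" "V \<in> borel_measurable M"
  proof -
    have "(\<lambda>x. cnj (fst (V x))) \<in> borel_measurable M"
      by (rule borel_measurable_continuous_on[OF _ fs(1)[OF that(2)]]) (intro continuous_intros)
    then show ?thesis
      unfolding form_integrand_def
      by (intro borel_measurable_add borel_measurable_cdot borel_measurable_mult_vec borel_measurable_times
          borel_measurable_smult borel_measurable_const measurable_coeffs fs that Z(1) Y(1) X(1))
  qed
qed

lemma sqi_prf:
  assumes U: "sqi M U"
  shows "sqi M (prf U)" "sqn M (prf U) \<le> sqn M U"
proof -
  have "AE x in M. norm (prf U x) \<le> 1 * norm (U x)"
    by (rule AE_I2) (simp add: prf_def projection_data.norm_pr_le[OF projection] space_M)
  from sqi_dominated[OF U measurable_prf[OF sqi_measurable[OF U]] _ this]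
  show "sqi M (prf U)" "sqn M (prf U) \<le> sqn M U" by auto
qed

text \<open>\<open>hat\<close> and \<open>pr\<close> determine each other pointwise, so either can
  measure the size of a fibre element modulo singular directions.\<close>

lemma sqi_hatf:
  assumes U: "sqi M U"
  shows "sqi M (hatf U)" "sqn M (hatf U) \<le> (2 + 2 * \<kappa>) * sqn M (prf U)" "sqn M (prf U) \<le> sqn M (hatf U)"
proof -
  have "AE x in M. norm (hatf U x) \<le> (2 + 2 * \<kappa>) * norm (prf U x)"
    by (rule AE_I2) (use \<kappa> projection_data.norm_hat_le[OF projection] in \<open>simp add: prf_def hatf_def space_M\<close>)
  from sqi_dominated[OF sqi_prf(1)[OF U] measurable_hatf[OF sqi_measurable[OF U]] _ this]
  show h: "sqi M (hatf U)" "sqn M (hatf U) \<le> (2 + 2 * \<kappa>) * sqn M (prf U)" using \<kappa>(5) by auto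
  have "sqn M (prf U) = sqn M (prf (hatf U))"
    by (rule sqn_cong) (simp add: prf_def hatf_def projection_data.pr_hat[OF projection] space_M)
  then show "sqn M (prf U) \<le> sqn M (hatf U)" using sqi_prf(2)[OF h(1)] by simp
qed

section \<open>The form on square-integrable pairs\<close>

lemma aform_bound:
  assumes U: "sqi M U" and V: "sqi M V"
  shows "integrable M (\<lambda>x. form_integrand (Z x) (X x) (Y x) (c0 x) (U x) (V x))"
    "cmod (aform U V) \<le> (1 + 4 * \<kappa>) * (sqn M U * sqn M V)"
proof -
  have "AE x in M. x \<in> \<Omega>" using AE_space[of M] by (simp add: space_M)
  with \<kappa>(4) have "AE x in M. norm (form_integrand (Z x) (X x) (Y x) (c0 x) (U x) (V x)) \<le> (1 + 4 * \<kappa>) * (norm (U x) * norm (V x))"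
    by eventually_elim (rule form_integrand_bound[OF \<kappa>(1-3)])
  from sqi_bilinear[OF U V measurable_form[OF sqi_measurable[OF U] sqi_measurable[OF V]] _ this]
  show "integrable M (\<lambda>x. form_integrand (Z x) (X x) (Y x) (c0 x) (U x) (V x))"
    "cmod (aform U V) \<le> (1 + 4 * \<kappa>) * (sqn M U * sqn M V)" using \<kappa>(5) by (auto simp: aform_def)
qed

lemma aform_linear:
  assumes "sqi M U" "sqi M U'" "sqi M V"
  shows "aform (\<lambda>x. U x + U' x) V = aform U V + aform U' V" "aform V (\<lambda>x. U x + U' x) = aform V U + aform V U'"
    "aform (\<lambda>x. U x - U' x) V = aform U V - aform U' V" "aform V (\<lambda>x. U x - U' x) = aform V U - aform V U'"
    "aform (\<lambda>x. psm c (U x)) V = c * aform U V" "aform V (\<lambda>x. psm c (U x)) = cnj c * aform V U"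
  using aform_bound(1)[OF assms(1,3)] aform_bound(1)[OF assms(2,3)] aform_bound(1)[OF assms(3,1)] aform_bound(1)[OF assms(3,2)]
  by (simp_all add: aform_def form_integrand_add form_integrand_diff form_integrand_psm)

lemma aform_cong_AE:
  assumes "sqi M U" "sqi M U'" "sqi M V" "sqi M V'" "AE x in M. U x = U' x" "AE x in M. V x = V' x"
  shows "aform U V = aform U' V'"
  unfolding aform_def
proof (rule integral_cong_AE)
  show "AE x in M. form_integrand (Z x) (X x) (Y x) (c0 x) (U x) (V x) = form_integrand (Z x) (X x) (Y x) (c0 x) (U' x) (V' x)"
    using assms(5,6) by eventually_elim simp
qed (use assms in \<open>auto intro!: measurable_form dest: sqi_measurable\<close>)

lemma aform_hatf_prf: "aform (hatf U) V = aform (hatf U) (prf V)"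
  unfolding aform_def
  by (rule Bochner_Integration.integral_cong)
     (simp_all add: hatf_def prf_def space_M projection_data.form_integrand_hat_pr[OF projection, symmetric])

lemma aform_hatf_hatf: "aform (hatf U) (hatf V) = aform (hatf U) V"
proof -
  have "aform (hatf U) (prf (hatf V)) = aform (hatf U) (prf V)"
    unfolding aform_def by (rule Bochner_Integration.integral_cong)
      (simp_all add: hatf_def prf_def space_M projection_data.pr_hat[OF projection])
  then show ?thesis using aform_hatf_prf by metis
qed

text \<open>\<open>grad\<close> picks a weak gradient for each element of \<open>D\<close> without
  any compatibility, hence the exceptional null sets. The scalar case is the linear one with zero as
  first function.\<close>

lemma G_add: "u \<in> D \<Longrightarrow> v \<in> D \<Longrightarrow> AE x in M. G (\<lambda>x. u x + v x) x = G u x + G v x"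
  and G_cmult: "u \<in> D \<Longrightarrow> AE x in M. G (\<lambda>x. c * u x) x = psm c (G u x)"
proof -
  assume u: "u \<in> D"
  show "AE x in M. G (\<lambda>x. u x + v x) x = G u x + G v x" if v: "v \<in> D"
  proof -
    have "weak_grad \<Omega> (\<lambda>x. u x + 1 * v x) (grad (\<lambda>x. u x + v x))" using D_grad[OF D_add[OF u v]] by simp
    from weak_grad_linear[OF \<Omega> D_L2[OF u] D_L2[OF v] D_grad[OF u] D_grad[OF v] this]
    show ?thesis by eventually_elim (simp add: G_def matrix_vector_right_distrib)
  qed
  show "AE x in M. G (\<lambda>x. c * u x) x = psm c (G u x)"
  proof -
    have 0: "weak_grad \<Omega> (\<lambda>x. 0) (\<lambda>x. 0)" by (simp add: weak_grad_def L1loc_def)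
    have L: "L2 \<Omega> (\<lambda>x. 0)" by (simp add: L2_def)
    have "weak_grad \<Omega> (\<lambda>x. 0 + c * u x) (grad (\<lambda>x. c * u x))" using D_grad[OF D_cmult[OF u]] by simp
    from weak_grad_linear[OF \<Omega> L D_L2[OF u] 0 D_grad[OF u] this]
    show ?thesis by eventually_elim (simp add: G_def psm_def mult_vec_smult)
  qed
qed

lemma D_0: "(\<lambda>x. 0) \<in> D"
proof -
  have "iter_partial ks (\<lambda>x. 0) = (\<lambda>x. 0)" for ks :: "'n list"
    by (induction ks) (auto simp: partial_def)
  then show ?thesis by (intro D_test) (simp add: test_fn_def smooth_def tsupp_def)
qed

section \<open>The closure of the graph\<close>

lemma VV_sqi: "U \<in> VV \<Longrightarrow> sqi M U" by (simp add: VV_def)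

lemma VV_approx: "U \<in> VV \<Longrightarrow> e > 0 \<Longrightarrow> \<exists>s\<in>D. sqn M (\<lambda>x. G s x - U x) < e" by (simp add: VV_def)

lemma G_VV: "u \<in> D \<Longrightarrow> G u \<in> VV"
  by (auto simp: VV_def sqi_G intro!: bexI[of _ u])

lemma VV_limit:
  assumes U: "sqi M U" and ap: "\<And>e. e > 0 \<Longrightarrow> \<exists>U'\<in>VV. sqn M (\<lambda>x. U' x - U x) < e"
  shows "U \<in> VV"
  unfolding VV_def
proof (intro CollectI conjI allI impI U)
  fix e :: real assume "e > 0"
  then have e2: "e / 2 > 0" by simp
  obtain U' where U': "U' \<in> VV" "sqn M (\<lambda>x. U' x - U x) < e / 2" using ap[OF e2] by blast
  obtain s where s: "s \<in> D" "sqn M (\<lambda>x. G s x - U' x) < e / 2" using VV_approx[OF U'(1) e2] by blast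
  have "sqn M (\<lambda>x. G s x - U x) < e"
    using sqn_triangle_diff[OF sqi_G[OF s(1)] VV_sqi[OF U'(1)] U] U'(2) s(2) by linarith
  then show "\<exists>s\<in>D. sqn M (\<lambda>x. G s x - U x) < e" using s(1) by blast
qed

lemma VV_cong:
  assumes U: "U \<in> VV" and U': "sqi M U'" and ae: "AE x in M. U x = U' x"
  shows "U' \<in> VV"
proof (rule VV_limit[OF U'])
  fix e :: real assume "e > 0"
  have "sqn M (\<lambda>x. U x - U' x) = 0"
    using ae sqn_eq_0_iff[OF sqi_diff(1)[OF VV_sqi[OF U] U']] by (auto elim: eventually_mono)
  then have "sqn M (\<lambda>x. U x - U' x) < e" using \<open>e > 0\<close> by simp
  then show "\<exists>U''\<in>VV. sqn M (\<lambda>x. U'' x - U' x) < e" using U by blast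
qed

lemma VV_add:
  assumes U: "U \<in> VV" and V: "V \<in> VV"
  shows "(\<lambda>x. U x + V x) \<in> VV"
  unfolding VV_def
proof (intro CollectI conjI allI impI sqi_add VV_sqi U V)
  fix e :: real assume "e > 0"
  then have e2: "e / 2 > 0" by simp
  obtain s where s: "s \<in> D" "sqn M (\<lambda>x. G s x - U x) < e / 2" using VV_approx[OF U e2] by blast
  obtain t where t: "t \<in> D" "sqn M (\<lambda>x. G t x - V x) < e / 2" using VV_approx[OF V e2] by blast
  have st: "(\<lambda>x. s x + t x) \<in> D" by (rule D_add[OF s(1) t(1)])
  have sU: "sqi M (\<lambda>x. G s x - U x)" by (rule sqi_diff(1)[OF sqi_G[OF s(1)] VV_sqi[OF U]])
  have tV: "sqi M (\<lambda>x. G t x - V x)" by (rule sqi_diff(1)[OF sqi_G[OF t(1)] VV_sqi[OF V]])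
  have "sqn M (\<lambda>x. G (\<lambda>x. s x + t x) x - (U x + V x)) = sqn M (\<lambda>x. (G s x - U x) + (G t x - V x))"
  proof (rule sqn_cong_AE)
    show "AE x in M. G (\<lambda>x. s x + t x) x - (U x + V x) = (G s x - U x) + (G t x - V x)"
      using G_add[OF s(1) t(1)] by eventually_elim simp
  qed (intro sqi_measurable sqi_diff sqi_add sqi_G VV_sqi U V s(1) t(1) st)+
  also have "\<dots> \<le> sqn M (\<lambda>x. G s x - U x) + sqn M (\<lambda>x. G t x - V x)"
    by (rule sqi_add(2)[OF sU tV])
  also have "\<dots> < e" using s(2) t(2) by linarith
  finally show "\<exists>s\<in>D. sqn M (\<lambda>x. G s x - (U x + V x)) < e" using st by blast
qed

lemma VV_psm:
  assumes U: "U \<in> VV"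
  shows "(\<lambda>x. psm c (U x)) \<in> VV"
  unfolding VV_def
proof (intro CollectI conjI allI impI sqi_psm VV_sqi U)
  fix e :: real assume e: "e > 0"
  have c1: "cmod c + 1 > 0" by (simp add: add_nonneg_pos)
  then have "e / (cmod c + 1) > 0" using e by simp
  then obtain s where s: "s \<in> D" "sqn M (\<lambda>x. G s x - U x) < e / (cmod c + 1)" using VV_approx[OF U] by blast
  have sU: "sqi M (\<lambda>x. G s x - U x)" by (rule sqi_diff(1)[OF sqi_G[OF s(1)] VV_sqi[OF U]])
  have cs: "(\<lambda>x. c * s x) \<in> D" by (rule D_cmult[OF s(1)])
  have "sqn M (\<lambda>x. G (\<lambda>x. c * s x) x - psm c (U x)) = sqn M (\<lambda>x. psm c (G s x - U x))"
  proof (rule sqn_cong_AE)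
    show "AE x in M. G (\<lambda>x. c * s x) x - psm c (U x) = psm c (G s x - U x)"
      using G_cmult[OF s(1)] by eventually_elim (simp add: psm_def algebra_simps vector_ssub_ldistrib)
    show "(\<lambda>x. G (\<lambda>x. c * s x) x - psm c (U x)) \<in> borel_measurable M"
      by (rule sqi_measurable[OF sqi_diff(1)[OF sqi_G[OF cs] sqi_psm(1)[OF VV_sqi[OF U]]]])
    show "(\<lambda>x. psm c (G s x - U x)) \<in> borel_measurable M"
      by (rule sqi_measurable[OF sqi_psm(1)[OF sU]])
  qed
  also have "\<dots> = cmod c * sqn M (\<lambda>x. G s x - U x)" by (rule sqi_psm(2)[OF sU])
  also have "\<dots> \<le> (cmod c + 1) * sqn M (\<lambda>x. G s x - U x)" by (intro mult_right_mono) auto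
  also have "\<dots> < e" using s(2) c1 by (simp add: pos_less_divide_eq mult.commute)
  finally show "\<exists>s\<in>D. sqn M (\<lambda>x. G s x - psm c (U x)) < e" using cs by blast
qed

lemma VV_diff: 
  assumes "U \<in> VV" "V \<in> VV" shows "(\<lambda>x. U x - V x) \<in> VV"
proof -
  have "(\<lambda>x. U x + psm (-1) (V x)) \<in> VV" by (rule VV_add[OF assms(1) VV_psm[OF assms(2)]])
  moreover have "U x + psm (-1) (V x) = U x - V x" for x by (simp add: psm_def prod_eq_iff vec_eq_iff)
  ultimately show ?thesis by simp
qed

text \<open>The squared norm of a pair splits into those of its components, so approximation of
  \<open>(0, w)\<close> is approximation of both components. This ties the sequential definition of
  \<open>Vs\<close> to \<open>VV\<close>.\<close>

lemma Vs_iff: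
  assumes w: "sqi M w"
  shows "w \<in> Vs \<Omega> D grad C \<longleftrightarrow> (\<lambda>x. (0, w x)) \<in> VV"
proof
  have s0: "sqi M (\<lambda>x. (0, w x) :: complex \<times> (complex^'n))" by (rule sqi_Pair(1)[OF sqi_zero(1) w])
  have Tm: "sqi M (\<lambda>x. A x *v grad s x - w x)" "sqi M s" if "s \<in> D" for s
    using sqi_diff(1)[OF sqi_fst_snd(3)[OF sqi_G[OF that]] w] sqi_fst_snd(1)[OF sqi_G[OF that]] by (auto simp: G_def)
  have split: "(sqn M (\<lambda>x. G s x - (0, w x)))\<^sup>2 = (sqn M s)\<^sup>2 + (sqn M (\<lambda>x. A x *v grad s x - w x))\<^sup>2" if "s \<in> D" for s
    using sqi_Pair(2)[OF Tm(2,1)[OF that]] by (simp add: G_def)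
  {
    assume "w \<in> Vs \<Omega> D grad C"
    then obtain s where s: "\<And>n. s n \<in> D" "(\<lambda>n. sqn M (s n)) \<longlonglongrightarrow> 0" "(\<lambda>n. sqn M (\<lambda>x. A x *v grad (s n) x - w x)) \<longlonglongrightarrow> 0"
      by (auto simp: Vs_def l2norm_eq_sqn l2vnorm_eq_sqn)
    have "(\<lambda>n. (sqn M (s n))\<^sup>2 + (sqn M (\<lambda>x. A x *v grad (s n) x - w x))\<^sup>2) \<longlonglongrightarrow> 0\<^sup>2 + 0\<^sup>2"
      by (intro tendsto_intros s)
    then have l: "(\<lambda>n. (sqn M (\<lambda>x. G (s n) x - (0, w x)))\<^sup>2) \<longlonglongrightarrow> 0" by (simp add: split[OF s(1)])
    show "(\<lambda>x. (0, w x)) \<in> VV"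
      unfolding VV_def
    proof (intro CollectI conjI allI impI s0)
      fix e :: real assume e: "e > 0"
      then have "e\<^sup>2 > 0" by simp
      from order_tendstoD(2)[OF l this] obtain n where "(sqn M (\<lambda>x. G (s n) x - (0, w x)))\<^sup>2 < e\<^sup>2"
        by (auto simp: eventually_sequentially)
      then have "sqn M (\<lambda>x. G (s n) x - (0, w x)) < e" by (rule power2_less_imp_less) (use e in simp)
      then show "\<exists>s\<in>D. sqn M (\<lambda>x. G s x - (0, w x)) < e" using s(1) by blast
    qed
  }
  {
    assume V: "(\<lambda>x. (0, w x)) \<in> VV"
    have "\<forall>n. \<exists>s\<in>D. sqn M (\<lambda>x. G s x - (0, w x)) < inverse (real (Suc n))" using VV_approx[OF V] by simp
    then obtain s where s: "\<And>n. s n \<in> D" "\<And>n. sqn M (\<lambda>x. G (s n) x - (0, w x)) < inverse (real (Suc n))" by metis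
    have "sqn M (s n) \<le> inverse (real (Suc n))" "sqn M (\<lambda>x. A x *v grad (s n) x - w x) \<le> inverse (real (Suc n))" for n
      using sqi_fst_snd(2,4)[OF sqi_diff(1)[OF sqi_G[OF s(1)] s0], of n] s(2)[of n] by (auto simp: G_def)
    then have "(\<lambda>n. sqn M (s n)) \<longlonglongrightarrow> 0" "(\<lambda>n. sqn M (\<lambda>x. A x *v grad (s n) x - w x)) \<longlonglongrightarrow> 0"
      by (auto intro!: Lim_null_comparison[OF _ LIMSEQ_inverse_real_of_nat])
    then show "w \<in> Vs \<Omega> D grad C"
      using w s(1) by (auto simp: Vs_def l2norm_eq_sqn l2vnorm_eq_sqn L2v_iff_sqi)
  }
qed

lemma Q_VV:
  assumes w: "sqi M w" shows "(\<lambda>x. (0, Q x *v w x)) \<in> VV"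
proof -
  have v: "(\<lambda>x. Q x *v w x) \<in> Vs \<Omega> D grad C" using Q(3) w by (simp add: L2v_iff_sqi)
  then have "sqi M (\<lambda>x. Q x *v w x)" by (simp add: Vs_def L2v_iff_sqi)
  from Vs_iff[OF this] v show ?thesis by simp
qed

text \<open>\<open>U\<close> and \<open>hatf U\<close> differ by a singular element, which lies in
  the closure by the assumption on \<open>Q\<close>.\<close>

lemma hatf_VV:
  assumes U: "U \<in> VV" shows "hatf U \<in> VV"
proof -
  have d: "sqi M (\<lambda>x. U x - hatf U x)" by (intro sqi_diff sqi_hatf VV_sqi U)
  have "(\<lambda>x. U x - (0, Q x *v snd (U x - hatf U x))) \<in> VV"
    by (rule VV_diff[OF U Q_VV[OF sqi_fst_snd(3)[OF d]]])
  moreover have "AE x in M. U x - (0, Q x *v snd (U x - hatf U x)) = hatf U x"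
  proof (rule AE_I2)
    fix x assume "x \<in> space M"
    then have "x \<in> \<Omega>" by (simp add: space_M)
    from projection_data.hat_defect_Q[OF projection[OF this], of "U x" "Y x"]
    have e: "U x - hatf U x = (0, Q x *v snd (U x - hatf U x))" by (simp only: hatf_def)
    show "U x - (0, Q x *v snd (U x - hatf U x)) = hatf U x" by (subst e[symmetric]) simp
  qed
  ultimately show ?thesis by (rule VV_cong[OF _ sqi_hatf(1)[OF VV_sqi[OF U]]])
qed

lemma prf_VV:
  assumes U: "U \<in> VV" shows "prf U \<in> VV"
proof -
  have "(\<lambda>x. U x - (0, Q x *v snd (U x))) \<in> VV"
    by (rule VV_diff[OF U Q_VV[OF sqi_fst_snd(3)[OF VV_sqi[OF U]]]])
  moreover have "AE x in M. U x - (0, Q x *v snd (U x)) = prf U x"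
    by (rule AE_I2) (simp add: prf_def pr_def prod_eq_iff matrix_vector_mult_diff_rdistrib)
  ultimately show ?thesis by (rule VV_cong[OF _ sqi_prf(1)[OF VV_sqi[OF U]]])
qed

text \<open>The difference is \<open>(0, w)\<close> up to null sets, with \<open>w\<close> in
  \<open>Vs\<close>. Orthogonality of \<open>w - Q w\<close> to \<open>Vs\<close>, tested with
  \<open>w\<close> itself, makes the integral of \<open>|P w|^2\<close> vanish.\<close>

lemma VV_fst_unique:
  assumes U: "U \<in> VV" and U': "U' \<in> VV" and ae: "AE x in M. fst (U x) = fst (U' x)"
  shows "AE x in M. prf U x = prf U' x"
proof -
  define w where "w x = snd (U x - U' x)" for x
  have sd: "sqi M (\<lambda>x. U x - U' x)" by (intro sqi_diff VV_sqi U U')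
  have w: "sqi M w" unfolding w_def by (rule sqi_fst_snd(3)[OF sd])
  have "(\<lambda>x. (0, w x)) \<in> VV"
  proof (rule VV_cong[OF VV_diff[OF U U']])
    show "sqi M (\<lambda>x. (0, w x) :: complex \<times> (complex^'n))" by (rule sqi_Pair(1)[OF sqi_zero(1) w])
    show "AE x in M. U x - U' x = (0, w x)" using ae by eventually_elim (simp add: w_def prod_eq_iff)
  qed
  then have "w \<in> Vs \<Omega> D grad C" using Vs_iff[OF w] by simp
  then have "vinner \<Omega> (\<lambda>x. w x - Q x *v w x) w = 0" using Q(3) w by (simp add: L2v_iff_sqi)
  also have "vinner \<Omega> (\<lambda>x. w x - Q x *v w x) w = (LINT x|M. of_real ((norm (snd (pr (Q x) (0, w x))))\<^sup>2))"
    unfolding vinner_def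
  proof (rule Bochner_Integration.integral_cong)
    fix x assume "x \<in> space M"
    then have "x \<in> \<Omega>" by (simp add: space_M)
    note p = projection[OF this]
    show "cdot (w x - Q x *v w x) (w x) = of_real ((norm (snd (pr (Q x) (0, w x))))\<^sup>2)"
      using projection_data.cdot_P[OF p, of "w x"] by (simp only: pr_def snd_conv projection_data.Pv[OF p])
  qed simp
  finally have "complex_of_real (LINT x|M. (norm (snd (pr (Q x) (0, w x))))\<^sup>2) = 0"
    by (simp only: integral_complex_of_real)
  then have "sqn M (\<lambda>x. snd (pr (Q x) (0, w x))) = 0" by (simp add: sqn_def)
  moreover have sp: "sqi M (prf (\<lambda>x. (0, w x)))" by (intro sqi_prf sqi_Pair sqi_zero w)
  then have "sqi M (\<lambda>x. snd (pr (Q x) (0, w x)))" using sqi_fst_snd(3)[OF sp] by (simp add: prf_def)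
  ultimately have "AE x in M. snd (pr (Q x) (0, w x)) = 0"
    using sqn_eq_0_iff by blast
  with ae show ?thesis
    by eventually_elim (simp add: prf_def pr_def w_def matrix_vector_mult_diff_distrib)
qed

end

section \<open>The explicit formula and its bounds, pointwise\<close>

context projection_data
begin

text \<open>The integrand is expanded at \<open>(fst p, w - W e)\<close> against
  \<open>(fst p', z)\<close>. A vector \<open>W y\<close> is orthogonal to \<open>z\<close>, which
  lies in the range of \<open>P\<close>, so the correction reaches the leading part only behind
  \<open>Z\<close>; there the two factors \<open>\<i>\<close> and the minus sign combine to
  \<open>+ Z W Z\<close>.\<close>

lemma form_integrand_hat_formula:
  "form_integrand Z X Y c (hat Z Q Y p) p'
    = cdot ((mat 1 + cscale \<i> Z + Z ** W ** Z) *v (P *v snd p)) (P *v snd p')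
    + cstar X ((mat 1 - cscale \<i> (W ** Z)) *v (P *v snd p)) * cnj (fst p')
    + fst p * cnj (cstar Y ((mat 1 + cscale \<i> (adj W ** Z)) *v (P *v snd p')))
    - cstar X (W *v Y) * fst p * cnj (fst p') + c * fst p * cnj (fst p')"
proof -
  define w where "w = P *v snd p"
  define z where "z = P *v snd p'"
  define e where "e = \<i> *s (Z *v w) + fst p *s Y"
  have h: "hat Z Q Y p = (fst p, w - W *v e)" by (simp add: hat_def w_def e_def)
  have pz: "pr Q p' = (fst p', z)" by (simp add: pr_def z_def)
  have Wz: "cdot (W *v y) z = 0" for y
    unfolding z_def by (simp add: cdot_hermitian[OF hP, symmetric] PWv)
  \<comment> \<open>The product of \<open>Y\<close> with the correction moves \<open>W\<close> to
    its adjoint, so that it fits into the bracket acting on \<open>z\<close>.\<close>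
  have WY: "cdot Y (adj W *v (Z *v z)) = cdot (Z *v (W *v Y)) z"
    by (simp add: cdot_adj[symmetric] cdot_hermitian[OF hZ])
  have t1: "cdot ((w - W *v e) + \<i> *s (Z *v (w - W *v e))) z
     = cdot (w + \<i> *s (Z *v w) + Z *v (W *v (Z *v w))) z - \<i> * fst p * cdot (Z *v (W *v Y)) z"
    by (simp add: e_def cdot_add_left cdot_diff_left cdot_smult_left Wz matrix_vector_right_distrib
        matrix_vector_mult_diff_distrib mult_vec_smult vector_add_ldistrib vector_ssub_ldistrib algebra_simps)
  have t2: "cdot (w - W *v e) X = cdot (w - \<i> *s (W *v (Z *v w))) X - fst p * cdot (W *v Y) X"
    by (simp add: e_def cdot_add_left cdot_diff_left cdot_smult_left matrix_vector_right_distrib mult_vec_smult)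
  have t3: "cnj (cdot (z + \<i> *s (adj W *v (Z *v z))) Y) = cdot Y z - \<i> * cdot (Z *v (W *v Y)) z"
    unfolding cnj_cdot by (simp add: cdot_add_right cdot_smult_right WY)
  have m1: "(mat 1 + cscale \<i> Z + Z ** W ** Z) *v w = w + \<i> *s (Z *v w) + Z *v (W *v (Z *v w))"
    by (simp add: matrix_vector_mult_add_rdistrib cscale_mult_vec matrix_vector_mul_assoc[symmetric])
  have m2: "(mat 1 - cscale \<i> (W ** Z)) *v w = w - \<i> *s (W *v (Z *v w))"
    by (simp add: matrix_vector_mult_diff_rdistrib cscale_mult_vec matrix_vector_mul_assoc[symmetric])
  have m3: "(mat 1 + cscale \<i> (adj W ** Z)) *v z = z + \<i> *s (adj W *v (Z *v z))"
    by (simp add: matrix_vector_mult_add_rdistrib cscale_mult_vec matrix_vector_mul_assoc[symmetric])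
  show ?thesis
    apply (subst form_integrand_hat_pr)
    unfolding h pz w_def[symmetric] z_def[symmetric] m1 m2 m3
      cstar_eq_cdot t3 form_integrand_def fst_conv snd_conv t1 t2
    by (simp add: algebra_simps)
qed

abbreviation "K1 \<equiv> mat 1 + cscale \<i> Z + Z ** W ** Z"
abbreviation "K2 \<equiv> mat 1 - cscale \<i> (W ** Z)"
abbreviation "K3 \<equiv> mat 1 + cscale \<i> (adj W ** Z)"

lemma K_bounds:
  assumes k: "norm Z \<le> k"
  shows "norm (K1 *v y) \<le> (1 + k + k\<^sup>2) * norm y" "norm (K2 *v y) \<le> (1 + k) * norm y" "norm (K3 *v y) \<le> (1 + k) * norm y"
proof -
  have k0: "0 \<le> k" using k norm_ge_zero order_trans by blast
  have z: "norm (Z *v x) \<le> k * norm x" for x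
    using norm_mult_vec_le[of Z x] mult_right_mono[OF k norm_ge_zero, of x] by linarith
  have "norm (Z *v (W *v (Z *v y))) \<le> k * norm (W *v (Z *v y))" by (rule z)
  also have "\<dots> \<le> k * (k * norm y)" by (intro mult_left_mono order_trans[OF norm_W_le z] k0)
  finally have zwz: "norm (Z *v (W *v (Z *v y))) \<le> k\<^sup>2 * norm y" by (simp add: power2_eq_square mult.assoc)
  have m1: "K1 *v y = y + \<i> *s (Z *v y) + Z *v (W *v (Z *v y))"
    by (simp add: matrix_vector_mult_add_rdistrib cscale_mult_vec matrix_vector_mul_assoc[symmetric])
  have "norm (K1 *v y) \<le> norm y + norm (Z *v y) + norm (Z *v (W *v (Z *v y)))"
    unfolding m1 by (intro norm_triangle_le add_mono order_refl) (simp add: norm_smult_vec)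
  then show "norm (K1 *v y) \<le> (1 + k + k\<^sup>2) * norm y" using z[of y] zwz by (simp add: algebra_simps)
  have m2: "K2 *v y = y - \<i> *s (W *v (Z *v y))"
    by (simp add: matrix_vector_mult_diff_rdistrib cscale_mult_vec matrix_vector_mul_assoc[symmetric])
  have "norm (K2 *v y) \<le> norm y + norm (W *v (Z *v y))"
    unfolding m2 using norm_triangle_ineq4[of y "\<i> *s (W *v (Z *v y))"] by (simp add: norm_smult_vec)
  then show "norm (K2 *v y) \<le> (1 + k) * norm y" using order_trans[OF norm_W_le z, of y] by (simp add: algebra_simps)
  have m3: "K3 *v y = y + \<i> *s (adj W *v (Z *v y))"
    by (simp add: matrix_vector_mult_add_rdistrib cscale_mult_vec matrix_vector_mul_assoc[symmetric])
  have "norm (K3 *v y) \<le> norm y + norm (adj W *v (Z *v y))"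
    unfolding m3 using norm_triangle_ineq[of y "\<i> *s (adj W *v (Z *v y))"] by (simp add: norm_smult_vec)
  then show "norm (K3 *v y) \<le> (1 + k) * norm y" using order_trans[OF norm_adj_W_le z, of y] by (simp add: algebra_simps)
qed

text \<open>\<open>Z W Z\<close> contributes the real part of the form of \<open>W\<close> at
  \<open>Z y\<close>, which is nonnegative, and \<open>\<i> Z\<close> contributes nothing.\<close>

lemma K1_coercive: "(norm y)\<^sup>2 \<le> Re (cdot (K1 *v y) y)"
proof -
  have m1: "K1 *v y = (y + \<i> *s (Z *v y)) + Z *v (W *v (Z *v y))"
    by (simp add: matrix_vector_mult_add_rdistrib cscale_mult_vec matrix_vector_mul_assoc[symmetric])
  show ?thesis
    using Re_cdot_W_nonneg[of "Z *v y"] Re_cdot_one_plus_i_hermitian(1)[OF hZ, of y]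
    unfolding m1 by (simp add: cdot_add_left cdot_hermitian[OF hZ, of "W *v (Z *v y)"])
qed

end

text \<open>Forms are total functions, so sectoriality has to be carried over from a closed
  extension to the version that is zero off the domain.\<close>

lemma sectorial_vertex_cong:
  assumes sv: "sectorial_vertex \<Omega> b D \<gamma>" and eq: "\<And>u v. u \<in> D \<Longrightarrow> v \<in> D \<Longrightarrow> r u v = b u v"
  shows "sectorial_vertex \<Omega> r D \<gamma>"
proof -
  interpret sectorial_form \<Omega> b D \<gamma> by unfold_locales (rule sv)
  have "sesq_form \<Omega> r D"
    unfolding sesq_form_def
  proof (intro conjI ballI allI impI)
    fix u v w c assume u: "u \<in> D" and v: "v \<in> D" and w: "w \<in> D"
    note uv = V_add[OF u v, unfolded plus_fun_def] and cu = V_cmult[OF u, of c]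
    show "r (\<lambda>x. u x + v x) w = r u w + r v w" "r (\<lambda>x. c * u x) w = c * r u w"
      "r w (\<lambda>x. u x + v x) = r w u + r w v" "r w (\<lambda>x. c * u x) = cnj c * r w u"
      using b_lin[OF u v w, unfolded plus_fun_def] by (simp_all add: eq u v w uv cu)
  qed (use V_L2 V_0 V_add V_cmult b_null in \<open>auto simp: eq zero_fun_def plus_fun_def\<close>)
  then show ?thesis using sv eq unfolding sectorial_vertex_def by simp
qed

section \<open>The closed extension of the regularised form\<close>

context differential_form
begin

definition "Dbar = {x. \<exists>w. (\<lambda>y. (x y, w y)) \<in> VV}"
text \<open>Some element of the fibre over \<open>x\<close>; by \<open>bb_eq\<close> the choice does
  not influence the form.\<close>

definition "Uf x y = (x y, (SOME w. (\<lambda>y. (x y, w y)) \<in> VV) y)"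
definition "bb x y = aform (hatf (Uf x)) (Uf y)"
text \<open>Zero off \<open>D\<close>, in accordance with the normalisation in
  \<open>reg_part\<close>.\<close>

definition "rf u v = (if u \<in> D \<and> v \<in> D then aform (hatf (G u)) (G v) else 0)"

lemma Uf_VV: "x \<in> Dbar \<Longrightarrow> Uf x \<in> VV"
  unfolding Dbar_def Uf_def[abs_def] using someI_ex[of "\<lambda>w. (\<lambda>y. (x y, w y)) \<in> VV"] by simp

lemma fst_Uf [simp]: "fst (Uf x y) = x y" by (simp add: Uf_def)

lemma DbarI: "U \<in> VV \<Longrightarrow> (\<lambda>z. fst (U z)) \<in> Dbar"
  unfolding Dbar_def by (auto intro!: exI[of _ "\<lambda>z. snd (U z)"])

lemma Dbar_sqi: "x \<in> Dbar \<Longrightarrow> sqi M x"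
  using sqi_fst_snd(1)[OF VV_sqi[OF Uf_VV]] by simp

lemma fst_G [simp]: "fst (G u x) = u x" by (simp add: G_def)

lemma D_Dbar: "D \<subseteq> Dbar"
  using DbarI[OF G_VV] by auto

lemma hatf_cong_AE:
  assumes "AE x in M. prf U x = prf V x"
  shows "AE x in M. hatf U x = hatf V x"
proof -
  have "AE x in M. x \<in> \<Omega>" using AE_space[of M] by (simp add: space_M)
  with assms show ?thesis
    by eventually_elim (metis hatf_def prf_def projection_data.hat_pr[OF projection])
qed

text \<open>Fibres are unique up to singular parts, to which neither argument reacts: the first
  because of \<open>hatf\<close>, the second by \<open>aform_hatf_prf\<close>. The algebraic
  properties of \<open>bb\<close> are read off convenient representatives through this
  lemma.\<close>

lemma bb_eq:
  assumes x: "x \<in> Dbar" and y: "y \<in> Dbar" and U: "U \<in> VV" and V: "V \<in> VV"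
    and xU: "AE z in M. x z = fst (U z)" and yV: "AE z in M. y z = fst (V z)"
  shows "bb x y = aform (hatf U) V"
proof -
  have "AE z in M. prf (Uf x) z = prf U z"
    by (rule VV_fst_unique[OF Uf_VV[OF x] U]) (use xU in simp)
  then have h: "AE z in M. hatf (Uf x) z = hatf U z" by (rule hatf_cong_AE)
  have p: "AE z in M. prf (Uf y) z = prf V z"
    by (rule VV_fst_unique[OF Uf_VV[OF y] V]) (use yV in simp)
  have "bb x y = aform (hatf (Uf x)) (prf (Uf y))" unfolding bb_def by (rule aform_hatf_prf)
  also have "\<dots> = aform (hatf U) (prf V)"
    by (rule aform_cong_AE[OF _ _ _ _ h p]) (intro sqi_hatf(1) sqi_prf(1) VV_sqi Uf_VV x y U V)+
  finally show ?thesis by (simp add: aform_hatf_prf[symmetric])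
qed

lemma hatf_linear:
  "hatf (\<lambda>x. U x + V x) = (\<lambda>x. hatf U x + hatf V x)" "hatf (\<lambda>x. psm c (U x)) = (\<lambda>x. psm c (hatf U x))"
  by (simp_all add: hatf_def hat_add hat_psm fun_eq_iff)

lemma Dbar_add: "x \<in> Dbar \<Longrightarrow> y \<in> Dbar \<Longrightarrow> (\<lambda>z. x z + y z) \<in> Dbar"
  using DbarI[OF VV_add[OF Uf_VV Uf_VV]] by simp

lemma Dbar_cmult: "x \<in> Dbar \<Longrightarrow> (\<lambda>z. c * x z) \<in> Dbar"
  using DbarI[OF VV_psm[OF Uf_VV], of x c] by (simp add: psm_def)

lemma Dbar_diff: "x \<in> Dbar \<Longrightarrow> y \<in> Dbar \<Longrightarrow> (\<lambda>z. x z - y z) \<in> Dbar"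
  using DbarI[OF VV_diff[OF Uf_VV Uf_VV]] by simp

lemma sesq_bb: "sesq_form \<Omega> bb Dbar"
  unfolding sesq_form_def
proof (intro conjI ballI allI impI)
  show "(\<lambda>x. 0) \<in> Dbar" using D_0 D_Dbar by blast
  fix u assume u: "u \<in> Dbar"
  show "L2 \<Omega> u" using Dbar_sqi[OF u] by (simp add: L2_iff_sqi)
  show cu: "(\<lambda>x. c * u x) \<in> Dbar" for c by (rule Dbar_cmult[OF u])
  fix v assume v: "v \<in> Dbar"
  show uv: "(\<lambda>x. u x + v x) \<in> Dbar" by (rule Dbar_add[OF u v])
  {
    fix w c assume w: "w \<in> Dbar"
    note sq = VV_sqi[OF Uf_VV[OF u]] VV_sqi[OF Uf_VV[OF v]] VV_sqi[OF Uf_VV[OF w]]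
    have "bb (\<lambda>x. u x + v x) w = aform (hatf (\<lambda>x. Uf u x + Uf v x)) (Uf w)"
      by (rule bb_eq[OF uv w VV_add[OF Uf_VV[OF u] Uf_VV[OF v]] Uf_VV[OF w]]) auto
    then show "bb (\<lambda>x. u x + v x) w = bb u w + bb v w"
      by (simp add: hatf_linear aform_linear(1)[OF sqi_hatf(1)[OF sq(1)] sqi_hatf(1)[OF sq(2)] sq(3)] bb_def)
    have "bb (\<lambda>x. c * u x) w = aform (hatf (\<lambda>x. psm c (Uf u x))) (Uf w)"
      by (rule bb_eq[OF cu w VV_psm[OF Uf_VV[OF u]] Uf_VV[OF w]]) (auto simp: psm_def)
    then show "bb (\<lambda>x. c * u x) w = c * bb u w"
      by (simp add: hatf_linear aform_linear(5)[OF sqi_hatf(1)[OF sq(1)] sqi_hatf(1)[OF sq(2)] sq(3)] bb_def)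
    have "bb w (\<lambda>x. u x + v x) = aform (hatf (Uf w)) (\<lambda>x. Uf u x + Uf v x)"
      by (rule bb_eq[OF w uv Uf_VV[OF w] VV_add[OF Uf_VV[OF u] Uf_VV[OF v]]]) auto
    then show "bb w (\<lambda>x. u x + v x) = bb w u + bb w v"
      by (simp add: aform_linear(2)[OF sq(1,2) sqi_hatf(1)[OF sq(3)]] bb_def)
    have "bb w (\<lambda>x. c * u x) = aform (hatf (Uf w)) (\<lambda>x. psm c (Uf u x))"
      by (rule bb_eq[OF w cu Uf_VV[OF w] VV_psm[OF Uf_VV[OF u]]]) (auto simp: psm_def)
    then show "bb w (\<lambda>x. c * u x) = cnj c * bb w u"
      by (simp add: aform_linear(6)[OF sq(1,2) sqi_hatf(1)[OF sq(3)]] bb_def)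
  }
  assume "l2norm \<Omega> u = 0"
  \<comment> \<open>A null function is also represented by the zero pair, where the form
    vanishes.\<close>
  then have ae: "AE x in M. u x = fst (psm 0 (Uf u x))"
    using sqn_eq_0_iff[OF Dbar_sqi[OF u]] by (simp add: l2norm_eq_sqn psm_def)
  note sq = VV_sqi[OF Uf_VV[OF u]] VV_sqi[OF Uf_VV[OF v]]
  have "bb u v = aform (hatf (\<lambda>x. psm 0 (Uf u x))) (Uf v)"
    by (rule bb_eq[OF u v VV_psm[OF Uf_VV[OF u]] Uf_VV[OF v] ae]) auto
  then show "bb u v = 0"
    by (simp add: hatf_linear aform_linear(5)[OF sqi_hatf(1)[OF sq(1)] sqi_hatf(1)[OF sq(2)] sq(2)])
  have "bb v u = aform (hatf (Uf v)) (\<lambda>x. psm 0 (Uf u x))"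
    by (rule bb_eq[OF v u Uf_VV[OF v] VV_psm[OF Uf_VV[OF u]] _ ae]) auto
  then show "bb v u = 0"
    by (simp add: aform_linear(6)[OF sq(1,2) sqi_hatf(1)[OF sq(2)]])
qed

text \<open>The L2 loss in \<open>form_integrand_coercive\<close>.\<close>

definition "c1 = 2 * \<kappa>\<^sup>2 + \<kappa>"

lemma c1_nonneg: "0 \<le> c1" using \<kappa>(5) by (simp add: c1_def)

lemma sqn_split: "sqi M U \<Longrightarrow> (sqn M U)\<^sup>2 = (sqn M (\<lambda>x. fst (U x)))\<^sup>2 + (sqn M (\<lambda>x. snd (U x)))\<^sup>2"
  using sqi_Pair(2)[OF sqi_fst_snd(1)[of M U] sqi_fst_snd(3)[of M U]] by simp

lemma aform_coercive:
  assumes U: "sqi M U"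
  shows "(sqn M U)\<^sup>2 \<le> 2 * Re (aform U U) + (2 * c1 + 1) * (sqn M (\<lambda>x. fst (U x)))\<^sup>2"
proof -
  note s = sqi_integrable[OF sqi_fst_snd(1)[OF U]] sqi_integrable[OF sqi_fst_snd(3)[OF U]]
  have i: "integrable M (\<lambda>x. form_integrand (Z x) (X x) (Y x) (c0 x) (U x) (U x))" by (rule aform_bound(1)[OF U U])
  have "AE x in M. x \<in> \<Omega>" using AE_space[of M] by (simp add: space_M)
  with \<kappa>(4) have "AE x in M. (norm (snd (U x)))\<^sup>2 / 2 - c1 * (norm (fst (U x)))\<^sup>2
      \<le> Re (form_integrand (Z x) (X x) (Y x) (c0 x) (U x) (U x))"
    unfolding c1_def by eventually_elim (use form_integrand_coercive \<kappa> Z(3) in blast)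
  then have "(LINT x|M. (norm (snd (U x)))\<^sup>2 / 2 - c1 * (norm (fst (U x)))\<^sup>2)
      \<le> (LINT x|M. Re (form_integrand (Z x) (X x) (Y x) (c0 x) (U x) (U x)))"
    using s i by (intro integral_mono_AE) auto
  also have "\<dots> = Re (aform U U)" using i by (simp add: aform_def)
  also have "(LINT x|M. (norm (snd (U x)))\<^sup>2 / 2 - c1 * (norm (fst (U x)))\<^sup>2)
     = (sqn M (\<lambda>x. snd (U x)))\<^sup>2 / 2 - c1 * (sqn M (\<lambda>x. fst (U x)))\<^sup>2"
    using s by (simp add: sqn_power2)
  finally show ?thesis using sqn_split[OF U] by (simp add: algebra_simps)
qed

text \<open>The loss \<open>c1\<close> is compensated, and the further 1 leaves room for the first
  component in the norm of a pair.\<close>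

definition "\<gamma>0 = - (c1 + 1)"

lemma bb_bounds:
  assumes U: "U \<in> VV" and x: "\<And>z. fst (U z) = x z"
  shows "Re (bb x x) - \<gamma>0 * (l2norm \<Omega> x)\<^sup>2 \<ge> (sqn M (hatf U))\<^sup>2 / 2"
    "cmod (bb x x) \<le> (1 + 4 * \<kappa>) * (sqn M (hatf U))\<^sup>2"
    "l2norm \<Omega> x \<le> sqn M (hatf U)"
proof -
  have xD: "x \<in> Dbar" using DbarI[OF U] by (simp add: x)
  note h = sqi_hatf(1)[OF VV_sqi[OF U]]
  have "bb x x = aform (hatf U) U" by (rule bb_eq[OF xD xD U U]) (auto simp: x)
  then have e: "bb x x = aform (hatf U) (hatf U)" by (simp add: aform_hatf_hatf)
  have f: "(\<lambda>z. fst (hatf U z)) = x" by (simp add: hatf_def hat_def x)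
  show "Re (bb x x) - \<gamma>0 * (l2norm \<Omega> x)\<^sup>2 \<ge> (sqn M (hatf U))\<^sup>2 / 2"
  proof -
    have "(sqn M (hatf U))\<^sup>2 \<le> 2 * Re (bb x x) + 2 * (c1 * (sqn M x)\<^sup>2) + (sqn M x)\<^sup>2"
      using aform_coercive[OF h] unfolding f e by (simp add: algebra_simps)
    moreover have "\<gamma>0 * (sqn M x)\<^sup>2 = - (c1 * (sqn M x)\<^sup>2) - (sqn M x)\<^sup>2" by (simp add: \<gamma>0_def algebra_simps)
    moreover have "0 \<le> (sqn M x)\<^sup>2" by simp
    ultimately show ?thesis unfolding l2norm_eq_sqn by linarith
  qed
  show "cmod (bb x x) \<le> (1 + 4 * \<kappa>) * (sqn M (hatf U))\<^sup>2"
    unfolding e using aform_bound(2)[OF h h] by (simp add: power2_eq_square)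
  show "l2norm \<Omega> x \<le> sqn M (hatf U)" using sqi_fst_snd(2)[OF h] by (simp add: f l2norm_eq_sqn)
qed

text \<open>The angle compares the upper bound \<open>1 + 4 \<kappa>\<close> of the form with its
  lower bound \<open>1/2\<close> after the shift, both relative to the squared norm of the selected
  element.\<close>

lemma sectorial_bb: "sectorial_vertex \<Omega> bb Dbar \<gamma>0"
  unfolding sectorial_vertex_def
proof (intro conjI sesq_bb exI[of _ "arctan (2 * (1 + 4 * \<kappa>))"] ballI)
  show "0 \<le> arctan (2 * (1 + 4 * \<kappa>))" using \<kappa>(5) by simp
  show "arctan (2 * (1 + 4 * \<kappa>)) < pi / 2" by (rule arctan_ubound)
  fix u assume u: "u \<in> Dbar"
  note b = bb_bounds[OF Uf_VV[OF u] fst_Uf]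
  show "bb u u - complex_of_real (\<gamma>0 * (l2norm \<Omega> u)\<^sup>2) \<in> sector (arctan (2 * (1 + 4 * \<kappa>)))"
  proof (rule sectorI)
    have p: "0 \<le> (sqn M (hatf (Uf u)))\<^sup>2" by simp
    have re: "Re (bb u u - complex_of_real (\<gamma>0 * (l2norm \<Omega> u)\<^sup>2)) = Re (bb u u) - \<gamma>0 * (l2norm \<Omega> u)\<^sup>2"
      and im: "Im (bb u u - complex_of_real (\<gamma>0 * (l2norm \<Omega> u)\<^sup>2)) = Im (bb u u)"
      by (simp_all del: of_real_mult of_real_power)
    show "0 \<le> Re (bb u u - complex_of_real (\<gamma>0 * (l2norm \<Omega> u)\<^sup>2))" unfolding re using b(1) p by linarith
    have "\<bar>Im (bb u u)\<bar> \<le> (1 + 4 * \<kappa>) * (sqn M (hatf (Uf u)))\<^sup>2" using b(2) abs_Im_le_cmod order_trans by blast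
    also have "\<dots> \<le> (1 + 4 * \<kappa>) * (2 * (Re (bb u u) - \<gamma>0 * (l2norm \<Omega> u)\<^sup>2))"
      using b(1) \<kappa>(5) by (intro mult_left_mono) auto
    finally show "\<bar>Im (bb u u - complex_of_real (\<gamma>0 * (l2norm \<Omega> u)\<^sup>2))\<bar>
        \<le> 2 * (1 + 4 * \<kappa>) * Re (bb u u - complex_of_real (\<gamma>0 * (l2norm \<Omega> u)\<^sup>2))"
      unfolding re im by (simp add: algebra_simps)
  qed
qed

text \<open>Together with \<open>form_norm_bb_le\<close> this makes the form norm comparable to the
  L2 norm of the nonsingular part, so that completeness is inherited from L2.\<close>

lemma form_norm_bb_ge:
  assumes U: "U \<in> VV" and x: "\<And>z. fst (U z) = x z"
  shows "sqn M (prf U) \<le> 2 * form_norm \<Omega> bb \<gamma>0 x"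
proof -
  have "(sqn M (hatf U))\<^sup>2 / 2 \<le> Re (bb x x) + (1 - \<gamma>0) * (l2norm \<Omega> x)\<^sup>2"
    using bb_bounds(1)[OF U x] zero_le_power2[of "l2norm \<Omega> x"] by (simp only: left_diff_distrib)
  moreover have "S \<le> 4 * E" if "S / 2 \<le> E" "0 \<le> S" for S E :: real using that by linarith
  ultimately have "(sqn M (hatf U))\<^sup>2 \<le> 4 * (Re (bb x x) + (1 - \<gamma>0) * (l2norm \<Omega> x)\<^sup>2)"
    using zero_le_power2 by blast
  then have "sqrt ((sqn M (hatf U))\<^sup>2) \<le> sqrt (4 * (Re (bb x x) + (1 - \<gamma>0) * (l2norm \<Omega> x)\<^sup>2))"
    by (rule real_sqrt_le_mono)
  then have "sqn M (hatf U) \<le> 2 * form_norm \<Omega> bb \<gamma>0 x"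
    unfolding real_sqrt_mult form_norm_def by simp
  then show ?thesis using sqi_hatf(3)[OF VV_sqi[OF U]] by linarith
qed

lemma form_norm_bb_le:
  "\<exists>c. \<forall>U\<in>VV. form_norm \<Omega> bb \<gamma>0 (\<lambda>z. fst (U z)) \<le> c * sqn M U"
proof -
  define k where "k = (1 + 4 * \<kappa>) + (1 - \<gamma>0)"
  have g0: "1 - \<gamma>0 \<ge> 0" using c1_nonneg by (simp add: \<gamma>0_def)
  have k0: "k \<ge> 0" using \<kappa>(5) g0 by (simp add: k_def)
  have "form_norm \<Omega> bb \<gamma>0 (\<lambda>z. fst (U z)) \<le> (sqrt k * (2 + 2 * \<kappa>)) * sqn M U" if U: "U \<in> VV" for U
  proof -
    define x where "x = (\<lambda>z. fst (U z))"
    have x: "fst (U z) = x z" for z by (simp add: x_def)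
    note b = bb_bounds[OF U x]
    have "Re (bb x x) + (1 - \<gamma>0) * (l2norm \<Omega> x)\<^sup>2 \<le> (1 + 4 * \<kappa>) * (sqn M (hatf U))\<^sup>2 + (1 - \<gamma>0) * (sqn M (hatf U))\<^sup>2"
      using b(2,3) complex_Re_le_cmod[of "bb x x"] g0 by (intro add_mono mult_left_mono power_mono) auto
    also have "\<dots> = k * (sqn M (hatf U))\<^sup>2" by (simp add: k_def algebra_simps)
    finally have "form_norm \<Omega> bb \<gamma>0 x \<le> sqrt (k * (sqn M (hatf U))\<^sup>2)"
      unfolding form_norm_def by (rule real_sqrt_le_mono)
    also have "\<dots> = sqrt k * sqn M (hatf U)" by (simp add: real_sqrt_mult)
    also have "\<dots> \<le> sqrt k * ((2 + 2 * \<kappa>) * sqn M U)"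
    proof (intro mult_left_mono)
      have "sqn M (hatf U) \<le> (2 + 2 * \<kappa>) * sqn M (prf U)" by (rule sqi_hatf(2)[OF VV_sqi[OF U]])
      also have "\<dots> \<le> (2 + 2 * \<kappa>) * sqn M U"
        using \<kappa>(5) sqi_prf(2)[OF VV_sqi[OF U]] by (intro mult_left_mono) auto
      finally show "sqn M (hatf U) \<le> (2 + 2 * \<kappa>) * sqn M U" .
    qed (use k0 in simp)
    finally show ?thesis by (simp add: x_def mult.assoc)
  qed
  then show ?thesis by blast
qed

lemma closed_bb: "closed_form \<Omega> bb Dbar"
  unfolding closed_form_def
proof (intro exI[of _ \<gamma>0] conjI sectorial_bb allI impI)
  fix s :: "nat \<Rightarrow> real^'n \<Rightarrow> complex"
  assume s: "(\<forall>n. s n \<in> Dbar) \<and>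
     (\<forall>e>0. \<exists>N. \<forall>m\<ge>N. \<forall>n\<ge>N. form_norm \<Omega> bb \<gamma>0 (\<lambda>x. s m x - s n x) < e)"
  have sD: "s n \<in> Dbar" for n using s by blast
  \<comment> \<open>Nonsingular representatives are controlled by the form norm; the chosen
    \<open>Uf (s n)\<close> need not be Cauchy, since nothing restrains their singular
    parts.\<close>
  define U where "U n = prf (Uf (s n))" for n
  have UV: "U n \<in> VV" for n unfolding U_def by (rule prf_VV[OF Uf_VV[OF sD]])
  have Uf: "fst (U n z) = s n z" for n z by (simp add: U_def prf_def pr_def)
  have diff: "sqn M (\<lambda>x. U m x - U n x) \<le> 2 * form_norm \<Omega> bb \<gamma>0 (\<lambda>x. s m x - s n x)" for m n
  proof -
    have d: "(\<lambda>x. U m x - U n x) \<in> VV" by (rule VV_diff[OF UV UV])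
    have "sqn M (\<lambda>x. U m x - U n x) = sqn M (prf (\<lambda>x. U m x - U n x))"
    proof (rule sqn_cong)
      fix x assume "x \<in> space M"
      then have "projection_data (Z x) (Q x)" using projection by (simp add: space_M)
      from projection_data.PPv[OF this] show "U m x - U n x = prf (\<lambda>x. U m x - U n x) x"
        by (simp add: U_def prf_def pr_def matrix_vector_mult_diff_distrib)
    qed
    also have "\<dots> \<le> 2 * form_norm \<Omega> bb \<gamma>0 (\<lambda>x. s m x - s n x)"
      by (rule form_norm_bb_ge[OF d]) (simp add: Uf)
    finally show ?thesis .
  qed
  have "\<exists>V. sqi M V \<and> (\<lambda>n. sqn M (\<lambda>x. U n x - V x)) \<longlonglongrightarrow> 0"
  proof (rule square_integrable_complete[OF VV_sqi[OF UV]])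
    fix e :: real assume "e > 0"
    then have "e / 2 > 0" by simp
    then obtain N where N: "\<forall>m\<ge>N. \<forall>n\<ge>N. form_norm \<Omega> bb \<gamma>0 (\<lambda>x. s m x - s n x) < e / 2" using s by blast
    have "sqn M (\<lambda>x. U m x - U n x) < e" if "m \<ge> N" "n \<ge> N" for m n
    proof -
      have "form_norm \<Omega> bb \<gamma>0 (\<lambda>x. s m x - s n x) < e / 2" using N that by blast
      then show ?thesis using diff[of m n] by linarith
    qed
    then show "\<exists>N. \<forall>m\<ge>N. \<forall>n\<ge>N. sqn M (\<lambda>x. U m x - U n x) < e" by blast
  qed
  then obtain V where V: "sqi M V" and lim: "(\<lambda>n. sqn M (\<lambda>x. U n x - V x)) \<longlonglongrightarrow> 0" by blast
  have VV: "V \<in> VV"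
  proof (rule VV_limit[OF V])
    fix e :: real assume "e > 0"
    from order_tendstoD(2)[OF lim this] obtain n where "sqn M (\<lambda>x. U n x - V x) < e"
      by (auto simp: eventually_sequentially)
    then show "\<exists>U'\<in>VV. sqn M (\<lambda>x. U' x - V x) < e" using UV by blast
  qed
  obtain c where c: "\<And>U. U \<in> VV \<Longrightarrow> form_norm \<Omega> bb \<gamma>0 (\<lambda>z. fst (U z)) \<le> c * sqn M U" using form_norm_bb_le by blast
  interpret sectorial_form \<Omega> bb Dbar \<gamma>0 by unfold_locales (rule sectorial_bb)
  have "(\<lambda>n. form_norm \<Omega> bb \<gamma>0 (\<lambda>x. s n x - fst (V x))) \<longlonglongrightarrow> 0"
  proof (rule Lim_null_comparison)
    show "(\<lambda>n. c * sqn M (\<lambda>x. U n x - V x)) \<longlonglongrightarrow> 0" by (rule tendsto_mult_right_zero[OF lim])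
    have "norm (form_norm \<Omega> bb \<gamma>0 (\<lambda>x. s n x - fst (V x))) \<le> c * sqn M (\<lambda>x. U n x - V x)" for n
    proof -
      have "(\<lambda>x. s n x - fst (V x)) \<in> Dbar" using Dbar_diff[OF sD DbarI[OF VV]] by simp
      then have "0 \<le> form_norm \<Omega> bb \<gamma>0 (\<lambda>x. s n x - fst (V x))" by (rule q_nonneg)
      then show ?thesis using c[OF VV_diff[OF UV VV], of n] by (simp add: Uf)
    qed
    then show "\<forall>\<^sub>F n in sequentially. norm (form_norm \<Omega> bb \<gamma>0 (\<lambda>x. s n x - fst (V x))) \<le> c * sqn M (\<lambda>x. U n x - V x)"
      by simp
  qed
  then show "\<exists>u\<in>Dbar. (\<lambda>n. form_norm \<Omega> bb \<gamma>0 (\<lambda>x. s n x - u x)) \<longlonglongrightarrow> 0"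
    using DbarI[OF VV] by (rule_tac bexI[of _ "\<lambda>x. fst (V x)"])
qed

lemma bb_rf: "u \<in> D \<Longrightarrow> v \<in> D \<Longrightarrow> bb u v = rf u v"
  using bb_eq[of u v "G u" "G v"] D_Dbar G_VV by (auto simp: rf_def)

lemma closable_rf: "closable \<Omega> rf D"
  unfolding closable_def using D_Dbar bb_rf closed_bb by blast

lemma sectorial_rf: "sectorial_vertex \<Omega> rf D \<gamma>0"
proof (rule sectorial_vertex_cong)
  show "sectorial_vertex \<Omega> bb D \<gamma>0"
    by (rule sectorial_vertex_mono[OF sectorial_bb D_Dbar])
       (use D_0 D_add D_cmult in \<open>auto simp: zero_fun_def plus_fun_def\<close>)
qed (simp add: bb_rf)

text \<open>The hermitian square root is moved from one argument to the other: it combines with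
  \<open>1 + iZ\<close> to \<open>C\<close>, and with \<open>X\<close> and \<open>Y\<close> to the
  conjugate of \<open>b\<close> and to \<open>d\<close>.\<close>

lemma diff_form_aform:
  assumes u: "u \<in> D" and v: "v \<in> D"
  shows "diff_form \<Omega> grad C b d c0 u v = aform (G u) (G v)"
proof -
  note U = sqi_G[OF u] and V = sqi_G[OF v]
  have mG: "grad u \<in> borel_measurable M" "grad v \<in> borel_measurable M" using measurable_coeffs(3) u v by auto
  have mu: "u \<in> borel_measurable M" "v \<in> borel_measurable M" using D_L2 u v by (auto simp: L2_def)
  have mcv: "(\<lambda>x. cnj (v x)) \<in> borel_measurable M"
    by (rule borel_measurable_continuous_on[OF _ mu(2)]) (intro continuous_intros)
  have mT: "(\<lambda>x. A x *v grad u x) \<in> borel_measurable M" "(\<lambda>x. A x *v grad v x) \<in> borel_measurable M"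
    by (intro borel_measurable_mult_vec measurable_coeffs u v)+
  have le: "cmod (u x) \<le> norm (G u x)" "norm (A x *v grad u x) \<le> norm (G u x)"
    "cmod (v x) \<le> norm (G v x)" "norm (A x *v grad v x) \<le> norm (G v x)" for x
    using norm_fst_snd_le[of "G u x"] norm_fst_snd_le[of "G v x"] by (simp_all add: G_def)
  have i2: "integrable M (\<lambda>x. cdot (A x *v grad u x) (X x) * cnj (v x))"
  proof (rule sqi_bilinear(1)[OF U V _ \<kappa>(5)])
    show "AE x in M. norm (cdot (A x *v grad u x) (X x) * cnj (v x)) \<le> \<kappa> * (norm (G u x) * norm (G v x))"
    proof (rule AE_I2)
      fix x assume "x \<in> space M"
      then have k: "norm (X x) \<le> \<kappa>" by (simp add: \<kappa> space_M)
      have "norm (cdot (A x *v grad u x) (X x) * cnj (v x)) \<le> (norm (A x *v grad u x) * norm (X x)) * cmod (v x)"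
        by (simp add: norm_mult mult_right_mono norm_cdot_le)
      also have "\<dots> \<le> (norm (G u x) * \<kappa>) * norm (G v x)"
        by (intro mult_mono le k) (simp_all add: \<kappa>(5))
      finally show "norm (cdot (A x *v grad u x) (X x) * cnj (v x)) \<le> \<kappa> * (norm (G u x) * norm (G v x))"
        by (simp add: mult_ac)
    qed
  qed (intro borel_measurable_times borel_measurable_cdot mT mcv X(1))
  have i3: "integrable M (\<lambda>x. u x * cdot (Y x) (A x *v grad v x))"
  proof (rule sqi_bilinear(1)[OF U V _ \<kappa>(5)])
    show "AE x in M. norm (u x * cdot (Y x) (A x *v grad v x)) \<le> \<kappa> * (norm (G u x) * norm (G v x))"
    proof (rule AE_I2)
      fix x assume "x \<in> space M"
      then have k: "norm (Y x) \<le> \<kappa>" by (simp add: \<kappa> space_M)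
      have "norm (u x * cdot (Y x) (A x *v grad v x)) \<le> cmod (u x) * (norm (Y x) * norm (A x *v grad v x))"
        by (simp add: norm_mult mult_left_mono norm_cdot_le)
      also have "\<dots> \<le> norm (G u x) * (\<kappa> * norm (G v x))"
        by (intro mult_mono le k) (simp_all add: \<kappa>(5))
      finally show "norm (u x * cdot (Y x) (A x *v grad v x)) \<le> \<kappa> * (norm (G u x) * norm (G v x))"
        by (simp add: mult_ac)
    qed
  qed (intro borel_measurable_times borel_measurable_cdot mT mu Y(1))
  have i4: "integrable M (\<lambda>x. c0 x * u x * cnj (v x))"
  proof (rule sqi_bilinear(1)[OF U V _ \<kappa>(5)])
    show "AE x in M. norm (c0 x * u x * cnj (v x)) \<le> \<kappa> * (norm (G u x) * norm (G v x))"
      using \<kappa>(4)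
    proof eventually_elim
      case (elim x)
      have "norm (c0 x * u x * cnj (v x)) \<le> \<kappa> * norm (G u x) * norm (G v x)"
        unfolding norm_mult complex_mod_cnj by (intro mult_mono le elim) (simp_all add: \<kappa>(5))
      then show ?case by (simp add: mult.assoc)
    qed
  qed (intro borel_measurable_times measurable_coeffs mu mcv)
  define t1 where "t1 x = cdot (A x *v grad u x + \<i> *s (Z x *v (A x *v grad u x))) (A x *v grad v x)" for x
  have fi: "form_integrand (Z x) (X x) (Y x) (c0 x) (G u x) (G v x)
     = t1 x + cdot (A x *v grad u x) (X x) * cnj (v x) + u x * cdot (Y x) (A x *v grad v x) + c0 x * u x * cnj (v x)" for x
    by (simp add: form_integrand_def G_def t1_def)
  \<comment> \<open>The leading term is integrable as the whole integrand minus the other three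
    terms.\<close>
  have "integrable M (\<lambda>x. (t1 x + cdot (A x *v grad u x) (X x) * cnj (v x) + u x * cdot (Y x) (A x *v grad v x) + c0 x * u x * cnj (v x))
     - cdot (A x *v grad u x) (X x) * cnj (v x) - u x * cdot (Y x) (A x *v grad v x) - c0 x * u x * cnj (v x))"
    using aform_bound(1)[OF U V] i2 i3 i4 unfolding fi by (intro Bochner_Integration.integrable_diff)
  then have i1: "integrable M t1" by simp
  have "aform (G u) (G v) = (LINT x|M. t1 x) + (LINT x|M. cdot (A x *v grad u x) (X x) * cnj (v x))
     + (LINT x|M. u x * cdot (Y x) (A x *v grad v x)) + (LINT x|M. c0 x * u x * cnj (v x))"
    unfolding aform_def fi using i1 i2 i3 i4 by simp
  also have "(LINT x|M. t1 x) = (LINT x|M. cdot (C x *v grad u x) (grad v x))"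
  proof (rule Bochner_Integration.integral_cong)
    fix x assume "x \<in> space M"
    then have x: "x \<in> \<Omega>" by (simp add: space_M)
    have "C x = A x ** (mat 1 + cscale \<i> (Z x)) ** A x" using Z(4) x by simp
    then show "t1 x = cdot (C x *v grad u x) (grad v x)"
      by (simp add: t1_def matrix_vector_mul_assoc[symmetric] cdot_hermitian[OF A_hermitian[OF x]]
          matrix_vector_mult_add_rdistrib cscale_mult_vec)
  qed simp
  also have "(LINT x|M. cdot (A x *v grad u x) (X x) * cnj (v x)) = (LINT x|M. (\<Sum>k\<in>UNIV. b x $ k * grad u x $ k) * cnj (v x))"
  proof (rule Bochner_Integration.integral_cong)
    fix x assume "x \<in> space M"
    then have x: "x \<in> \<Omega>" by (simp add: space_M)
    have "cdot (A x *v grad u x) (X x) = cdot (grad u x) (vconj (b x))"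
      using X(3) x by (simp add: cdot_hermitian[OF A_hermitian[OF x]])
    then show "cdot (A x *v grad u x) (X x) * cnj (v x) = (\<Sum>k\<in>UNIV. b x $ k * grad u x $ k) * cnj (v x)"
      by (simp add: cdot_def vconj_def mult.commute)
  qed simp
  also have "(LINT x|M. u x * cdot (Y x) (A x *v grad v x)) = (LINT x|M. (\<Sum>k\<in>UNIV. d x $ k * u x * cnj (grad v x $ k)))"
  proof (rule Bochner_Integration.integral_cong)
    fix x assume "x \<in> space M"
    then have x: "x \<in> \<Omega>" by (simp add: space_M)
    have "cdot (Y x) (A x *v grad v x) = cdot (d x) (grad v x)"
      using Y(3) x by (simp add: cdot_hermitian[OF A_hermitian[OF x], symmetric])
    then show "u x * cdot (Y x) (A x *v grad v x) = (\<Sum>k\<in>UNIV. d x $ k * u x * cnj (grad v x $ k))"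
      by (simp add: cdot_def sum_distrib_left mult_ac)
  qed simp
  finally show ?thesis by (simp add: diff_form_def)
qed

section \<open>Equality of the associated operators\<close>

text \<open>The definition of the operator bounds only real parts and first components; by
  coercivity this controls whole pairs.\<close>

lemma bounded_sqn:
  assumes "sqi M U" "Re (aform U U) \<le> c" "sqn M (\<lambda>x. fst (U x)) \<le> r"
  shows "sqn M U \<le> sqrt (2 * \<bar>c\<bar> + (2 * c1 + 1) * r\<^sup>2)"
proof -
  have "(sqn M U)\<^sup>2 \<le> 2 * Re (aform U U) + (2 * c1 + 1) * (sqn M (\<lambda>x. fst (U x)))\<^sup>2" by (rule aform_coercive[OF assms(1)])
  also have "\<dots> \<le> 2 * \<bar>c\<bar> + (2 * c1 + 1) * r\<^sup>2"
    using assms(2,3) c1_nonneg by (intro add_mono mult_left_mono power_mono) auto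
  finally show ?thesis by (simp add: real_le_rsqrt)
qed

lemma L2_tendsto_bounded:
  assumes s: "\<And>n. sqi M (s n)" and x: "sqi M x" and lim: "(\<lambda>n. sqn M (\<lambda>y. s n y - x y)) \<longlonglongrightarrow> 0"
  shows "\<exists>r. \<forall>n. sqn M (s n) \<le> r"
proof -
  have "Bseq (\<lambda>n. sqn M (\<lambda>y. s n y - x y))" using lim by (simp add: convergent_imp_Bseq convergentI)
  then obtain r where r: "\<And>n. sqn M (\<lambda>y. s n y - x y) \<le> r" by (auto simp: Bseq_def)
  have "sqn M (s n) \<le> r + sqn M x" for n
    using sqi_add(2)[OF sqi_diff(1)[OF s x] x, of n] r[of n] by simp
  then show ?thesis by blast
qed

text \<open>In this direction the sequence given for the original form works unchanged.\<close>

lemma assoc_op_rf_subset: "assoc_op \<Omega> (diff_form \<Omega> grad C b d c0) D \<subseteq> assoc_op \<Omega> rf D"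
proof
  fix xf assume a: "xf \<in> assoc_op \<Omega> (diff_form \<Omega> grad C b d c0) D"
  obtain x f where xf: "xf = (x, f)" by (cases xf)
  obtain s c where xL: "L2 \<Omega> x" and fL: "L2 \<Omega> f" and sD: "\<And>n. s n \<in> D"
    and sx: "(\<lambda>n. l2norm \<Omega> (\<lambda>y. s n y - x y)) \<longlonglongrightarrow> 0"
    and bd: "\<And>n. Re (diff_form \<Omega> grad C b d c0 (s n) (s n)) \<le> c"
    and lim: "\<And>v. v \<in> D \<Longrightarrow> (\<lambda>n. diff_form \<Omega> grad C b d c0 (s n) v) \<longlonglongrightarrow> linner \<Omega> f v"
    using a unfolding xf assoc_op_def by blast
  have sS: "sqi M (s n)" for n using D_L2[OF sD] by (simp add: L2_iff_sqi)
  obtain r where r: "\<And>n. sqn M (s n) \<le> r"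
    using L2_tendsto_bounded[where s = s and x = x, OF sS] xL sx unfolding L2_iff_sqi l2norm_eq_sqn by blast
  define R where "R = sqrt (2 * \<bar>c\<bar> + (2 * c1 + 1) * r\<^sup>2)"
  have GR: "sqn M (G (s n)) \<le> R" for n
    unfolding R_def by (rule bounded_sqn[OF sqi_G[OF sD]]) (use bd[of n] r[of n] in \<open>simp_all add: diff_form_aform sD\<close>)
  have R0: "0 \<le> R" using GR[of 0] sqn_nonneg order_trans by blast
  define K where "K = 1 + 4 * \<kappa>"
  have K0: "0 \<le> K" using \<kappa>(5) by (simp add: K_def)
  have ext: "(\<lambda>n. aform (G (s n)) V) \<longlonglongrightarrow> linner \<Omega> f (\<lambda>x. fst (V x))" if V: "V \<in> VV" for V
  proof (rule LIMSEQ_I)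
    fix e :: real assume e: "e > 0"
    define m where "m = K * R + l2norm \<Omega> f"
    have m0: "0 \<le> m" using K0 R0 by (simp add: m_def)
    \<comment> \<open>Both error terms are linear in the distance of \<open>G t\<close> from
      \<open>V\<close>, with total factor \<open>m\<close>. The choice of \<open>\<delta>\<close>
      keeps them below \<open>e / 2\<close>, and the summand 1 avoids a zero denominator.\<close>
    define \<delta> where "\<delta> = e / (2 * (m + 1))"
    have \<delta>: "\<delta> > 0" using e m0 by (simp add: \<delta>_def)
    obtain t where t: "t \<in> D" "sqn M (\<lambda>x. G t x - V x) < \<delta>" using VV_approx[OF V \<delta>] by blast
    have "e / 2 > 0" using e by simp
    from LIMSEQ_D[OF lim[OF t(1)] this] obtain N where
      N: "\<And>n. n \<ge> N \<Longrightarrow> cmod (diff_form \<Omega> grad C b d c0 (s n) t - linner \<Omega> f t) < e / 2" by auto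
    have d: "sqi M (\<lambda>x. G t x - V x)" by (rule sqi_diff(1)[OF sqi_G[OF t(1)] VV_sqi[OF V]])
    have fV: "L2 \<Omega> (\<lambda>x. fst (V x))" using sqi_fst_snd(1)[OF VV_sqi[OF V]] by (simp add: L2_iff_sqi)
    have "cmod (aform (G (s n)) V - linner \<Omega> f (\<lambda>x. fst (V x))) < e" if "n \<ge> N" for n
    proof -
      have 1: "aform (G (s n)) V = diff_form \<Omega> grad C b d c0 (s n) t - aform (G (s n)) (\<lambda>x. G t x - V x)"
        using aform_linear(4)[OF sqi_G[OF t(1)] VV_sqi[OF V] sqi_G[OF sD]] by (simp add: diff_form_aform sD t)
      have 2: "linner \<Omega> f (\<lambda>x. fst (V x)) = linner \<Omega> f t - linner \<Omega> f (t - (\<lambda>x. fst (V x)))"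
        using linner_diff_right[OF D_L2[OF t(1)] fV fL] by simp
      have 3: "cmod (aform (G (s n)) (\<lambda>x. G t x - V x)) \<le> K * (R * \<delta>)"
      proof -
        have "cmod (aform (G (s n)) (\<lambda>x. G t x - V x)) \<le> K * (sqn M (G (s n)) * sqn M (\<lambda>x. G t x - V x))"
          unfolding K_def by (rule aform_bound(2)[OF sqi_G[OF sD] d])
        also have "\<dots> \<le> K * (R * \<delta>)" using GR t(2) R0 K0 by (intro mult_left_mono mult_mono) auto
        finally show ?thesis .
      qed
      have 4: "cmod (linner \<Omega> f (t - (\<lambda>x. fst (V x)))) \<le> l2norm \<Omega> f * \<delta>"
      proof -
        have "l2norm \<Omega> (t - (\<lambda>x. fst (V x))) \<le> \<delta>"
          using sqi_fst_snd(2)[OF d] t(2) by (simp add: l2norm_eq_sqn fun_diff_def)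
        then show ?thesis
          using order_trans[OF linner_integrable(2)[OF fL L2_diff[OF D_L2[OF t(1)] fV]] mult_left_mono] by simp
      qed
      have tri: "cmod ((p - x) - (q - y)) \<le> cmod (p - q) + cmod x + cmod y" for p q x y :: complex
        using norm_triangle_ineq4[of "p - q" "x - y"] norm_triangle_ineq4[of x y] by (simp add: algebra_simps)
      have "cmod (aform (G (s n)) V - linner \<Omega> f (\<lambda>x. fst (V x))) \<le> cmod (diff_form \<Omega> grad C b d c0 (s n) t - linner \<Omega> f t)
         + cmod (aform (G (s n)) (\<lambda>x. G t x - V x)) + cmod (linner \<Omega> f (t - (\<lambda>x. fst (V x))))"
        unfolding 1 2 by (rule tri)
      moreover have "K * (R * \<delta>) + l2norm \<Omega> f * \<delta> = m * \<delta>" by (simp add: m_def algebra_simps)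
      moreover have "m * \<delta> \<le> (m + 1) * \<delta>" using \<delta> by simp
      moreover have "(m + 1) * \<delta> = e / 2" using m0 by (simp add: \<delta>_def field_simps)
      ultimately show ?thesis using N[OF that] 3 4 by linarith
    qed
    then show "\<exists>N. \<forall>n\<ge>N. norm (aform (G (s n)) V - linner \<Omega> f (\<lambda>x. fst (V x))) < e" by blast
  qed
  have "Re (rf (s n) (s n)) \<le> K * ((2 + 2 * \<kappa>) * R * R)" for n
  proof -
    have "Re (rf (s n) (s n)) \<le> cmod (aform (hatf (G (s n))) (G (s n)))" by (simp add: rf_def sD complex_Re_le_cmod)
    also have "\<dots> \<le> K * (sqn M (hatf (G (s n))) * sqn M (G (s n)))"
      unfolding K_def by (rule aform_bound(2)[OF sqi_hatf(1)[OF sqi_G[OF sD]] sqi_G[OF sD]])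
    also have "\<dots> \<le> K * (((2 + 2 * \<kappa>) * R) * R)"
    proof (intro mult_left_mono[OF _ K0] mult_mono GR)
      have "sqn M (hatf (G (s n))) \<le> (2 + 2 * \<kappa>) * sqn M (prf (G (s n)))" by (rule sqi_hatf(2)[OF sqi_G[OF sD]])
      also have "\<dots> \<le> (2 + 2 * \<kappa>) * R"
        using order_trans[OF sqi_prf(2)[OF sqi_G[OF sD]] GR] \<kappa>(5) by (intro mult_left_mono) auto
      finally show "sqn M (hatf (G (s n))) \<le> (2 + 2 * \<kappa>) * R" .
    qed (use R0 \<kappa>(5) in auto)
    finally show ?thesis by simp
  qed
  moreover have "(\<lambda>n. rf (s n) v) \<longlonglongrightarrow> linner \<Omega> f v" if v: "v \<in> D" for v
  proof -
    \<comment> \<open>The test field of \<open>form_integrand_defect\<close> for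
      \<open>p' = G v\<close>; it does not depend on \<open>n\<close>.\<close>
    define \<psi> where "\<psi> x = adj (Wmat (Z x) (Q x)) *v
      (snd (G v x) - \<i> *s (Z x *v snd (G v x)) + fst (G v x) *s X x)" for x
    have s\<psi>: "sqi M \<psi>"
    proof (rule sqi_dominated(1)[OF sqi_G[OF v], of _ "1 + 2 * \<kappa>"])
      have "(\<lambda>x. fst (G v x)) \<in> borel_measurable M" "(\<lambda>x. snd (G v x)) \<in> borel_measurable M"
        using sqi_measurable sqi_fst_snd(1,3)[OF sqi_G[OF v]] by blast+
      then show "\<psi> \<in> borel_measurable M"
        unfolding \<psi>_def
        by (intro borel_measurable_mult_vec borel_measurable_adj borel_measurable_add borel_measurable_diff
            borel_measurable_smult borel_measurable_const measurable_coeffs Z(1) X(1))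
      show "0 \<le> 1 + 2 * \<kappa>" using \<kappa>(5) by simp
      show "AE x in M. norm (\<psi> x) \<le> (1 + 2 * \<kappa>) * norm (G v x)"
      proof (rule AE_I2)
        fix x assume "x \<in> space M"
        then have x: "x \<in> \<Omega>" by (simp add: space_M)
        let ?p = "G v x"
        have "norm (\<psi> x) \<le> norm (snd ?p - \<i> *s (Z x *v snd ?p) + fst ?p *s X x)"
          unfolding \<psi>_def by (rule projection_data.norm_adj_W_le[OF projection[OF x]])
        also have "\<dots> \<le> norm (snd ?p) + norm (Z x *v snd ?p) + cmod (fst ?p) * norm (X x)"
          by (intro norm_triangle_le add_mono order_trans[OF norm_triangle_ineq4])
             (simp_all add: norm_smult_vec)
        also have "\<dots> \<le> norm ?p + \<kappa> * norm ?p + norm ?p * \<kappa>"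
          by (intro add_mono mult_mono norm_fst_snd_le \<kappa>(2)[OF x] \<kappa>(5) norm_ge_zero
              order_trans[OF norm_mult_vec_le mult_mono[OF \<kappa>(1)[OF x] norm_fst_snd_le(2) \<kappa>(5) norm_ge_zero]])
        finally show "norm (\<psi> x) \<le> (1 + 2 * \<kappa>) * norm ?p" by (simp add: algebra_simps)
      qed
    qed
    have V0: "(\<lambda>x. (0, Q x *v \<psi> x)) \<in> VV" by (rule Q_VV[OF s\<psi>])
    \<comment> \<open>The first component of the test element is zero, so the limit is the product
      of \<open>f\<close> with the zero function.\<close>
    have "(\<lambda>n. aform (G (s n)) (\<lambda>x. (0, Q x *v \<psi> x))) \<longlonglongrightarrow> 0"
      using ext[OF V0] by (simp add: linner_def)
    moreover have "diff_form \<Omega> grad C b d c0 (s n) v - rf (s n) v = aform (G (s n)) (\<lambda>x. (0, Q x *v \<psi> x))" for n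
    proof -
      have "aform (G (s n)) (\<lambda>x. (0, Q x *v \<psi> x)) = aform (\<lambda>x. G (s n) x - hatf (G (s n)) x) (G v)"
        unfolding aform_def
        by (rule Bochner_Integration.integral_cong)
           (simp_all add: space_M hatf_def \<psi>_def projection_data.form_integrand_defect[OF projection])
      also have "\<dots> = aform (G (s n)) (G v) - aform (hatf (G (s n))) (G v)"
        by (rule aform_linear(3)[OF sqi_G[OF sD] sqi_hatf(1)[OF sqi_G[OF sD]] sqi_G[OF v]])
      finally show ?thesis by (simp add: diff_form_aform rf_def sD v)
    qed
    ultimately have "(\<lambda>n. diff_form \<Omega> grad C b d c0 (s n) v - (diff_form \<Omega> grad C b d c0 (s n) v - rf (s n) v)) \<longlonglongrightarrow> linner \<Omega> f v - 0"
      by (intro tendsto_diff lim v) simp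
    then show ?thesis by simp
  qed
  ultimately show "xf \<in> assoc_op \<Omega> rf D"
    unfolding xf assoc_op_def using xL fL sD sx by blast
qed

text \<open>Here the sequence must change: boundedness of \<open>rf\<close> says nothing about the
  singular part of \<open>G (s n)\<close>. It is replaced by \<open>t n\<close> in \<open>D\<close>
  whose graph element is close to the selected element \<open>H n\<close>.\<close>

lemma assoc_op_rf_supset: "assoc_op \<Omega> rf D \<subseteq> assoc_op \<Omega> (diff_form \<Omega> grad C b d c0) D"
proof
  fix xf assume a: "xf \<in> assoc_op \<Omega> rf D"
  obtain x f where xf: "xf = (x, f)" by (cases xf)
  obtain s c where xL: "L2 \<Omega> x" and fL: "L2 \<Omega> f" and sD: "\<And>n. s n \<in> D"
    and sx: "(\<lambda>n. l2norm \<Omega> (\<lambda>y. s n y - x y)) \<longlonglongrightarrow> 0"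
    and bd: "\<And>n. Re (rf (s n) (s n)) \<le> c"
    and lim: "\<And>v. v \<in> D \<Longrightarrow> (\<lambda>n. rf (s n) v) \<longlonglongrightarrow> linner \<Omega> f v"
    using a unfolding xf assoc_op_def by blast
  have sS: "sqi M (s n)" for n using D_L2[OF sD] by (simp add: L2_iff_sqi)
  obtain r where r: "\<And>n. sqn M (s n) \<le> r"
    using L2_tendsto_bounded[where s = s and x = x, OF sS] xL sx unfolding L2_iff_sqi l2norm_eq_sqn by blast
  define R where "R = sqrt (2 * \<bar>c\<bar> + (2 * c1 + 1) * r\<^sup>2)"
  define H where "H n = hatf (G (s n))" for n
  have sH: "sqi M (H n)" for n unfolding H_def by (rule sqi_hatf(1)[OF sqi_G[OF sD]])
  have fH: "fst (H n y) = s n y" for n y by (simp add: H_def hatf_def hat_def)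
  \<comment> \<open>\<open>aform_hatf_hatf\<close> identifies \<open>rf\<close> on the diagonal with
    the form at \<open>H n\<close>, to which coercivity applies.\<close>
  have HR: "sqn M (H n) \<le> R" for n
    unfolding R_def
    by (rule bounded_sqn[OF sH]) (use bd[of n] r[of n] in \<open>simp_all add: fH, simp add: H_def aform_hatf_hatf rf_def sD\<close>)
  have R0: "0 \<le> R" using HR[of 0] sqn_nonneg order_trans by blast
  define K where "K = 1 + 4 * \<kappa>"
  have K0: "0 \<le> K" using \<kappa>(5) by (simp add: K_def)
  have "\<exists>t\<in>D. sqn M (\<lambda>x. G t x - H n x) < inverse (real (Suc n))" for n
    unfolding H_def by (rule VV_approx[OF hatf_VV[OF G_VV[OF sD]]]) simp
  then obtain t where tD: "\<And>n. t n \<in> D" and t: "\<And>n. sqn M (\<lambda>x. G (t n) x - H n x) < inverse (real (Suc n))"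
    by metis
  have d: "sqi M (\<lambda>x. G (t n) x - H n x)" for n by (rule sqi_diff(1)[OF sqi_G[OF tD] sH])
  have "(\<lambda>n. l2norm \<Omega> (\<lambda>y. t n y - x y)) \<longlonglongrightarrow> 0"
  proof (rule Lim_null_comparison)
    have "sqn M (\<lambda>y. t n y - x y) \<le> inverse (real (Suc n)) + sqn M (\<lambda>y. s n y - x y)" for n
    proof -
      have tS: "sqi M (t n)" and xS: "sqi M x" using D_L2[OF tD] xL by (auto simp: L2_iff_sqi)
      have "sqn M (\<lambda>y. t n y - s n y) \<le> inverse (real (Suc n))"
        using sqi_fst_snd(2)[OF d[of n]] t[of n] by (simp add: fH)
      then show ?thesis using sqn_triangle_diff[OF tS sS xS, of n] by linarith
    qed
    then show "\<forall>\<^sub>F n in sequentially. norm (l2norm \<Omega> (\<lambda>y. t n y - x y)) \<le> inverse (real (Suc n)) + l2norm \<Omega> (\<lambda>y. s n y - x y)"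
      by (simp add: l2norm_eq_sqn)
    show "(\<lambda>n. inverse (real (Suc n)) + l2norm \<Omega> (\<lambda>y. s n y - x y)) \<longlonglongrightarrow> 0"
      using tendsto_add[OF LIMSEQ_inverse_real_of_nat sx] by simp
  qed
  moreover have "Re (diff_form \<Omega> grad C b d c0 (t n) (t n)) \<le> K * ((1 + R) * (1 + R))" for n
  proof -
    have "inverse (real (Suc n)) \<le> 1" by (simp add: field_simps)
    then have "sqn M (G (t n)) \<le> 1 + R"
      using sqi_add(2)[OF d[of n] sH[of n]] t[of n] HR[of n] by simp
    then have "K * (sqn M (G (t n)) * sqn M (G (t n))) \<le> K * ((1 + R) * (1 + R))"
      using K0 R0 by (intro mult_left_mono mult_mono) auto
    then show ?thesis
      using aform_bound(2)[OF sqi_G[OF tD] sqi_G[OF tD], of n n] complex_Re_le_cmod[of "aform (G (t n)) (G (t n))"]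
      unfolding diff_form_aform[OF tD tD] K_def by linarith
  qed
  moreover have "(\<lambda>n. diff_form \<Omega> grad C b d c0 (t n) v) \<longlonglongrightarrow> linner \<Omega> f v" if v: "v \<in> D" for v
  proof -
    have "(\<lambda>n. diff_form \<Omega> grad C b d c0 (t n) v - rf (s n) v) \<longlonglongrightarrow> 0"
    proof (rule Lim_null_comparison)
      show "(\<lambda>n. K * (inverse (real (Suc n)) * sqn M (G v))) \<longlonglongrightarrow> 0"
        by (rule tendsto_mult_right_zero[OF tendsto_mult_left_zero[OF LIMSEQ_inverse_real_of_nat]])
      have "cmod (diff_form \<Omega> grad C b d c0 (t n) v - rf (s n) v) \<le> K * (inverse (real (Suc n)) * sqn M (G v))" for n
      proof -
        have "diff_form \<Omega> grad C b d c0 (t n) v - rf (s n) v = aform (\<lambda>x. G (t n) x - H n x) (G v)"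
          using aform_linear(3)[OF sqi_G[OF tD] sH sqi_G[OF v]] by (simp add: diff_form_aform tD v rf_def sD H_def)
        also have "cmod \<dots> \<le> K * (sqn M (\<lambda>x. G (t n) x - H n x) * sqn M (G v))"
          unfolding K_def by (rule aform_bound(2)[OF d sqi_G[OF v]])
        also have "\<dots> \<le> K * (inverse (real (Suc n)) * sqn M (G v))"
          using t[of n] K0 by (intro mult_left_mono mult_right_mono) auto
        finally show ?thesis .
      qed
      then show "\<forall>\<^sub>F n in sequentially. norm (diff_form \<Omega> grad C b d c0 (t n) v - rf (s n) v) \<le> K * (inverse (real (Suc n)) * sqn M (G v))"
        by simp
    qed
    from tendsto_add[OF this lim[OF v]] show ?thesis by simp
  qed
  ultimately show "xf \<in> assoc_op \<Omega> (diff_form \<Omega> grad C b d c0) D"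
    unfolding xf assoc_op_def using xL fL tD by blast
qed

text \<open>The definite description asks for uniqueness as well:
  \<open>closable_form_unique\<close> settles arguments in \<open>D\<close>, the normalisation all
  others.\<close>

lemma reg_part_eq_rf: "reg_part \<Omega> (diff_form \<Omega> grad C b d c0) D = rf"
  unfolding reg_part_def
proof (rule the_equality)
  have sec: "sectorial \<Omega> rf D" using sectorial_rf by (auto simp: sectorial_def)
  then show "sectorial \<Omega> rf D \<and> closable \<Omega> rf D \<and> assoc_op \<Omega> rf D = assoc_op \<Omega> (diff_form \<Omega> grad C b d c0) D \<and>
      (\<forall>u v. \<not> (u \<in> D \<and> v \<in> D) \<longrightarrow> rf u v = 0)"
    using closable_rf assoc_op_rf_subset assoc_op_rf_supset by (auto simp: rf_def)
  fix r assume r: "sectorial \<Omega> r D \<and> closable \<Omega> r D \<and> assoc_op \<Omega> r D = assoc_op \<Omega> (diff_form \<Omega> grad C b d c0) D \<and>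
      (\<forall>u v. \<not> (u \<in> D \<and> v \<in> D) \<longrightarrow> r u v = 0)"
  show "r = rf"
  proof (intro ext)
    fix u v
    show "r u v = rf u v"
    proof (cases "u \<in> D \<and> v \<in> D")
      case True
      show ?thesis
      proof (rule closable_form_unique[of \<Omega> r D rf u v])
        show "sesq_form \<Omega> r D" "sesq_form \<Omega> rf D"
          using r sec by (auto simp: sectorial_def sectorial_vertex_def)
        show "assoc_op \<Omega> r D = assoc_op \<Omega> rf D" using r assoc_op_rf_subset assoc_op_rf_supset by auto
      qed (use True r closable_rf in auto)
    next
      case False
      then show ?thesis using r by (auto simp: rf_def)
    qed
  qed
qed

section \<open>The explicit formula and the new coefficients\<close>

abbreviation "Wf x \<equiv> Wmat (Z x) (Q x)"
abbreviation "Pf x \<equiv> mat 1 - Q x"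
abbreviation "L1 x \<equiv> mat 1 + cscale \<i> (Z x) + Z x ** Wf x ** Z x"
abbreviation "L2f x \<equiv> mat 1 - cscale \<i> (Wf x ** Z x)"
abbreviation "L3 x \<equiv> mat 1 + cscale \<i> (adj (Wf x) ** Z x)"
abbreviation "PT u x \<equiv> Pf x *v (A x *v grad u x)"

lemma measurable_L: "L1 \<in> borel_measurable M" "L2f \<in> borel_measurable M" "L3 \<in> borel_measurable M"
  by (intro borel_measurable_add borel_measurable_diff borel_measurable_const borel_measurable_cscale
      borel_measurable_matrix_mult borel_measurable_adj measurable_coeffs(5) Z(1))+

lemma measurable_PT: "u \<in> D \<Longrightarrow> (\<lambda>x. PT u x) \<in> borel_measurable M"
  by (intro borel_measurable_mult_vec measurable_coeffs)

text \<open>Splitting one integral into the inner products of the formula needs integrability of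
  every term by itself.\<close>

lemma rf_terms_integrable:
  assumes u: "u \<in> D" and v: "v \<in> D"
  shows "integrable M (\<lambda>x. cdot (L1 x *v PT u x) (PT v x))"
    "integrable M (\<lambda>x. cstar (X x) (L2f x *v PT u x) * cnj (v x))"
    "integrable M (\<lambda>x. u x * cnj (cstar (Y x) (L3 x *v PT v x)))"
    "integrable M (\<lambda>x. cstar (X x) (Wf x *v Y x) * u x * cnj (v x))"
    "integrable M (\<lambda>x. c0 x * u x * cnj (v x))"
proof -
  note U = sqi_G[OF u] and V = sqi_G[OF v]
  note k0 = \<kappa>(5)
  have mu: "u \<in> borel_measurable M" "v \<in> borel_measurable M" using D_L2 u v by (auto simp: L2_def)
  have mcnj: "(\<lambda>x. cnj (h x)) \<in> borel_measurable M" if "h \<in> borel_measurable M" for h :: "real^'n \<Rightarrow> complex"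
    by (rule borel_measurable_continuous_on[OF _ that]) (intro continuous_intros)
  have le: "cmod (w x) \<le> norm (G w x)" "norm (A x *v grad w x) \<le> norm (G w x)" for w x
    using norm_fst_snd_le[of "G w x"] by (simp_all add: G_def)
  have leP: "norm (PT w x) \<le> norm (G w x)" if "x \<in> \<Omega>" for w x
    by (rule order_trans[OF projection_data.norm_P_le[OF projection[OF that]] le(2)])
  have K: "norm (L1 x *v y) \<le> (1 + \<kappa> + \<kappa>\<^sup>2) * norm y" "norm (L2f x *v y) \<le> (1 + \<kappa>) * norm y"
    "norm (L3 x *v y) \<le> (1 + \<kappa>) * norm y" if "x \<in> \<Omega>" for x y
    using projection_data.K_bounds[OF projection[OF that] \<kappa>(1)[OF that]] by auto
  have ml: "(\<lambda>x. L1 x *v PT u x) \<in> borel_measurable M" "(\<lambda>x. L2f x *v PT u x) \<in> borel_measurable M"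
    "(\<lambda>x. L3 x *v PT v x) \<in> borel_measurable M"
    by (intro borel_measurable_mult_vec[OF _ measurable_PT] measurable_L u v)+
  show "integrable M (\<lambda>x. cdot (L1 x *v PT u x) (PT v x))"
  proof (rule sqi_bilinear(1)[OF U V _ _ AE_I2])
    show "(\<lambda>x. cdot (L1 x *v PT u x) (PT v x)) \<in> borel_measurable M"
      by (intro borel_measurable_cdot ml measurable_PT[OF v])
    fix x assume "x \<in> space M"
    then have x: "x \<in> \<Omega>" by (simp add: space_M)
    have "norm (cdot (L1 x *v PT u x) (PT v x)) \<le> norm (L1 x *v PT u x) * norm (PT v x)" by (rule norm_cdot_le)
    also have "\<dots> \<le> ((1 + \<kappa> + \<kappa>\<^sup>2) * norm (G u x)) * norm (G v x)"
      using k0 by (intro mult_mono leP[OF x] order_trans[OF K(1)[OF x] mult_left_mono[OF leP[OF x]]]) auto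
    finally show "norm (cdot (L1 x *v PT u x) (PT v x)) \<le> (1 + \<kappa> + \<kappa>\<^sup>2) * (norm (G u x) * norm (G v x))"
      by (simp add: mult.assoc)
  qed (use k0 in simp)
  show "integrable M (\<lambda>x. cstar (X x) (L2f x *v PT u x) * cnj (v x))"
  proof (rule sqi_bilinear(1)[OF U V _ _ AE_I2])
    show "(\<lambda>x. cstar (X x) (L2f x *v PT u x) * cnj (v x)) \<in> borel_measurable M"
      unfolding cstar_eq_cdot by (intro borel_measurable_times borel_measurable_cdot ml X(1) mcnj mu)
    fix x assume "x \<in> space M"
    then have x: "x \<in> \<Omega>" by (simp add: space_M)
    have "norm (cstar (X x) (L2f x *v PT u x) * cnj (v x)) \<le> (norm (L2f x *v PT u x) * norm (X x)) * cmod (v x)"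
      unfolding cstar_eq_cdot by (simp add: norm_mult mult_right_mono norm_cdot_le)
    also have "\<dots> \<le> (((1 + \<kappa>) * norm (G u x)) * \<kappa>) * norm (G v x)"
      using k0 by (intro mult_mono le \<kappa>(2)[OF x] order_trans[OF K(2)[OF x] mult_left_mono[OF leP[OF x]]]) auto
    finally show "norm (cstar (X x) (L2f x *v PT u x) * cnj (v x)) \<le> ((1 + \<kappa>) * \<kappa>) * (norm (G u x) * norm (G v x))"
      by (simp add: mult_ac)
  qed (use k0 in simp)
  show "integrable M (\<lambda>x. u x * cnj (cstar (Y x) (L3 x *v PT v x)))"
  proof (rule sqi_bilinear(1)[OF U V _ _ AE_I2])
    show "(\<lambda>x. u x * cnj (cstar (Y x) (L3 x *v PT v x))) \<in> borel_measurable M"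
      unfolding cstar_eq_cdot by (intro borel_measurable_times borel_measurable_cdot ml Y(1) mcnj mu)
    fix x assume "x \<in> space M"
    then have x: "x \<in> \<Omega>" by (simp add: space_M)
    have "norm (u x * cnj (cstar (Y x) (L3 x *v PT v x))) \<le> cmod (u x) * (norm (L3 x *v PT v x) * norm (Y x))"
      unfolding cstar_eq_cdot by (simp add: norm_mult mult_left_mono norm_cdot_le)
    also have "\<dots> \<le> norm (G u x) * (((1 + \<kappa>) * norm (G v x)) * \<kappa>)"
      using k0 by (intro mult_mono le \<kappa>(3)[OF x] order_trans[OF K(3)[OF x] mult_left_mono[OF leP[OF x]]]) auto
    finally show "norm (u x * cnj (cstar (Y x) (L3 x *v PT v x))) \<le> ((1 + \<kappa>) * \<kappa>) * (norm (G u x) * norm (G v x))"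
      by (simp add: mult_ac)
  qed (use k0 in simp)
  show "integrable M (\<lambda>x. cstar (X x) (Wf x *v Y x) * u x * cnj (v x))"
  proof (rule sqi_bilinear(1)[OF U V _ _ AE_I2])
    show "(\<lambda>x. cstar (X x) (Wf x *v Y x) * u x * cnj (v x)) \<in> borel_measurable M"
      unfolding cstar_eq_cdot
      by (intro borel_measurable_times borel_measurable_cdot borel_measurable_mult_vec measurable_coeffs X(1) Y(1) mcnj mu)
    fix x assume "x \<in> space M"
    then have x: "x \<in> \<Omega>" by (simp add: space_M)
    have "cmod (cstar (X x) (Wf x *v Y x)) \<le> \<kappa> * \<kappa>"
      unfolding cstar_eq_cdot using projection_data.norm_W_le[OF projection[OF x], of "Y x"] \<kappa>(2,3)[OF x]
      by (intro order_trans[OF norm_cdot_le] mult_mono) (auto simp: k0)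
    then have "norm (cstar (X x) (Wf x *v Y x) * u x * cnj (v x)) \<le> ((\<kappa> * \<kappa>) * norm (G u x)) * norm (G v x)"
      unfolding norm_mult complex_mod_cnj using k0 by (intro mult_mono le) auto
    then show "norm (cstar (X x) (Wf x *v Y x) * u x * cnj (v x)) \<le> (\<kappa> * \<kappa>) * (norm (G u x) * norm (G v x))"
      by (simp add: mult.assoc)
  qed (use k0 in simp)
  show "integrable M (\<lambda>x. c0 x * u x * cnj (v x))"
  proof (rule sqi_bilinear(1)[OF U V _ k0])
    show "AE x in M. norm (c0 x * u x * cnj (v x)) \<le> \<kappa> * (norm (G u x) * norm (G v x))"
      using \<kappa>(4)
    proof eventually_elim
      case (elim x)
      have "norm (c0 x * u x * cnj (v x)) \<le> \<kappa> * norm (G u x) * norm (G v x)"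
        unfolding norm_mult complex_mod_cnj by (intro mult_mono le elim) (simp_all add: k0)
      then show ?case by (simp add: mult.assoc)
    qed
  qed (intro borel_measurable_times measurable_coeffs mu mcnj)
qed

lemma rf_formula:
  assumes u: "u \<in> D" and v: "v \<in> D"
  shows "rf u v = vinner \<Omega> (\<lambda>x. L1 x *v PT u x) (\<lambda>x. PT v x)
    + linner \<Omega> (\<lambda>x. cstar (X x) (L2f x *v PT u x)) v
    + linner \<Omega> u (\<lambda>x. cstar (Y x) (L3 x *v PT v x))
    - linner \<Omega> (\<lambda>x. cstar (X x) (Wf x *v Y x) * u x) v
    + linner \<Omega> (\<lambda>x. c0 x * u x) v"
proof -
  have "rf u v = (LINT x|M. cdot (L1 x *v PT u x) (PT v x) + cstar (X x) (L2f x *v PT u x) * cnj (v x)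
     + u x * cnj (cstar (Y x) (L3 x *v PT v x)) - cstar (X x) (Wf x *v Y x) * u x * cnj (v x) + c0 x * u x * cnj (v x))"
    (is "_ = (LINT x|M. ?F x)")
  proof -
    have "aform (hatf (G u)) (G v) = (LINT x|M. ?F x)"
      unfolding aform_def
    proof (rule Bochner_Integration.integral_cong)
      fix x assume "x \<in> space M"
      then have x: "x \<in> \<Omega>" by (simp add: space_M)
      show "form_integrand (Z x) (X x) (Y x) (c0 x) (hatf (G u) x) (G v x) = ?F x"
        unfolding hatf_def projection_data.form_integrand_hat_formula[OF projection[OF x]] by (simp add: G_def)
    qed simp
    then show ?thesis by (simp add: rf_def u v)
  qed
  then show ?thesis
    using rf_terms_integrable[OF u v] by (simp add: vinner_def linner_def)
qed

text \<open>Coefficients that present the regular part as a differential form: the factors in front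
  of the gradients are moved to the other side, which produces the adjoints. The conjugation in
  \<open>b'\<close> matches the bilinear way in which \<open>b\<close> enters
  \<open>diff_form\<close>, and \<open>c0'\<close> absorbs the term with \<open>W Y\<close>.\<close>

definition "C' x = A x ** Pf x ** L1 x ** Pf x ** A x"
definition "b' x = vconj (A x *v (Pf x *v (adj (L2f x) *v X x)))"
definition "d' x = A x *v (Pf x *v (adj (L3 x) *v Y x))"
definition "c0' x = c0 x - cstar (X x) (Wf x *v Y x)"

lemma cdot_C':
  assumes x: "x \<in> \<Omega>"
  shows "cdot (C' x *v \<xi>) \<eta> = cdot (L1 x *v (Pf x *v (A x *v \<xi>))) (Pf x *v (A x *v \<eta>))"
  by (simp add: C'_def matrix_vector_mul_assoc[symmetric] cdot_hermitian[OF A_hermitian[OF x]]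
      cdot_hermitian[OF projection_data.hP[OF projection[OF x]]])

lemma cdot_coeffs':
  assumes x: "x \<in> \<Omega>"
  shows "cdot (vconj (b' x)) \<xi> = cdot (X x) (L2f x *v (Pf x *v (A x *v \<xi>)))"
    "cdot (d' x) \<xi> = cdot (Y x) (L3 x *v (Pf x *v (A x *v \<xi>)))"
proof -
  have vv: "vconj (vconj y) = y" for y :: "complex^'n" by (simp add: vconj_def vec_eq_iff)
  have e: "cdot (A x *v (Pf x *v (adj N *v y))) \<xi> = cdot y (N *v (Pf x *v (A x *v \<xi>)))" for N :: "complex^'n^'n" and y
    by (simp only: cdot_hermitian[OF A_hermitian[OF x]] cdot_hermitian[OF projection_data.hP[OF projection[OF x]]] cdot_adj[of "adj N"] adj_adj)
  show "cdot (vconj (b' x)) \<xi> = cdot (X x) (L2f x *v (Pf x *v (A x *v \<xi>)))"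
    unfolding b'_def vv by (rule e)
  show "cdot (d' x) \<xi> = cdot (Y x) (L3 x *v (Pf x *v (A x *v \<xi>)))"
    unfolding d'_def by (rule e)
qed

text \<open>By \<open>K1_coercive\<close> the real part of \<open>C'\<close> dominates the square of
  P A^(1/2). Bounds of the new first-order coefficients in terms of P A^(1/2) thus become bounds in
  terms of the square root belonging to \<open>C'\<close>, as the setting demands.\<close>

lemma norm_sqrtA_C':
  assumes x: "x \<in> \<Omega>"
  shows "norm (Pf x *v (A x *v \<xi>)) \<le> norm (sqrtA C' x *v \<xi>)"
proof -
  have ge: "(norm (Pf x *v (A x *v \<zeta>)))\<^sup>2 \<le> Re (cdot (C' x *v \<zeta>) \<zeta>)" for \<zeta>
    unfolding cdot_C'[OF x] by (rule projection_data.K1_coercive[OF projection[OF x]])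
  have "0 \<le> Re (cdot (C' x *v \<zeta>) \<zeta>)" for \<zeta> using ge[of \<zeta>] zero_le_power2 order_trans by blast
  from msqrt_herm_part(3)[OF this] have "(norm (sqrtA C' x *v \<xi>))\<^sup>2 = Re (cdot (C' x *v \<xi>) \<xi>)"
    unfolding sqrtA_def by blast
  then have "(norm (Pf x *v (A x *v \<xi>)))\<^sup>2 \<le> (norm (sqrtA C' x *v \<xi>))\<^sup>2" using ge[of \<xi>] by simp
  then show ?thesis by (rule power2_le_imp_le) simp
qed

lemma diff_setting': "diff_setting \<Omega> D grad C' b' d' c0'"
  unfolding diff_setting_def
proof (intro conjI)
  note mA = measurable_coeffs(1) and mP = measurable_coeffs(4)
  show "C' \<in> borel_measurable M" unfolding C'_def[abs_def]
    by (intro borel_measurable_matrix_mult mA mP measurable_L)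
  show "b' \<in> borel_measurable M" unfolding b'_def[abs_def]
    by (intro borel_measurable_vconj borel_measurable_mult_vec mA mP borel_measurable_adj measurable_L X(1))
  show "d' \<in> borel_measurable M" unfolding d'_def[abs_def]
    by (intro borel_measurable_mult_vec mA mP borel_measurable_adj measurable_L Y(1))
  show "c0' \<in> borel_measurable M" unfolding c0'_def[abs_def] cstar_eq_cdot
    by (intro borel_measurable_diff borel_measurable_cdot borel_measurable_mult_vec measurable_coeffs X(1) Y(1))
  have "AE x in M. x \<in> \<Omega>" using AE_space[of M] by (simp add: space_M)
  with \<kappa>(4) have "AE x in M. cmod (c0' x) \<le> \<kappa> + \<kappa> * \<kappa>"
  proof eventually_elim
    case (elim x)
    have "cmod (cstar (X x) (Wf x *v Y x)) \<le> \<kappa> * \<kappa>"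
      unfolding cstar_eq_cdot using projection_data.norm_W_le[OF projection[OF elim(2)], of "Y x"] \<kappa>(2,3)[OF elim(2)]
      by (intro order_trans[OF norm_cdot_le] mult_mono) (auto simp: \<kappa>(5))
    then show ?case unfolding c0'_def using norm_triangle_ineq4[of "c0 x" "cstar (X x) (Wf x *v Y x)"] elim(1) by linarith
  qed
  then show "ess_bounded \<Omega> c0'" unfolding ess_bounded_def by blast
  show "\<forall>u\<in>D. integrable M (\<lambda>x. cdot (C' x *v grad u x) (grad u x))"
  proof
    fix u assume u: "u \<in> D"
    have "integrable M (\<lambda>x. cdot (C' x *v grad u x) (grad u x)) \<longleftrightarrow> integrable M (\<lambda>x. cdot (L1 x *v PT u x) (PT u x))"
      by (rule Bochner_Integration.integrable_cong) (simp_all add: space_M cdot_C')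
    then show "integrable M (\<lambda>x. cdot (C' x *v grad u x) (grad u x))" using rf_terms_integrable(1)[OF u u] by simp
  qed
  \<comment> \<open>\<open>k\<close> bounds \<open>L1\<close> in norm, while its real part is at
    least the identity; this gives the sector angle \<open>arctan k\<close>.\<close>
  define k where "k = 1 + \<kappa> + \<kappa>\<^sup>2"
  have k0: "0 \<le> k" using \<kappa>(5) by (simp add: k_def)
  show "\<exists>\<theta>. 0 \<le> \<theta> \<and> \<theta> < pi / 2 \<and> (\<forall>x\<in>\<Omega>. \<forall>\<xi>. cdot (C' x *v \<xi>) \<xi> \<in> sector \<theta>)"
  proof (intro exI[of _ "arctan k"] conjI ballI allI)
    show "0 \<le> arctan k" using k0 by simp
    show "arctan k < pi / 2" by (rule arctan_ubound)
    fix x \<xi> assume x: "x \<in> \<Omega>"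
    define y where "y = Pf x *v (A x *v \<xi>)"
    have e: "cdot (C' x *v \<xi>) \<xi> = cdot (L1 x *v y) y" by (simp add: cdot_C'[OF x] y_def)
    have co: "(norm y)\<^sup>2 \<le> Re (cdot (L1 x *v y) y)" by (rule projection_data.K1_coercive[OF projection[OF x]])
    show "cdot (C' x *v \<xi>) \<xi> \<in> sector (arctan k)"
      unfolding e
    proof (rule sectorI)
      show "0 \<le> Re (cdot (L1 x *v y) y)" using co zero_le_power2 order_trans by blast
      have "\<bar>Im (cdot (L1 x *v y) y)\<bar> \<le> norm (L1 x *v y) * norm y"
        using abs_Im_le_cmod norm_cdot_le order_trans by blast
      also have "\<dots> \<le> (k * norm y) * norm y" unfolding k_def
        by (intro mult_right_mono projection_data.K_bounds(1)[OF projection[OF x] \<kappa>(1)[OF x]]) simp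
      also have "\<dots> = k * (norm y)\<^sup>2" by (simp add: power2_eq_square)
      also have "\<dots> \<le> k * Re (cdot (L1 x *v y) y)" by (rule mult_left_mono[OF co k0])
      finally show "\<bar>Im (cdot (L1 x *v y) y)\<bar> \<le> k * Re (cdot (L1 x *v y) y)" .
    qed
  qed
  \<comment> \<open>In the constant, \<open>\<kappa>\<close> bounds \<open>X\<close> and
    \<open>Y\<close>, and \<open>1 + \<kappa>\<close> bounds \<open>L2f\<close> and
    \<open>L3\<close>; the final 1 makes it positive.\<close>
  show "\<exists>K>0. \<forall>x\<in>\<Omega>. \<forall>\<xi>. cmod (cdot (vconj (b' x)) \<xi>) \<le> K * norm (sqrtA C' x *v \<xi>) \<and>
        cmod (cdot (d' x) \<xi>) \<le> K * norm (sqrtA C' x *v \<xi>)"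
  proof (intro exI[of _ "\<kappa> * (1 + \<kappa>) + 1"] conjI ballI allI)
    show "0 < \<kappa> * (1 + \<kappa>) + 1" using \<kappa>(5) by (intro add_nonneg_pos mult_nonneg_nonneg) auto
    fix x \<xi> assume x: "x \<in> \<Omega>"
    define y where "y = Pf x *v (A x *v \<xi>)"
    have ny: "norm y \<le> norm (sqrtA C' x *v \<xi>)" unfolding y_def by (rule norm_sqrtA_C'[OF x])
    have main: "cmod (cdot a (N *v y)) \<le> (\<kappa> * (1 + \<kappa>) + 1) * norm (sqrtA C' x *v \<xi>)"
      if a: "norm a \<le> \<kappa>" and N: "norm (N *v y) \<le> (1 + \<kappa>) * norm y" for a and N :: "complex^'n^'n"
    proof -
      have "cmod (cdot a (N *v y)) \<le> norm a * norm (N *v y)" by (rule norm_cdot_le)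
      also have "\<dots> \<le> \<kappa> * ((1 + \<kappa>) * norm y)" by (intro mult_mono a N) (auto simp: \<kappa>(5))
      also have "\<dots> \<le> (\<kappa> * (1 + \<kappa>) + 1) * norm y" by (simp add: algebra_simps)
      also have "\<dots> \<le> (\<kappa> * (1 + \<kappa>) + 1) * norm (sqrtA C' x *v \<xi>)"
        using \<kappa>(5) by (intro mult_left_mono ny) auto
      finally show ?thesis .
    qed
    note Kb = projection_data.K_bounds[OF projection[OF x] \<kappa>(1)[OF x]]
    show "cmod (cdot (vconj (b' x)) \<xi>) \<le> (\<kappa> * (1 + \<kappa>) + 1) * norm (sqrtA C' x *v \<xi>)"
      unfolding cdot_coeffs'(1)[OF x] y_def[symmetric] by (rule main[OF \<kappa>(2)[OF x] Kb(2)])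
    show "cmod (cdot (d' x) \<xi>) \<le> (\<kappa> * (1 + \<kappa>) + 1) * norm (sqrtA C' x *v \<xi>)"
      unfolding cdot_coeffs'(2)[OF x] y_def[symmetric] by (rule main[OF \<kappa>(3)[OF x] Kb(3)])
  qed
qed (use setting in \<open>auto simp: diff_setting_def\<close>)

lemma rf_diff_form:
  assumes u: "u \<in> D" and v: "v \<in> D"
  shows "rf u v = diff_form \<Omega> grad C' b' d' c0' u v"
proof -
  note i = rf_terms_integrable[OF u v]
  have "(LINT x|M. cdot (C' x *v grad u x) (grad v x)) = (LINT x|M. cdot (L1 x *v PT u x) (PT v x))"
    by (rule Bochner_Integration.integral_cong) (simp_all add: space_M cdot_C')
  moreover have "(LINT x|M. (\<Sum>k\<in>UNIV. b' x $ k * grad u x $ k) * cnj (v x)) = (LINT x|M. cstar (X x) (L2f x *v PT u x) * cnj (v x))"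
  proof (rule Bochner_Integration.integral_cong)
    fix x assume "x \<in> space M"
    then have x: "x \<in> \<Omega>" by (simp add: space_M)
    have "(\<Sum>k\<in>UNIV. b' x $ k * grad u x $ k) = cnj (cdot (vconj (b' x)) (grad u x))"
      by (simp add: cdot_def vconj_def)
    also have "\<dots> = cstar (X x) (L2f x *v PT u x)" unfolding cdot_coeffs'(1)[OF x] cstar_eq_cdot cnj_cdot ..
    finally show "(\<Sum>k\<in>UNIV. b' x $ k * grad u x $ k) * cnj (v x) = cstar (X x) (L2f x *v PT u x) * cnj (v x)" by simp
  qed simp
  moreover have "(LINT x|M. (\<Sum>k\<in>UNIV. d' x $ k * u x * cnj (grad v x $ k))) = (LINT x|M. u x * cnj (cstar (Y x) (L3 x *v PT v x)))"
  proof (rule Bochner_Integration.integral_cong)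
    fix x assume "x \<in> space M"
    then have x: "x \<in> \<Omega>" by (simp add: space_M)
    have "(\<Sum>k\<in>UNIV. d' x $ k * u x * cnj (grad v x $ k)) = u x * cdot (d' x) (grad v x)"
      by (simp add: cdot_def sum_distrib_left mult_ac)
    also have "\<dots> = u x * cnj (cstar (Y x) (L3 x *v PT v x))" unfolding cdot_coeffs'(2)[OF x] cstar_eq_cdot cnj_cdot ..
    finally show "(\<Sum>k\<in>UNIV. d' x $ k * u x * cnj (grad v x $ k)) = u x * cnj (cstar (Y x) (L3 x *v PT v x))" .
  qed simp
  moreover have "(LINT x|M. c0' x * u x * cnj (v x))
      = (LINT x|M. c0 x * u x * cnj (v x)) - (LINT x|M. cstar (X x) (Wf x *v Y x) * u x * cnj (v x))"
    unfolding c0'_def left_diff_distrib using i(4,5) by simp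
  ultimately show ?thesis unfolding rf_formula[OF u v] diff_form_def by (simp add: vinner_def linner_def)
qed

end

theorem theorem3p2:
  fixes \<Omega> :: "(real^'n) set"
    and D :: "(real^'n \<Rightarrow> complex) set"
    and grad :: "(real^'n \<Rightarrow> complex) \<Rightarrow> real^'n \<Rightarrow> complex^'n"
    and C :: "real^'n \<Rightarrow> complex^'n^'n"
    and b d :: "real^'n \<Rightarrow> complex^'n"
    and c0 :: "real^'n \<Rightarrow> complex"
    and X Y :: "real^'n \<Rightarrow> complex^'n"
    and Z Q :: "real^'n \<Rightarrow> complex^'n^'n"
  assumes setting: "diff_setting \<Omega> D grad C b d c0"
    and LB: "condL \<Omega> D C \<or> condB \<Omega> D C"
    and X: "X \<in> borel_measurable (lebesgue_on \<Omega>)" "bounded (X ` \<Omega>)"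
           "\<forall>x\<in>\<Omega>. sqrtA C x *v X x = vconj (b x)"
    and Y: "Y \<in> borel_measurable (lebesgue_on \<Omega>)" "bounded (Y ` \<Omega>)"
           "\<forall>x\<in>\<Omega>. sqrtA C x *v Y x = d x"
    and Z: "Z \<in> borel_measurable (lebesgue_on \<Omega>)" "bounded (Z ` \<Omega>)"
           "\<forall>x\<in>\<Omega>. hermitian (Z x)"
           "\<forall>x\<in>\<Omega>. sqrtA C x ** (mat 1 + cscale \<i> (Z x)) ** sqrtA C x = C x"
    and Q: "Q \<in> borel_measurable (lebesgue_on \<Omega>)"
           "\<forall>x\<in>\<Omega>. Q x ** Q x = Q x \<and> hermitian (Q x)"
           "\<forall>w. L2v \<Omega> w \<longrightarrow> (\<lambda>x. Q x *v w x) \<in> Vs \<Omega> D grad C \<and>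
                (\<forall>z\<in>Vs \<Omega> D grad C. vinner \<Omega> (\<lambda>x. w x - Q x *v w x) z = 0)"
  shows
    "let a = diff_form \<Omega> grad C b d c0;
         Ah = sqrtA C;
         W = (\<lambda>x. Q x ** matrix_inv (mat 1 + cscale \<i> (Q x ** Z x ** Q x)) ** Q x);
         P = (\<lambda>x. mat 1 - Q x)
     in (\<forall>u\<in>D. \<forall>v\<in>D.
           reg_part \<Omega> a D u v =
             vinner \<Omega> (\<lambda>x. (mat 1 + cscale \<i> (Z x) + Z x ** W x ** Z x) *v (P x *v (Ah x *v grad u x)))
                      (\<lambda>x. P x *v (Ah x *v grad v x))
           + linner \<Omega> (\<lambda>x. cstar (X x) ((mat 1 - cscale \<i> (W x ** Z x)) *v (P x *v (Ah x *v grad u x)))) v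
           + linner \<Omega> u (\<lambda>x. cstar (Y x) ((mat 1 + cscale \<i> (adj (W x) ** Z x)) *v (P x *v (Ah x *v grad v x))))
           - linner \<Omega> (\<lambda>x. cstar (X x) (W x *v Y x) * u x) v
           + linner \<Omega> (\<lambda>x. c0 x * u x) v)
        \<and> (\<exists>C' b' d' c0'. diff_setting \<Omega> D grad C' b' d' c0' \<and>
             (\<forall>u\<in>D. \<forall>v\<in>D. reg_part \<Omega> a D u v = diff_form \<Omega> grad C' b' d' c0' u v))"
proof -
  interpret differential_form \<Omega> D grad C b d c0 X Y Z Q
    by unfold_locales (fact setting X Y Z Q)+
  have "\<exists>C' b' d' c0'. diff_setting \<Omega> D grad C' b' d' c0' \<and>
      (\<forall>u\<in>D. \<forall>v\<in>D. rf u v = diff_form \<Omega> grad C' b' d' c0' u v)"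
    using diff_setting' rf_diff_form by blast
  then show ?thesis
    unfolding Let_def reg_part_eq_rf Wmat_def[symmetric] using rf_formula by blast
qed

end
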